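(* Assume (H1), (H2), (H3), (H4). Let $(u_n)\subset H_0^1(\Omega)$ be bounded with $j_\xi(x,u_n,\nabla u_n)\cdot\nabla u_n\in L^1(\Omega)$ for each $n$, and let $(w_n)\subset H^{-1}(\Omega)$ satisfy $$\int_\Omega j_s(x,u_n,\nabla u_n)v+\int_\Omega j_\xi(x,u_n,\nabla u_n)\cdot\nabla v=\langle w_n,v\rangle\qquad\forall v\in V_{u_n}.$$ If $(w_n)$ converges strongly in $H^{-1}(\Omega)$, then a subsequence of $(u_n)$ converges strongly in $H_0^1(\Omega)$.
   Context: $\Omega\subset\mathbb{R}^N$ bounded open, $N\ge3$. $j$ measurable in $x$, $C^1$ in $(s,\xi)$, partial derivatives $j_s,j_\xi$. (H1) $\xi\mapsto j(x,s,\xi)$ strictly convex; (H2) $\alpha_0|\xi|^2\le j(x,s,\xi)\le\alpha(|s|)|\xi|^2$ ($\alpha_0>0$, $\alpha$ positive increasing continuous); (H3) $|j_s(x,s,\xi)|\le\beta(|s|)|\xi|^2$ ($\beta$ positive increasing continuous); (H4) $j_s(x,s,\xi)s\ge0$ for $|s|\ge R$, some $R>0$. $V_u=\{v\in H_0^1(\Omega)\cap L^\infty(\Omega): u\in L^\infty(\{x:v(x)\ne0\})\}$. *)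

theory Defs
  imports "HOL-Analysis.Analysis"
begin

definition smooth_fun :: "('a::euclidean_space \<Rightarrow> real) \<Rightarrow> bool" where
  "smooth_fun f \<longleftrightarrow> (\<exists>F. f \<in> F \<and> (\<forall>g\<in>F. (\<forall>x. g differentiable (at x)) \<and>
        (\<forall>b\<in>Basis. (\<lambda>x. frechet_derivative g (at x) b) \<in> F)))"

definition test_fun :: "'a::euclidean_space set \<Rightarrow> ('a \<Rightarrow> real) \<Rightarrow> bool" where
  "test_fun \<Omega> \<phi> \<longleftrightarrow> smooth_fun \<phi> \<and>
     (\<exists>K. compact K \<and> K \<subseteq> \<Omega> \<and> (\<forall>x. x \<notin> K \<longrightarrow> \<phi> x = 0))"

definition is_weak_grad :: "'a::euclidean_space set \<Rightarrow> ('a \<Rightarrow> real) \<Rightarrow> ('a \<Rightarrow> 'a) \<Rightarrow> bool" where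
  "is_weak_grad \<Omega> u g \<longleftrightarrow>
     (\<forall>K. compact K \<and> K \<subseteq> \<Omega> \<longrightarrow> set_integrable lebesgue K u \<and> set_integrable lebesgue K g) \<and>
     (\<forall>\<phi>. test_fun \<Omega> \<phi> \<longrightarrow> (\<forall>b\<in>Basis.
        (LINT x:\<Omega>|lebesgue. u x * frechet_derivative \<phi> (at x) b)
          = - (LINT x:\<Omega>|lebesgue. (g x \<bullet> b) * \<phi> x)))"

text \<open>The weak gradient (unique up to null sets).\<close>
definition wgrad :: "'a::euclidean_space set \<Rightarrow> ('a \<Rightarrow> real) \<Rightarrow> ('a \<Rightarrow> 'a)" where
  "wgrad \<Omega> u = (SOME g. is_weak_grad \<Omega> u g)"

definition L2_on :: "'a::euclidean_space set \<Rightarrow> ('a \<Rightarrow> 'b::euclidean_space) \<Rightarrow> bool" where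
  "L2_on \<Omega> f \<longleftrightarrow> set_borel_measurable lebesgue \<Omega> f \<and>
     set_integrable lebesgue \<Omega> (\<lambda>x. (norm (f x))\<^sup>2)"

definition h1norm :: "'a::euclidean_space set \<Rightarrow> ('a \<Rightarrow> real) \<Rightarrow> real" where
  "h1norm \<Omega> u = sqrt ((LINT x:\<Omega>|lebesgue. (u x)\<^sup>2) + (LINT x:\<Omega>|lebesgue. (norm (wgrad \<Omega> u x))\<^sup>2))"

definition H01 :: "'a::euclidean_space set \<Rightarrow> ('a \<Rightarrow> real) \<Rightarrow> bool" where
  "H01 \<Omega> u \<longleftrightarrow> (\<exists>g. is_weak_grad \<Omega> u g) \<and> L2_on \<Omega> u \<and> L2_on \<Omega> (wgrad \<Omega> u) \<and>
     (\<exists>\<phi>. (\<forall>k. test_fun \<Omega> (\<phi> k)) \<and>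
        (\<lambda>k. h1norm \<Omega> (\<lambda>x. \<phi> k x - u x)) \<longlonglongrightarrow> 0)"

definition Hm1 :: "'a::euclidean_space set \<Rightarrow> (('a \<Rightarrow> real) \<Rightarrow> real) \<Rightarrow> bool" where
  "Hm1 \<Omega> w \<longleftrightarrow>
     (\<forall>u v. H01 \<Omega> u \<longrightarrow> H01 \<Omega> v \<longrightarrow> w (\<lambda>x. u x + v x) = w u + w v) \<and>
     (\<forall>c u. H01 \<Omega> u \<longrightarrow> w (\<lambda>x. c * u x) = c * w u) \<and>
     (\<exists>C. \<forall>v. H01 \<Omega> v \<longrightarrow> \<bar>w v\<bar> \<le> C * h1norm \<Omega> v)"

definition hm1norm :: "'a::euclidean_space set \<Rightarrow> (('a \<Rightarrow> real) \<Rightarrow> real) \<Rightarrow> real" where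
  "hm1norm \<Omega> w = Sup {\<bar>w v\<bar> | v. H01 \<Omega> v \<and> h1norm \<Omega> v \<le> 1}"

definition Vset :: "'a::euclidean_space set \<Rightarrow> ('a \<Rightarrow> real) \<Rightarrow> ('a \<Rightarrow> real) set" where
  "Vset \<Omega> u = {v. H01 \<Omega> v \<and> (\<exists>C. AE x in lebesgue. x \<in> \<Omega> \<longrightarrow> \<bar>v x\<bar> \<le> C) \<and>
                  (\<exists>C. AE x in lebesgue. x \<in> \<Omega> \<and> v x \<noteq> 0 \<longrightarrow> \<bar>u x\<bar> \<le> C)}"

definition strictly_convex_fun :: "('a::real_vector \<Rightarrow> real) \<Rightarrow> bool" where
  "strictly_convex_fun f \<longleftrightarrow> (\<forall>x y t. x \<noteq> y \<and> 0 < t \<and> t < 1 \<longrightarrow>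
      f ((1 - t) *\<^sub>R x + t *\<^sub>R y) < (1 - t) * f x + t * f y)"

end

theory Submission
  imports Defs "HOL-Complex_Analysis.Great_Picard"
begin

text \<open>Along a subsequence \<open>u\<^sub>n\<close> converges weakly in the Sobolev space and, by Rellich's theorem, almost
  everywhere, to some \<open>u\<close>. By (H4) the term with \<open>j\<^sub>s\<close> is nonnegative on large values of \<open>u\<^sub>n\<close>, so
  testing with the part of \<open>u\<^sub>n\<close> above a level \<open>k\<close> bounds the energy on \<open>{|u\<^sub>n| > k}\<close>, uniformly in \<open>n\<close>
  up to the error in \<open>w\<^sub>n\<close>, by a quantity that vanishes as \<open>k \<rightarrow> \<infinity>\<close>. Below the level \<open>k\<close> one tests
  with \<open>\<phi> (T\<^sub>k u\<^sub>n - T\<^sub>k u)\<close>, where \<open>T\<^sub>k\<close> is truncation and \<open>\<phi>\<close> grows exponentially: \<open>\<phi>'\<close> then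
  dominates the term with \<open>j\<^sub>s\<close>, which is quadratic in the gradient, and the integral of the
  monotonicity gap \<open>(j\<^sub>\<xi> (x, u\<^sub>n, \<nabla>T\<^sub>k u\<^sub>n) - j\<^sub>\<xi> (x, u\<^sub>n, \<nabla>T\<^sub>k u)) \<bullet> (\<nabla>T\<^sub>k u\<^sub>n - \<nabla>T\<^sub>k u)\<close> tends to zero.
  Strict convexity turns this into almost everywhere convergence of the gradients, and since the
  gap controls \<open>|\<nabla>T\<^sub>k u\<^sub>n|\<^sup>2\<close> the truncations converge strongly. Together with the bound on the tails
  this gives strong convergence.\<close>

section \<open>Hilbert spaces\<close>

lemma subspace_closure:
  fixes S :: "'a::real_normed_vector set"
  assumes "subspace S" shows "subspace (closure S)"
  unfolding subspace_def
proof (intro conjI ballI allI)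
  show "0 \<in> closure S" using subspace_0[OF assms] closure_subset by blast
next
  fix x y assume "x \<in> closure S" "y \<in> closure S"
  then obtain a b where "\<forall>n. a n \<in> S" "a \<longlonglongrightarrow> x" "\<forall>n. b n \<in> S" "b \<longlonglongrightarrow> y"
    unfolding closure_sequential by blast
  then show "x + y \<in> closure S" unfolding closure_sequential
    using subspace_add[OF assms] by (intro exI[of _ "\<lambda>n. a n + b n"]) (auto intro: tendsto_add)
next
  fix c :: real and x assume "x \<in> closure S"
  then obtain a where "\<forall>n. a n \<in> S" "a \<longlonglongrightarrow> x" unfolding closure_sequential by blast
  then show "c *\<^sub>R x \<in> closure S" unfolding closure_sequential
    using subspace_mul[OF assms] by (intro exI[of _ "\<lambda>n. c *\<^sub>R a n"]) (auto intro: tendsto_scaleR)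
qed

lemma minimizing_sequence_Cauchy:
  fixes S :: "'a::real_inner set"
  assumes "convex S" and in_S: "\<And>n. y n \<in> S" and minimizing: "(\<lambda>n. dist x (y n)) \<longlonglongrightarrow> infdist x S"
  shows "Cauchy y"
proof (rule metric_CauchyI)
  let ?d = "infdist x S"
  fix e :: real assume "0 < e"
  have "(\<lambda>n. (dist x (y n))\<^sup>2) \<longlonglongrightarrow> ?d\<^sup>2" by (intro tendsto_intros minimizing)
  then have "\<forall>\<^sub>F n in sequentially. (dist x (y n))\<^sup>2 < ?d\<^sup>2 + e\<^sup>2 / 4"
    using \<open>0 < e\<close> by (intro order_tendstoD) auto
  then obtain N where N: "\<And>n. N \<le> n \<Longrightarrow> (dist x (y n))\<^sup>2 < ?d\<^sup>2 + e\<^sup>2 / 4"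
    unfolding eventually_sequentially by blast
  show "\<exists>N. \<forall>m\<ge>N. \<forall>n\<ge>N. dist (y m) (y n) < e"
  proof (intro exI[of _ N] allI impI)
    fix m n assume "N \<le> m" "N \<le> n"
    let ?mid = "(1/2) *\<^sub>R y m + (1/2) *\<^sub>R y n"
    have "?mid \<in> S" using \<open>convex S\<close> in_S by (intro convexD) auto
    then have "?d\<^sup>2 \<le> (dist x ?mid)\<^sup>2" by (intro power_mono infdist_le infdist_nonneg)
    moreover have "(dist (y m) (y n))\<^sup>2 = 2 * (dist x (y m))\<^sup>2 + 2 * (dist x (y n))\<^sup>2 - 4 * (dist x ?mid)\<^sup>2"
      unfolding dist_norm power2_norm_eq_inner
      by (simp add: inner_simps inner_commute algebra_simps)
    ultimately have "(dist (y m) (y n))\<^sup>2 < e\<^sup>2"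
      using N[OF \<open>N \<le> m\<close>] N[OF \<open>N \<le> n\<close>] by linarith
    then show "dist (y m) (y n) < e" using \<open>0 < e\<close> by (simp add: power2_less_imp_less)
  qed
qed

lemma minimizing_sequence_exists:
  fixes S :: "'a::metric_space set"
  assumes "S \<noteq> {}"
  obtains y where "\<And>n. y n \<in> S" "(\<lambda>n. dist x (y n)) \<longlonglongrightarrow> infdist x S"
proof -
  have "\<exists>y\<in>S. dist x y < infdist x S + inverse (real (Suc n))" for n
  proof (rule ccontr)
    assume "\<not> ?thesis"
    then have "infdist x S + inverse (real (Suc n)) \<le> infdist x S"
      using assms by (subst (2) infdist_notempty) (auto intro: cINF_greatest simp: not_less)
    then show False by simp
  qed
  then obtain y where y: "\<And>n. y n \<in> S" "\<And>n. dist x (y n) < infdist x S + inverse (real (Suc n))"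
    by metis
  have "(\<lambda>n. dist x (y n)) \<longlonglongrightarrow> infdist x S"
  proof (rule tendsto_sandwich[OF _ _ tendsto_const])
    show "(\<lambda>n. infdist x S + inverse (real (Suc n))) \<longlonglongrightarrow> infdist x S"
      using tendsto_add[OF tendsto_const LIMSEQ_inverse_real_of_nat, of "infdist x S"] by simp
  qed (use infdist_le[OF y(1)] less_imp_le[OF y(2)] in \<open>auto intro!: always_eventually\<close>)
  with y(1) that show thesis by blast
qed

lemma closest_point_exists_Hilbert:
  fixes S :: "'a::{real_inner,complete_space} set"
  assumes "closed S" "convex S" "S \<noteq> {}"
  obtains p where "p \<in> S" "\<And>z. z \<in> S \<Longrightarrow> dist x p \<le> dist x z"
proof -
  obtain y where y: "\<And>n. y n \<in> S" "(\<lambda>n. dist x (y n)) \<longlonglongrightarrow> infdist x S"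
    using minimizing_sequence_exists[OF assms(3)] by blast
  obtain p where p: "y \<longlonglongrightarrow> p"
    using Cauchy_convergent[OF minimizing_sequence_Cauchy[OF assms(2) y]] convergent_def by blast
  have "(\<lambda>n. dist x (y n)) \<longlonglongrightarrow> dist x p" by (intro tendsto_intros p)
  with y(2) have "dist x p = infdist x S" by (rule LIMSEQ_unique[symmetric])
  then show thesis using closed_sequentially[OF assms(1) y(1) p] infdist_le that by metis
qed

lemma orthogonal_projection_exists:
  fixes S :: "'a::{real_inner,complete_space} set"
  assumes "closed S" "subspace S"
  obtains p where "p \<in> S" "\<And>z. z \<in> S \<Longrightarrow> (x - p) \<bullet> z = 0"
proof -
  have "convex S" "S \<noteq> {}" using subspace_imp_convex subspace_0 assms(2) by blast+
  then obtain p where p: "p \<in> S" "\<And>z. z \<in> S \<Longrightarrow> dist x p \<le> dist x z"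
    using closest_point_exists_Hilbert[OF assms(1)] by blast
  have "(x - p) \<bullet> z = 0" if "z \<in> S" for z
  proof (rule antisym)
    have "p + z \<in> S" "p - z \<in> S"
      using assms(2) p(1) that by (simp_all add: subspace_add subspace_diff)
    then have "(x - p) \<bullet> (p + z - p) \<le> 0" "(x - p) \<bullet> (p - z - p) \<le> 0"
      using any_closest_point_dot[OF \<open>convex S\<close> assms(1) p(1)] p(2) by blast+
    then show "(x - p) \<bullet> z \<le> 0" "0 \<le> (x - p) \<bullet> z" by simp_all
  qed
  with p(1) that show thesis by blast
qed

definition bounded_functional_on :: "'a::real_normed_vector set \<Rightarrow> ('a \<Rightarrow> real) \<Rightarrow> bool" where
  "bounded_functional_on S f \<longleftrightarrow>
     (\<forall>x\<in>S. \<forall>y\<in>S. f (x + y) = f x + f y) \<and> (\<forall>c. \<forall>x\<in>S. f (c *\<^sub>R x) = c * f x) \<and>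
     (\<exists>C. \<forall>x\<in>S. \<bar>f x\<bar> \<le> C * norm x)"

lemma bounded_functional_on_diff:
  assumes "subspace S" "bounded_functional_on S f" "x \<in> S" "y \<in> S"
  shows "f (x - y) = f x - f y"
proof -
  have "(-1) *\<^sub>R y \<in> S" using assms by (simp add: subspace_neg)
  then have "f (x + (-1) *\<^sub>R y) = f x + (-1) * f y"
    using assms unfolding bounded_functional_on_def by metis
  then show ?thesis by simp
qed

lemma closed_subspace_kernel:
  assumes "closed S" "subspace S" and f: "bounded_functional_on S f"
  shows "closed {x\<in>S. f x = 0}" "subspace {x\<in>S. f x = 0}"
proof -
  obtain C where C: "\<And>x. x \<in> S \<Longrightarrow> \<bar>f x\<bar> \<le> C * norm x"
    using f unfolding bounded_functional_on_def by blast
  show "closed {x\<in>S. f x = 0}"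
    unfolding closed_sequential_limits
  proof (intro allI impI, elim conjE)
    fix x l assume x: "\<forall>n. x n \<in> {x\<in>S. f x = 0}" "x \<longlonglongrightarrow> l"
    have l: "l \<in> S" using closed_sequentially[OF assms(1), of x l] x by auto
    have "(\<lambda>n. C * norm (l - x n)) \<longlonglongrightarrow> C * norm (l - l)" by (intro tendsto_intros x)
    moreover have "\<bar>f l\<bar> \<le> C * norm (l - x n)" for n
      using C[of "l - x n"] bounded_functional_on_diff[OF assms(2) f l, of "x n"] l x(1) assms(2)
      by (auto simp: subspace_diff)
    ultimately have "\<bar>f l\<bar> \<le> 0" using LIMSEQ_le_const by fastforce
    then show "l \<in> {x\<in>S. f x = 0}" using l by simp
  qed
  have "f 0 = 0" using bounded_functional_on_diff[OF assms(2) f, of 0 0] subspace_0[OF assms(2)] by simp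
  with f assms(2) show "subspace {x\<in>S. f x = 0}"
    unfolding bounded_functional_on_def
    by (intro subspaceI) (auto simp: subspace_0 subspace_add subspace_mul)
qed

lemma Riesz_representation:
  fixes S :: "'a::{real_inner,complete_space} set"
  assumes S: "closed S" "subspace S" and f: "bounded_functional_on S f"
  obtains y where "y \<in> S" "\<And>x. x \<in> S \<Longrightarrow> f x = y \<bullet> x"
proof (cases "\<forall>x\<in>S. f x = 0")
  case True
  then show thesis using that[of 0] subspace_0[OF S(2)] by auto
next
  case False
  then obtain v where v: "v \<in> S" "f v \<noteq> 0" by blast
  obtain p where "p \<in> {x\<in>S. f x = 0}" "\<And>z. z \<in> {x\<in>S. f x = 0} \<Longrightarrow> (v - p) \<bullet> z = 0"
    by (rule orthogonal_projection_exists[OF closed_subspace_kernel[OF S f], where x=v]) (rule that)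
  then have p: "p \<in> S" "f p = 0" and orth: "\<And>z. z \<in> S \<Longrightarrow> f z = 0 \<Longrightarrow> (v - p) \<bullet> z = 0"
    by auto
  define e where "e = v - p"
  have e: "e \<in> S" "f e \<noteq> 0"
    using v p bounded_functional_on_diff[OF S(2) f] S(2) by (auto simp: e_def subspace_diff)
  have "f 0 = 0" using bounded_functional_on_diff[OF S(2) f e(1) e(1)] by simp
  with e have "e \<bullet> e \<noteq> 0" by auto
  show thesis
  proof
    show "(f e / (e \<bullet> e)) *\<^sub>R e \<in> S" using e S(2) by (simp add: subspace_mul)
    fix x assume x: "x \<in> S"
    let ?z = "x - (f x / f e) *\<^sub>R e"
    have "f ?z = f x - f ((f x / f e) *\<^sub>R e)"
      using x e S(2) by (intro bounded_functional_on_diff[OF S(2) f] subspace_mul)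
    also have "f ((f x / f e) *\<^sub>R e) = f x"
      using f e unfolding bounded_functional_on_def by simp
    finally have "e \<bullet> ?z = 0"
      unfolding e_def[symmetric] using orth[of ?z] x e S(2)
      by (simp add: e_def[symmetric] subspace_diff subspace_mul)
    then have "e \<bullet> x = (f x / f e) * (e \<bullet> e)" by (simp add: inner_diff_right)
    then show "f x = (f e / (e \<bullet> e)) *\<^sub>R e \<bullet> x" using e \<open>e \<bullet> e \<noteq> 0\<close> by simp
  qed
qed

lemma closed_subspace_convergent_inner:
  fixes x :: "nat \<Rightarrow> 'a::real_inner"
  assumes norm_le: "\<And>n. norm (x n) \<le> B"
  shows "closed {y. convergent (\<lambda>n. x n \<bullet> y)}" "subspace {y. convergent (\<lambda>n. x n \<bullet> y)}"
proof -
  show "subspace {y. convergent (\<lambda>n. x n \<bullet> y)}"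
    unfolding subspace_def
    by (auto simp: inner_add_right convergent_const intro: convergent_add convergent_mult)
  show "closed {y. convergent (\<lambda>n. x n \<bullet> y)}"
    unfolding closed_sequential_limits
  proof (intro allI impI, elim conjE)
    fix y l assume y: "\<forall>n. y n \<in> {y. convergent (\<lambda>n. x n \<bullet> y)}" "y \<longlonglongrightarrow> l"
    have "Cauchy (\<lambda>n. x n \<bullet> l)"
    proof (rule metric_CauchyI)
      fix e :: real assume "0 < e"
      have "(\<lambda>k. B * norm (y k - l)) \<longlonglongrightarrow> B * norm (l - l)" by (intro tendsto_intros y(2))
      then have "\<forall>\<^sub>F k in sequentially. B * norm (y k - l) < e / 3"
        using \<open>0 < e\<close> by (intro order_tendstoD(2)[where y="B * norm (l - l)"]) auto
      then obtain k where k: "B * norm (y k - l) < e / 3"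
        by (auto simp: eventually_sequentially)
      have approx: "\<bar>x n \<bullet> (y k - l)\<bar> < e / 3" for n
        using Cauchy_Schwarz_ineq2[of "x n" "y k - l"]
          mult_right_mono[OF norm_le[of n] norm_ge_zero[of "y k - l"]] k by linarith
      have "Cauchy (\<lambda>n. x n \<bullet> y k)" using y(1) by (auto intro: convergent_Cauchy)
      then obtain N where N: "\<And>m n. N \<le> m \<Longrightarrow> N \<le> n \<Longrightarrow> dist (x m \<bullet> y k) (x n \<bullet> y k) < e / 3"
        using \<open>0 < e\<close> unfolding Cauchy_def by (metis zero_less_divide_iff zero_less_numeral)
      have "dist (x m \<bullet> l) (x n \<bullet> l) < e" if "N \<le> m" "N \<le> n" for m n
        using N[OF that] approx[of m] approx[of n]
        unfolding dist_real_def inner_diff_right by linarith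
      then show "\<exists>N. \<forall>m\<ge>N. \<forall>n\<ge>N. dist (x m \<bullet> l) (x n \<bullet> l) < e" by blast
    qed
    then show "l \<in> {y. convergent (\<lambda>n. x n \<bullet> y)}" by (simp add: Cauchy_convergent_iff)
  qed
qed

lemma convergent_inner_imp_weak_limit:
  fixes x :: "nat \<Rightarrow> 'a::{real_inner,complete_space}"
  assumes norm_le: "\<And>n. norm (x n) \<le> B" and "\<And>y. convergent (\<lambda>n. x n \<bullet> y)"
  obtains l where "\<And>y. (\<lambda>n. x n \<bullet> y) \<longlonglongrightarrow> l \<bullet> y"
proof -
  define f where "f y = lim (\<lambda>n. x n \<bullet> y)" for y
  have f: "(\<lambda>n. x n \<bullet> y) \<longlonglongrightarrow> f y" for y
    using assms(2) unfolding f_def by (simp add: convergent_LIMSEQ_iff)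
  have "bounded_functional_on UNIV f"
    unfolding bounded_functional_on_def
  proof (intro conjI ballI allI exI)
    show "f (y + z) = f y + f z" for y z
      by (rule LIMSEQ_unique[OF f]) (auto simp: inner_add_right intro!: tendsto_intros f)
    show "f (c *\<^sub>R y) = c * f y" for c y
      by (rule LIMSEQ_unique[OF f]) (auto intro!: tendsto_intros f)
    show "\<bar>f y\<bar> \<le> B * norm y" for y
    proof (rule LIMSEQ_le_const2)
      show "(\<lambda>n. \<bar>x n \<bullet> y\<bar>) \<longlonglongrightarrow> \<bar>f y\<bar>" by (intro tendsto_intros f)
      have "\<bar>x n \<bullet> y\<bar> \<le> B * norm y" for n
        using Cauchy_Schwarz_ineq2[of "x n" y] mult_right_mono[OF norm_le[of n], of "norm y"] by simp
      then show "\<exists>N. \<forall>n\<ge>N. \<bar>x n \<bullet> y\<bar> \<le> B * norm y" by blast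
    qed
  qed
  then obtain l where "\<And>y. f y = l \<bullet> y" by (rule Riesz_representation[rotated 2]) auto
  with f have "(\<lambda>n. x n \<bullet> y) \<longlonglongrightarrow> l \<bullet> y" for y by simp
  then show thesis by (rule that)
qed

lemma weak_limit_in_closed_subspace:
  fixes x :: "nat \<Rightarrow> 'a::{real_inner,complete_space}"
  assumes S: "closed S" "subspace S" and in_S: "\<And>n. x n \<in> S"
    and weak: "\<And>y. (\<lambda>n. x n \<bullet> y) \<longlonglongrightarrow> l \<bullet> y"
  shows "l \<in> S"
proof -
  obtain p where p: "p \<in> S" and orth: "\<And>z. z \<in> S \<Longrightarrow> z \<bullet> (l - p) = 0"
    using orthogonal_projection_exists[OF S] by (metis inner_commute)
  have "l \<bullet> (l - p) = 0"
    using weak[of "l - p"] orth[OF in_S] by (simp add: LIMSEQ_const_iff)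
  then have "(l - p) \<bullet> (l - p) = 0" using orth[OF p] by (simp add: inner_diff_left)
  then show ?thesis using p by simp
qed

lemma bounded_imp_weakly_convergent_subsequence:
  fixes x :: "nat \<Rightarrow> 'a::{real_inner,complete_space}"
  assumes S: "closed S" "subspace S" and in_S: "\<And>n. x n \<in> S" and norm_le: "\<And>n. norm (x n) \<le> B"
  obtains r l where "strict_mono (r::nat\<Rightarrow>nat)" "l \<in> S" "\<And>y. (\<lambda>n. x (r n) \<bullet> y) \<longlonglongrightarrow> l \<bullet> y"
proof -
  have "0 \<le> B" using norm_le[of 0] norm_ge_zero order_trans by blast
  then have "norm (x n) * norm y \<le> B * B" if "y \<in> range x" for n y
    using that norm_le by (intro mult_mono) auto
  then have bounded: "norm (x n \<bullet> y) \<le> B * B" if "y \<in> range x" for n y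
    using that Cauchy_Schwarz_ineq2[of "x n" y] order_trans by fastforce
  obtain r where r: "strict_mono (r::nat\<Rightarrow>nat)"
    and range_conv: "\<And>y. y \<in> range x \<Longrightarrow> \<exists>l. (\<lambda>n. x (r n) \<bullet> y) \<longlonglongrightarrow> l"
    by (rule function_convergent_subsequence[of "range x" "\<lambda>n y. x n \<bullet> y" "B * B"])
      (use bounded in auto)
  define T where "T = {y. convergent (\<lambda>n. x (r n) \<bullet> y)}"
  note T = closed_subspace_convergent_inner[of "\<lambda>n. x (r n)", OF norm_le, folded T_def]
  have "y \<in> T" for y
  proof -
    obtain p where p: "p \<in> T" and orth: "\<And>z. z \<in> T \<Longrightarrow> (y - p) \<bullet> z = 0"
      using orthogonal_projection_exists[OF T] by blast
    have "x n \<bullet> (y - p) = 0" for n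
      using orth[of "x n"] range_conv[of "x n"] by (simp add: T_def convergent_def inner_commute)
    then have "y - p \<in> T" by (simp add: T_def convergent_const)
    then show "y \<in> T" using subspace_add[OF T(2) _ p, of "y - p"] by simp
  qed
  then obtain l where l: "\<And>y. (\<lambda>n. x (r n) \<bullet> y) \<longlonglongrightarrow> l \<bullet> y"
    using convergent_inner_imp_weak_limit[of "\<lambda>n. x (r n)", OF norm_le] by (auto simp: T_def)
  with r that weak_limit_in_closed_subspace[OF S in_S l] show thesis by blast
qed

section \<open>Square-integrable functions\<close>

definition square_integrable :: "'m measure \<Rightarrow> ('m \<Rightarrow> 'b::euclidean_space) \<Rightarrow> bool" where
  "square_integrable M f \<longleftrightarrow> f \<in> borel_measurable M \<and> integrable M (\<lambda>x. (norm (f x))\<^sup>2)"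

lemma square_integrable_measurable [measurable_dest]: "square_integrable M f \<Longrightarrow> f \<in> borel_measurable M"
  and square_integrable_integrable_power2: "square_integrable M f \<Longrightarrow> integrable M (\<lambda>x. (norm (f x))\<^sup>2)"
  by (auto simp: square_integrable_def)

lemma square_integrable_bound:
  assumes F: "square_integrable M F" and [measurable]: "f \<in> borel_measurable M"
    and dominated: "AE x in M. norm (f x) \<le> norm (F x)"
  shows "square_integrable M f"
  unfolding square_integrable_def
proof
  show "integrable M (\<lambda>x. (norm (f x))\<^sup>2)"
  proof (rule Bochner_Integration.integrable_bound[OF square_integrable_integrable_power2[OF F]])
    show "AE x in M. norm ((norm (f x))\<^sup>2) \<le> norm ((norm (F x))\<^sup>2)"
      using dominated by eventually_elim (simp add: power_mono)
  qed measurable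
qed fact

lemma power2_norm_add_le:
  fixes a b :: "'a::real_normed_vector"
  shows "(norm (a + b))\<^sup>2 \<le> 2 * (norm a)\<^sup>2 + 2 * (norm b)\<^sup>2"
proof -
  have "(norm (a + b))\<^sup>2 \<le> (norm a + norm b)\<^sup>2" by (intro power_mono norm_triangle_ineq) auto
  also have "\<dots> \<le> 2 * (norm a)\<^sup>2 + 2 * (norm b)\<^sup>2"
    using sum_squares_bound[of "norm a" "norm b"] by (simp add: power2_sum)
  finally show ?thesis .
qed

lemma square_integrable_add:
  assumes [measurable]: "square_integrable M f" "square_integrable M g"
  shows "square_integrable M (\<lambda>x. f x + g x)"
proof -
  have "integrable M (\<lambda>x. 2 * (norm (f x))\<^sup>2 + 2 * (norm (g x))\<^sup>2)"
    using assms by (auto simp: square_integrable_def)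
  then have "integrable M (\<lambda>x. (norm (f x + g x))\<^sup>2)"
    by (rule Bochner_Integration.integrable_bound) (auto simp: power2_norm_add_le)
  then show ?thesis unfolding square_integrable_def by simp
qed

lemma square_integrable_scaleR: "square_integrable M f \<Longrightarrow> square_integrable M (\<lambda>x. c *\<^sub>R f x)"
  by (auto simp: square_integrable_def power_mult_distrib)

lemma square_integrable_minus: "square_integrable M f \<Longrightarrow> square_integrable M (\<lambda>x. - f x)"
  by (auto simp: square_integrable_def)

lemma square_integrable_diff:
  "square_integrable M f \<Longrightarrow> square_integrable M g \<Longrightarrow> square_integrable M (\<lambda>x. f x - g x)"
  using square_integrable_add[of M f "\<lambda>x. - g x"] square_integrable_minus[of M g] by simp

lemma square_integrable_zero: "square_integrable M (\<lambda>x. 0)"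
  by (auto simp: square_integrable_def)

lemma square_integrable_bounded_scaleR:
  fixes c :: "'m \<Rightarrow> real"
  assumes [measurable]: "square_integrable M f" "c \<in> borel_measurable M" and "\<And>x. \<bar>c x\<bar> \<le> C"
  shows "square_integrable M (\<lambda>x. c x *\<^sub>R f x)"
proof (rule square_integrable_bound[OF square_integrable_scaleR[OF assms(1), of C]])
  show "AE x in M. norm (c x *\<^sub>R f x) \<le> norm (C *\<^sub>R f x)"
    using assms(3) by (auto intro!: mult_right_mono AE_I2 order_trans[OF _ abs_ge_self])
qed measurable

lemma square_integrable_inner_const:
  assumes [measurable]: "square_integrable M f"
  shows "square_integrable M (\<lambda>x. f x \<bullet> b)"
proof (rule square_integrable_bound[OF square_integrable_scaleR[OF assms, of "norm b"]])
  show "AE x in M. norm (f x \<bullet> b) \<le> norm (norm b *\<^sub>R f x)"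
    by (intro AE_I2) (simp add: Cauchy_Schwarz_ineq2 mult.commute[of "norm b"])
qed measurable

lemma square_integrable_scaleR_const:
  fixes f :: "'m \<Rightarrow> real"
  assumes [measurable]: "square_integrable M f"
  shows "square_integrable M (\<lambda>x. f x *\<^sub>R b)"
  by (rule square_integrable_bound[OF square_integrable_scaleR[OF assms, of "norm b"]])
    (auto simp: abs_mult mult.commute)

lemma square_integrable_Pair:
  fixes u :: "'m \<Rightarrow> 'b::euclidean_space" and g :: "'m \<Rightarrow> 'c::euclidean_space"
  assumes "square_integrable M u" "square_integrable M g"
  shows "square_integrable M (\<lambda>x. (u x, g x))"
  using assms by (auto simp: square_integrable_def norm_Pair borel_measurable_Pair)

lemma square_integrable_fst: "square_integrable M f \<Longrightarrow> square_integrable M (\<lambda>x. fst (f x))"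
  and square_integrable_snd: "square_integrable M f \<Longrightarrow> square_integrable M (\<lambda>x. snd (f x))"
  for f :: "'m \<Rightarrow> 'b::euclidean_space \<times> 'c::euclidean_space"
proof -
  assume f: "square_integrable M f"
  have measurable: "(\<lambda>x. fst (f x)) \<in> borel_measurable M" "(\<lambda>x. snd (f x)) \<in> borel_measurable M"
    by (rule borel_measurable_continuous_on[OF _ square_integrable_measurable[OF f]],
        intro continuous_intros)+
  have "norm (fst p) \<le> norm p" "norm (snd p) \<le> norm p" for p :: "'b \<times> 'c"
    by (metis norm_fst_le norm_snd_le prod.collapse)+
  then show "square_integrable M (\<lambda>x. fst (f x))" "square_integrable M (\<lambda>x. snd (f x))"
    using square_integrable_bound[OF f] measurable by blast+
qed

lemma integrable_norm_mult_square_integrable: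
  assumes [measurable]: "square_integrable M f" "square_integrable M g"
  shows "integrable M (\<lambda>x. norm (f x) * norm (g x))"
proof (rule Bochner_Integration.integrable_bound)
  show "integrable M (\<lambda>x. (norm (f x))\<^sup>2 + (norm (g x))\<^sup>2)"
    using assms by (auto simp: square_integrable_def)
  have "norm (f x) * norm (g x) \<le> (norm (f x))\<^sup>2 + (norm (g x))\<^sup>2" for x
    using sum_squares_bound[of "norm (f x)" "norm (g x)"]
      mult_nonneg_nonneg[OF norm_ge_zero[of "f x"] norm_ge_zero[of "g x"]] by linarith
  then show "AE x in M. norm (norm (f x) * norm (g x)) \<le> norm ((norm (f x))\<^sup>2 + (norm (g x))\<^sup>2)"
    by (auto intro: order_trans[OF _ abs_ge_self])
qed measurable

lemma integrable_inner_square_integrable: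
  assumes [measurable]: "square_integrable M f" "square_integrable M g"
  shows "integrable M (\<lambda>x. f x \<bullet> g x)"
  by (rule Bochner_Integration.integrable_bound[OF integrable_norm_mult_square_integrable[OF assms]])
    (auto simp: Cauchy_Schwarz_ineq2)

lemma integrable_scaleR_square_integrable:
  fixes f :: "'m \<Rightarrow> real"
  assumes [measurable]: "square_integrable M f" "square_integrable M g"
  shows "integrable M (\<lambda>x. f x *\<^sub>R g x)"
  by (rule Bochner_Integration.integrable_bound[OF integrable_norm_mult_square_integrable[OF assms]]) auto

lemma (in finite_measure) square_integrable_const: "square_integrable M (\<lambda>x. c)"
  by (auto simp: square_integrable_def)

lemma (in finite_measure) square_integrable_bounded:
  assumes "f \<in> borel_measurable M" "\<And>x. norm (f x) \<le> C"
  shows "square_integrable M f"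
  by (rule square_integrable_bound[OF square_integrable_const[of C] assms(1)])
    (use assms(2) in \<open>auto intro: order_trans[OF _ abs_ge_self]\<close>)

lemma (in finite_measure) square_integrable_imp_integrable:
  "square_integrable M f \<Longrightarrow> integrable M f"
  using integrable_scaleR_square_integrable[OF square_integrable_const[of 1]] by simp

definition L2_norm :: "'m measure \<Rightarrow> ('m \<Rightarrow> 'b::euclidean_space) \<Rightarrow> real" where
  "L2_norm M f = sqrt (\<integral>x. (norm (f x))\<^sup>2 \<partial>M)"

lemma L2_norm_nonneg: "0 \<le> L2_norm M f"
  by (simp add: L2_norm_def)

lemma L2_norm_power2: "(L2_norm M f)\<^sup>2 = (\<integral>x. (norm (f x))\<^sup>2 \<partial>M)"
  by (simp add: L2_norm_def)

lemma L2_norm_zero: "L2_norm M (\<lambda>x. 0) = 0"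
  by (simp add: L2_norm_def)

lemma integral_norm_mult_le_L2_norm:
  assumes [measurable]: "square_integrable M f" "square_integrable M g"
  shows "(\<integral>x. norm (f x) * norm (g x) \<partial>M) \<le> L2_norm M f * L2_norm M g"
proof -
  have "ennreal ((\<integral>x. norm (f x) * norm (g x) \<partial>M)\<^sup>2)
      = (\<integral>\<^sup>+x. ennreal (norm (f x)) * ennreal (norm (g x)) \<partial>M)\<^sup>2"
    using nn_integral_eq_integral[OF integrable_norm_mult_square_integrable[OF assms]]
    by (simp add: ennreal_mult ennreal_power)
  also have "\<dots> \<le> (\<integral>\<^sup>+x. (ennreal (norm (f x)))\<^sup>2 \<partial>M) * (\<integral>\<^sup>+x. (ennreal (norm (g x)))\<^sup>2 \<partial>M)"
    by (rule Cauchy_Schwarz_nn_integral) measurable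
  also have "\<dots> = ennreal ((L2_norm M f)\<^sup>2 * (L2_norm M g)\<^sup>2)"
    using nn_integral_eq_integral[OF square_integrable_integrable_power2[OF assms(1)]]
      nn_integral_eq_integral[OF square_integrable_integrable_power2[OF assms(2)]]
    by (simp add: L2_norm_power2 ennreal_mult ennreal_power)
  finally have "(\<integral>x. norm (f x) * norm (g x) \<partial>M)\<^sup>2 \<le> (L2_norm M f * L2_norm M g)\<^sup>2"
    by (simp add: ennreal_le_iff power_mult_distrib)
  then show ?thesis by (rule power2_le_imp_le) (simp add: L2_norm_nonneg)
qed

lemma abs_integral_inner_le_L2_norm:
  assumes "square_integrable M f" "square_integrable M g"
  shows "\<bar>\<integral>x. f x \<bullet> g x \<partial>M\<bar> \<le> L2_norm M f * L2_norm M g"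
proof -
  have "\<bar>\<integral>x. f x \<bullet> g x \<partial>M\<bar> \<le> (\<integral>x. \<bar>f x \<bullet> g x\<bar> \<partial>M)"
    using integral_norm_bound[of M "\<lambda>x. f x \<bullet> g x"] by simp
  also have "\<dots> \<le> (\<integral>x. norm (f x) * norm (g x) \<partial>M)"
    by (intro integral_mono integrable_abs integrable_inner_square_integrable
        integrable_norm_mult_square_integrable assms Cauchy_Schwarz_ineq2)
  also have "\<dots> \<le> L2_norm M f * L2_norm M g" by (rule integral_norm_mult_le_L2_norm[OF assms])
  finally show ?thesis .
qed

lemma L2_norm_triangle_ineq:
  assumes "square_integrable M f" "square_integrable M g"
  shows "L2_norm M (\<lambda>x. f x + g x) \<le> L2_norm M f + L2_norm M g"
proof (rule power2_le_imp_le)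
  have "(L2_norm M (\<lambda>x. f x + g x))\<^sup>2 = (\<integral>x. (norm (f x))\<^sup>2 + 2 * (f x \<bullet> g x) + (norm (g x))\<^sup>2 \<partial>M)"
    unfolding L2_norm_power2 power2_norm_eq_inner
    by (intro Bochner_Integration.integral_cong refl) (simp add: inner_simps inner_commute)
  also have "\<dots> = (L2_norm M f)\<^sup>2 + 2 * (\<integral>x. f x \<bullet> g x \<partial>M) + (L2_norm M g)\<^sup>2"
    using assms by (simp add: L2_norm_power2 square_integrable_integrable_power2
        integrable_inner_square_integrable)
  also have "\<dots> \<le> (L2_norm M f + L2_norm M g)\<^sup>2"
    using abs_integral_inner_le_L2_norm[OF assms] by (simp add: power2_sum)
  finally show "(L2_norm M (\<lambda>x. f x + g x))\<^sup>2 \<le> (L2_norm M f + L2_norm M g)\<^sup>2" .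
qed (simp add: L2_norm_nonneg)

lemma L2_norm_scaleR: "L2_norm M (\<lambda>x. c *\<^sub>R f x) = \<bar>c\<bar> * L2_norm M f"
  by (simp add: L2_norm_def power_mult_distrib real_sqrt_mult)

lemma L2_norm_minus_commute: "L2_norm M (\<lambda>x. f x - g x) = L2_norm M (\<lambda>x. g x - f x)"
  by (simp add: L2_norm_def norm_minus_commute)

lemma L2_norm_triangle_ineq4:
  assumes "square_integrable M f" "square_integrable M g"
  shows "L2_norm M (\<lambda>x. f x - g x) \<le> L2_norm M f + L2_norm M g"
  using L2_norm_triangle_ineq[OF assms(1) square_integrable_minus[OF assms(2)]]
    L2_norm_scaleR[of M "-1" g] by simp

lemma L2_norm_triangle_sub:
  assumes "square_integrable M f" "square_integrable M g"
  shows "L2_norm M f \<le> L2_norm M g + L2_norm M (\<lambda>x. f x - g x)"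
  using L2_norm_triangle_ineq[OF assms(2) square_integrable_diff[OF assms]] by simp

lemma L2_norm_mono:
  assumes "square_integrable M g" "f \<in> borel_measurable M" "AE x in M. norm (f x) \<le> norm (g x)"
  shows "L2_norm M f \<le> L2_norm M g"
  unfolding L2_norm_def
proof (intro real_sqrt_le_mono integral_mono_AE)
  show "integrable M (\<lambda>x. (norm (f x))\<^sup>2)"
    using square_integrable_bound[OF assms] by (rule square_integrable_integrable_power2)
  show "AE x in M. (norm (f x))\<^sup>2 \<le> (norm (g x))\<^sup>2"
    using assms(3) by eventually_elim (simp add: power_mono)
qed (use assms square_integrable_integrable_power2 in auto)

lemma L2_norm_bounded_scaleR_le:
  fixes c :: "'m \<Rightarrow> real"
  assumes f: "square_integrable M f" and [measurable]: "c \<in> borel_measurable M"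
    and coeff_le: "\<And>x. \<bar>c x\<bar> \<le> C"
  shows "L2_norm M (\<lambda>x. c x *\<^sub>R f x) \<le> C * L2_norm M f"
proof -
  note [measurable] = f
  have "0 \<le> C" using coeff_le[of undefined] by linarith
  have "L2_norm M (\<lambda>x. c x *\<^sub>R f x) \<le> L2_norm M (\<lambda>x. C *\<^sub>R f x)"
  proof (rule L2_norm_mono[OF square_integrable_scaleR[OF f]])
    show "AE x in M. norm (c x *\<^sub>R f x) \<le> norm (C *\<^sub>R f x)"
      using coeff_le \<open>0 \<le> C\<close> by (simp add: mult_right_mono)
  qed measurable
  then show ?thesis using \<open>0 \<le> C\<close> by (simp add: L2_norm_scaleR)
qed

lemma L2_norm_cong_AE:
  assumes "f \<in> borel_measurable M" "g \<in> borel_measurable M" "AE x in M. f x = g x"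
  shows "L2_norm M f = L2_norm M g"
  unfolding L2_norm_def using assms by (intro arg_cong[of _ _ sqrt] integral_cong_AE) auto

lemma L2_norm_Pair_power2:
  assumes "square_integrable M u" "square_integrable M g"
  shows "(L2_norm M (\<lambda>x. (u x, g x)))\<^sup>2 = (L2_norm M u)\<^sup>2 + (L2_norm M g)\<^sup>2"
  using assms by (simp add: L2_norm_power2 norm_Pair square_integrable_integrable_power2)

lemma L2_norm_Pair_bounds:
  assumes "square_integrable M u" "square_integrable M g"
  shows L2_norm_fst_le_Pair: "L2_norm M u \<le> L2_norm M (\<lambda>x. (u x, g x))"
    and L2_norm_snd_le_Pair: "L2_norm M g \<le> L2_norm M (\<lambda>x. (u x, g x))"
    and L2_norm_Pair_le: "L2_norm M (\<lambda>x. (u x, g x)) \<le> L2_norm M u + L2_norm M g"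
  by (rule power2_le_imp_le; simp add: L2_norm_Pair_power2[OF assms] L2_norm_nonneg power2_sum)+

definition L2_tendsto :: "'m measure \<Rightarrow> (nat \<Rightarrow> 'm \<Rightarrow> 'b::euclidean_space) \<Rightarrow> ('m \<Rightarrow> 'b) \<Rightarrow> bool" where
  "L2_tendsto M f f0 \<longleftrightarrow> (\<lambda>n. L2_norm M (\<lambda>x. f n x - f0 x)) \<longlonglongrightarrow> 0"

lemma L2_tendstoD: "L2_tendsto M f f0 \<Longrightarrow> (\<lambda>n. L2_norm M (\<lambda>x. f n x - f0 x)) \<longlonglongrightarrow> 0"
  by (simp add: L2_tendsto_def)

lemma L2_tendsto_if_le:
  assumes "\<And>n. L2_norm M (\<lambda>x. f n x - f0 x) \<le> b n" "b \<longlonglongrightarrow> 0"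
  shows "L2_tendsto M f f0"
  unfolding L2_tendsto_def
  by (rule Lim_null_comparison[OF always_eventually assms(2)]) (simp add: L2_norm_nonneg assms(1))

lemma L2_tendsto_subseq:
  "L2_tendsto M f f0 \<Longrightarrow> strict_mono r \<Longrightarrow> L2_tendsto M (\<lambda>n. f (r n)) f0"
  unfolding L2_tendsto_def using LIMSEQ_subseq_LIMSEQ by (fastforce simp: o_def)

lemma L2_tendsto_norm:
  assumes f: "\<And>n. square_integrable M (f n)" "square_integrable M f0" and lim: "L2_tendsto M f f0"
  shows "(\<lambda>n. L2_norm M (f n)) \<longlonglongrightarrow> L2_norm M f0"
proof (rule LIM_zero_cancel, rule Lim_null_comparison[OF always_eventually L2_tendstoD[OF lim]], rule allI)
  show "norm (L2_norm M (f n) - L2_norm M f0) \<le> L2_norm M (\<lambda>x. f n x - f0 x)" for n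
    using L2_norm_triangle_sub[OF f(1)[of n] f(2)] L2_norm_triangle_sub[OF f(2) f(1)[of n]]
      L2_norm_minus_commute[of M "f n" f0] by simp
qed

lemma L2_tendsto_Pair_iff:
  assumes "\<And>n. square_integrable M (u n)" "square_integrable M u0"
    and "\<And>n. square_integrable M (g n)" "square_integrable M g0"
  shows "L2_tendsto M (\<lambda>n x. (u n x, g n x)) (\<lambda>x. (u0 x, g0 x)) \<longleftrightarrow> L2_tendsto M u u0 \<and> L2_tendsto M g g0"
proof -
  have diff_in_L2: "square_integrable M (\<lambda>x. u n x - u0 x)" "square_integrable M (\<lambda>x. g n x - g0 x)" for n
    by (intro square_integrable_diff assms)+
  show ?thesis
  proof (intro iffI conjI)
    assume lim: "L2_tendsto M (\<lambda>n x. (u n x, g n x)) (\<lambda>x. (u0 x, g0 x))"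
    show "L2_tendsto M u u0"
      by (rule L2_tendsto_if_le[OF _ L2_tendstoD[OF lim]]) (use L2_norm_fst_le_Pair[OF diff_in_L2] in simp)
    show "L2_tendsto M g g0"
      by (rule L2_tendsto_if_le[OF _ L2_tendstoD[OF lim]]) (use L2_norm_snd_le_Pair[OF diff_in_L2] in simp)
  next
    assume "L2_tendsto M u u0 \<and> L2_tendsto M g g0"
    then have "(\<lambda>n. L2_norm M (\<lambda>x. u n x - u0 x) + L2_norm M (\<lambda>x. g n x - g0 x)) \<longlonglongrightarrow> 0"
      unfolding L2_tendsto_def by (auto intro: tendsto_add_zero)
    then show "L2_tendsto M (\<lambda>n x. (u n x, g n x)) (\<lambda>x. (u0 x, g0 x))"
      by (rule L2_tendsto_if_le[rotated]) (use L2_norm_Pair_le[OF diff_in_L2] in simp)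
  qed
qed

lemma L2_dominated_convergence:
  assumes F: "square_integrable M F"
    and [measurable]: "\<And>n. f n \<in> borel_measurable M" "f0 \<in> borel_measurable M"
    and dominated: "\<And>n. AE x in M. norm (f n x) \<le> norm (F x)"
    and lim: "AE x in M. (\<lambda>n. f n x) \<longlonglongrightarrow> f0 x"
  shows "square_integrable M f0" "L2_tendsto M f f0"
proof -
  have le_all: "AE x in M. \<forall>n. norm (f n x) \<le> norm (F x)" using dominated by (simp add: AE_all_countable)
  have le_limit: "AE x in M. norm (f0 x) \<le> norm (F x)"
    using le_all lim
  proof eventually_elim
    case (elim x)
    then show ?case by (intro LIMSEQ_le_const2[OF tendsto_norm[OF elim(2)]]) auto
  qed
  then show "square_integrable M f0" by (intro square_integrable_bound[OF F]) measurable
  have "(\<lambda>n. \<integral>x. (norm (f n x - f0 x))\<^sup>2 \<partial>M) \<longlonglongrightarrow> (\<integral>x. 0 \<partial>M)"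
  proof (rule integral_dominated_convergence[where w="\<lambda>x. 4 * (norm (F x))\<^sup>2"])
    show "integrable M (\<lambda>x. 4 * (norm (F x))\<^sup>2)"
      using square_integrable_integrable_power2[OF F] by simp
    show "AE x in M. (\<lambda>n. (norm (f n x - f0 x))\<^sup>2) \<longlonglongrightarrow> 0"
      using lim by eventually_elim (auto intro!: tendsto_eq_intros)
    show "AE x in M. norm ((norm (f n x - f0 x))\<^sup>2) \<le> 4 * (norm (F x))\<^sup>2" for n
      using le_all le_limit
    proof eventually_elim
      case (elim x)
      have "norm (f n x - f0 x) \<le> 2 * norm (F x)"
        using elim(1)[rule_format, of n] elim(2) norm_triangle_ineq4[of "f n x" "f0 x"] by linarith
      then have "(norm (f n x - f0 x))\<^sup>2 \<le> (2 * norm (F x))\<^sup>2" by (rule power_mono) simp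
      then show ?case by (simp add: power_mult_distrib)
    qed
  qed auto
  from tendsto_real_sqrt[OF this] show "L2_tendsto M f f0"
    by (simp add: L2_tendsto_def L2_norm_def)
qed

lemma L2_tendsto_imp_AE_subseq:
  assumes "\<And>n. square_integrable M (f n)" "square_integrable M f0" "L2_tendsto M f f0"
  obtains r where "strict_mono (r::nat\<Rightarrow>nat)" "AE x in M. (\<lambda>n. f (r n) x) \<longlonglongrightarrow> f0 x"
proof -
  have "(\<lambda>n. (L2_norm M (\<lambda>x. f n x - f0 x))\<^sup>2) \<longlonglongrightarrow> 0\<^sup>2"
    by (intro tendsto_intros L2_tendstoD assms)
  then have "(\<lambda>n. \<integral>x. norm ((norm (f n x - f0 x))\<^sup>2) \<partial>M) \<longlonglongrightarrow> 0" by (simp add: L2_norm_power2)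
  from tendsto_L1_AE_subseq[OF square_integrable_integrable_power2[OF square_integrable_diff[OF assms(1,2)]] this]
  obtain r where r: "strict_mono (r::nat\<Rightarrow>nat)"
    and sq: "AE x in M. (\<lambda>n. (norm (f (r n) x - f0 x))\<^sup>2) \<longlonglongrightarrow> 0" by blast
  have "AE x in M. (\<lambda>n. f (r n) x) \<longlonglongrightarrow> f0 x"
    using sq
  proof eventually_elim
    case (elim x)
    from tendsto_real_sqrt[OF this] show ?case by (simp add: tendsto_norm_zero_iff LIM_zero_cancel)
  qed
  with r that show thesis by blast
qed

lemma L2_tendsto_unique:
  assumes f: "\<And>n. square_integrable M (f n)" and sq: "square_integrable M f0" "square_integrable M f1"
    and lim: "L2_tendsto M f f0" "L2_tendsto M f f1"
  shows "AE x in M. f0 x = f1 x"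
proof -
  note diff_in_L2 = square_integrable_diff[OF sq]
  have "(\<lambda>n. L2_norm M (\<lambda>x. f n x - f1 x) + L2_norm M (\<lambda>x. f n x - f0 x)) \<longlonglongrightarrow> 0"
    using tendsto_add[OF L2_tendstoD[OF lim(2)] L2_tendstoD[OF lim(1)]] by simp
  moreover have "L2_norm M (\<lambda>x. f0 x - f1 x)
      \<le> L2_norm M (\<lambda>x. f n x - f1 x) + L2_norm M (\<lambda>x. f n x - f0 x)" for n
    using L2_norm_triangle_ineq4[OF square_integrable_diff[OF f sq(2)] square_integrable_diff[OF f sq(1)],
        of n n] by simp
  ultimately have "L2_norm M (\<lambda>x. f0 x - f1 x) \<le> 0" by (intro LIMSEQ_le_const) auto
  then have "L2_norm M (\<lambda>x. f0 x - f1 x) = 0" using L2_norm_nonneg[of M "\<lambda>x. f0 x - f1 x"] by simp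
  then have "AE x in M. (norm (f0 x - f1 x))\<^sup>2 = 0"
    using integral_nonneg_eq_0_iff_AE[OF square_integrable_integrable_power2[OF diff_in_L2]]
    by (simp add: L2_norm_def)
  then show ?thesis by eventually_elim simp
qed

lemma integral_inner_tendsto_zero:
  assumes f: "\<And>n. square_integrable M (f n)" "\<And>n. L2_norm M (f n) \<le> B"
    and h: "\<And>n. square_integrable M (h n)" "L2_tendsto M h (\<lambda>x. 0)"
  shows "(\<lambda>n. \<integral>x. f n x \<bullet> h n x \<partial>M) \<longlonglongrightarrow> 0"
proof (rule Lim_null_comparison)
  show "\<forall>\<^sub>F n in sequentially. norm (\<integral>x. f n x \<bullet> h n x \<partial>M) \<le> B * L2_norm M (h n)"
    using order_trans[OF abs_integral_inner_le_L2_norm[OF f(1) h(1)]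
        mult_right_mono[OF f(2) L2_norm_nonneg]]
    by (intro always_eventually) auto
  show "(\<lambda>n. B * L2_norm M (h n)) \<longlonglongrightarrow> 0"
    using L2_tendstoD[OF h(2)] by (intro tendsto_mult_right_zero) simp
qed

definition L2_weakly_tendsto ::
    "'m measure \<Rightarrow> (nat \<Rightarrow> 'm \<Rightarrow> 'b::euclidean_space) \<Rightarrow> ('m \<Rightarrow> 'b) \<Rightarrow> bool" where
  "L2_weakly_tendsto M f f0 \<longleftrightarrow>
     (\<forall>h. square_integrable M h \<longrightarrow> (\<lambda>n. \<integral>x. f n x \<bullet> h x \<partial>M) \<longlonglongrightarrow> (\<integral>x. f0 x \<bullet> h x \<partial>M))"

lemma L2_weakly_tendstoD:
  "L2_weakly_tendsto M f f0 \<Longrightarrow> square_integrable M h \<Longrightarrow>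
    (\<lambda>n. \<integral>x. f n x \<bullet> h x \<partial>M) \<longlonglongrightarrow> (\<integral>x. f0 x \<bullet> h x \<partial>M)"
  by (simp add: L2_weakly_tendsto_def)

lemma L2_weakly_tendsto_const: "L2_weakly_tendsto M (\<lambda>n. f) f"
  by (simp add: L2_weakly_tendsto_def)

lemma L2_weakly_tendsto_subseq:
  "L2_weakly_tendsto M f f0 \<Longrightarrow> strict_mono r \<Longrightarrow> L2_weakly_tendsto M (\<lambda>n. f (r n)) f0"
  unfolding L2_weakly_tendsto_def using LIMSEQ_subseq_LIMSEQ by (fastforce simp: o_def)

lemma L2_tendsto_imp_weakly_tendsto:
  fixes f0 :: "'m \<Rightarrow> 'b::euclidean_space"
  assumes "\<And>n. square_integrable M (f n)" "square_integrable M f0" "L2_tendsto M f f0"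
  shows "L2_weakly_tendsto M f f0"
  unfolding L2_weakly_tendsto_def
proof (intro allI impI)
  fix h :: "'m \<Rightarrow> 'b" assume h: "square_integrable M h"
  have "(\<lambda>n. \<integral>x. h x \<bullet> (f n x - f0 x) \<partial>M) \<longlonglongrightarrow> 0"
    using assms by (intro integral_inner_tendsto_zero[OF h order_refl])
      (auto simp: L2_tendsto_def intro: square_integrable_diff)
  moreover have "(\<integral>x. h x \<bullet> (f n x - f0 x) \<partial>M) = (\<integral>x. f n x \<bullet> h x \<partial>M) - (\<integral>x. f0 x \<bullet> h x \<partial>M)" for n
    unfolding inner_diff_right inner_commute[of "h _"]
    by (intro Bochner_Integration.integral_diff integrable_inner_square_integrable assms h)
  ultimately show "(\<lambda>n. \<integral>x. f n x \<bullet> h x \<partial>M) \<longlonglongrightarrow> (\<integral>x. f0 x \<bullet> h x \<partial>M)"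
    by (simp add: LIM_zero_iff)
qed

lemma L2_weakly_tendsto_diff:
  fixes f0 :: "'m \<Rightarrow> 'b::euclidean_space"
  assumes f: "\<And>n. square_integrable M (f n)" "square_integrable M f0" "L2_weakly_tendsto M f f0"
    and g: "\<And>n. square_integrable M (g n)" "square_integrable M g0" "L2_weakly_tendsto M g g0"
  shows "L2_weakly_tendsto M (\<lambda>n x. f n x - g n x) (\<lambda>x. f0 x - g0 x)"
  unfolding L2_weakly_tendsto_def
proof (intro allI impI)
  fix h :: "'m \<Rightarrow> 'b" assume h: "square_integrable M h"
  have "(\<lambda>n. (\<integral>x. f n x \<bullet> h x \<partial>M) - (\<integral>x. g n x \<bullet> h x \<partial>M)) \<longlonglongrightarrow> (\<integral>x. f0 x \<bullet> h x \<partial>M) - (\<integral>x. g0 x \<bullet> h x \<partial>M)"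
    by (intro tendsto_diff L2_weakly_tendstoD f(3) g(3) h)
  then show "(\<lambda>n. \<integral>x. (f n x - g n x) \<bullet> h x \<partial>M) \<longlonglongrightarrow> (\<integral>x. (f0 x - g0 x) \<bullet> h x \<partial>M)"
    using f(1,2) g(1,2) h by (simp add: inner_diff_left integrable_inner_square_integrable)
qed

lemma L2_weakly_tendsto_inner:
  assumes f: "\<And>n. square_integrable M (f n)" "\<And>n. L2_norm M (f n) \<le> B" "L2_weakly_tendsto M f f0"
    and h: "\<And>n. square_integrable M (h n)" "square_integrable M h0" "L2_tendsto M h h0"
  shows "(\<lambda>n. \<integral>x. f n x \<bullet> h n x \<partial>M) \<longlonglongrightarrow> (\<integral>x. f0 x \<bullet> h0 x \<partial>M)"
proof -
  have "(\<lambda>n. \<integral>x. f n x \<bullet> (h n x - h0 x) \<partial>M) \<longlonglongrightarrow> 0"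
    using h by (intro integral_inner_tendsto_zero[OF f(1,2)])
      (auto simp: L2_tendsto_def intro: square_integrable_diff)
  moreover have "(\<lambda>n. \<integral>x. f n x \<bullet> h0 x \<partial>M) \<longlonglongrightarrow> (\<integral>x. f0 x \<bullet> h0 x \<partial>M)"
    by (rule L2_weakly_tendstoD[OF f(3) h(2)])
  ultimately have "(\<lambda>n. (\<integral>x. f n x \<bullet> (h n x - h0 x) \<partial>M) + (\<integral>x. f n x \<bullet> h0 x \<partial>M))
      \<longlonglongrightarrow> 0 + (\<integral>x. f0 x \<bullet> h0 x \<partial>M)" by (rule tendsto_add)
  then show ?thesis
    using f(1) h(1,2) by (simp add: inner_diff_right integrable_inner_square_integrable)
qed

lemma integral_inner_dominated_tendsto_zero:
  assumes f: "\<And>n. square_integrable M (f n)" "\<And>n. L2_norm M (f n) \<le> B"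
    and H: "square_integrable M H" and h: "\<And>n. h n \<in> borel_measurable M"
    and dominated: "\<And>n. AE x in M. norm (h n x) \<le> norm (H x)"
    and lim: "AE x in M. (\<lambda>n. h n x) \<longlonglongrightarrow> 0"
  shows "(\<lambda>n. \<integral>x. f n x \<bullet> h n x \<partial>M) \<longlonglongrightarrow> 0"
  by (intro integral_inner_tendsto_zero[OF f] square_integrable_bound[OF H h dominated]
      L2_dominated_convergence(2)[OF H h _ dominated lim]) simp

lemma L2_weakly_tendsto_inner_dominated:
  assumes f: "\<And>n. square_integrable M (f n)" "\<And>n. L2_norm M (f n) \<le> B" "L2_weakly_tendsto M f f0"
    and H: "square_integrable M H" and h: "\<And>n. h n \<in> borel_measurable M" "h0 \<in> borel_measurable M"
    and dominated: "\<And>n. AE x in M. norm (h n x) \<le> norm (H x)"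
    and lim: "AE x in M. (\<lambda>n. h n x) \<longlonglongrightarrow> h0 x"
  shows "(\<lambda>n. \<integral>x. f n x \<bullet> h n x \<partial>M) \<longlonglongrightarrow> (\<integral>x. f0 x \<bullet> h0 x \<partial>M)"
  by (intro L2_weakly_tendsto_inner[OF f] square_integrable_bound[OF H h(1) dominated]
      L2_dominated_convergence[OF H h dominated lim])

lemma tendsto_if_subsubsequence_tendsto:
  fixes a :: "nat \<Rightarrow> 'a::topological_space"
  assumes "\<And>r::nat\<Rightarrow>nat. strict_mono r \<Longrightarrow> \<exists>q::nat\<Rightarrow>nat. strict_mono q \<and> (\<lambda>n. a (r (q n))) \<longlonglongrightarrow> l"
  shows "a \<longlonglongrightarrow> l"
proof (rule topological_tendstoI, rule ccontr)
  fix S assume "open S" "l \<in> S" and "\<not> (\<forall>\<^sub>F n in sequentially. a n \<in> S)"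
  then have inf: "infinite {n. a n \<notin> S}" by (simp add: eventually_cofinite flip: cofinite_eq_sequentially)
  then have "strict_mono (enumerate {n. a n \<notin> S})" by (rule strict_mono_enumerate)
  then obtain q where "(\<lambda>n. a (enumerate {n. a n \<notin> S} (q n))) \<longlonglongrightarrow> l" using assms by blast
  then have "\<forall>\<^sub>F n in sequentially. a (enumerate {n. a n \<notin> S} (q n)) \<in> S"
    using \<open>open S\<close> \<open>l \<in> S\<close> by (rule topological_tendstoD)
  then show False using enumerate_in_set[OF inf] by (auto simp: eventually_sequentially)
qed

lemma integral_tendsto_zero_if_dominated_up_to_null:
  fixes f g :: "nat \<Rightarrow> 'm \<Rightarrow> real"
  assumes f: "\<And>n. f n \<in> borel_measurable M" "\<And>n. AE x in M. 0 \<le> f n x" "AE x in M. (\<lambda>n. f n x) \<longlonglongrightarrow> 0"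
    and g: "\<And>n. integrable M (g n)" "\<And>n. AE x in M. 0 \<le> g n x" "AE x in M. (\<lambda>n. g n x) \<longlonglongrightarrow> 0"
      "(\<lambda>n. \<integral>x. g n x \<partial>M) \<longlonglongrightarrow> 0"
    and h: "integrable M h" and dominated: "\<And>n. AE x in M. f n x \<le> g n x + h x"
  shows "(\<lambda>n. \<integral>x. f n x \<partial>M) \<longlonglongrightarrow> 0"
proof -
  note [measurable] = f(1) borel_measurable_integrable[OF g(1)] borel_measurable_integrable[OF h]
  define excess where "excess n x = max 0 (f n x - g n x)" for n x
  have [measurable]: "excess n \<in> borel_measurable M" for n unfolding excess_def[abs_def] by measurable
  have excess_le: "AE x in M. norm (excess n x) \<le> \<bar>h x\<bar>" for n
    using dominated[of n] by eventually_elim (auto simp: excess_def)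
  have excess_integrable: "integrable M (excess n)" for n
    by (rule Bochner_Integration.integrable_bound[OF h]) (use excess_le[of n] in auto)
  have "(\<lambda>n. \<integral>x. excess n x \<partial>M) \<longlonglongrightarrow> (\<integral>x. 0 \<partial>M)"
  proof (rule integral_dominated_convergence[OF _ _ integrable_abs[OF h] _ excess_le])
    show "AE x in M. (\<lambda>n. excess n x) \<longlonglongrightarrow> 0"
      using f(3) g(3)
    proof eventually_elim
      case (elim x)
      then have "(\<lambda>n. max 0 (f n x - g n x)) \<longlonglongrightarrow> max 0 (0 - 0)" by (intro tendsto_intros)
      then show ?case by (simp add: excess_def)
    qed
  qed auto
  from tendsto_add[OF g(4) this] have upper: "(\<lambda>n. (\<integral>x. g n x \<partial>M) + (\<integral>x. excess n x \<partial>M)) \<longlonglongrightarrow> 0" by simp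
  have "norm (\<integral>x. f n x \<partial>M) \<le> (\<integral>x. g n x \<partial>M) + (\<integral>x. excess n x \<partial>M)" for n
  proof -
    have "norm (\<integral>x. f n x \<partial>M) = (\<integral>x. f n x \<partial>M)" using integral_nonneg_AE[OF f(2)] by simp
    also have "\<dots> \<le> (\<integral>x. g n x + excess n x \<partial>M)"
    proof (rule integral_mono_AE')
      show "integrable M (\<lambda>x. g n x + excess n x)"
        by (intro Bochner_Integration.integrable_add g(1) excess_integrable)
      show "AE x in M. 0 \<le> g n x + excess n x"
        using g(2)[of n] by eventually_elim (simp add: excess_def)
    qed (simp add: excess_def)
    finally show ?thesis using g(1) excess_integrable by simp
  qed
  then show ?thesis by (intro Lim_null_comparison[OF always_eventually upper] allI)
qed

lemma integral_tendsto_zero_if_L1_controlled: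
  fixes f g :: "nat \<Rightarrow> 'm \<Rightarrow> real"
  assumes f: "\<And>n. f n \<in> borel_measurable M" "\<And>n. AE x in M. 0 \<le> f n x"
    and g: "\<And>n. integrable M (g n)" "\<And>n. AE x in M. 0 \<le> g n x" "(\<lambda>n. \<integral>x. g n x \<partial>M) \<longlonglongrightarrow> 0"
    and h: "integrable M h" and dominated: "\<And>n. AE x in M. f n x \<le> g n x + h x"
    and controlled: "\<And>r. strict_mono (r::nat\<Rightarrow>nat) \<Longrightarrow> AE x in M. (\<lambda>n. g (r n) x) \<longlonglongrightarrow> 0 \<Longrightarrow>
      AE x in M. (\<lambda>n. f (r n) x) \<longlonglongrightarrow> 0"
  shows "(\<lambda>n. \<integral>x. f n x \<partial>M) \<longlonglongrightarrow> 0"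
proof (rule tendsto_if_subsubsequence_tendsto)
  fix r :: "nat \<Rightarrow> nat" assume r: "strict_mono r"
  note [measurable] = borel_measurable_integrable[OF g(1)]
  have "(\<integral>x. norm (g n x) \<partial>M) = (\<integral>x. g n x \<partial>M)" for n
    using g(2)[of n] by (intro integral_cong_AE) auto
  then have "(\<lambda>n. \<integral>x. norm (g (r n) x) \<partial>M) \<longlonglongrightarrow> 0"
    using LIMSEQ_subseq_LIMSEQ[OF g(3) r] by (simp add: o_def)
  from tendsto_L1_AE_subseq[OF g(1) this]
  obtain q where q: "strict_mono (q::nat\<Rightarrow>nat)" and g_lim: "AE x in M. (\<lambda>n. g (r (q n)) x) \<longlonglongrightarrow> 0"
    by blast
  have rq: "strict_mono (\<lambda>n. r (q n))" using r q by (simp add: strict_mono_def)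
  have "(\<lambda>n. \<integral>x. g (r (q n)) x \<partial>M) \<longlonglongrightarrow> 0" using LIMSEQ_subseq_LIMSEQ[OF g(3) rq] by (simp add: o_def)
  from integral_tendsto_zero_if_dominated_up_to_null[OF f(1,2) controlled[OF rq g_lim] g(1,2) g_lim this h
      dominated] q
  show "\<exists>q. strict_mono q \<and> (\<lambda>n. \<integral>x. f (r (q n)) x \<partial>M) \<longlonglongrightarrow> 0" by blast
qed

lemma L2_norm_le_if_AE_limit:
  assumes f: "\<And>n. square_integrable M (f n)" "\<And>n. L2_norm M (f n) \<le> C"
    and [measurable]: "f0 \<in> borel_measurable M" and lim: "AE x in M. (\<lambda>n. f n x) \<longlonglongrightarrow> f0 x"
  shows "square_integrable M f0" "L2_norm M f0 \<le> C"
proof -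
  note [measurable] = f(1)
  have "0 \<le> C" using f(2)[of 0] L2_norm_nonneg order_trans by blast
  have "(\<integral>\<^sup>+x. ennreal ((norm (f0 x))\<^sup>2) \<partial>M) = (\<integral>\<^sup>+x. liminf (\<lambda>n. ennreal ((norm (f n x))\<^sup>2)) \<partial>M)"
  proof (rule nn_integral_cong_AE)
    show "AE x in M. ennreal ((norm (f0 x))\<^sup>2) = liminf (\<lambda>n. ennreal ((norm (f n x))\<^sup>2))"
      using lim
    proof eventually_elim
      case (elim x)
      then have "(\<lambda>n. ennreal ((norm (f n x))\<^sup>2)) \<longlonglongrightarrow> ennreal ((norm (f0 x))\<^sup>2)"
        by (intro tendsto_ennrealI tendsto_intros)
      from lim_imp_Liminf[OF sequentially_bot this] show ?case by (rule sym)
    qed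
  qed
  also have "\<dots> \<le> liminf (\<lambda>n. \<integral>\<^sup>+x. ennreal ((norm (f n x))\<^sup>2) \<partial>M)"
    by (intro nn_integral_liminf) measurable
  also have "\<dots> \<le> liminf (\<lambda>n::nat. ennreal (C\<^sup>2))"
  proof (rule Liminf_mono, rule always_eventually, rule allI)
    fix n
    have "(\<integral>\<^sup>+x. ennreal ((norm (f n x))\<^sup>2) \<partial>M) = ennreal ((L2_norm M (f n))\<^sup>2)"
      unfolding L2_norm_power2
      by (intro nn_integral_eq_integral square_integrable_integrable_power2 f(1)) auto
    also have "\<dots> \<le> ennreal (C\<^sup>2)" using f(2)[of n] by (intro ennreal_leI power_mono L2_norm_nonneg)
    finally show "(\<integral>\<^sup>+x. ennreal ((norm (f n x))\<^sup>2) \<partial>M) \<le> ennreal (C\<^sup>2)" .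
  qed
  finally have Fatou: "(\<integral>\<^sup>+x. ennreal ((norm (f0 x))\<^sup>2) \<partial>M) \<le> ennreal (C\<^sup>2)" by (simp add: Liminf_const)
  have integrability: "integrable M (\<lambda>x. (norm (f0 x))\<^sup>2)"
    by (rule integrableI_bounded) (use Fatou in \<open>auto simp: le_less_trans[OF _ ennreal_less_top]\<close>)
  then show "square_integrable M f0" by (simp add: square_integrable_def)
  have "ennreal ((L2_norm M f0)\<^sup>2) \<le> ennreal (C\<^sup>2)"
    using Fatou nn_integral_eq_integral[OF integrability] by (simp add: L2_norm_power2)
  then have "(L2_norm M f0)\<^sup>2 \<le> C\<^sup>2" by (simp add: ennreal_le_iff)
  then show "L2_norm M f0 \<le> C" using \<open>0 \<le> C\<close> by (rule power2_le_imp_le)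
qed

definition L2_Cauchy :: "'m measure \<Rightarrow> (nat \<Rightarrow> 'm \<Rightarrow> 'b::euclidean_space) \<Rightarrow> bool" where
  "L2_Cauchy M f \<longleftrightarrow> (\<forall>e>0. \<exists>N. \<forall>m\<ge>N. \<forall>n\<ge>N. L2_norm M (\<lambda>x. f m x - f n x) < e)"

lemma L2_CauchyD:
  assumes "L2_Cauchy M f" "0 < e"
  obtains N where "\<And>m n. N \<le> m \<Longrightarrow> N \<le> n \<Longrightarrow> L2_norm M (\<lambda>x. f m x - f n x) < e"
  using assms unfolding L2_Cauchy_def by blast

lemma L2_Cauchy_imp_L1_Cauchy_scaleR:
  fixes w :: "'m \<Rightarrow> real"
  assumes w: "square_integrable M w" and f: "\<And>n. square_integrable M (f n)" and "L2_Cauchy M f" "0 < e"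
  shows "\<exists>N. \<forall>i\<ge>N. \<forall>j\<ge>N. (LINT x|M. norm (w x *\<^sub>R f i x - w x *\<^sub>R f j x)) < e"
proof -
  have "0 < e / (L2_norm M w + 1)" using \<open>0 < e\<close> L2_norm_nonneg[of M w] by simp
  from L2_CauchyD[OF \<open>L2_Cauchy M f\<close> this]
  obtain N where N: "\<And>i j. N \<le> i \<Longrightarrow> N \<le> j \<Longrightarrow> L2_norm M (\<lambda>x. f i x - f j x) < e / (L2_norm M w + 1)"
    by metis
  have "(LINT x|M. norm (w x *\<^sub>R f i x - w x *\<^sub>R f j x)) < e" if "N \<le> i" "N \<le> j" for i j
  proof -
    have "(LINT x|M. norm (w x *\<^sub>R f i x - w x *\<^sub>R f j x)) \<le> L2_norm M w * L2_norm M (\<lambda>x. f i x - f j x)"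
      using integral_norm_mult_le_L2_norm[OF w square_integrable_diff[OF f f], of i j]
      by (simp flip: scaleR_diff_right)
    also have "\<dots> \<le> (L2_norm M w + 1) * L2_norm M (\<lambda>x. f i x - f j x)"
      by (intro mult_right_mono L2_norm_nonneg) simp
    also have "\<dots> < e" using N[OF that] L2_norm_nonneg[of M w] by (simp add: field_simps)
    finally show ?thesis .
  qed
  then show ?thesis by blast
qed

lemma (in sigma_finite_measure) positive_square_integrable_exists:
  obtains w :: "'a \<Rightarrow> real" where "square_integrable M w" "\<And>x. 0 < w x"
proof -
  obtain w where [measurable]: "w \<in> borel_measurable M" and w: "\<And>x. 0 < w x" "\<And>x. w x \<le> (1::real)"
    and "integrable M w" using obtain_positive_integrable_function by metis
  have "(w x)\<^sup>2 \<le> w x" for x using w[of x] by (simp add: power2_eq_square mult_left_le)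
  then have "integrable M (\<lambda>x. (norm (w x))\<^sup>2)"
    by (intro Bochner_Integration.integrable_bound[OF \<open>integrable M w\<close>])
      (auto intro: order_trans[OF _ abs_ge_self])
  then have "square_integrable M w" by (simp add: square_integrable_def)
  with w(1) that show thesis by blast
qed

lemma (in sigma_finite_measure) L2_Cauchy_imp_AE_convergent_subseq:
  assumes f: "\<And>n. square_integrable M (f n)" and "L2_Cauchy M f"
  obtains r where "strict_mono (r::nat\<Rightarrow>nat)" "AE x in M. convergent (\<lambda>n. f (r n) x)"
proof -
  obtain w :: "'a \<Rightarrow> real" where w: "square_integrable M w" "\<And>x. 0 < w x"
    by (rule positive_square_integrable_exists) (rule that)
  obtain r where r: "strict_mono (r::nat\<Rightarrow>nat)" and Cauchy: "AE x in M. Cauchy (\<lambda>n. w x *\<^sub>R f (r n) x)"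
    using cauchy_L1_AE_cauchy_subseq[OF integrable_scaleR_square_integrable[OF w(1) f]
        L2_Cauchy_imp_L1_Cauchy_scaleR[OF w(1) f \<open>L2_Cauchy M f\<close>]] by blast
  have "AE x in M. convergent (\<lambda>n. f (r n) x)"
    using Cauchy
  proof eventually_elim
    case (elim x)
    then obtain l where "(\<lambda>n. w x *\<^sub>R f (r n) x) \<longlonglongrightarrow> l"
      using Cauchy_convergent convergent_def by blast
    then have "(\<lambda>n. inverse (w x) *\<^sub>R (w x *\<^sub>R f (r n) x)) \<longlonglongrightarrow> inverse (w x) *\<^sub>R l"
      by (intro tendsto_intros)
    then show ?case using w(2)[of x] by (auto simp: convergent_def)
  qed
  with r that show thesis by blast
qed

lemma L2_Cauchy_AE_subseq_limit:
  assumes f: "\<And>n. square_integrable M (f n)" and Cauchy: "L2_Cauchy M f"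
    and r: "strict_mono (r::nat\<Rightarrow>nat)" and lim: "AE x in M. (\<lambda>n. f (r n) x) \<longlonglongrightarrow> g x"
    and [measurable]: "g \<in> borel_measurable M"
  shows "square_integrable M g" "L2_tendsto M f g"
proof -
  note [measurable] = f
  have close: "\<exists>N. \<forall>n\<ge>N. square_integrable M (\<lambda>x. f n x - g x) \<and> L2_norm M (\<lambda>x. f n x - g x) \<le> e"
    if "0 < e" for e
  proof -
    obtain N where N: "\<And>m n. N \<le> m \<Longrightarrow> N \<le> n \<Longrightarrow> L2_norm M (\<lambda>x. f m x - f n x) < e"
      using L2_CauchyD[OF Cauchy \<open>0 < e\<close>] by metis
    have "square_integrable M (\<lambda>x. f n x - g x) \<and> L2_norm M (\<lambda>x. f n x - g x) \<le> e" if "N \<le> n" for n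
    proof -
      have diff_in_L2: "square_integrable M (\<lambda>x. f n x - f (r (m + N)) x)" for m
        by (intro square_integrable_diff f)
      have dominated: "L2_norm M (\<lambda>x. f n x - f (r (m + N)) x) \<le> e" for m
        using N[OF that, of "r (m + N)"] seq_suble[OF r, of "m + N"] by simp
      have "AE x in M. (\<lambda>m. f n x - f (r (m + N)) x) \<longlonglongrightarrow> f n x - g x"
        using lim by eventually_elim (intro tendsto_intros LIMSEQ_ignore_initial_segment)
      from L2_norm_le_if_AE_limit[OF diff_in_L2 dominated _ this] show ?thesis by simp
    qed
    then show ?thesis by blast
  qed
  obtain n where "square_integrable M (\<lambda>x. f n x - g x)" using close[of 1] by auto
  from square_integrable_diff[OF f[of n] this] show "square_integrable M g" by simp
  show "L2_tendsto M f g"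
    unfolding L2_tendsto_def
  proof (rule LIMSEQ_I)
    fix e :: real assume "0 < e"
    then obtain N where "\<And>n. N \<le> n \<Longrightarrow> L2_norm M (\<lambda>x. f n x - g x) \<le> e / 2" using close[of "e / 2"] by auto
    with \<open>0 < e\<close> show "\<exists>N. \<forall>n\<ge>N. norm (L2_norm M (\<lambda>x. f n x - g x) - 0) < e"
      by (intro exI[of _ N]) (fastforce simp: L2_norm_nonneg)
  qed
qed

lemma (in sigma_finite_measure) Riesz_Fischer:
  assumes f: "\<And>n. square_integrable M (f n)" and Cauchy: "L2_Cauchy M f"
  obtains g where "square_integrable M g" "L2_tendsto M f g"
proof -
  note [measurable] = f
  obtain r where r: "strict_mono (r::nat\<Rightarrow>nat)" and conv: "AE x in M. convergent (\<lambda>n. f (r n) x)"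
    using L2_Cauchy_imp_AE_convergent_subseq[OF f Cauchy] by blast
  define g where "g x = lim (\<lambda>n. f (r n) x)" for x
  have [measurable]: "g \<in> borel_measurable M" unfolding g_def by measurable
  have "AE x in M. (\<lambda>n. f (r n) x) \<longlonglongrightarrow> g x"
    using conv by eventually_elim (simp add: g_def convergent_LIMSEQ_iff)
  from L2_Cauchy_AE_subseq_limit[OF f Cauchy r this] that show thesis by simp
qed

section \<open>The Hilbert space of square-integrable functions\<close>

quotient_type (overloaded) ('a, 'b) ltwo = "'a::euclidean_space \<Rightarrow> 'b::euclidean_space" /
  partial: "\<lambda>f g. square_integrable lebesgue f \<and> square_integrable lebesgue g \<and> (AE x in lebesgue. f x
      = g x)"
proof (rule part_equivpI)
  show "\<exists>f::'a \<Rightarrow> 'b. square_integrable lebesgue f \<and> square_integrable lebesgue f \<and> (AE x in lebesgue. f x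
      = f x)"
    using square_integrable_zero[of lebesgue] by auto
qed (auto intro!: sympI transpI elim: AE_mp)

lemma abs_ltwo_eq_iff:
  "square_integrable lebesgue f \<Longrightarrow> square_integrable lebesgue g \<Longrightarrow>
    abs_ltwo f = abs_ltwo g \<longleftrightarrow> (AE x in lebesgue. f x = g x)"
  using Quotient_rel[OF Quotient_ltwo, of f g] by auto

lemma square_integrable_rep_ltwo: "square_integrable lebesgue (rep_ltwo z)"
  using Quotient_rep_reflp[OF Quotient_ltwo, of z] by blast

lemma abs_rep_ltwo: "abs_ltwo (rep_ltwo z) = z"
  by (rule Quotient_abs_rep[OF Quotient_ltwo])

instantiation ltwo :: (euclidean_space, euclidean_space) real_inner
begin

lift_definition zero_ltwo :: "('a, 'b) ltwo" is "\<lambda>x. 0"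
  by (simp add: square_integrable_zero)

lift_definition plus_ltwo :: "('a, 'b) ltwo \<Rightarrow> ('a, 'b) ltwo \<Rightarrow> ('a, 'b) ltwo" is "\<lambda>f g x. f x + g x"
  using square_integrable_add by (fastforce elim: AE_mp)

lift_definition minus_ltwo :: "('a, 'b) ltwo \<Rightarrow> ('a, 'b) ltwo \<Rightarrow> ('a, 'b) ltwo" is "\<lambda>f g x. f x - g x"
  using square_integrable_diff by (fastforce elim: AE_mp)

lift_definition uminus_ltwo :: "('a, 'b) ltwo \<Rightarrow> ('a, 'b) ltwo" is "\<lambda>f x. - f x"
  by (simp add: square_integrable_minus)

lift_definition scaleR_ltwo :: "real \<Rightarrow> ('a, 'b) ltwo \<Rightarrow> ('a, 'b) ltwo" is "\<lambda>c f x. c *\<^sub>R f x"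
  by (simp add: square_integrable_scaleR)

lift_definition inner_ltwo :: "('a, 'b) ltwo \<Rightarrow> ('a, 'b) ltwo \<Rightarrow> real" is
  "\<lambda>f g. \<integral>x. f x \<bullet> g x \<partial>lebesgue"
proof (rule integral_cong_AE, goal_cases)
  case (1 f f' g g')
  then show ?case using borel_measurable_inner[OF square_integrable_measurable
      square_integrable_measurable] by blast
next
  case (2 f f' g g')
  then show ?case using borel_measurable_inner[OF square_integrable_measurable
      square_integrable_measurable] by blast
next
  case (3 f f' g g')
  then have "AE x in lebesgue. f x = f' x" "AE x in lebesgue. g x = g' x" by auto
  then show ?case by eventually_elim simp
qed

definition norm_ltwo :: "('a, 'b) ltwo \<Rightarrow> real" where "norm_ltwo x = sqrt (x \<bullet> x)"

definition dist_ltwo :: "('a, 'b) ltwo \<Rightarrow> ('a, 'b) ltwo \<Rightarrow> real" where "dist_ltwo x y = norm (x - y)"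

definition sgn_ltwo :: "('a, 'b) ltwo \<Rightarrow> ('a, 'b) ltwo" where "sgn_ltwo x = inverse (norm x) *\<^sub>R x"

definition uniformity_ltwo :: "(('a, 'b) ltwo \<times> ('a, 'b) ltwo) filter" where
  "uniformity_ltwo = (INF e\<in>{0<..}. principal {(x, y). dist x y < e})"

definition open_ltwo :: "('a, 'b) ltwo set \<Rightarrow> bool" where
  "open_ltwo U \<longleftrightarrow> (\<forall>x\<in>U. \<forall>\<^sub>F (x', y) in uniformity. x' = x \<longrightarrow> y \<in> U)"

instance
proof
  fix x y z :: "('a, 'b) ltwo" and r s :: real
  show "x + y + z = x + (y + z)" by transfer (simp add: square_integrable_add add.assoc)
  show "x + y = y + x" by transfer (simp add: square_integrable_add add.commute)
  show "0 + x = x" by transfer simp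
  show "- x + x = 0" by transfer (simp add: square_integrable_zero)
  show "x - y = x + - y" by transfer (simp add: square_integrable_diff)
  show "r *\<^sub>R (x + y) = r *\<^sub>R x + r *\<^sub>R y"
    by transfer (simp add: square_integrable_add square_integrable_scaleR scaleR_add_right)
  show "(r + s) *\<^sub>R x = r *\<^sub>R x + s *\<^sub>R x"
    by transfer (simp add: square_integrable_add square_integrable_scaleR scaleR_add_left)
  show "r *\<^sub>R s *\<^sub>R x = (r * s) *\<^sub>R x"
    by transfer (simp add: square_integrable_scaleR)
  show "1 *\<^sub>R x = x" by transfer simp
  show "dist x y = norm (x - y)" by (rule dist_ltwo_def)
  show "sgn x = inverse (norm x) *\<^sub>R x" by (rule sgn_ltwo_def)
  show "uniformity = (INF e\<in>{0<..}. principal {(x::('a, 'b) ltwo, y). dist x y < e})"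
    by (rule uniformity_ltwo_def)
  show "open U \<longleftrightarrow> (\<forall>x\<in>U. \<forall>\<^sub>F (x', y) in uniformity. x' = x \<longrightarrow> y \<in> U)" for U :: "('a, 'b) ltwo set"
    by (rule open_ltwo_def)
  show "x \<bullet> y = y \<bullet> x" by transfer (simp add: inner_commute)
  show "(x + y) \<bullet> z = x \<bullet> z + y \<bullet> z"
    by transfer (simp add: inner_add_left integrable_inner_square_integrable)
  show "(r *\<^sub>R x) \<bullet> y = r * (x \<bullet> y)" by transfer simp
  show "0 \<le> x \<bullet> x" by transfer simp
  show "x \<bullet> x = 0 \<longleftrightarrow> x = 0"
  proof (transfer)
    fix f :: "'a \<Rightarrow> 'b"
    assume "square_integrable lebesgue f \<and> square_integrable lebesgue f \<and> (AE x in lebesgue. f x = f x)"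
    then have f: "square_integrable lebesgue f" by blast
    have "(LINT x|lebesgue. f x \<bullet> f x) = 0 \<longleftrightarrow> (AE x in lebesgue. f x \<bullet> f x = 0)"
      using f by (intro integral_nonneg_eq_0_iff_AE integrable_inner_square_integrable) auto
    then show "((LINT x|lebesgue. f x \<bullet> f x) = 0) =
        (square_integrable lebesgue f \<and> square_integrable lebesgue (\<lambda>x. 0::'b) \<and>
            (AE x in lebesgue. f x = 0))"
      using f square_integrable_zero by auto
  qed
  show "norm x = sqrt (x \<bullet> x)" by (rule norm_ltwo_def)
qed

end

lemma abs_ltwo_add:
  "square_integrable lebesgue f \<Longrightarrow> square_integrable lebesgue g \<Longrightarrow>
    abs_ltwo f + abs_ltwo g = abs_ltwo (\<lambda>x. f x + g x)"
  by (rule plus_ltwo.abs_eq) auto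

lemma abs_ltwo_diff:
  "square_integrable lebesgue f \<Longrightarrow> square_integrable lebesgue g \<Longrightarrow>
    abs_ltwo f - abs_ltwo g = abs_ltwo (\<lambda>x. f x - g x)"
  by (rule minus_ltwo.abs_eq) auto

lemma abs_ltwo_scaleR: "square_integrable lebesgue f \<Longrightarrow> c *\<^sub>R abs_ltwo f = abs_ltwo (\<lambda>x. c *\<^sub>R f x)"
  by (rule scaleR_ltwo.abs_eq) auto

lemma abs_ltwo_inner:
  "square_integrable lebesgue f \<Longrightarrow> square_integrable lebesgue g \<Longrightarrow>
    abs_ltwo f \<bullet> abs_ltwo g = (\<integral>x. f x \<bullet> g x \<partial>lebesgue)"
  by (rule inner_ltwo.abs_eq) auto

lemma norm_abs_ltwo: "square_integrable lebesgue f \<Longrightarrow> norm (abs_ltwo f) = L2_norm lebesgue f"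
  by (simp add: norm_ltwo_def abs_ltwo_inner L2_norm_def power2_norm_eq_inner)

lemma dist_abs_ltwo:
  "square_integrable lebesgue f \<Longrightarrow> square_integrable lebesgue g \<Longrightarrow>
    dist (abs_ltwo f) (abs_ltwo g) = L2_norm lebesgue (\<lambda>x. f x - g x)"
  by (simp add: dist_norm abs_ltwo_diff norm_abs_ltwo square_integrable_diff)

lemma sigma_finite_lebesgue: "sigma_finite_measure (lebesgue :: 'a::euclidean_space measure)"
proof
  obtain A :: "'a set set" where A: "countable A" "A \<subseteq> sets lborel" "\<Union>A = space lborel"
      "\<forall>a\<in>A. emeasure lborel a \<noteq> \<infinity>"
    using lborel.sigma_finite_countable by blast
  then have "A \<subseteq> sets lebesgue" "\<forall>a\<in>A. emeasure lebesgue a \<noteq> \<infinity>" by auto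
  with A show "\<exists>A::'a set set. countable A \<and> A \<subseteq> sets lebesgue \<and> \<Union>A = space lebesgue \<and>
      (\<forall>a\<in>A. emeasure lebesgue a \<noteq> \<infinity>)"
    by auto
qed

instance ltwo :: (euclidean_space, euclidean_space) complete_space
proof
  fix X :: "nat \<Rightarrow> ('a, 'b) ltwo" assume X: "Cauchy X"
  define f where "f n = rep_ltwo (X n)" for n
  have f: "square_integrable lebesgue (f n)" "X n = abs_ltwo (f n)" for n
    by (simp_all add: f_def square_integrable_rep_ltwo abs_rep_ltwo)
  have "L2_Cauchy lebesgue f" using X unfolding Cauchy_def L2_Cauchy_def by (simp add: f dist_abs_ltwo)
  then obtain g where g: "square_integrable lebesgue g" "L2_tendsto lebesgue f g"
    using sigma_finite_measure.Riesz_Fischer[OF sigma_finite_lebesgue, of f] f(1) by blast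
  have "(\<lambda>n. dist (X n) (abs_ltwo g)) \<longlonglongrightarrow> 0"
    using L2_tendstoD[OF g(2)] g(1) by (simp add: f dist_abs_ltwo)
  then have "X \<longlonglongrightarrow> abs_ltwo g" by (rule iffD2[OF tendsto_dist_iff])
  then show "convergent X" by (auto simp: convergent_def)
qed

definition L2_class :: "'a::euclidean_space set \<Rightarrow> ('a \<Rightarrow> 'b::euclidean_space) \<Rightarrow> ('a, 'b) ltwo" where
  "L2_class \<Omega> f = abs_ltwo (\<lambda>x. indicator \<Omega> x *\<^sub>R f x)"

context
  fixes \<Omega> :: "'a::euclidean_space set"
  assumes \<Omega>: "\<Omega> \<in> sets lebesgue"
begin

lemma square_integrable_lebesgue_on:
  "square_integrable (lebesgue_on \<Omega>) f \<longleftrightarrow> square_integrable lebesgue (\<lambda>x. indicator \<Omega> x *\<^sub>R f x)"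
proof -
  have "(\<lambda>x. indicator \<Omega> x *\<^sub>R (norm (f x))\<^sup>2) = (\<lambda>x. (norm (indicator \<Omega> x *\<^sub>R f x))\<^sup>2)"
    by (auto simp: indicator_def)
  then show ?thesis unfolding square_integrable_def
    using \<Omega> by (simp add: borel_measurable_restrict_space_iff integrable_restrict_space)
qed

lemma L2_class_add:
  "square_integrable (lebesgue_on \<Omega>) f \<Longrightarrow> square_integrable (lebesgue_on \<Omega>) g \<Longrightarrow>
    L2_class \<Omega> f + L2_class \<Omega> g = L2_class \<Omega> (\<lambda>x. f x + g x)"
  by (simp add: L2_class_def square_integrable_lebesgue_on abs_ltwo_add scaleR_add_right)

lemma L2_class_diff:
  "square_integrable (lebesgue_on \<Omega>) f \<Longrightarrow> square_integrable (lebesgue_on \<Omega>) g \<Longrightarrow>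
    L2_class \<Omega> f - L2_class \<Omega> g = L2_class \<Omega> (\<lambda>x. f x - g x)"
  by (simp add: L2_class_def square_integrable_lebesgue_on abs_ltwo_diff scaleR_diff_right)

lemma L2_class_scaleR:
  "square_integrable (lebesgue_on \<Omega>) f \<Longrightarrow> c *\<^sub>R L2_class \<Omega> f = L2_class \<Omega> (\<lambda>x. c *\<^sub>R f x)"
  by (simp add: L2_class_def square_integrable_lebesgue_on abs_ltwo_scaleR mult.commute)

lemma L2_class_zero: "L2_class \<Omega> (\<lambda>x. 0) = (0 :: ('a, 'b::euclidean_space) ltwo)"
  using L2_class_scaleR[OF square_integrable_zero, of 0] by simp

lemma L2_class_inner:
  assumes "square_integrable (lebesgue_on \<Omega>) f" "square_integrable (lebesgue_on \<Omega>) g"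
  shows "L2_class \<Omega> f \<bullet> L2_class \<Omega> g = (\<integral>x. f x \<bullet> g x \<partial>lebesgue_on \<Omega>)"
proof -
  have "(\<lambda>x. (indicator \<Omega> x *\<^sub>R f x) \<bullet> (indicator \<Omega> x *\<^sub>R g x)) = (\<lambda>x. indicator \<Omega> x *\<^sub>R (f x \<bullet> g x))"
    by (auto simp: indicator_def)
  then show ?thesis
    using assms \<Omega>
    by (simp add: L2_class_def square_integrable_lebesgue_on abs_ltwo_inner integral_restrict_space)
qed

lemma norm_L2_class:
  "square_integrable (lebesgue_on \<Omega>) f \<Longrightarrow> norm (L2_class \<Omega> f) = L2_norm (lebesgue_on \<Omega>) f"
  by (simp add: norm_eq_sqrt_inner L2_class_inner L2_norm_def)

lemma L2_class_cong_AE: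
  assumes "square_integrable (lebesgue_on \<Omega>) f" "square_integrable (lebesgue_on \<Omega>) g"
    and eq: "AE x in lebesgue_on \<Omega>. f x = g x"
  shows "L2_class \<Omega> f = L2_class \<Omega> g"
proof -
  have "AE x in lebesgue. x \<in> \<Omega> \<longrightarrow> f x = g x" using eq \<Omega> by (simp add: AE_restrict_space_iff)
  then have "AE x in lebesgue. indicator \<Omega> x *\<^sub>R f x = indicator \<Omega> x *\<^sub>R g x"
    by eventually_elim (auto simp: indicator_def)
  then show ?thesis using assms by (simp add: L2_class_def square_integrable_lebesgue_on abs_ltwo_eq_iff)
qed

lemma L2_class_tendsto_iff:
  assumes "\<And>n. square_integrable (lebesgue_on \<Omega>) (f n)" "square_integrable (lebesgue_on \<Omega>) g"
  shows "(\<lambda>n. L2_class \<Omega> (f n)) \<longlonglongrightarrow> L2_class \<Omega> g \<longleftrightarrow> L2_tendsto (lebesgue_on \<Omega>) f g"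
  unfolding tendsto_dist_iff[of "\<lambda>n. L2_class \<Omega> (f n)"] L2_tendsto_def dist_norm
  using assms by (simp add: L2_class_diff norm_L2_class square_integrable_diff)

lemma L2_class_limit:
  assumes f: "\<And>n. square_integrable (lebesgue_on \<Omega>) (f n)" and lim: "(\<lambda>n. L2_class \<Omega> (f n)) \<longlonglongrightarrow> l"
  obtains g where "square_integrable (lebesgue_on \<Omega>) g" "l = L2_class \<Omega> g"
proof -
  define g where "g = rep_ltwo l"
  have g: "square_integrable lebesgue g" "l = abs_ltwo g"
    by (simp_all add: g_def square_integrable_rep_ltwo abs_rep_ltwo)
  have restrict: "square_integrable lebesgue (\<lambda>x. indicator \<Omega> x *\<^sub>R g x)"
    using \<Omega> by (intro square_integrable_bounded_scaleR[OF g(1), of _ 1] borel_measurable_indicator) auto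
  note ext = f[unfolded square_integrable_lebesgue_on]
  have "dist (L2_class \<Omega> (f n)) (L2_class \<Omega> g) \<le> dist (L2_class \<Omega> (f n)) l" for n
    unfolding L2_class_def g(2) dist_abs_ltwo[OF ext restrict] dist_abs_ltwo[OF ext g(1)]
  proof (rule L2_norm_mono[OF square_integrable_diff[OF ext g(1)]])
    show "(\<lambda>x. indicator \<Omega> x *\<^sub>R f n x - indicator \<Omega> x *\<^sub>R g x) \<in> borel_measurable lebesgue"
      using square_integrable_diff[OF ext[of n] restrict] by measurable
  qed (auto simp: indicator_def)
  then have "(\<lambda>n. dist (L2_class \<Omega> (f n)) (L2_class \<Omega> g)) \<longlonglongrightarrow> 0"
    by (intro Lim_null_comparison[OF always_eventually iffD1[OF tendsto_dist_iff lim]]) simp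
  then have "(\<lambda>n. L2_class \<Omega> (f n)) \<longlonglongrightarrow> L2_class \<Omega> g" by (rule iffD2[OF tendsto_dist_iff])
  with lim have "l = L2_class \<Omega> g" by (rule LIMSEQ_unique)
  with restrict show thesis by (intro that[of g]) (simp_all add: square_integrable_lebesgue_on)
qed

end

section \<open>Test functions\<close>

definition flat :: "nat \<Rightarrow> real \<Rightarrow> real" where
  "flat n t = (if t > 0 then (1/t)^n * exp (- (1/t)) else 0)"

lemma flat_tendsto_zero: "(flat n \<longlongrightarrow> 0) (at 0)"
proof (rule filterlim_split_at)
  show "(flat n \<longlongrightarrow> 0) (at_left 0)"
    by (rule tendsto_eventually) (auto simp: flat_def eventually_at_filter)
  have "((\<lambda>t. (inverse t)^n / exp (inverse t)) \<longlongrightarrow> 0) (at_right (0::real))"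
    by (rule filterlim_compose[OF tendsto_power_div_exp_0 filterlim_inverse_at_top_right])
  then show "(flat n \<longlongrightarrow> 0) (at_right 0)"
    by (rule filterlim_mono_eventually)
      (auto simp: flat_def eventually_at_filter exp_minus inverse_eq_divide)
qed

lemma flat_has_real_derivative:
  "(flat n has_real_derivative flat (n + 2) t - real n * flat (n + 1) t) (at t)"
proof -
  consider (pos) "t > 0" | (neg) "t < 0" | (zero) "t = 0" by linarith
  then show ?thesis
  proof cases
    case pos
    have recip: "((\<lambda>t. 1/t) has_real_derivative - ((1/t)\<^sup>2)) (at t)"
      using pos by (auto intro!: derivative_eq_intros simp: power2_eq_square)
    have "((\<lambda>t. (1/t)^n * exp (- (1/t))) has_real_derivative
        flat (n + 2) t - real n * flat (n + 1) t) (at t)"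
      by (rule DERIV_cong[OF DERIV_mult[OF DERIV_power[OF recip] DERIV_fun_exp[OF DERIV_minus[OF recip]]]])
        (use pos in \<open>cases n; simp add: flat_def power2_eq_square algebra_simps\<close>)
    then show ?thesis
      by (rule has_field_derivative_transform_within_open[where S="{0<..}"])
        (use pos in \<open>auto simp: flat_def\<close>)
  next
    case neg
    have "((\<lambda>t. 0) has_real_derivative flat (n + 2) t - real n * flat (n + 1) t) (at t)"
      using neg by (simp add: flat_def)
    then show ?thesis
      by (rule has_field_derivative_transform_within_open[where S="{..<0}"])
        (use neg in \<open>auto simp: flat_def\<close>)
  next
    case zero
    have "(\<lambda>h. (flat n (0 + h) - flat n 0) / h) = flat (n + 1)"
      by (auto simp: flat_def fun_eq_iff)
    then show ?thesis using flat_tendsto_zero[of "n + 1"] zero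
      unfolding DERIV_def by (simp add: flat_def)
  qed
qed

lemma smooth_fun_differentiable: "smooth_fun f \<Longrightarrow> f differentiable (at x)"
  unfolding smooth_fun_def by blast

lemma smooth_fun_partial: "smooth_fun f \<Longrightarrow> b \<in> Basis \<Longrightarrow> smooth_fun (\<lambda>x. frechet_derivative f (at x) b)"
  unfolding smooth_fun_def by blast

lemma has_derivative_flat_affine:
  "((\<lambda>x. flat n (x \<bullet> v + c)) has_derivative
    (\<lambda>h. (flat (n + 2) (x \<bullet> v + c) - real n * flat (n + 1) (x \<bullet> v + c)) * (h \<bullet> v))) (at x)"
proof -
  have "((\<lambda>x. x \<bullet> v + c) has_derivative (\<lambda>h. h \<bullet> v)) (at x)" by (auto intro!: derivative_eq_intros)
  from has_derivative_compose[OF this flat_has_real_derivative[unfolded has_field_derivative_def]]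
  show ?thesis by (simp add: mult.commute)
qed

text \<open>The closure of the smooth functions under these operations is stable under partial
  derivatives, hence it consists of smooth functions.\<close>

inductive smooth_algebra :: "('a::euclidean_space \<Rightarrow> real) \<Rightarrow> bool" where
  base: "smooth_fun f \<Longrightarrow> smooth_algebra f"
| const: "smooth_algebra (\<lambda>x. c)"
| flat: "smooth_algebra (\<lambda>x. flat n (x \<bullet> v + c))"
| add: "smooth_algebra f \<Longrightarrow> smooth_algebra g \<Longrightarrow> smooth_algebra (\<lambda>x. f x + g x)"
| mult: "smooth_algebra f \<Longrightarrow> smooth_algebra g \<Longrightarrow> smooth_algebra (\<lambda>x. f x * g x)"

lemma smooth_algebra_derivative:
  assumes "smooth_algebra f"
  shows "(\<forall>x. f differentiable (at x)) \<and> (\<forall>b\<in>Basis. smooth_algebra (\<lambda>x. frechet_derivative f (at x) b))"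
  using assms
proof induction
  case (base f)
  then show ?case by (auto simp: smooth_fun_differentiable intro: smooth_algebra.base smooth_fun_partial)
next
  case (const c)
  then show ?case by (auto intro: smooth_algebra.const)
next
  case (flat n v c)
  have derivative: "frechet_derivative (\<lambda>x. flat n (x \<bullet> v + c)) (at x) =
      (\<lambda>h. (flat (n + 2) (x \<bullet> v + c) - real n * flat (n + 1) (x \<bullet> v + c)) * (h \<bullet> v))" for x
    by (rule frechet_derivative_at[OF has_derivative_flat_affine, symmetric])
  have "smooth_algebra (\<lambda>x. (flat (n + 2) (x \<bullet> v + c) + (- real n) * flat (n + 1) (x \<bullet> v + c)) * (b \<bullet> v))"
    for b
    by (intro smooth_algebra.mult smooth_algebra.add smooth_algebra.flat smooth_algebra.const)
  then show ?case unfolding derivative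
    using has_derivative_flat_affine[of n v c] by (auto simp: differentiable_def)
next
  case (add f g)
  then have has_derivative: "((\<lambda>x. f x + g x) has_derivative
      (\<lambda>h. frechet_derivative f (at x) h + frechet_derivative g (at x) h)) (at x)" for x
    by (intro has_derivative_add) (auto simp: frechet_derivative_works)
  have derivative: "frechet_derivative (\<lambda>x. f x + g x) (at x) =
      (\<lambda>h. frechet_derivative f (at x) h + frechet_derivative g (at x) h)" for x
    using frechet_derivative_at[OF has_derivative] by simp
  show ?case unfolding derivative using has_derivative add
    by (auto simp: differentiable_def intro: smooth_algebra.add)
next
  case (mult f g)
  then have has_derivative: "((\<lambda>x. f x * g x) has_derivative
      (\<lambda>h. f x * frechet_derivative g (at x) h + frechet_derivative f (at x) h * g x)) (at x)" for x
    by (intro has_derivative_mult) (auto simp: frechet_derivative_works)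
  have derivative: "frechet_derivative (\<lambda>x. f x * g x) (at x) =
      (\<lambda>h. f x * frechet_derivative g (at x) h + frechet_derivative f (at x) h * g x)" for x
    using frechet_derivative_at[OF has_derivative] by simp
  show ?case unfolding derivative using has_derivative mult
    by (auto simp: differentiable_def intro!: smooth_algebra.add smooth_algebra.mult)
qed

lemma smooth_algebra_imp_smooth_fun: "smooth_algebra f \<Longrightarrow> smooth_fun f"
  unfolding smooth_fun_def using smooth_algebra_derivative
  by (intro exI[of _ "Collect smooth_algebra"]) auto

lemma smooth_fun_const: "smooth_fun (\<lambda>x. c)"
  by (rule smooth_algebra_imp_smooth_fun[OF smooth_algebra.const])

lemma smooth_fun_add: "smooth_fun f \<Longrightarrow> smooth_fun g \<Longrightarrow> smooth_fun (\<lambda>x. f x + g x)"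
  by (rule smooth_algebra_imp_smooth_fun[OF smooth_algebra.add[OF smooth_algebra.base smooth_algebra.base]])

lemma smooth_fun_mult: "smooth_fun f \<Longrightarrow> smooth_fun g \<Longrightarrow> smooth_fun (\<lambda>x. f x * g x)"
  by (rule smooth_algebra_imp_smooth_fun[OF smooth_algebra.mult[OF smooth_algebra.base
      smooth_algebra.base]])

lemma smooth_fun_power: "smooth_fun f \<Longrightarrow> smooth_fun (\<lambda>x. f x ^ n)"
  by (induction n) (auto intro: smooth_fun_const smooth_fun_mult)

lemma smooth_fun_sum:
  "finite I \<Longrightarrow> (\<And>i. i \<in> I \<Longrightarrow> smooth_fun (f i)) \<Longrightarrow> smooth_fun (\<lambda>x. \<Sum>i\<in>I. f i x)"
  by (induction rule: finite_induct) (auto intro: smooth_fun_const smooth_fun_add)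

lemma smooth_fun_prod:
  "finite I \<Longrightarrow> (\<And>i. i \<in> I \<Longrightarrow> smooth_fun (f i)) \<Longrightarrow> smooth_fun (\<lambda>x. \<Prod>i\<in>I. f i x)"
  by (induction rule: finite_induct) (auto intro: smooth_fun_const smooth_fun_mult)

lemma smooth_fun_flat: "smooth_fun (\<lambda>x. flat n (x \<bullet> v + c))"
  by (rule smooth_algebra_imp_smooth_fun[OF smooth_algebra.flat])

definition grad :: "('a::euclidean_space \<Rightarrow> real) \<Rightarrow> 'a \<Rightarrow> 'a" where
  "grad f x = (\<Sum>b\<in>Basis. frechet_derivative f (at x) b *\<^sub>R b)"

lemma grad_inner_Basis: "b \<in> Basis \<Longrightarrow> grad f x \<bullet> b = frechet_derivative f (at x) b"
  by (simp add: grad_def inner_sum_left inner_Basis sum.delta' if_distrib cong: if_cong)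

lemma smooth_fun_has_derivative:
  assumes "smooth_fun f" shows "(f has_derivative (\<lambda>h. grad f x \<bullet> h)) (at x)"
proof -
  have deriv: "(f has_derivative frechet_derivative f (at x)) (at x)"
    using smooth_fun_differentiable[OF assms] by (simp add: frechet_derivative_works)
  then interpret linear "frechet_derivative f (at x)" using has_derivative_linear by blast
  have "frechet_derivative f (at x) h = grad f x \<bullet> h" for h
  proof -
    have "frechet_derivative f (at x) h = frechet_derivative f (at x) (\<Sum>b\<in>Basis. (h \<bullet> b) *\<^sub>R b)"
      by (simp add: euclidean_representation)
    also have "\<dots> = (\<Sum>b\<in>Basis. (h \<bullet> b) * frechet_derivative f (at x) b)" by (simp add: sum scale)
    finally show ?thesis
      by (simp add: grad_def inner_sum_left) (simp add: inner_commute[of h] mult.commute)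
  qed
  then have "frechet_derivative f (at x) = (\<lambda>h. grad f x \<bullet> h)" by auto
  with deriv show ?thesis by simp
qed

lemma grad_eqI:
  assumes "(f has_derivative (\<lambda>h. v \<bullet> h)) (at x)" shows "grad f x = v"
proof (rule euclidean_eqI)
  fix b :: 'a assume "b \<in> Basis"
  then show "grad f x \<bullet> b = v \<bullet> b"
    using fun_cong[OF frechet_derivative_at[OF assms], of b] by (simp add: grad_inner_Basis)
qed

lemma smooth_fun_continuous: "smooth_fun f \<Longrightarrow> continuous_on S f"
  by (meson continuous_at_imp_continuous_on differentiable_imp_continuous_within smooth_fun_differentiable)

lemma smooth_fun_continuous_grad: "smooth_fun f \<Longrightarrow> continuous_on S (grad f)"
  unfolding grad_def[abs_def] by (intro continuous_intros smooth_fun_continuous smooth_fun_partial)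

lemma grad_add: "smooth_fun f \<Longrightarrow> smooth_fun g \<Longrightarrow> grad (\<lambda>x. f x + g x) x = grad f x + grad g x"
  by (rule grad_eqI) (auto intro!: derivative_eq_intros smooth_fun_has_derivative simp: inner_add_left)

lemma grad_mult:
  "smooth_fun f \<Longrightarrow> smooth_fun g \<Longrightarrow> grad (\<lambda>x. f x * g x) x = f x *\<^sub>R grad g x + g x *\<^sub>R grad f x"
  by (rule grad_eqI) (auto intro!: derivative_eq_intros smooth_fun_has_derivative simp: inner_add_left)

lemma grad_cmult: "smooth_fun f \<Longrightarrow> grad (\<lambda>x. c * f x) x = c *\<^sub>R grad f x"
  by (rule grad_eqI) (auto intro!: derivative_eq_intros smooth_fun_has_derivative)

lemma grad_compose:
  assumes "smooth_fun f" "(P has_real_derivative p) (at (f x))"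
  shows "grad (\<lambda>x. P (f x)) x = p *\<^sub>R grad f x"
  using has_derivative_compose[OF smooth_fun_has_derivative[OF assms(1)]
      assms(2)[unfolded has_field_derivative_def]]
  by (intro grad_eqI) (simp only: inner_scaleR_left)

lemma test_fun_smooth: "test_fun \<Omega> \<phi> \<Longrightarrow> smooth_fun \<phi>"
  by (simp add: test_fun_def)

lemma test_fun_zero: "test_fun \<Omega> (\<lambda>x. 0)"
  unfolding test_fun_def by (auto intro: smooth_fun_const exI[of _ "{}"])

lemma test_fun_add:
  assumes "test_fun \<Omega> \<phi>" "test_fun \<Omega> \<psi>" shows "test_fun \<Omega> (\<lambda>x. \<phi> x + \<psi> x)"
proof -
  obtain K L where "compact K" "K \<subseteq> \<Omega>" "\<And>x. x \<notin> K \<Longrightarrow> \<phi> x = 0"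
    "compact L" "L \<subseteq> \<Omega>" "\<And>x. x \<notin> L \<Longrightarrow> \<psi> x = 0" using assms unfolding test_fun_def by metis
  then show ?thesis using assms unfolding test_fun_def
    by (auto intro!: smooth_fun_add exI[of _ "K \<union> L"])
qed

lemma test_fun_if_zero:
  assumes "test_fun \<Omega> \<phi>" "smooth_fun \<psi>" "\<And>x. \<phi> x = 0 \<Longrightarrow> \<psi> x = 0"
  shows "test_fun \<Omega> \<psi>"
  using assms unfolding test_fun_def by metis

lemma test_fun_mult: "test_fun \<Omega> \<phi> \<Longrightarrow> smooth_fun \<psi> \<Longrightarrow> test_fun \<Omega> (\<lambda>x. \<phi> x * \<psi> x)"
  by (rule test_fun_if_zero) (auto intro: smooth_fun_mult test_fun_smooth)

lemma test_fun_cmult: "test_fun \<Omega> \<phi> \<Longrightarrow> test_fun \<Omega> (\<lambda>x. c * \<phi> x)"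
  by (rule test_fun_if_zero) (auto intro: smooth_fun_mult smooth_fun_const test_fun_smooth)

lemma test_fun_measurable [measurable_dest]: "test_fun \<Omega> \<phi> \<Longrightarrow> \<phi> \<in> borel_measurable borel"
  by (intro borel_measurable_continuous_onI smooth_fun_continuous test_fun_smooth)

lemma grad_test_fun_measurable: "test_fun \<Omega> \<phi> \<Longrightarrow> grad \<phi> \<in> borel_measurable borel"
  by (intro borel_measurable_continuous_onI smooth_fun_continuous_grad test_fun_smooth)

lemma test_fun_support:
  assumes "test_fun \<Omega> \<phi>"
  obtains K where "compact K" "K \<subseteq> \<Omega>" "\<And>x. x \<notin> K \<Longrightarrow> \<phi> x = 0" "\<And>x. x \<notin> K \<Longrightarrow> grad \<phi> x = 0"
proof -
  obtain K where K: "compact K" "K \<subseteq> \<Omega>" "\<And>x. x \<notin> K \<Longrightarrow> \<phi> x = 0"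
    using assms unfolding test_fun_def by blast
  have "grad \<phi> x = 0" if "x \<notin> K" for x
  proof (rule grad_eqI)
    have "((\<lambda>x. 0) has_derivative (\<lambda>h. 0 \<bullet> h)) (at x)" by simp
    then show "(\<phi> has_derivative (\<lambda>h. 0 \<bullet> h)) (at x)"
      by (rule has_derivative_transform_within_open[where s="-K"])
        (use that K compact_imp_closed in auto)
  qed
  with K that show thesis by blast
qed

lemma test_fun_outside:
  assumes "test_fun \<Omega> \<phi>" "x \<notin> \<Omega>"
  shows "\<phi> x = 0" "grad \<phi> x = 0"
  by (rule test_fun_support[OF assms(1)], use assms(2) in blast)+

lemma test_fun_bounded:
  assumes "test_fun \<Omega> \<phi>"
  obtains C where "0 < C" "\<And>x. \<bar>\<phi> x\<bar> \<le> C" "\<And>x. norm (grad \<phi> x) \<le> C"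
proof -
  obtain K where K: "compact K" "\<And>x. x \<notin> K \<Longrightarrow> \<phi> x = 0" "\<And>x. x \<notin> K \<Longrightarrow> grad \<phi> x = 0"
    using test_fun_support[OF assms] by metis
  have "bounded (\<phi> ` K)" "bounded (grad \<phi> ` K)"
    using K(1) test_fun_smooth[OF assms]
    by (auto intro!: compact_imp_bounded compact_continuous_image smooth_fun_continuous
        smooth_fun_continuous_grad)
  then obtain A B where "0 < A" "\<And>x. x \<in> K \<Longrightarrow> \<bar>\<phi> x\<bar> \<le> A" "0 < B" "\<And>x. x \<in> K \<Longrightarrow> norm (grad \<phi> x) \<le> B"
    unfolding bounded_pos by auto
  with K(2,3) show thesis
    by (intro that[of "max A B"]) (metis abs_zero less_eq_real_def max.coboundedI1 max.coboundedI2
        less_max_iff_disj norm_zero)+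
qed

lemma test_fun_bounded_support:
  assumes "test_fun \<Omega> \<phi>"
  obtains r where "\<And>x. r < norm x \<Longrightarrow> \<phi> x = 0" "\<And>x. r < norm x \<Longrightarrow> grad \<phi> x = 0"
proof -
  obtain K where K: "compact K" "\<And>x. x \<notin> K \<Longrightarrow> \<phi> x = 0" "\<And>x. x \<notin> K \<Longrightarrow> grad \<phi> x = 0"
    using test_fun_support[OF assms] by metis
  obtain r where "\<And>x. x \<in> K \<Longrightarrow> norm x \<le> r"
    using compact_imp_bounded[OF K(1)] unfolding bounded_iff by blast
  with K(2,3) that show thesis by (meson leD)
qed

lemma integrable_lborel_if_bounded_support:
  fixes f :: "'a::euclidean_space \<Rightarrow> 'b::euclidean_space"
  assumes "f \<in> borel_measurable borel" "\<And>x. norm (f x) \<le> C" "\<And>x. r < norm x \<Longrightarrow> f x = 0"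
  shows "integrable lborel f"
proof (rule integrableI_bounded_set[where A="cball 0 r" and B=C])
  show "emeasure lborel (cball (0::'a) r) < \<infinity>" by (rule emeasure_lborel_cball_finite)
qed (use assms in \<open>auto simp: not_le\<close>)

lemma integrable_test_fun:
  assumes "test_fun \<Omega> \<phi>" shows "integrable lborel \<phi>"
proof -
  obtain C r where "\<And>x. \<bar>\<phi> x\<bar> \<le> C" "\<And>x. r < norm x \<Longrightarrow> \<phi> x = 0"
    using test_fun_bounded[OF assms] test_fun_bounded_support[OF assms] by metis
  then show ?thesis
    by (intro integrable_lborel_if_bounded_support[where C=C and r=r] test_fun_measurable[OF assms]) auto
qed

lemma lborel_integral_translate:
  fixes f :: "'a::euclidean_space \<Rightarrow> 'b::euclidean_space"
  assumes "f \<in> borel_measurable borel"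
  shows "(\<integral>x. f (x + c) \<partial>lborel) = (\<integral>x. f x \<partial>lborel)"
proof -
  have "(\<integral>x. f x \<partial>lborel) = (\<integral>x. f x \<partial>distr lborel borel ((+) c))" by (simp add: lborel_distr_plus)
  also have "\<dots> = (\<integral>x. f (c + x) \<partial>lborel)" using assms by (intro integral_distr) auto
  finally show ?thesis by (simp add: add.commute)
qed

lemma integrable_lborel_translate:
  fixes f :: "'a::euclidean_space \<Rightarrow> 'b::euclidean_space"
  assumes "integrable lborel f"
  shows "integrable lborel (\<lambda>x. f (x + c))"
proof -
  have "integrable (distr lborel borel ((+) c)) f" using assms by (simp add: lborel_distr_plus)
  then show ?thesis
    using borel_measurable_integrable[OF assms]
    by (subst (asm) integrable_distr_eq) (auto simp: add.commute)
qed

definition difference_quotient :: "('a::real_normed_vector \<Rightarrow> real) \<Rightarrow> 'a \<Rightarrow> nat \<Rightarrow> 'a \<Rightarrow> real" where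
  "difference_quotient f h n x = real (Suc n) * (f (x + (1 / real (Suc n)) *\<^sub>R h) - f x)"

lemma has_derivative_imp_difference_quotient_tendsto:
  assumes "(f has_derivative f') (at x)"
  shows "(\<lambda>n. difference_quotient f h n x) \<longlonglongrightarrow> f' h"
proof -
  interpret bounded_linear f' using assms by (rule has_derivative_bounded_linear)
  have "((\<lambda>t. x + t *\<^sub>R h) has_derivative (\<lambda>t. t *\<^sub>R h)) (at 0)"
    by (auto intro!: derivative_eq_intros)
  from has_derivative_compose[OF this, of f f'] assms
  have "((\<lambda>t. f (x + t *\<^sub>R h)) has_real_derivative f' h) (at 0)"
    by (simp add: has_field_derivative_def scaleR mult_commute_abs)
  then have "((\<lambda>t. (f (x + t *\<^sub>R h) - f x) / t) \<longlongrightarrow> f' h) (at 0)"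
    by (simp add: DERIV_def)
  moreover have "filterlim (\<lambda>n. 1 / real (Suc n)) (at 0) sequentially"
    using LIMSEQ_inverse_real_of_nat by (auto simp: filterlim_at inverse_eq_divide)
  ultimately have "(\<lambda>n. (f (x + (1 / real (Suc n)) *\<^sub>R h) - f x) / (1 / real (Suc n))) \<longlonglongrightarrow> f' h"
    by (rule filterlim_compose)
  then show ?thesis by (simp add: difference_quotient_def mult.commute)
qed

lemma test_fun_Lipschitz:
  assumes "test_fun \<Omega> \<phi>" "\<And>x. norm (grad \<phi> x) \<le> C"
  shows "\<bar>\<phi> x - \<phi> y\<bar> \<le> C * norm (x - y)"
proof -
  have "norm (\<phi> x - \<phi> y) \<le> C * norm (x - y)"
  proof (rule differentiable_bound[of UNIV \<phi> "\<lambda>x h. grad \<phi> x \<bullet> h"])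
    show "onorm (\<lambda>h. grad \<phi> x \<bullet> h) \<le> C" for x
    proof (rule onorm_le)
      show "norm (grad \<phi> x \<bullet> h) \<le> C * norm h" for h
        using Cauchy_Schwarz_ineq2[of "grad \<phi> x" h] mult_right_mono[OF assms(2)[of x], of "norm h"] by simp
    qed
  qed (auto intro: smooth_fun_has_derivative test_fun_smooth[OF assms(1)])
  then show ?thesis by simp
qed

lemma test_fun_difference_quotient_tendsto:
  assumes "test_fun \<Omega> \<phi>"
  shows "(\<lambda>n. difference_quotient \<phi> h n x) \<longlonglongrightarrow> grad \<phi> x \<bullet> h"
  by (intro has_derivative_imp_difference_quotient_tendsto smooth_fun_has_derivative
      test_fun_smooth[OF assms])

lemma test_fun_difference_quotient_bound:
  assumes test: "test_fun \<Omega> \<phi>"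
  obtains C r where "\<And>n x. \<bar>difference_quotient \<phi> h n x\<bar> \<le> C * indicator (cball 0 r) x"
proof -
  obtain C where C: "0 < C" "\<And>x. norm (grad \<phi> x) \<le> C" using test_fun_bounded[OF test] by metis
  obtain r where r: "\<And>x. r < norm x \<Longrightarrow> \<phi> x = 0" using test_fun_bounded_support[OF test] by metis
  have "\<bar>difference_quotient \<phi> h n x\<bar> \<le> (C * norm h) * indicator (cball 0 (r + norm h)) x" for x n
  proof (cases "x \<in> cball 0 (r + norm h)")
    case True
    have "\<bar>\<phi> (x + (1 / real (Suc n)) *\<^sub>R h) - \<phi> x\<bar> \<le> C * ((1 / real (Suc n)) * norm h)"
      using test_fun_Lipschitz[OF test C(2), of "x + (1 / real (Suc n)) *\<^sub>R h" x] by simp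
    then have "real (Suc n) * \<bar>\<phi> (x + (1 / real (Suc n)) *\<^sub>R h) - \<phi> x\<bar> \<le> C * norm h"
      by (simp add: field_simps)
    then show ?thesis using True by (simp add: difference_quotient_def abs_mult)
  next
    case False
    then have "r + norm h < norm x" by simp
    moreover have "norm ((1 / real (Suc n)) *\<^sub>R h) \<le> norm h" by (simp add: field_simps mult_le_cancel_left1)
    moreover have "norm x \<le> norm (x + (1 / real (Suc n)) *\<^sub>R h) + norm ((1 / real (Suc n)) *\<^sub>R h)"
      using norm_triangle_ineq4[of "x + (1 / real (Suc n)) *\<^sub>R h" "(1 / real (Suc n)) *\<^sub>R h"] by simp
    ultimately have "r < norm x" "r < norm (x + (1 / real (Suc n)) *\<^sub>R h)"
      using norm_ge_zero[of h] by linarith+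
    then show ?thesis using r False by (simp add: difference_quotient_def)
  qed
  then show thesis using that by blast
qed

lemma integrable_indicator_cball:
  "integrable lborel (\<lambda>x::'a::euclidean_space. C * indicator (cball 0 r) x :: real)"
  using emeasure_lborel_cball_finite[of "0::'a" r]
  by (intro integrable_mult_right integrable_real_indicator) simp_all

lemma integral_grad_test_fun:
  assumes test: "test_fun \<Omega> \<phi>"
  shows "(\<integral>x. grad \<phi> x \<bullet> h \<partial>lborel) = 0"
proof -
  note [measurable] = test_fun_measurable[OF test] grad_test_fun_measurable[OF test]
  obtain C r where bound: "\<And>n x. \<bar>difference_quotient \<phi> h n x\<bar> \<le> C * indicator (cball 0 r) x"
    using test_fun_difference_quotient_bound[OF test] by blast
  have "(\<lambda>n. \<integral>x. difference_quotient \<phi> h n x \<partial>lborel) \<longlonglongrightarrow> (\<integral>x. grad \<phi> x \<bullet> h \<partial>lborel)"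
  proof (rule integral_dominated_convergence[OF _ _ integrable_indicator_cball])
    show "difference_quotient \<phi> h n \<in> borel_measurable lborel" for n
      unfolding difference_quotient_def[abs_def] by measurable
    show "AE x in lborel. (\<lambda>n. difference_quotient \<phi> h n x) \<longlonglongrightarrow> grad \<phi> x \<bullet> h"
      using test_fun_difference_quotient_tendsto[OF test] by simp
  qed (use bound in auto)
  moreover have "(\<integral>x. difference_quotient \<phi> h n x \<partial>lborel) = 0" for n
    unfolding difference_quotient_def using integrable_test_fun[OF test]
    by (simp add: integrable_lborel_translate lborel_integral_translate)
  ultimately show ?thesis by (simp add: LIMSEQ_const_iff)
qed

lemma integrable_test_fun_mult_grad:
  assumes "test_fun \<Omega> \<phi>" "test_fun \<Omega>' \<psi>"
  shows "integrable lborel (\<lambda>x. \<phi> x * (grad \<psi> x \<bullet> b))"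
proof -
  note [measurable] = test_fun_measurable[OF assms(1)] grad_test_fun_measurable[OF assms(2)]
  obtain C D where C: "0 < C" "\<And>x. \<bar>\<phi> x\<bar> \<le> C" and D: "\<And>x. norm (grad \<psi> x) \<le> D"
    using test_fun_bounded[OF assms(1)] test_fun_bounded[OF assms(2)] by metis
  obtain r where r: "\<And>x. r < norm x \<Longrightarrow> \<phi> x = 0" using test_fun_bounded_support[OF assms(1)] by metis
  show ?thesis
  proof (rule integrable_lborel_if_bounded_support[where C="C * (D * norm b)" and r=r])
    fix x
    have "\<bar>grad \<psi> x \<bullet> b\<bar> \<le> D * norm b"
      using Cauchy_Schwarz_ineq2[of "grad \<psi> x" b] mult_right_mono[OF D, of "norm b" x] by simp
    then show "norm (\<phi> x * (grad \<psi> x \<bullet> b)) \<le> C * (D * norm b)"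
      unfolding real_norm_def abs_mult using C by (intro mult_mono) auto
  qed (use r in auto)
qed

lemma test_fun_integration_by_parts:
  assumes "test_fun \<Omega> \<phi>" "test_fun \<Omega> \<psi>"
  shows "(\<integral>x. \<phi> x * (grad \<psi> x \<bullet> b) \<partial>lborel) = - (\<integral>x. (grad \<phi> x \<bullet> b) * \<psi> x \<partial>lborel)"
proof -
  note smooth = test_fun_smooth[OF assms(1)] test_fun_smooth[OF assms(2)]
  have "(\<integral>x. grad (\<lambda>x. \<phi> x * \<psi> x) x \<bullet> b \<partial>lborel) = 0"
    by (rule integral_grad_test_fun[OF test_fun_mult[OF assms(1) smooth(2)]])
  moreover have "grad (\<lambda>x. \<phi> x * \<psi> x) x \<bullet> b = \<phi> x * (grad \<psi> x \<bullet> b) + \<psi> x * (grad \<phi> x \<bullet> b)" for x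
    by (simp add: grad_mult[OF smooth] inner_add_left)
  ultimately show ?thesis
    using integrable_test_fun_mult_grad[OF assms] integrable_test_fun_mult_grad[OF assms(2,1)]
    by (simp add: mult.commute[of _ "\<psi> _"])
qed

definition box_bump :: "'a::euclidean_space \<Rightarrow> 'a \<Rightarrow> nat \<Rightarrow> 'a \<Rightarrow> real" where
  "box_bump a b m x =
    (\<Prod>i\<in>Basis. flat 0 (real m * ((x - a) \<bullet> i)) * flat 0 (real m * ((b - x) \<bullet> i)))"

lemma flat_0_bounds: "0 \<le> flat 0 t" "flat 0 t \<le> 1"
  by (auto simp: flat_def)

lemma box_bump_outside: "x \<notin> box a b \<Longrightarrow> box_bump a b m x = 0"
proof -
  assume "x \<notin> box a b"
  then obtain i where i: "i \<in> Basis" "x \<bullet> i \<le> a \<bullet> i \<or> b \<bullet> i \<le> x \<bullet> i" by (auto simp: mem_box not_less)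
  then have "real m * ((x - a) \<bullet> i) \<le> 0 \<or> real m * ((b - x) \<bullet> i) \<le> 0"
    by (auto simp: inner_diff_left mult_nonneg_nonpos)
  then have "flat 0 (real m * ((x - a) \<bullet> i)) * flat 0 (real m * ((b - x) \<bullet> i)) = 0"
    by (auto simp: flat_def not_less)
  then show ?thesis unfolding box_bump_def using i(1) by (meson finite_Basis prod_zero)
qed

lemma abs_box_bump_le_1: "\<bar>box_bump a b m x\<bar> \<le> 1"
  unfolding box_bump_def abs_prod
  by (intro prod_le_1) (auto simp: abs_mult flat_0_bounds mult_le_one)

lemma flat_0_scale_tendsto:
  assumes "0 < t" shows "(\<lambda>m. flat 0 (real m * t)) \<longlonglongrightarrow> 1"
proof -
  have "(\<lambda>m. exp (- (inverse t * inverse (real m)))) \<longlonglongrightarrow> exp (- (inverse t * 0))"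
    by (intro tendsto_intros lim_inverse_n)
  moreover have "\<forall>\<^sub>F m in sequentially. exp (- (inverse t * inverse (real m))) = flat 0 (real m * t)"
    using eventually_gt_at_top[of "0::nat"]
    by eventually_elim (use assms in \<open>auto simp: flat_def field_simps\<close>)
  ultimately show ?thesis by (simp add: tendsto_cong)
qed

lemma box_bump_tendsto: "(\<lambda>m. box_bump a b m x) \<longlonglongrightarrow> indicator (box a b) x"
proof (cases "x \<in> box a b")
  case True
  then have "(\<lambda>m. box_bump a b m x) \<longlonglongrightarrow> (\<Prod>i\<in>(Basis::'a set). 1 * 1)"
    unfolding box_bump_def
    by (intro tendsto_prod tendsto_mult flat_0_scale_tendsto) (auto simp: mem_box inner_diff_left)
  then show ?thesis using True by simp
qed (simp add: box_bump_outside)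

lemma test_fun_box_bump:
  assumes "cbox a b \<subseteq> \<Omega>" shows "test_fun \<Omega> (box_bump a b m)"
proof -
  have "box_bump a b m = (\<lambda>x. \<Prod>i\<in>Basis. flat 0 (x \<bullet> (real m *\<^sub>R i) + - (real m * (a \<bullet> i)))
      * flat 0 (x \<bullet> (- real m *\<^sub>R i) + real m * (b \<bullet> i)))"
    by (simp add: box_bump_def[abs_def] inner_diff_left algebra_simps)
  then have "smooth_fun (box_bump a b m)"
    by (simp only:) (intro smooth_fun_prod smooth_fun_mult smooth_fun_flat finite_Basis)
  then show ?thesis unfolding test_fun_def using assms box_bump_outside[of _ a b m] box_subset_cbox[of a b]
    by (intro conjI exI[of _ "cbox a b"]) auto
qed

lemma set_integral_box_bump_tendsto:
  fixes f :: "'a::euclidean_space \<Rightarrow> real"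
  assumes cbox: "set_integrable lebesgue (cbox a b) f"
  shows "(\<lambda>m. LINT x:cbox a b|lebesgue. f x * box_bump a b m x) \<longlonglongrightarrow> (LINT x:box a b|lebesgue. f x)"
  unfolding set_lebesgue_integral_def
proof (rule integral_dominated_convergence[where w="\<lambda>x. norm (indicator (cbox a b) x *\<^sub>R f x)"])
  have bump: "box_bump a b m \<in> borel_measurable lebesgue" for m
    using test_fun_measurable[OF test_fun_box_bump[OF order_refl[of "cbox a b"]]]
    by (auto intro: measurable_completion)
  show "AE x in lebesgue. (\<lambda>m. indicator (cbox a b) x *\<^sub>R (f x * box_bump a b m x)) \<longlonglongrightarrow>
      indicator (box a b) x *\<^sub>R f x"
  proof (rule AE_I2)
    fix x
    have "(\<lambda>m. indicator (cbox a b) x *\<^sub>R (f x * box_bump a b m x)) \<longlonglongrightarrow>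
        indicator (cbox a b) x *\<^sub>R (f x * indicator (box a b) x)"
      by (intro tendsto_intros box_bump_tendsto)
    then show "(\<lambda>m. indicator (cbox a b) x *\<^sub>R (f x * box_bump a b m x)) \<longlonglongrightarrow>
        indicator (box a b) x *\<^sub>R f x"
      using box_subset_cbox[of a b] by (cases "x \<in> box a b") (auto simp: indicator_def)
  qed
  show "AE x in lebesgue. norm (indicator (cbox a b) x *\<^sub>R (f x * box_bump a b m x))
      \<le> norm (indicator (cbox a b) x *\<^sub>R f x)" for m
    using abs_box_bump_le_1[of a b m] by (intro AE_I2) (auto simp: abs_mult indicator_def mult_left_le)
  show "(\<lambda>x. indicator (cbox a b) x *\<^sub>R (f x * box_bump a b m x)) \<in> borel_measurable lebesgue" for m
    using borel_measurable_times[OF borel_measurable_integrable[OF cbox[unfolded set_integrable_def]] bump]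
    by (simp add: mult.assoc)
  have "set_integrable lebesgue (box a b) f"
    by (rule set_integrable_subset[OF cbox]) (auto simp: box_subset_cbox)
  then show "(\<lambda>x. indicator (box a b) x *\<^sub>R f x) \<in> borel_measurable lebesgue"
    unfolding set_integrable_def by (rule borel_measurable_integrable)
qed (use cbox in \<open>auto simp: set_integrable_def\<close>)

lemma integral_borel_set_zero_if_box_integrals_zero:
  fixes F :: "'a::euclidean_space \<Rightarrow> real"
  assumes F: "integrable lborel F" "(\<integral>x. F x \<partial>lborel) = 0"
    and box: "\<And>c d. (LINT x:box c d|lborel. F x) = 0" and "A \<in> sets borel"
  shows "(LINT x:A|lborel. F x) = 0"
proof -
  let ?boxes = "range (\<lambda>(a, b). box a b :: 'a set)"
  have stable: "Int_stable ?boxes" by (auto simp: Int_stable_def box_Int_box)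
  have "?boxes \<subseteq> Pow UNIV" by simp
  have "A \<in> sigma_sets UNIV ?boxes" using \<open>A \<in> sets borel\<close> by (simp add: borel_eq_box)
  then show ?thesis
  proof (induction A rule: sigma_sets_induct_disjoint[OF stable \<open>?boxes \<subseteq> Pow UNIV\<close>,
        consumes 1, case_names basic empty compl union])
    case (basic A)
    then show ?case using box by auto
  next
    case (compl A)
    then have A: "A \<in> sets borel" by (simp add: borel_eq_box)
    have "set_integrable lborel B F" if "B \<in> sets borel" for B
      unfolding set_integrable_def using that F(1) by (intro integrable_mult_indicator) auto
    then have "(LINT x:(UNIV - A) \<union> A|lborel. F x) = (LINT x:UNIV - A|lborel. F x) + (LINT x:A|lborel. F x)"
      using A by (intro set_integral_Un) auto
    then show ?case using F(2) compl.IH by (simp add: set_lebesgue_integral_def)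
  next
    case (union A)
    then have A: "A i \<in> sets lborel" for i by (auto simp: borel_eq_box)
    have "set_integrable lborel (\<Union>i. A i) F"
      unfolding set_integrable_def using A by (intro integrable_mult_indicator F(1)) auto
    with A have "(LINT x:(\<Union>i. A i)|lborel. F x) = (\<Sum>i. (LINT x:A i|lborel. F x))"
      using union(1) by (intro lebesgue_integral_countable_add) (auto simp: disjoint_family_on_def)
    then show ?case using union.IH by simp
  qed (simp add: set_lebesgue_integral_def)
qed

lemma AE_zero_if_box_integrals_zero:
  fixes F :: "'a::euclidean_space \<Rightarrow> real"
  assumes F: "integrable lebesgue F" "(\<integral>x. F x \<partial>lebesgue) = 0"
    and box: "\<And>c d. (LINT x:box c d|lebesgue. F x) = 0"
  shows "AE x in lebesgue. F x = 0"
proof -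
  obtain G where [measurable]: "G \<in> borel_measurable lborel" and "AE x in lborel. F x = G x"
    using completion_ex_borel_measurable_real[of F lborel] borel_measurable_integrable[OF F(1)] by blast
  then have eq: "AE x in lebesgue. F x = G x" by (simp add: AE_completion_iff)
  have "integrable lebesgue G"
    using F(1) eq by (subst integrable_cong_AE[symmetric, of F]) (auto intro: measurable_completion)
  then have integrability: "integrable lborel G" by (simp add: integrable_completion)
  have transfer: "(LINT x:A|lborel. G x) = (LINT x:A|lebesgue. F x)" if [measurable]: "A \<in> sets borel" for A
  proof -
    have "(LINT x:A|lborel. G x) = (LINT x:A|lebesgue. G x)"
      unfolding set_lebesgue_integral_def by (rule integral_completion[symmetric]) measurable
    also have "\<dots> = (LINT x:A|lebesgue. F x)"
      using eq F(1) by (intro set_lebesgue_integral_cong_AE) (auto intro: measurable_completion)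
    finally show ?thesis .
  qed
  have "(\<integral>x. G x \<partial>lborel) = 0" using transfer[of UNIV] F(2) by (simp add: set_lebesgue_integral_def)
  moreover have "(LINT x:box c d|lborel. G x) = 0" for c d by (simp only: transfer borel_open open_box box)
  ultimately have "(LINT x:A|lborel. G x) = 0" if "A \<in> sets borel" for A
    using that by (rule integral_borel_set_zero_if_box_integrals_zero[OF integrability])
  then have "AE x in lborel. G x = 0"
    using density_unique_real[OF integrability integrable_zero] by (simp add: set_lebesgue_integral_def)
  then have "AE x in lebesgue. G x = 0" by (simp add: AE_completion_iff)
  with eq show ?thesis by eventually_elim simp
qed

context
  fixes \<Omega> :: "'a::euclidean_space set" and f :: "'a \<Rightarrow> real"
  assumes locally_integrable: "\<And>K. compact K \<Longrightarrow> K \<subseteq> \<Omega> \<Longrightarrow> set_integrable lebesgue K f"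
    and test_integral_zero: "\<And>\<phi>. test_fun \<Omega> \<phi> \<Longrightarrow> (LINT x:\<Omega>|lebesgue. f x * \<phi> x) = 0"
begin

lemma box_integral_zero_if_test_integrals_zero:
  assumes cbox_subset: "cbox a b \<subseteq> \<Omega>"
  shows "set_integrable lebesgue (box a b) f" "(LINT x:box a b|lebesgue. f x) = 0"
proof -
  have cbox: "set_integrable lebesgue (cbox a b) f"
    by (rule locally_integrable[OF compact_cbox cbox_subset])
  then show "set_integrable lebesgue (box a b) f"
    by (rule set_integrable_subset) (auto simp: box_subset_cbox)
  have "(LINT x:cbox a b|lebesgue. f x * box_bump a b m x) = 0" for m
  proof -
    have "(LINT x:cbox a b|lebesgue. f x * box_bump a b m x) = (LINT x:\<Omega>|lebesgue. f x * box_bump a b m x)"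
      unfolding set_lebesgue_integral_def
      using cbox_subset box_bump_outside[of _ a b m] box_subset_cbox[of a b]
      by (intro Bochner_Integration.integral_cong) (auto simp: indicator_def)
    then show ?thesis using test_integral_zero[OF test_fun_box_bump[OF cbox_subset]] by simp
  qed
  with set_integral_box_bump_tendsto[OF cbox] show "(LINT x:box a b|lebesgue. f x) = 0"
    by (simp add: LIMSEQ_const_iff)
qed

lemma AE_zero_on_cbox_if_test_integrals_zero:
  assumes cbox_subset: "cbox a b \<subseteq> \<Omega>"
  shows "AE x in lebesgue. x \<in> cbox a b \<longrightarrow> f x = 0"
proof -
  note box = box_integral_zero_if_test_integrals_zero
  have "AE x in lebesgue. indicator (box a b) x *\<^sub>R f x = 0"
  proof (rule AE_zero_if_box_integrals_zero)
    show "integrable lebesgue (\<lambda>x. indicator (box a b) x *\<^sub>R f x)"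
      using box(1)[OF cbox_subset] by (simp add: set_integrable_def)
    show "(\<integral>x. indicator (box a b) x *\<^sub>R f x \<partial>lebesgue) = 0"
      using box(2)[OF cbox_subset] by (simp add: set_lebesgue_integral_def)
    fix c d
    obtain p q where Int_eq: "box c d \<inter> box a b = box p q" by (auto simp: box_Int_box)
    have "(LINT x:box c d|lebesgue. indicator (box a b) x *\<^sub>R f x) = (LINT x:box p q|lebesgue. f x)"
      unfolding set_lebesgue_integral_def Int_eq[symmetric]
      by (intro Bochner_Integration.integral_cong) (auto simp: indicator_def)
    also have "\<dots> = 0"
    proof (cases "box p q = {}")
      case False
      have "box p q \<subseteq> cbox a b" using Int_eq box_subset_cbox[of a b] by blast
      then have "cbox p q \<subseteq> cbox a b" using closure_box[OF False] closure_minimal closed_cbox by metis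
      then show ?thesis using box(2) cbox_subset by blast
    qed (simp add: set_lebesgue_integral_def)
    finally show "(LINT x:box c d|lebesgue. indicator (box a b) x *\<^sub>R f x) = 0" .
  qed
  moreover have "AE x in lebesgue. x \<notin> cbox a b - box a b"
    using negligible_frontier_interval[of a b] unfolding negligible_iff_null_sets by (rule AE_not_in)
  ultimately show ?thesis by eventually_elim (auto simp: indicator_def)
qed

lemma fundamental_lemma_calculus_of_variations:
  assumes "open \<Omega>"
  shows "AE x in lebesgue. x \<in> \<Omega> \<longrightarrow> f x = 0"
proof -
  obtain \<D> where \<D>: "countable \<D>" "\<D> \<subseteq> Pow \<Omega>" "\<And>X. X \<in> \<D> \<Longrightarrow> \<exists>a b. X = cbox a b" "\<Union>\<D> = \<Omega>"
    using open_countable_Union_open_cbox[OF assms] by blast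
  have "AE x in lebesgue. \<forall>X\<in>\<D>. x \<in> X \<longrightarrow> f x = 0"
    unfolding AE_ball_countable[OF \<D>(1)]
    using \<D>(2,3) AE_zero_on_cbox_if_test_integrals_zero by blast
  then show ?thesis by eventually_elim (use \<D>(4) in blast)
qed

end

section \<open>The Sobolev space\<close>

locale bounded_domain =
  fixes \<Omega> :: "'a::euclidean_space set"
  assumes open_domain: "open \<Omega>" and bounded_domain: "bounded \<Omega>"
begin

abbreviation M\<Omega> :: "'a measure" where "M\<Omega> \<equiv> lebesgue_on \<Omega>"

lemma lmeasurable_domain: "\<Omega> \<in> lmeasurable"
  by (rule lmeasurable_open[OF bounded_domain open_domain])

lemma sets_domain: "\<Omega> \<in> sets lebesgue"
  using lmeasurable_domain by (rule fmeasurableD)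

sublocale finite_measure M\<Omega>
  by (rule finite_measure_lebesgue_on[OF lmeasurable_domain])

lemma set_integral_domain:
  fixes f :: "'a \<Rightarrow> 'b::euclidean_space"
  shows "(LINT x:\<Omega>|lebesgue. f x) = (\<integral>x. f x \<partial>M\<Omega>)"
  using sets_domain by (simp add: set_lebesgue_integral_def integral_restrict_space)

lemma set_integrable_domain:
  fixes f :: "'a \<Rightarrow> 'b::euclidean_space"
  shows "set_integrable lebesgue \<Omega> f \<longleftrightarrow> integrable M\<Omega> f"
  using sets_domain by (simp add: set_integrable_def integrable_restrict_space)

lemma set_borel_measurable_domain:
  fixes f :: "'a \<Rightarrow> 'b::euclidean_space"
  shows "set_borel_measurable lebesgue \<Omega> f \<longleftrightarrow> f \<in> borel_measurable M\<Omega>"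
  using sets_domain by (simp add: set_borel_measurable_def borel_measurable_restrict_space_iff)

lemma AE_domain: "(AE x in M\<Omega>. P x) \<longleftrightarrow> (AE x in lebesgue. x \<in> \<Omega> \<longrightarrow> P x)"
  using sets_domain by (simp add: AE_restrict_space_iff)

lemma L2_on_domain:
  fixes f :: "'a \<Rightarrow> 'b::euclidean_space"
  shows "L2_on \<Omega> f \<longleftrightarrow> square_integrable M\<Omega> f"
  by (simp add: L2_on_def square_integrable_def set_borel_measurable_domain set_integrable_domain)

lemma borel_measurable_domain_cong_AE:
  fixes f g :: "'a \<Rightarrow> 'b::euclidean_space"
  assumes "f \<in> borel_measurable M\<Omega>" and eq: "AE x in M\<Omega>. f x = g x"
  shows "g \<in> borel_measurable M\<Omega>"
proof -
  have "(\<lambda>x. indicator \<Omega> x *\<^sub>R f x) \<in> borel_measurable lebesgue"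
    using assms(1) sets_domain by (simp add: borel_measurable_restrict_space_iff)
  moreover have "AE x in lebesgue. x \<in> \<Omega> \<longrightarrow> f x = g x" using eq by (simp only: AE_domain)
  then have "AE x in lebesgue. indicator \<Omega> x *\<^sub>R f x = indicator \<Omega> x *\<^sub>R g x"
    by eventually_elim (auto simp: indicator_def)
  ultimately have "(\<lambda>x. indicator \<Omega> x *\<^sub>R g x) \<in> borel_measurable lebesgue"
    by (rule borel_measurable_AE)
  then show ?thesis using sets_domain by (simp add: borel_measurable_restrict_space_iff)
qed

lemma square_integrable_domain_cong_AE:
  assumes "square_integrable M\<Omega> f" and eq: "AE x in M\<Omega>. f x = g x"
  shows "square_integrable M\<Omega> g"
proof (rule square_integrable_bound[OF assms(1)])
  show "g \<in> borel_measurable M\<Omega>"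
    by (rule borel_measurable_domain_cong_AE[OF square_integrable_measurable[OF assms(1)] eq])
  show "AE x in M\<Omega>. norm (g x) \<le> norm (f x)" using eq by eventually_elim simp
qed

lemma borel_measurable_domain_if_borel:
  fixes f :: "'a \<Rightarrow> 'b::euclidean_space"
  assumes "f \<in> borel_measurable borel" shows "f \<in> borel_measurable M\<Omega>"
  using assms by (intro measurable_restrict_space1 measurable_completion) simp

lemma integral_domain_eq_lborel:
  fixes f :: "'a \<Rightarrow> 'b::euclidean_space"
  assumes "f \<in> borel_measurable borel" and outside: "\<And>x. x \<notin> \<Omega> \<Longrightarrow> f x = 0"
  shows "(\<integral>x. f x \<partial>M\<Omega>) = (\<integral>x. f x \<partial>lborel)"
proof -
  have "(\<integral>x. f x \<partial>M\<Omega>) = (\<integral>x. indicator \<Omega> x *\<^sub>R f x \<partial>lebesgue)"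
    using sets_domain by (simp add: integral_restrict_space)
  also have "(\<lambda>x. indicator \<Omega> x *\<^sub>R f x) = f" using outside by (auto simp: indicator_def)
  also have "(\<integral>x. f x \<partial>lebesgue) = (\<integral>x. f x \<partial>lborel)" using assms(1) by (intro integral_completion) simp
  finally show ?thesis .
qed

lemma square_integrable_test_fun: "square_integrable M\<Omega> \<phi>"
  and square_integrable_grad_test_fun: "square_integrable M\<Omega> (grad \<phi>)" if test: "test_fun \<Omega> \<phi>"
proof -
  obtain C where C: "\<And>x. \<bar>\<phi> x\<bar> \<le> C" "\<And>x. norm (grad \<phi> x) \<le> C"
    using test_fun_bounded[OF test] by metis
  show "square_integrable M\<Omega> \<phi>"
    using C(1) by (intro square_integrable_bounded borel_measurable_domain_if_borel
        test_fun_measurable[OF test]) simp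
  show "square_integrable M\<Omega> (grad \<phi>)"
    by (rule square_integrable_bounded[OF borel_measurable_domain_if_borel[OF grad_test_fun_measurable[OF test]] C(2)])
qed

abbreviation graph_class :: "('a \<Rightarrow> real) \<Rightarrow> ('a \<Rightarrow> 'a) \<Rightarrow> ('a, real \<times> 'a) ltwo" where
  "graph_class u g \<equiv> L2_class \<Omega> (\<lambda>x. (u x, g x))"

definition test_graph :: "('a, real \<times> 'a) ltwo set" where
  "test_graph = (\<lambda>\<phi>. graph_class \<phi> (grad \<phi>)) ` Collect (test_fun \<Omega>)"

text \<open>\<open>H01_grad u g\<close>: the function \<open>u\<close> belongs to the closure of the test functions in the Sobolev norm,
  and \<open>g\<close> is its weak gradient.\<close>

definition H01_grad :: "('a \<Rightarrow> real) \<Rightarrow> ('a \<Rightarrow> 'a) \<Rightarrow> bool" where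
  "H01_grad u g \<longleftrightarrow>
    square_integrable M\<Omega> u \<and> square_integrable M\<Omega> g \<and> graph_class u g \<in> closure test_graph"

lemma H01_grad_square_integrable:
  assumes "H01_grad u g"
  shows H01_grad_square_integrable_fun: "square_integrable M\<Omega> u"
    and H01_grad_square_integrable_grad: "square_integrable M\<Omega> g"
    and H01_grad_square_integrable_Pair: "square_integrable M\<Omega> (\<lambda>x. (u x, g x))"
  using assms by (auto simp: H01_grad_def square_integrable_Pair)

lemma test_graphI: "test_fun \<Omega> \<phi> \<Longrightarrow> graph_class \<phi> (grad \<phi>) \<in> test_graph"
  by (auto simp: test_graph_def)

lemma square_integrable_test_fun_Pair:
  "test_fun \<Omega> \<phi> \<Longrightarrow> square_integrable M\<Omega> (\<lambda>x. (\<phi> x, grad \<phi> x))"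
  by (intro square_integrable_Pair square_integrable_test_fun square_integrable_grad_test_fun)

lemma subspace_test_graph: "subspace test_graph"
  unfolding subspace_def
proof (intro conjI ballI allI)
  have "grad (\<lambda>x::'a. 0) = (\<lambda>x. 0)" by (rule ext, rule grad_eqI) simp
  then have "graph_class (\<lambda>x. 0) (grad (\<lambda>x. 0)) = 0"
    using L2_class_zero[OF sets_domain, where 'b="real \<times> 'a"] by (simp add: zero_prod_def)
  then show "0 \<in> test_graph" using test_graphI[OF test_fun_zero] by simp
next
  fix l m assume "l \<in> test_graph" "m \<in> test_graph"
  then obtain \<phi> \<psi> where test: "test_fun \<Omega> \<phi>" "test_fun \<Omega> \<psi>"
    and l_m_eq: "l = graph_class \<phi> (grad \<phi>)" "m = graph_class \<psi> (grad \<psi>)"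
    by (auto simp: test_graph_def)
  have "l + m = L2_class \<Omega> (\<lambda>x. (\<phi> x, grad \<phi> x) + (\<psi> x, grad \<psi> x))"
    unfolding l_m_eq by (intro L2_class_add[OF sets_domain] square_integrable_test_fun_Pair test)
  also have "\<dots> = graph_class (\<lambda>x. \<phi> x + \<psi> x) (grad (\<lambda>x. \<phi> x + \<psi> x))"
    by (simp add: grad_add[OF test_fun_smooth[OF test(1)] test_fun_smooth[OF test(2)]])
  finally show "l + m \<in> test_graph" using test_graphI[OF test_fun_add[OF test]] by simp
next
  fix c :: real and l assume "l \<in> test_graph"
  then obtain \<phi> where test: "test_fun \<Omega> \<phi>" and l: "l = graph_class \<phi> (grad \<phi>)"
    by (auto simp: test_graph_def)
  have "c *\<^sub>R l = L2_class \<Omega> (\<lambda>x. c *\<^sub>R (\<phi> x, grad \<phi> x))"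
    unfolding l by (intro L2_class_scaleR[OF sets_domain] square_integrable_test_fun_Pair test)
  also have "\<dots> = graph_class (\<lambda>x. c * \<phi> x) (grad (\<lambda>x. c * \<phi> x))"
    by (simp add: grad_cmult[OF test_fun_smooth[OF test]])
  finally show "c *\<^sub>R l \<in> test_graph" using test_graphI[OF test_fun_cmult[OF test]] by simp
qed

lemma subspace_closure_test_graph: "subspace (closure test_graph)"
  by (rule subspace_closure[OF subspace_test_graph])

lemma H01_grad_test_fun: "test_fun \<Omega> \<phi> \<Longrightarrow> H01_grad \<phi> (grad \<phi>)"
  using closure_subset[of test_graph]
  by (auto simp: H01_grad_def test_graphI square_integrable_test_fun square_integrable_grad_test_fun)

lemma H01_grad_add:
  assumes "H01_grad u g" "H01_grad v h" shows "H01_grad (\<lambda>x. u x + v x) (\<lambda>x. g x + h x)"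
proof -
  have "graph_class u g + graph_class v h \<in> closure test_graph"
    using assms by (intro subspace_add[OF subspace_closure_test_graph]) (auto simp: H01_grad_def)
  then show ?thesis
    using assms H01_grad_square_integrable_Pair[OF assms(1)] H01_grad_square_integrable_Pair[OF assms(2)]
    by (simp add: H01_grad_def L2_class_add[OF sets_domain] square_integrable_add)
qed

lemma H01_grad_scaleR:
  assumes "H01_grad u g" shows "H01_grad (\<lambda>x. c * u x) (\<lambda>x. c *\<^sub>R g x)"
proof -
  have "c *\<^sub>R graph_class u g \<in> closure test_graph"
    using assms by (intro subspace_mul[OF subspace_closure_test_graph]) (auto simp: H01_grad_def)
  then show ?thesis
    using assms H01_grad_square_integrable_Pair[OF assms] square_integrable_scaleR[of M\<Omega> u c]
    by (simp add: H01_grad_def L2_class_scaleR[OF sets_domain] square_integrable_scaleR)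
qed

lemma H01_grad_diff:
  "H01_grad u g \<Longrightarrow> H01_grad v h \<Longrightarrow> H01_grad (\<lambda>x. u x - v x) (\<lambda>x. g x - h x)"
  using H01_grad_add[of u g "\<lambda>x. -1 * v x" "\<lambda>x. -1 *\<^sub>R h x"] H01_grad_scaleR[of v h "-1"] by simp

lemma H01_grad_cong_AE:
  assumes "H01_grad u g" and eq: "AE x in M\<Omega>. u x = v x" "AE x in M\<Omega>. g x = h x"
  shows "H01_grad v h"
proof -
  have in_L2: "square_integrable M\<Omega> v" "square_integrable M\<Omega> h"
    using assms square_integrable_domain_cong_AE H01_grad_square_integrable by blast+
  have "graph_class u g = graph_class v h"
  proof (rule L2_class_cong_AE[OF sets_domain H01_grad_square_integrable_Pair[OF assms(1)]])
    show "AE x in M\<Omega>. (u x, g x) = (v x, h x)" using eq by eventually_elim simp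
  qed (intro square_integrable_Pair in_L2)
  with in_L2 show ?thesis using assms(1) by (simp add: H01_grad_def)
qed

lemma graph_class_tendsto_iff:
  assumes "\<And>n. square_integrable M\<Omega> (u n)" "square_integrable M\<Omega> u0"
    and "\<And>n. square_integrable M\<Omega> (g n)" "square_integrable M\<Omega> g0"
  shows "(\<lambda>n. graph_class (u n) (g n)) \<longlonglongrightarrow> graph_class u0 g0 \<longleftrightarrow> L2_tendsto M\<Omega> u u0 \<and> L2_tendsto M\<Omega> g g0"
  using assms by (simp add: L2_class_tendsto_iff[OF sets_domain] L2_tendsto_Pair_iff square_integrable_Pair)

lemma H01_grad_limit:
  assumes in_H01: "\<And>n. H01_grad (u n) (g n)" and in_L2: "square_integrable M\<Omega> u0" "square_integrable M\<Omega> g0"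
    and lim: "L2_tendsto M\<Omega> u u0" "L2_tendsto M\<Omega> g g0"
  shows "H01_grad u0 g0"
proof -
  have "(\<lambda>n. graph_class (u n) (g n)) \<longlonglongrightarrow> graph_class u0 g0"
    using in_H01 in_L2 lim by (subst graph_class_tendsto_iff) (auto simp: H01_grad_def)
  then have "graph_class u0 g0 \<in> closure test_graph"
    using closed_sequentially[OF closed_closure, of "\<lambda>n. graph_class (u n) (g n)"] in_H01
    by (auto simp: H01_grad_def)
  then show ?thesis using in_L2 by (simp add: H01_grad_def)
qed

lemma H01_grad_dominated_limit:
  assumes in_H01: "\<And>n. H01_grad (u n) (g n)"
    and measurable: "u0 \<in> borel_measurable M\<Omega>" "g0 \<in> borel_measurable M\<Omega>"
    and U: "square_integrable M\<Omega> U" "\<And>n. AE x in M\<Omega>. norm (u n x) \<le> norm (U x)"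
    and G: "square_integrable M\<Omega> G" "\<And>n. AE x in M\<Omega>. norm (g n x) \<le> norm (G x)"
    and lim: "AE x in M\<Omega>. (\<lambda>n. u n x) \<longlonglongrightarrow> u0 x" "AE x in M\<Omega>. (\<lambda>n. g n x) \<longlonglongrightarrow> g0 x"
  shows "H01_grad u0 g0"
proof -
  have "u n \<in> borel_measurable M\<Omega>" "g n \<in> borel_measurable M\<Omega>" for n
    using H01_grad_square_integrable[OF in_H01[of n]] square_integrable_measurable by auto
  note u0 = L2_dominated_convergence[OF U(1) this(1) measurable(1) U(2) lim(1)]
    and g0 = L2_dominated_convergence[OF G(1) this(2) measurable(2) G(2) lim(2)]
  show ?thesis by (rule H01_grad_limit[OF in_H01 u0(1) g0(1) u0(2) g0(2)])
qed

lemma H01_grad_approx: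
  assumes "H01_grad u g"
  obtains \<phi> where "\<And>k. test_fun \<Omega> (\<phi> k)" "L2_tendsto M\<Omega> \<phi> u" "L2_tendsto M\<Omega> (\<lambda>k. grad (\<phi> k)) g"
proof -
  obtain l where l: "\<forall>n. l n \<in> test_graph" "l \<longlonglongrightarrow> graph_class u g"
    using assms unfolding H01_grad_def closure_sequential by blast
  then have "\<forall>n. \<exists>\<phi>. test_fun \<Omega> \<phi> \<and> l n = graph_class \<phi> (grad \<phi>)" by (auto simp: test_graph_def)
  then obtain \<phi> where \<phi>: "\<And>n. test_fun \<Omega> (\<phi> n)" "\<And>n. l n = graph_class (\<phi> n) (grad (\<phi> n))" by metis
  have "(\<lambda>n. graph_class (\<phi> n) (grad (\<phi> n))) \<longlonglongrightarrow> graph_class u g"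
    using l(2) by (simp add: \<phi>(2)[abs_def])
  then have "L2_tendsto M\<Omega> \<phi> u \<and> L2_tendsto M\<Omega> (\<lambda>k. grad (\<phi> k)) g"
    by (subst (asm) graph_class_tendsto_iff)
      (use assms \<phi>(1) square_integrable_test_fun square_integrable_grad_test_fun
          in \<open>auto simp: H01_grad_def\<close>)
  with \<phi>(1) that show thesis by blast
qed

lemma closure_test_graphE:
  assumes "l \<in> closure test_graph"
  obtains u g where "H01_grad u g" "l = graph_class u g"
proof -
  obtain z where z: "\<forall>n. z n \<in> test_graph" "z \<longlonglongrightarrow> l" using assms unfolding closure_sequential by blast
  then have "\<forall>n. \<exists>\<phi>. test_fun \<Omega> \<phi> \<and> z n = graph_class \<phi> (grad \<phi>)" by (auto simp: test_graph_def)
  then obtain \<phi> where \<phi>: "\<And>n. test_fun \<Omega> (\<phi> n)" "\<And>n. z n = graph_class (\<phi> n) (grad (\<phi> n))" by metis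
  have "(\<lambda>n. graph_class (\<phi> n) (grad (\<phi> n))) \<longlonglongrightarrow> l" using z(2) by (simp add: \<phi>(2)[abs_def])
  then obtain f where f: "square_integrable M\<Omega> f" "l = L2_class \<Omega> f"
    by (rule L2_class_limit[OF sets_domain square_integrable_test_fun_Pair[OF \<phi>(1)]])
  show thesis
  proof
    show "l = graph_class (\<lambda>x. fst (f x)) (\<lambda>x. snd (f x))" using f(2) by simp
    with assms f(1) show "H01_grad (\<lambda>x. fst (f x)) (\<lambda>x. snd (f x))"
      by (simp add: H01_grad_def square_integrable_fst square_integrable_snd)
  qed
qed

lemma integrable_times_compact_support:
  fixes f q :: "'a \<Rightarrow> real"
  assumes f: "set_integrable lebesgue K f" and K: "K \<subseteq> \<Omega>"
    and q: "q \<in> borel_measurable borel" "\<And>x. \<bar>q x\<bar> \<le> C" "\<And>x. x \<notin> K \<Longrightarrow> q x = 0"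
  shows "integrable M\<Omega> (\<lambda>x. f x * q x)"
proof -
  have q_lebesgue: "q \<in> borel_measurable lebesgue" using q(1) by (intro measurable_completion) simp
  have indicator_integrable: "integrable lebesgue (\<lambda>x. indicator K x * f x)" using f
    by (simp add: set_integrable_def)
  have "integrable lebesgue (\<lambda>x. (indicator K x * f x) * q x)"
  proof (rule Bochner_Integration.integrable_bound[OF integrable_mult_right[OF indicator_integrable, of C]])
    show "AE x in lebesgue. norm (indicator K x * f x * q x) \<le> norm (C * (indicator K x * f x))"
    proof (rule AE_I2)
      fix x
      have "\<bar>q x\<bar> * \<bar>indicator K x * f x\<bar> \<le> \<bar>C\<bar> * \<bar>indicator K x * f x\<bar>"
        using q(2)[of x] by (intro mult_right_mono) auto
      then show "norm (indicator K x * f x * q x) \<le> norm (C * (indicator K x * f x))"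
        by (simp add: abs_mult mult_ac)
    qed
  qed (use indicator_integrable q_lebesgue in \<open>auto intro: borel_measurable_times\<close>)
  moreover have "(\<lambda>x. (indicator K x * f x) * q x) = (\<lambda>x. indicator \<Omega> x *\<^sub>R (f x * q x))"
    using K q(3) by (auto simp: indicator_def fun_eq_iff)
  ultimately show ?thesis using sets_domain by (simp add: integrable_restrict_space)
qed

lemma set_integrable_inner:
  assumes "set_integrable lebesgue K g" shows "set_integrable lebesgue K (\<lambda>x. g x \<bullet> b)"
  using integrable_inner_left[of b lebesgue "\<lambda>x. indicator K x *\<^sub>R g x"] assms
  by (simp add: set_integrable_def)

lemma is_weak_grad_integrable:
  assumes weak: "is_weak_grad \<Omega> u g" and test: "test_fun \<Omega> \<phi>" and b: "b \<in> Basis"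
  shows "integrable M\<Omega> (\<lambda>x. u x * frechet_derivative \<phi> (at x) b)"
    and "integrable M\<Omega> (\<lambda>x. (g x \<bullet> b) * \<phi> x)"
proof -
  obtain K where K: "compact K" "K \<subseteq> \<Omega>" "\<And>x. x \<notin> K \<Longrightarrow> \<phi> x = 0" "\<And>x. x \<notin> K \<Longrightarrow> grad \<phi> x = 0"
    by (rule test_fun_support[OF test]) (rule that)
  obtain C where C: "\<And>x. \<bar>\<phi> x\<bar> \<le> C" "\<And>x. norm (grad \<phi> x) \<le> C" using test_fun_bounded[OF test] by metis
  note [measurable] = test_fun_measurable[OF test] grad_test_fun_measurable[OF test]
  have integrability: "set_integrable lebesgue K u" "set_integrable lebesgue K (\<lambda>x. g x \<bullet> b)"
    using weak K(1,2) unfolding is_weak_grad_def by (auto intro: set_integrable_inner)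
  have "integrable M\<Omega> (\<lambda>x. u x * (grad \<phi> x \<bullet> b))"
  proof (rule integrable_times_compact_support[OF integrability(1) K(2), of _ C])
    show "\<bar>grad \<phi> x \<bullet> b\<bar> \<le> C" for x using Basis_le_norm[OF b, of "grad \<phi> x"] C(2)[of x] by linarith
  qed (use K(4) in auto)
  then show "integrable M\<Omega> (\<lambda>x. u x * frechet_derivative \<phi> (at x) b)" by (simp add: grad_inner_Basis[OF b])
  show "integrable M\<Omega> (\<lambda>x. (g x \<bullet> b) * \<phi> x)"
    by (rule integrable_times_compact_support[OF integrability(2) K(2) _ C(1) K(3)]) measurable
qed

lemma is_weak_grad_diff:
  assumes "is_weak_grad \<Omega> u g" "is_weak_grad \<Omega> v h"
  shows "is_weak_grad \<Omega> (\<lambda>x. u x - v x) (\<lambda>x. g x - h x)"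
  unfolding is_weak_grad_def
proof (intro conjI allI impI ballI)
  fix K assume "compact K \<and> K \<subseteq> \<Omega>"
  then show "set_integrable lebesgue K (\<lambda>x. u x - v x)" "set_integrable lebesgue K (\<lambda>x. g x - h x)"
    using assms unfolding is_weak_grad_def by (auto intro: set_integral_diff)
next
  fix \<phi> and b :: 'a assume test: "test_fun \<Omega> \<phi>" and b: "b \<in> Basis"
  note integrability = is_weak_grad_integrable[OF assms(1) test b]
    is_weak_grad_integrable[OF assms(2) test b]
  have "(LINT x:\<Omega>|lebesgue. (u x - v x) * frechet_derivative \<phi> (at x) b)
    = (LINT x:\<Omega>|lebesgue. u x * frechet_derivative \<phi> (at x) b)
      - (LINT x:\<Omega>|lebesgue. v x * frechet_derivative \<phi> (at x) b)"
    unfolding set_integral_domain left_diff_distrib using integrability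
    by (intro Bochner_Integration.integral_diff)
  moreover have "(LINT x:\<Omega>|lebesgue. ((g x - h x) \<bullet> b) * \<phi> x)
    = (LINT x:\<Omega>|lebesgue. (g x \<bullet> b) * \<phi> x) - (LINT x:\<Omega>|lebesgue. (h x \<bullet> b) * \<phi> x)"
    unfolding set_integral_domain left_diff_distrib inner_diff_left
    using integrability by (intro Bochner_Integration.integral_diff)
  ultimately show "(LINT x:\<Omega>|lebesgue. (u x - v x) * frechet_derivative \<phi> (at x) b)
      = - (LINT x:\<Omega>|lebesgue. ((g x - h x) \<bullet> b) * \<phi> x)"
    using assms test b unfolding is_weak_grad_def by simp
qed

lemma is_weak_grad_unique:
  assumes "is_weak_grad \<Omega> u g" "is_weak_grad \<Omega> u h"
  shows "AE x in M\<Omega>. g x = h x"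
proof -
  note diff = is_weak_grad_diff[OF assms]
  have "AE x in lebesgue. x \<in> \<Omega> \<longrightarrow> (g x - h x) \<bullet> b = 0" if b: "b \<in> Basis" for b
  proof (rule fundamental_lemma_calculus_of_variations[OF _ _ open_domain])
    show "set_integrable lebesgue K (\<lambda>x. (g x - h x) \<bullet> b)" if "compact K" "K \<subseteq> \<Omega>" for K
      using diff that unfolding is_weak_grad_def by (intro set_integrable_inner) blast
    fix \<phi> assume "test_fun \<Omega> \<phi>"
    then have "(LINT x:\<Omega>|lebesgue. (u x - u x) * frechet_derivative \<phi> (at x) b)
      = - (LINT x:\<Omega>|lebesgue. ((g x - h x) \<bullet> b) * \<phi> x)" using diff b unfolding is_weak_grad_def by blast
    then show "(LINT x:\<Omega>|lebesgue. ((g x - h x) \<bullet> b) * \<phi> x) = 0" by (simp add: set_lebesgue_integral_def)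
  qed
  then have "AE x in lebesgue. \<forall>b\<in>Basis. x \<in> \<Omega> \<longrightarrow> (g x - h x) \<bullet> b = 0"
    by (subst AE_ball_countable) (auto intro: countable_finite)
  then have "AE x in lebesgue. x \<in> \<Omega> \<longrightarrow> g x = h x"
    by eventually_elim (auto intro: euclidean_eqI simp: inner_diff_left)
  then show ?thesis by (simp only: AE_domain)
qed

lemma H01_grad_integration_by_parts:
  assumes in_H01: "H01_grad u g" and \<psi>: "test_fun \<Omega> \<psi>"
  shows "(\<integral>x. u x * (grad \<psi> x \<bullet> b) \<partial>M\<Omega>) = - (\<integral>x. (g x \<bullet> b) * \<psi> x \<partial>M\<Omega>)"
proof -
  obtain \<phi> where \<phi>: "\<And>k. test_fun \<Omega> (\<phi> k)" "L2_tendsto M\<Omega> \<phi> u" "L2_tendsto M\<Omega> (\<lambda>k. grad (\<phi> k)) g"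
    using H01_grad_approx[OF in_H01] by blast
  have weakly: "L2_weakly_tendsto M\<Omega> \<phi> u" "L2_weakly_tendsto M\<Omega> (\<lambda>k. grad (\<phi> k)) g"
    using \<phi> H01_grad_square_integrable[OF in_H01]
    by (auto intro!: L2_tendsto_imp_weakly_tendsto square_integrable_test_fun
        square_integrable_grad_test_fun)
  have "square_integrable M\<Omega> (\<lambda>x. grad \<psi> x \<bullet> b)"
    by (intro square_integrable_inner_const square_integrable_grad_test_fun \<psi>)
  from L2_weakly_tendstoD[OF weakly(1) this]
  have lhs: "(\<lambda>k. \<integral>x. \<phi> k x * (grad \<psi> x \<bullet> b) \<partial>M\<Omega>) \<longlonglongrightarrow> (\<integral>x. u x * (grad \<psi> x \<bullet> b) \<partial>M\<Omega>)"
    by simp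
  have "square_integrable M\<Omega> (\<lambda>x. \<psi> x *\<^sub>R b)"
    by (intro square_integrable_scaleR_const square_integrable_test_fun \<psi>)
  from L2_weakly_tendstoD[OF weakly(2) this]
  have rhs: "(\<lambda>k. - (\<integral>x. (grad (\<phi> k) x \<bullet> b) * \<psi> x \<partial>M\<Omega>)) \<longlonglongrightarrow> - (\<integral>x. (g x \<bullet> b) * \<psi> x \<partial>M\<Omega>)"
    by (intro tendsto_minus) (simp add: mult.commute)
  have "(\<integral>x. \<phi> k x * (grad \<psi> x \<bullet> b) \<partial>M\<Omega>) = - (\<integral>x. (grad (\<phi> k) x \<bullet> b) * \<psi> x \<partial>M\<Omega>)" for k
  proof -
    note [measurable] = test_fun_measurable[OF \<phi>(1)] grad_test_fun_measurable[OF \<phi>(1)]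
      test_fun_measurable[OF \<psi>] grad_test_fun_measurable[OF \<psi>]
    have "(\<integral>x. \<phi> k x * (grad \<psi> x \<bullet> b) \<partial>M\<Omega>) = (\<integral>x. \<phi> k x * (grad \<psi> x \<bullet> b) \<partial>lborel)"
      by (intro integral_domain_eq_lborel) (auto simp: test_fun_outside[OF \<psi>])
    also have "\<dots> = - (\<integral>x. (grad (\<phi> k) x \<bullet> b) * \<psi> x \<partial>lborel)"
      by (rule test_fun_integration_by_parts[OF \<phi>(1) \<psi>])
    also have "(\<integral>x. (grad (\<phi> k) x \<bullet> b) * \<psi> x \<partial>lborel) = (\<integral>x. (grad (\<phi> k) x \<bullet> b) * \<psi> x \<partial>M\<Omega>)"
      by (intro integral_domain_eq_lborel[symmetric]) (auto simp: test_fun_outside[OF \<psi>])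
    finally show ?thesis .
  qed
  with lhs rhs show ?thesis using LIMSEQ_unique by fastforce
qed

lemma H01_grad_imp_is_weak_grad:
  assumes "H01_grad u g" shows "is_weak_grad \<Omega> u g"
  unfolding is_weak_grad_def
proof (intro conjI allI impI ballI)
  fix K assume K: "compact K \<and> K \<subseteq> \<Omega>"
  then have "K \<in> sets lebesgue" using lmeasurable_compact fmeasurableD by blast
  moreover have "set_integrable lebesgue \<Omega> u" "set_integrable lebesgue \<Omega> g"
    unfolding set_integrable_domain
    by (intro square_integrable_imp_integrable H01_grad_square_integrable[OF assms])+
  ultimately show "set_integrable lebesgue K u" "set_integrable lebesgue K g"
    using K by (metis set_integrable_subset)+
next
  fix \<psi> and b :: 'a assume "test_fun \<Omega> \<psi>" "b \<in> Basis"
  then show "(LINT x:\<Omega>|lebesgue. u x * frechet_derivative \<psi> (at x) b)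
      = - (LINT x:\<Omega>|lebesgue. (g x \<bullet> b) * \<psi> x)"
    using H01_grad_integration_by_parts[OF assms, of \<psi> b]
    by (simp add: set_integral_domain grad_inner_Basis)
qed

lemma is_weak_grad_wgrad: "is_weak_grad \<Omega> u g \<Longrightarrow> is_weak_grad \<Omega> u (wgrad \<Omega> u)"
  unfolding wgrad_def by (rule someI[of "is_weak_grad \<Omega> u"])

lemma is_weak_grad_imp_wgrad_AE: "is_weak_grad \<Omega> u g \<Longrightarrow> AE x in M\<Omega>. wgrad \<Omega> u x = g x"
  using is_weak_grad_unique is_weak_grad_wgrad by blast

lemma H01_grad_imp_wgrad_AE: "H01_grad u g \<Longrightarrow> AE x in M\<Omega>. wgrad \<Omega> u x = g x"
  by (intro is_weak_grad_imp_wgrad_AE H01_grad_imp_is_weak_grad)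

lemma h1norm_eq_L2_norm:
  assumes weak: "is_weak_grad \<Omega> u g" and in_L2: "square_integrable M\<Omega> u" "square_integrable M\<Omega> g"
  shows "h1norm \<Omega> u = L2_norm M\<Omega> (\<lambda>x. (u x, g x))"
proof -
  have eq: "AE x in M\<Omega>. g x = wgrad \<Omega> u x"
    using is_weak_grad_imp_wgrad_AE[OF weak] by eventually_elim simp
  note [measurable] = in_L2(2) square_integrable_domain_cong_AE[OF in_L2(2) eq]
  have "L2_norm M\<Omega> (wgrad \<Omega> u) = L2_norm M\<Omega> g" using eq by (intro L2_norm_cong_AE[symmetric]) measurable
  then have "(L2_norm M\<Omega> u)\<^sup>2 + (L2_norm M\<Omega> (wgrad \<Omega> u))\<^sup>2 = (L2_norm M\<Omega> (\<lambda>x. (u x, g x)))\<^sup>2"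
    by (simp add: L2_norm_Pair_power2[OF in_L2])
  then show ?thesis by (simp add: h1norm_def set_integral_domain L2_norm_power2 L2_norm_def)
qed

lemma H01_grad_h1norm: "H01_grad u g \<Longrightarrow> h1norm \<Omega> u = L2_norm M\<Omega> (\<lambda>x. (u x, g x))"
  by (intro h1norm_eq_L2_norm H01_grad_imp_is_weak_grad H01_grad_square_integrable)

lemma h1norm_diff_tendsto_iff:
  assumes "\<And>n. is_weak_grad \<Omega> (u n) (g n)" "\<And>n. square_integrable M\<Omega> (u n)" "\<And>n. square_integrable M\<Omega> (g n)"
    and "is_weak_grad \<Omega> u0 g0" "square_integrable M\<Omega> u0" "square_integrable M\<Omega> g0"
  shows "(\<lambda>n. h1norm \<Omega> (\<lambda>x. u n x - u0 x)) \<longlonglongrightarrow> 0 \<longleftrightarrow> L2_tendsto M\<Omega> u u0 \<and> L2_tendsto M\<Omega> g g0"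
proof -
  have "h1norm \<Omega> (\<lambda>x. u n x - u0 x) = L2_norm M\<Omega> (\<lambda>x. (u n x, g n x) - (u0 x, g0 x))" for n
    using assms by (simp add: h1norm_eq_L2_norm[OF is_weak_grad_diff] square_integrable_diff)
  then show ?thesis using L2_tendsto_Pair_iff[OF assms(2,5,3,6)] by (simp only: L2_tendsto_def)
qed

lemma H01_imp_H01_grad:
  assumes "H01 \<Omega> u" shows "H01_grad u (wgrad \<Omega> u)"
proof -
  have weak: "is_weak_grad \<Omega> u (wgrad \<Omega> u)"
    and in_L2: "square_integrable M\<Omega> u" "square_integrable M\<Omega> (wgrad \<Omega> u)"
    using assms is_weak_grad_wgrad unfolding H01_def L2_on_domain by blast+
  obtain \<phi> where test: "\<And>k. test_fun \<Omega> (\<phi> k)" and lim: "(\<lambda>k. h1norm \<Omega> (\<lambda>x. \<phi> k x - u x)) \<longlonglongrightarrow> 0"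
    using assms unfolding H01_def by blast
  note in_H01 = H01_grad_test_fun[OF test]
  have "L2_tendsto M\<Omega> \<phi> u \<and> L2_tendsto M\<Omega> (\<lambda>k. grad (\<phi> k)) (wgrad \<Omega> u)"
    using lim by (simp add: h1norm_diff_tendsto_iff[OF H01_grad_imp_is_weak_grad[OF in_H01]
        H01_grad_square_integrable(1,2)[OF in_H01] weak in_L2])
  then show ?thesis using H01_grad_limit[of \<phi> "\<lambda>k. grad (\<phi> k)", OF in_H01 in_L2] by blast
qed

lemma H01_grad_imp_H01:
  assumes in_H01: "H01_grad u g" shows "H01 \<Omega> u"
proof -
  have "AE x in M\<Omega>. g x = wgrad \<Omega> u x" using H01_grad_imp_wgrad_AE[OF in_H01] by eventually_elim simp
  then have wgrad: "square_integrable M\<Omega> (wgrad \<Omega> u)"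
    by (rule square_integrable_domain_cong_AE[OF H01_grad_square_integrable_grad[OF in_H01]])
  obtain \<phi> where \<phi>: "\<And>k. test_fun \<Omega> (\<phi> k)" "L2_tendsto M\<Omega> \<phi> u" "L2_tendsto M\<Omega> (\<lambda>k. grad (\<phi> k)) g"
    using H01_grad_approx[OF in_H01] by blast
  note H\<phi> = H01_grad_test_fun[OF \<phi>(1)]
  have "(\<lambda>k. h1norm \<Omega> (\<lambda>x. \<phi> k x - u x)) \<longlonglongrightarrow> 0"
    using \<phi>(2,3)
    by (simp add: h1norm_diff_tendsto_iff[OF H01_grad_imp_is_weak_grad[OF H\<phi>]
        H01_grad_square_integrable(1,2)[OF H\<phi>] H01_grad_imp_is_weak_grad[OF in_H01]
        H01_grad_square_integrable(1,2)[OF in_H01]])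
  then show ?thesis
    unfolding H01_def L2_on_domain
    using H01_grad_imp_is_weak_grad[OF in_H01] H01_grad_square_integrable_fun[OF in_H01] wgrad \<phi>(1) by blast
qed

end

section \<open>Chain rules\<close>

lemma L2_tendsto_bounded_scaleR:
  fixes c :: "nat \<Rightarrow> 'm \<Rightarrow> real"
  assumes f: "\<And>n. square_integrable M (f n)" "square_integrable M f0" "L2_tendsto M f f0"
    and [measurable]: "\<And>n. c n \<in> borel_measurable M" "c0 \<in> borel_measurable M"
    and bound: "\<And>n x. \<bar>c n x\<bar> \<le> C" and lim: "AE x in M. (\<lambda>n. c n x) \<longlonglongrightarrow> c0 x"
  shows "L2_tendsto M (\<lambda>n x. c n x *\<^sub>R f n x) (\<lambda>x. c0 x *\<^sub>R f0 x)"
proof -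
  note [measurable] = f(1,2)
  have meas: "\<And>n. (\<lambda>x. c n x *\<^sub>R f0 x) \<in> borel_measurable M" "(\<lambda>x. c0 x *\<^sub>R f0 x) \<in> borel_measurable M"
    by measurable
  have dominated: "AE x in M. norm (c n x *\<^sub>R f0 x) \<le> norm (C *\<^sub>R f0 x)" for n
    using bound by (auto intro!: mult_right_mono AE_I2 order_trans[OF _ abs_ge_self])
  have pointwise: "AE x in M. (\<lambda>n. c n x *\<^sub>R f0 x) \<longlonglongrightarrow> c0 x *\<^sub>R f0 x"
    using lim by eventually_elim (intro tendsto_intros)
  note limit = L2_dominated_convergence[OF square_integrable_scaleR[OF f(2)] meas dominated pointwise]
  have in_L2: "square_integrable M (\<lambda>x. c n x *\<^sub>R (f n x - f0 x))"
    "square_integrable M (\<lambda>x. c n x *\<^sub>R f0 x)" for n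
    using bound by (auto intro!: square_integrable_bounded_scaleR square_integrable_diff f)
  have "(\<lambda>n. C * L2_norm M (\<lambda>x. f n x - f0 x) + L2_norm M (\<lambda>x. c n x *\<^sub>R f0 x - c0 x *\<^sub>R f0 x)) \<longlonglongrightarrow> C * 0 + 0"
    by (intro tendsto_intros L2_tendstoD f(3) limit(2))
  moreover have "L2_norm M (\<lambda>x. c n x *\<^sub>R f n x - c0 x *\<^sub>R f0 x)
      \<le> C * L2_norm M (\<lambda>x. f n x - f0 x) + L2_norm M (\<lambda>x. c n x *\<^sub>R f0 x - c0 x *\<^sub>R f0 x)" for n
  proof -
    have "L2_norm M (\<lambda>x. c n x *\<^sub>R (f n x - f0 x)) \<le> C * L2_norm M (\<lambda>x. f n x - f0 x)"
      by (intro L2_norm_bounded_scaleR_le square_integrable_diff f bound) measurable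
    then show ?thesis
      using L2_norm_triangle_ineq[OF in_L2(1)[of n] square_integrable_diff[OF in_L2(2)[of n] limit(1)]]
      by (simp add: scaleR_diff_right)
  qed
  ultimately show ?thesis by (intro L2_tendsto_if_le) auto
qed

lemma derivative_bound_imp_Lipschitz:
  fixes \<Phi> \<Phi>' :: "real \<Rightarrow> real"
  assumes "\<And>t. (\<Phi> has_real_derivative \<Phi>' t) (at t)" "\<And>t. \<bar>\<Phi>' t\<bar> \<le> L"
  shows "\<bar>\<Phi> s - \<Phi> t\<bar> \<le> L * \<bar>s - t\<bar>"
  using field_differentiable_bound[of UNIV \<Phi> \<Phi>' L s t] assms by simp

lemma L2_Lipschitz_compose:
  fixes \<Phi> :: "real \<Rightarrow> real"
  assumes [measurable]: "\<Phi> \<in> borel_measurable borel" and Lipschitz: "\<And>s t. \<bar>\<Phi> s - \<Phi> t\<bar> \<le> L * \<bar>s - t\<bar>"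
  shows square_integrable_Lipschitz_compose:
      "\<Phi> 0 = 0 \<Longrightarrow> square_integrable M u \<Longrightarrow> square_integrable M (\<lambda>x. \<Phi> (u x))"
    and L2_tendsto_Lipschitz_compose:
      "(\<And>n. square_integrable M (f n)) \<Longrightarrow> square_integrable M u \<Longrightarrow> L2_tendsto M f u \<Longrightarrow>
        L2_tendsto M (\<lambda>n x. \<Phi> (f n x)) (\<lambda>x. \<Phi> (u x))"
proof -
  have "0 \<le> L" using Lipschitz[of 0 1] by simp
  assume u [measurable]: "square_integrable M u"
  show "square_integrable M (\<lambda>x. \<Phi> (u x))" if "\<Phi> 0 = 0"
  proof (rule square_integrable_bound[OF square_integrable_scaleR[OF u, of L]])
    show "AE x in M. norm (\<Phi> (u x)) \<le> norm (L *\<^sub>R u x)"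
      using Lipschitz[of "u _" 0] that \<open>0 \<le> L\<close> by (simp add: abs_mult)
  qed measurable
  assume f [measurable]: "\<And>n. square_integrable M (f n)" and lim: "L2_tendsto M f u"
  have "L2_norm M (\<lambda>x. \<Phi> (f n x) - \<Phi> (u x)) \<le> L * L2_norm M (\<lambda>x. f n x - u x)" for n
  proof -
    have "L2_norm M (\<lambda>x. \<Phi> (f n x) - \<Phi> (u x)) \<le> L2_norm M (\<lambda>x. L *\<^sub>R (f n x - u x))"
      by (rule L2_norm_mono[OF square_integrable_scaleR[OF square_integrable_diff[OF f u]]])
        (use Lipschitz \<open>0 \<le> L\<close> in \<open>auto simp: abs_mult\<close>)
    then show ?thesis using \<open>0 \<le> L\<close> by (simp only: L2_norm_scaleR abs_of_nonneg)
  qed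
  then show "L2_tendsto M (\<lambda>n x. \<Phi> (f n x)) (\<lambda>x. \<Phi> (u x))"
    by (rule L2_tendsto_if_le) (rule tendsto_mult_right_zero[OF L2_tendstoD[OF lim]])
qed

definition polynomial_antiderivative :: "(nat \<Rightarrow> real) \<Rightarrow> nat \<Rightarrow> real \<Rightarrow> real" where
  "polynomial_antiderivative a n t = (\<Sum>i\<le>n. a i / real (Suc i) * t ^ Suc i)"

lemma polynomial_antiderivative_has_real_derivative:
  "(polynomial_antiderivative a n has_real_derivative (\<Sum>i\<le>n. a i * t ^ i)) (at t)"
  unfolding polynomial_antiderivative_def[abs_def]
  by (auto intro!: derivative_eq_intros sum.cong simp del: power_Suc)

lemma polynomial_antiderivative_0: "polynomial_antiderivative a n 0 = 0"
  by (simp add: polynomial_antiderivative_def)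

lemma test_fun_polynomial_antiderivative:
  assumes "test_fun \<Omega> \<phi>" shows "test_fun \<Omega> (\<lambda>x. polynomial_antiderivative a n (\<phi> x))"
proof (rule test_fun_if_zero[OF assms])
  show "smooth_fun (\<lambda>x. polynomial_antiderivative a n (\<phi> x))"
    unfolding polynomial_antiderivative_def
    by (intro smooth_fun_sum smooth_fun_mult smooth_fun_const smooth_fun_power test_fun_smooth[OF assms])
      simp
qed (simp add: polynomial_antiderivative_0)

lemma C1_polynomial_approximation:
  fixes \<Phi> \<Phi>' :: "real \<Rightarrow> real"
  assumes deriv: "\<And>t. (\<Phi> has_real_derivative \<Phi>' t) (at t)" and cont: "continuous_on UNIV \<Phi>'"
    and "\<Phi> 0 = 0" "0 < C" "0 < e"
  obtains a n where "\<And>t. \<bar>t\<bar> \<le> C \<Longrightarrow> \<bar>(\<Sum>i\<le>n. a i * t ^ i) - \<Phi>' t\<bar> \<le> e"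
    and "\<And>t. \<bar>t\<bar> \<le> C \<Longrightarrow> \<bar>polynomial_antiderivative a n t - \<Phi> t\<bar> \<le> C * e"
proof -
  obtain p where "real_polynomial_function p" and p: "\<And>t. t \<in> {-C..C} \<Longrightarrow> \<bar>\<Phi>' t - p t\<bar> < e"
    using Stone_Weierstrass_real_polynomial_function[of "{-C..C}" \<Phi>' e] continuous_on_subset[OF cont]
      \<open>0 < e\<close>
    by (auto intro: that)
  then obtain a n where "p = (\<lambda>t. \<Sum>i\<le>n. a i * t ^ i)" unfolding real_polynomial_function_iff_sum by blast
  then have close: "\<bar>(\<Sum>i\<le>n. a i * t ^ i) - \<Phi>' t\<bar> \<le> e" if "\<bar>t\<bar> \<le> C" for t
    using p[of t] that abs_minus_commute[of "\<Phi>' t"] by (simp add: abs_le_iff[of t])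
  have "\<bar>polynomial_antiderivative a n t - \<Phi> t\<bar> \<le> C * e" if "\<bar>t\<bar> \<le> C" for t
  proof -
    let ?D = "\<lambda>t. polynomial_antiderivative a n t - \<Phi> t"
    have "norm (?D t - ?D 0) \<le> e * norm (t - 0)"
    proof (rule field_differentiable_bound[of "{-C..C}"])
      show "(?D has_field_derivative (\<Sum>i\<le>n. a i * z ^ i) - \<Phi>' z) (at z within {-C..C})" for z
        by (rule DERIV_subset[OF DERIV_diff[OF polynomial_antiderivative_has_real_derivative deriv]]) simp
    qed (use that close \<open>0 < C\<close> in \<open>auto simp: abs_le_iff\<close>)
    also have "\<dots> \<le> e * C" using that \<open>0 < e\<close> by simp
    finally show ?thesis using \<open>\<Phi> 0 = 0\<close> by (simp add: polynomial_antiderivative_0 mult.commute)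
  qed
  with close that show thesis by blast
qed

lemma continuous_bounded_interval:
  fixes f :: "real \<Rightarrow> real"
  assumes "continuous_on UNIV f"
  obtains B where "0 \<le> B" "\<And>t. \<bar>t\<bar> \<le> C \<Longrightarrow> \<bar>f t\<bar> \<le> B"
proof -
  have "bounded (f ` {-C..C})"
    using assms by (auto intro!: compact_imp_bounded compact_continuous_image intro: continuous_on_subset)
  then obtain B where B: "0 < B" "\<And>t. t \<in> {-C..C} \<Longrightarrow> \<bar>f t\<bar> \<le> B" unfolding bounded_pos by auto
  show thesis by (rule that[of B]) (use B in \<open>auto simp: abs_le_iff\<close>)
qed

lemma has_real_derivative_imp_continuous_on:
  assumes "\<And>t::real. (\<Phi> has_real_derivative \<Phi>' t) (at t)"
  shows "continuous_on UNIV \<Phi>"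
  using assms by (meson DERIV_isCont continuous_at_imp_continuous_on)

lemma C1_polynomial_approximating_sequence:
  fixes \<Phi> \<Phi>' :: "real \<Rightarrow> real"
  assumes deriv: "\<And>t. (\<Phi> has_real_derivative \<Phi>' t) (at t)" and cont: "continuous_on UNIV \<Phi>'"
    and zero: "\<Phi> 0 = 0" and "0 < C"
  obtains a n D where
    "\<And>t. \<bar>t\<bar> \<le> C \<Longrightarrow> (\<lambda>k. polynomial_antiderivative (a k) (n k) t) \<longlonglongrightarrow> \<Phi> t"
    "\<And>t. \<bar>t\<bar> \<le> C \<Longrightarrow> (\<lambda>k. \<Sum>i\<le>n k. a k i * t ^ i) \<longlonglongrightarrow> \<Phi>' t"
    "\<And>k t. \<bar>t\<bar> \<le> C \<Longrightarrow> \<bar>polynomial_antiderivative (a k) (n k) t\<bar> \<le> D"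
    "\<And>k t. \<bar>t\<bar> \<le> C \<Longrightarrow> \<bar>\<Sum>i\<le>n k. a k i * t ^ i\<bar> \<le> D"
proof -
  obtain B B' where B: "\<And>t. \<bar>t\<bar> \<le> C \<Longrightarrow> \<bar>\<Phi> t\<bar> \<le> B" and B': "\<And>t. \<bar>t\<bar> \<le> C \<Longrightarrow> \<bar>\<Phi>' t\<bar> \<le> B'"
    using continuous_bounded_interval[OF has_real_derivative_imp_continuous_on[OF deriv]]
      continuous_bounded_interval[OF cont] by metis
  define e where "e k = inverse (real (Suc k))" for k
  have e: "0 < e k" "e k \<le> 1" for k by (simp_all add: e_def inverse_le_1_iff)
  have e_lim: "e \<longlonglongrightarrow> 0" unfolding e_def[abs_def] by (rule LIMSEQ_inverse_real_of_nat)
  have "\<exists>a n. (\<forall>t. \<bar>t\<bar> \<le> C \<longrightarrow> \<bar>(\<Sum>i\<le>n. a i * t ^ i) - \<Phi>' t\<bar> \<le> e k) \<and>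
      (\<forall>t. \<bar>t\<bar> \<le> C \<longrightarrow> \<bar>polynomial_antiderivative a n t - \<Phi> t\<bar> \<le> C * e k)" for k
    using C1_polynomial_approximation[OF deriv cont zero \<open>0 < C\<close> e(1)] by metis
  then obtain a n where p: "\<And>k t. \<bar>t\<bar> \<le> C \<Longrightarrow> \<bar>(\<Sum>i\<le>n k. a k i * t ^ i) - \<Phi>' t\<bar> \<le> e k"
    and P: "\<And>k t. \<bar>t\<bar> \<le> C \<Longrightarrow> \<bar>polynomial_antiderivative (a k) (n k) t - \<Phi> t\<bar> \<le> C * e k" by metis
  show thesis
  proof (rule that[of a n "max (B + C) (B' + 1)"])
    fix t assume t: "\<bar>t\<bar> \<le> C"
    show "(\<lambda>k. polynomial_antiderivative (a k) (n k) t) \<longlonglongrightarrow> \<Phi> t"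
      by (rule LIM_zero_cancel[OF Lim_null_comparison[OF always_eventually
          tendsto_mult_right_zero[where c = C, OF e_lim]]])
        (simp add: P[OF t])
    show "(\<lambda>k. \<Sum>i\<le>n k. a k i * t ^ i) \<longlonglongrightarrow> \<Phi>' t"
      by (rule LIM_zero_cancel[OF Lim_null_comparison[OF always_eventually e_lim]]) (simp add: p[OF t])
    show "\<bar>\<Sum>i\<le>n k. a k i * t ^ i\<bar> \<le> max (B + C) (B' + 1)" for k
      using p[OF t, of k] B'[OF t] e(2)[of k] by linarith
    show "\<bar>polynomial_antiderivative (a k) (n k) t\<bar> \<le> max (B + C) (B' + 1)" for k
      using P[OF t, of k] B[OF t] mult_left_mono[OF e(2)[of k], of C] \<open>0 < C\<close> by linarith
  qed
qed

lemma continuous_has_antiderivative: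
  fixes f :: "real \<Rightarrow> real"
  assumes "continuous_on UNIV f"
  obtains F where "F 0 = 0" "\<And>x. (F has_real_derivative f x) (at x)"
proof -
  define F where "F = (\<lambda>u. LBINT y=ereal 0..ereal u. f y)"
  have "(F has_real_derivative f x) (at x)" for x
  proof -
    have "((\<lambda>u. LBINT y=ereal 0..ereal u. f y) has_vector_derivative (f x)) (at x within {-\<bar>x\<bar>-1..\<bar>x\<bar>+1})"
      by (rule interval_integral_FTC2) (use assms continuous_on_subset in auto)
    then show ?thesis
      unfolding F_def has_real_derivative_iff_has_vector_derivative
      by (subst (asm) at_within_interior) auto
  qed
  moreover have "F 0 = 0" by (simp add: F_def)
  ultimately show thesis using that by blast
qed

definition smooth_pospart :: "real \<Rightarrow> real \<Rightarrow> real" where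
  "smooth_pospart e t = sqrt (e\<^sup>2 + (max 0 t)\<^sup>2) - e"

lemma max_zero_power2_has_real_derivative:
  "((\<lambda>t. (max 0 t)\<^sup>2) has_real_derivative 2 * max 0 t) (at t)"
proof -
  consider (pos) "t > 0" | (neg) "t < 0" | (zero) "t = 0" by linarith
  then show ?thesis
  proof cases
    case pos
    have "((\<lambda>t. t\<^sup>2) has_real_derivative 2 * max 0 t) (at t)"
      using pos by (auto intro!: derivative_eq_intros)
    then show ?thesis
      by (rule has_field_derivative_transform_within_open[where S="{0<..}"]) (use pos in auto)
  next
    case neg
    have "((\<lambda>t. 0) has_real_derivative 2 * max 0 t) (at t)" using neg by simp
    then show ?thesis
      by (rule has_field_derivative_transform_within_open[where S="{..<0}"]) (use neg in auto)
  next
    case zero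
    have "((\<lambda>h::real. max 0 h) \<longlongrightarrow> max 0 0) (at 0)" by (intro tendsto_intros)
    moreover have "(\<lambda>h::real. ((max 0 (0 + h))\<^sup>2 - (max 0 0)\<^sup>2) / h) = max 0"
      by (auto simp: fun_eq_iff max_def power2_eq_square)
    ultimately show ?thesis using zero unfolding DERIV_def by simp
  qed
qed

lemma smooth_pospart_has_real_derivative:
  assumes "0 < e"
  shows "(smooth_pospart e has_real_derivative max 0 t / sqrt (e\<^sup>2 + (max 0 t)\<^sup>2)) (at t)"
proof -
  have "0 < e\<^sup>2 + (max 0 t)\<^sup>2" using assms by (simp add: add_pos_nonneg)
  moreover have "((\<lambda>t. e\<^sup>2 + (max 0 t)\<^sup>2) has_real_derivative 0 + 2 * max 0 t) (at t)"
    by (intro DERIV_add DERIV_const max_zero_power2_has_real_derivative)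
  ultimately have "((\<lambda>t. sqrt (e\<^sup>2 + (max 0 t)\<^sup>2)) has_real_derivative
      inverse (sqrt (e\<^sup>2 + (max 0 t)\<^sup>2)) / 2 * (0 + 2 * max 0 t)) (at t)"
    by (intro DERIV_chain2[where f=sqrt] DERIV_real_sqrt)
  from DERIV_diff[OF this DERIV_const[of e]] show ?thesis
    by (simp add: smooth_pospart_def[abs_def] field_simps)
qed

lemma smooth_pospart_derivative_bound: "\<bar>max 0 t / sqrt (e\<^sup>2 + (max 0 t)\<^sup>2)\<bar> \<le> 1"
proof -
  have "max 0 t \<le> sqrt (e\<^sup>2 + (max 0 t)\<^sup>2)" by (intro real_le_rsqrt) simp
  then have "max 0 t / sqrt (e\<^sup>2 + (max 0 t)\<^sup>2) \<le> sqrt (e\<^sup>2 + (max 0 t)\<^sup>2) / sqrt (e\<^sup>2 + (max 0 t)\<^sup>2)"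
    by (intro divide_right_mono) auto
  also have "\<dots> \<le> 1" by (simp add: divide_self_if)
  finally show ?thesis by simp
qed

lemma smooth_pospart_tendsto:
  assumes "e \<longlonglongrightarrow> 0"
  shows "(\<lambda>n. smooth_pospart (e n) t) \<longlonglongrightarrow> max 0 t"
    and "(\<lambda>n. max 0 t / sqrt ((e n)\<^sup>2 + (max 0 t)\<^sup>2)) \<longlonglongrightarrow> indicator {0<..} t"
proof -
  have "(\<lambda>n. sqrt ((e n)\<^sup>2 + (max 0 t)\<^sup>2) - e n) \<longlonglongrightarrow> sqrt (0\<^sup>2 + (max 0 t)\<^sup>2) - 0"
    by (intro tendsto_intros assms)
  then show "(\<lambda>n. smooth_pospart (e n) t) \<longlonglongrightarrow> max 0 t" by (simp add: smooth_pospart_def)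
  show "(\<lambda>n. max 0 t / sqrt ((e n)\<^sup>2 + (max 0 t)\<^sup>2)) \<longlonglongrightarrow> indicator {0<..} t"
  proof (cases "0 < t")
    case True
    then have "(\<lambda>n. max 0 t / sqrt ((e n)\<^sup>2 + (max 0 t)\<^sup>2)) \<longlonglongrightarrow> max 0 t / sqrt (0\<^sup>2 + (max 0 t)\<^sup>2)"
      by (intro tendsto_intros assms) auto
    with True show ?thesis by simp
  qed simp
qed

definition truncate :: "real \<Rightarrow> real \<Rightarrow> real" where
  "truncate k s = max (- k) (min k s)"

lemma truncate_eq_pospart: "0 \<le> k \<Longrightarrow> truncate k s = s - max 0 (s - k) + max 0 (- s - k)"
  by (auto simp: truncate_def max_def min_def)

lemma abs_truncate_le: "0 \<le> k \<Longrightarrow> \<bar>truncate k s\<bar> \<le> k"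
  and truncate_eq: "\<bar>s\<bar> \<le> k \<Longrightarrow> truncate k s = s"
  and truncate_eq_level: "0 \<le> k \<Longrightarrow> k \<le> s \<Longrightarrow> truncate k s = k"
  and truncate_eq_minus_level: "0 \<le> k \<Longrightarrow> s \<le> - k \<Longrightarrow> truncate k s = - k"
  by (auto simp: truncate_def)

lemma continuous_on_truncate: "continuous_on S (truncate k)"
  unfolding truncate_def[abs_def] by (intro continuous_intros)

lemma borel_measurable_truncate [measurable]: "truncate k \<in> borel_measurable borel"
  by (intro borel_measurable_continuous_onI continuous_on_truncate)

context bounded_domain
begin

lemma H01_grad_chain_test_fun:
  assumes test: "test_fun \<Omega> \<phi>" and deriv: "\<And>t. (\<Phi> has_real_derivative \<Phi>' t) (at t)"
    and cont: "continuous_on UNIV \<Phi>'" and "\<Phi> 0 = 0"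
  shows "H01_grad (\<lambda>x. \<Phi> (\<phi> x)) (\<lambda>x. \<Phi>' (\<phi> x) *\<^sub>R grad \<phi> x)"
proof -
  obtain C where C: "0 < C" "\<And>x. \<bar>\<phi> x\<bar> \<le> C" using test_fun_bounded[OF test] by metis
  obtain a n D where limit: "\<And>t. \<bar>t\<bar> \<le> C \<Longrightarrow> (\<lambda>k. polynomial_antiderivative (a k) (n k) t) \<longlonglongrightarrow> \<Phi> t"
      "\<And>t. \<bar>t\<bar> \<le> C \<Longrightarrow> (\<lambda>k. \<Sum>i\<le>n k. a k i * t ^ i) \<longlonglongrightarrow> \<Phi>' t"
    and bound: "\<And>k t. \<bar>t\<bar> \<le> C \<Longrightarrow> \<bar>polynomial_antiderivative (a k) (n k) t\<bar> \<le> D"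
      "\<And>k t. \<bar>t\<bar> \<le> C \<Longrightarrow> \<bar>\<Sum>i\<le>n k. a k i * t ^ i\<bar> \<le> D"
    by (rule C1_polynomial_approximating_sequence[OF deriv cont \<open>\<Phi> 0 = 0\<close> C(1)]) (rule that)
  let ?p = "\<lambda>k x. \<Sum>i\<le>n k. a k i * \<phi> x ^ i" and ?P = "\<lambda>k x. polynomial_antiderivative (a k) (n k) (\<phi> x)"
  have in_H01: "H01_grad (?P k) (\<lambda>x. ?p k x *\<^sub>R grad \<phi> x)" for k
    using H01_grad_test_fun[OF test_fun_polynomial_antiderivative[OF test, where a="a k" and n="n k"]]
    unfolding grad_compose[OF test_fun_smooth[OF test] polynomial_antiderivative_has_real_derivative,
        abs_def] .
  note [measurable] = square_integrable_test_fun[OF test] square_integrable_grad_test_fun[OF test]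
    borel_measurable_continuous_onI[OF has_real_derivative_imp_continuous_on[OF deriv]]
    borel_measurable_continuous_onI[OF cont]
  show ?thesis
  proof (rule H01_grad_dominated_limit[OF in_H01])
    show "AE x in M\<Omega>. (\<lambda>k. ?P k x) \<longlonglongrightarrow> \<Phi> (\<phi> x)" by (intro AE_I2 limit C)
    show "AE x in M\<Omega>. (\<lambda>k. ?p k x *\<^sub>R grad \<phi> x) \<longlonglongrightarrow> \<Phi>' (\<phi> x) *\<^sub>R grad \<phi> x"
      by (intro AE_I2 tendsto_scaleR tendsto_const limit C)
    show "AE x in M\<Omega>. norm (?P k x) \<le> norm D" for k
      using order_trans[OF bound(1)[OF C(2)] abs_ge_self] by simp
    show "AE x in M\<Omega>. norm (?p k x *\<^sub>R grad \<phi> x) \<le> norm (D *\<^sub>R grad \<phi> x)" for k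
      unfolding norm_scaleR real_norm_def using order_trans[OF bound(2)[OF C(2)] abs_ge_self]
      by (intro AE_I2 mult_right_mono) auto
    show "square_integrable M\<Omega> (\<lambda>x. D *\<^sub>R grad \<phi> x)"
      by (intro square_integrable_scaleR square_integrable_grad_test_fun test)
  qed (simp_all add: square_integrable_const)
qed

lemma H01_grad_approx_AE:
  assumes in_H01: "H01_grad u g"
  obtains \<phi> where "\<And>k. test_fun \<Omega> (\<phi> k)" "L2_tendsto M\<Omega> \<phi> u" "L2_tendsto M\<Omega> (\<lambda>k. grad (\<phi> k)) g"
    and "AE x in M\<Omega>. (\<lambda>k. \<phi> k x) \<longlonglongrightarrow> u x"
proof -
  obtain \<phi> where \<phi>: "\<And>k. test_fun \<Omega> (\<phi> k)" "L2_tendsto M\<Omega> \<phi> u" "L2_tendsto M\<Omega> (\<lambda>k. grad (\<phi> k)) g"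
    using H01_grad_approx[OF in_H01] by blast
  obtain r where r: "strict_mono (r::nat\<Rightarrow>nat)" and "AE x in M\<Omega>. (\<lambda>k. \<phi> (r k) x) \<longlonglongrightarrow> u x"
    using L2_tendsto_imp_AE_subseq[OF square_integrable_test_fun[OF \<phi>(1)]
        H01_grad_square_integrable_fun[OF in_H01] \<phi>(2)]
    by blast
  then show thesis
    using that[of "\<lambda>k. \<phi> (r k)"] \<phi>(1) L2_tendsto_subseq[OF \<phi>(2) r] L2_tendsto_subseq[OF \<phi>(3) r] by blast
qed

lemma H01_grad_chain:
  assumes in_H01: "H01_grad u g" and deriv: "\<And>t. (\<Phi> has_real_derivative \<Phi>' t) (at t)"
    and cont: "continuous_on UNIV \<Phi>'" and "\<Phi> 0 = 0" and bound: "\<And>t. \<bar>\<Phi>' t\<bar> \<le> L"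
  shows "H01_grad (\<lambda>x. \<Phi> (u x)) (\<lambda>x. \<Phi>' (u x) *\<^sub>R g x)"
proof -
  note [measurable] = borel_measurable_continuous_onI[OF has_real_derivative_imp_continuous_on[OF deriv]]
    borel_measurable_continuous_onI[OF cont]
  note in_L2 = H01_grad_square_integrable(1,2)[OF in_H01] note [measurable] = in_L2
  note Lipschitz = derivative_bound_imp_Lipschitz[OF deriv bound]
  obtain \<phi> where \<phi>: "\<And>k. test_fun \<Omega> (\<phi> k)" "L2_tendsto M\<Omega> \<phi> u" "L2_tendsto M\<Omega> (\<lambda>k. grad (\<phi> k)) g"
    and \<phi>_lim: "AE x in M\<Omega>. (\<lambda>k. \<phi> k x) \<longlonglongrightarrow> u x"
    using H01_grad_approx_AE[OF in_H01] by blast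
  note test_in_L2 = square_integrable_test_fun[OF \<phi>(1)] square_integrable_grad_test_fun[OF \<phi>(1)]
  note [measurable] = test_in_L2
  show ?thesis
  proof (rule H01_grad_limit[OF H01_grad_chain_test_fun[OF \<phi>(1) deriv cont \<open>\<Phi> 0 = 0\<close>]])
    show "square_integrable M\<Omega> (\<lambda>x. \<Phi> (u x))"
      by (rule square_integrable_Lipschitz_compose[OF _ Lipschitz \<open>\<Phi> 0 = 0\<close> in_L2(1)]) measurable
    show "square_integrable M\<Omega> (\<lambda>x. \<Phi>' (u x) *\<^sub>R g x)"
      by (rule square_integrable_bounded_scaleR[OF in_L2(2) _ bound]) measurable
    show "L2_tendsto M\<Omega> (\<lambda>k x. \<Phi> (\<phi> k x)) (\<lambda>x. \<Phi> (u x))"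
      by (rule L2_tendsto_Lipschitz_compose[OF _ Lipschitz test_in_L2(1) in_L2(1) \<phi>(2)]) measurable
    show "L2_tendsto M\<Omega> (\<lambda>k x. \<Phi>' (\<phi> k x) *\<^sub>R grad (\<phi> k) x) (\<lambda>x. \<Phi>' (u x) *\<^sub>R g x)"
    proof (rule L2_tendsto_bounded_scaleR[OF test_in_L2(2) in_L2(2) \<phi>(3) _ _ bound])
      show "AE x in M\<Omega>. (\<lambda>k. \<Phi>' (\<phi> k x)) \<longlonglongrightarrow> \<Phi>' (u x)"
        using \<phi>_lim by eventually_elim (rule continuous_on_tendsto_compose[OF cont], auto)
    qed measurable
  qed
qed

lemma H01_grad_chain_bounded:
  assumes in_H01: "H01_grad u g" and bound: "\<And>x. \<bar>u x\<bar> \<le> A"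
    and deriv: "\<And>t. (\<Phi> has_real_derivative \<Phi>' t) (at t)"
    and cont: "continuous_on UNIV \<Phi>'" and "\<Phi> 0 = 0"
  shows "H01_grad (\<lambda>x. \<Phi> (u x)) (\<lambda>x. \<Phi>' (u x) *\<^sub>R g x)"
proof -
  have "0 \<le> A" using bound[of undefined] by linarith
  define q where "q t = \<Phi>' (truncate A t)" for t
  have q_cont: "continuous_on UNIV q"
    unfolding q_def by (rule continuous_on_compose2[OF cont continuous_on_truncate]) simp
  obtain F where F: "F 0 = 0" "\<And>t. (F has_real_derivative q t) (at t)"
    using continuous_has_antiderivative[OF q_cont] by blast
  obtain L where L: "\<And>t. \<bar>t\<bar> \<le> A \<Longrightarrow> \<bar>\<Phi>' t\<bar> \<le> L" using continuous_bounded_interval[OF cont] by blast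
  then have q_bound: "\<bar>q t\<bar> \<le> L" for t unfolding q_def using abs_truncate_le[OF \<open>0 \<le> A\<close>] by blast
  have q_eq: "q t = \<Phi>' t" if "\<bar>t\<bar> \<le> A" for t using that by (simp add: q_def truncate_eq)
  have "\<exists>c. \<forall>t\<in>{-A..A}. F t - \<Phi> t = c"
  proof (rule has_field_derivative_zero_constant)
    fix t assume "t \<in> {-A..A}"
    then have "((\<lambda>t. F t - \<Phi> t) has_field_derivative 0) (at t)"
      using DERIV_diff[OF F(2)[of t] deriv[of t]] q_eq[of t] by (simp add: abs_le_iff)
    then show "((\<lambda>t. F t - \<Phi> t) has_field_derivative 0) (at t within {-A..A})"
      by (rule DERIV_subset) simp
  qed simp
  then obtain c where c: "\<And>t. t \<in> {-A..A} \<Longrightarrow> F t - \<Phi> t = c" by blast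
  have "F t = \<Phi> t" if "\<bar>t\<bar> \<le> A" for t
    using c[of t] c[of 0] that F(1) \<open>\<Phi> 0 = 0\<close> \<open>0 \<le> A\<close> by (simp add: abs_le_iff)
  then show ?thesis using H01_grad_chain[OF in_H01 F(2) q_cont F(1) q_bound] bound q_eq by simp
qed

lemma H01_grad_pospart:
  assumes in_H01: "H01_grad u g" and "0 \<le> a"
  shows "H01_grad (\<lambda>x. max 0 (u x - a)) (\<lambda>x. indicator {a<..} (u x) *\<^sub>R g x)"
proof -
  note in_L2 = H01_grad_square_integrable(1,2)[OF in_H01] note [measurable] = in_L2
  define e where "e n = inverse (real (Suc n))" for n
  have e: "0 < e n" for n by (simp add: e_def)
  have e_lim: "e \<longlonglongrightarrow> 0" unfolding e_def[abs_def] by (rule LIMSEQ_inverse_real_of_nat)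
  let ?F = "\<lambda>n t. smooth_pospart (e n) (t - a)"
    and ?f = "\<lambda>n t. max 0 (t - a) / sqrt ((e n)\<^sup>2 + (max 0 (t - a))\<^sup>2)"
  have deriv: "(?F n has_real_derivative ?f n t) (at t)" for n t
    using smooth_pospart_has_real_derivative[OF e, of n "t - a"]
      DERIV_shift[of "smooth_pospart (e n)" _ t "- a"]
    by simp
  have bound: "\<bar>?f n t\<bar> \<le> 1" for n t by (rule smooth_pospart_derivative_bound)
  have zero: "?F n 0 = 0" for n using \<open>0 \<le> a\<close> e[of n] by (simp add: smooth_pospart_def)
  have cont: "continuous_on UNIV (?f n)" for n
  proof -
    have "(e n)\<^sup>2 + (max 0 (t - a))\<^sup>2 \<noteq> 0" for t
      using e[of n] by (metis add_pos_nonneg less_irrefl zero_le_power2 zero_less_power)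
    then show ?thesis by (intro continuous_intros) simp
  qed
  have approx: "H01_grad (\<lambda>x. ?F n (u x)) (\<lambda>x. ?f n (u x) *\<^sub>R g x)" for n
    by (rule H01_grad_chain[OF in_H01 deriv cont zero bound])
  show ?thesis
  proof (rule H01_grad_dominated_limit[OF approx _ _ in_L2(1) _ in_L2(2)])
    show "AE x in M\<Omega>. norm (?F n (u x)) \<le> norm (u x)" for n
      using derivative_bound_imp_Lipschitz[OF deriv bound, of n "u _" 0] zero by simp
    show "AE x in M\<Omega>. norm (?f n (u x) *\<^sub>R g x) \<le> norm (g x)" for n
      by (intro AE_I2) (simp only: norm_scaleR real_norm_def
          mult_left_le_one_le[OF norm_ge_zero abs_ge_zero bound])
    show "AE x in M\<Omega>. (\<lambda>n. ?F n (u x)) \<longlonglongrightarrow> max 0 (u x - a)"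
      using smooth_pospart_tendsto(1)[OF e_lim] by simp
    have "(\<lambda>n. ?f n t) \<longlonglongrightarrow> indicator {a<..} t" for t
      using smooth_pospart_tendsto(2)[OF e_lim, of "t - a"] by (simp add: indicator_def)
    then show "AE x in M\<Omega>. (\<lambda>n. ?f n (u x) *\<^sub>R g x) \<longlonglongrightarrow> indicator {a<..} (u x) *\<^sub>R g x"
      by (intro AE_I2 tendsto_scaleR tendsto_const)
  qed measurable
qed

lemma H01_grad_truncate:
  assumes in_H01: "H01_grad u g" and k: "0 \<le> k"
  shows "H01_grad (\<lambda>x. truncate k (u x)) (\<lambda>x. indicator {-k..k} (u x) *\<^sub>R g x)"
proof -
  have "H01_grad (\<lambda>x. max 0 (- u x - k)) (\<lambda>x. indicator {k<..} (- u x) *\<^sub>R - g x)"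
    using H01_grad_pospart[OF H01_grad_scaleR[OF in_H01, of "-1"] k] by simp
  from H01_grad_add[OF H01_grad_diff[OF in_H01 H01_grad_pospart[OF in_H01 k]] this]
  have "H01_grad (\<lambda>x. truncate k (u x))
      (\<lambda>x. g x - indicator {k<..} (u x) *\<^sub>R g x + indicator {k<..} (- u x) *\<^sub>R - g x)"
    by (simp only: truncate_eq_pospart[OF k])
  moreover have "g x - indicator {k<..} (u x) *\<^sub>R g x + indicator {k<..} (- u x) *\<^sub>R - g x
      = indicator {-k..k} (u x) *\<^sub>R g x" for x
    using k by (auto simp: indicator_def)
  ultimately show ?thesis by simp
qed

lemma H01_grad_power2:
  assumes "H01_grad u g" "\<And>x. \<bar>u x\<bar> \<le> A"
  shows "H01_grad (\<lambda>x. (u x)\<^sup>2) (\<lambda>x. (2 * u x) *\<^sub>R g x)"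
proof (rule H01_grad_chain_bounded[OF assms, of "\<lambda>t. t\<^sup>2" "\<lambda>t. 2 * t"])
  show "((\<lambda>t. t\<^sup>2) has_real_derivative 2 * t) (at t)" for t :: real by (auto intro!: derivative_eq_intros)
qed (auto intro!: continuous_intros)

lemma H01_grad_mult:
  assumes u: "H01_grad u g" "\<And>x. \<bar>u x\<bar> \<le> A" and v: "H01_grad v h" "\<And>x. \<bar>v x\<bar> \<le> B"
  shows "H01_grad (\<lambda>x. u x * v x) (\<lambda>x. u x *\<^sub>R h x + v x *\<^sub>R g x)"
proof -
  have bounds: "\<bar>u x + v x\<bar> \<le> A + B" "\<bar>u x - v x\<bar> \<le> A + B" for x using u(2)[of x] v(2)[of x] by linarith+
  have "H01_grad (\<lambda>x. (1/4) * ((u x + v x)\<^sup>2 - (u x - v x)\<^sup>2))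
     (\<lambda>x. (1/4) *\<^sub>R ((2 * (u x + v x)) *\<^sub>R (g x + h x) - (2 * (u x - v x)) *\<^sub>R (g x - h x)))"
    by (rule H01_grad_scaleR[OF H01_grad_diff[OF H01_grad_power2[OF H01_grad_add[OF u(1) v(1)] bounds(1)]
        H01_grad_power2[OF H01_grad_diff[OF u(1) v(1)] bounds(2)]]])
  moreover have "(1/4) * ((u x + v x)\<^sup>2 - (u x - v x)\<^sup>2) = u x * v x" for x
    by (simp add: power2_eq_square algebra_simps)
  moreover have "(1/4) *\<^sub>R ((2 * (u x + v x)) *\<^sub>R (g x + h x) - (2 * (u x - v x)) *\<^sub>R (g x - h x))
      = u x *\<^sub>R h x + v x *\<^sub>R g x" for x
    by (rule euclidean_eqI) (simp add: inner_simps algebra_simps)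
  ultimately show ?thesis by simp
qed

end

section \<open>Compactness\<close>

lemma square_integrable_translate:
  fixes f :: "'a::euclidean_space \<Rightarrow> 'b::euclidean_space"
  assumes f: "square_integrable lborel f" shows "square_integrable lborel (\<lambda>x. f (x + c))"
proof -
  have [measurable]: "f \<in> borel_measurable borel" using square_integrable_measurable[OF f] by simp
  have "(\<lambda>x. f (x + c)) \<in> borel_measurable lborel" by measurable
  with integrable_lborel_translate[OF square_integrable_integrable_power2[OF f], of c]
  show ?thesis by (simp add: square_integrable_def)
qed

lemma L2_norm_translate:
  fixes f :: "'a::euclidean_space \<Rightarrow> 'b::euclidean_space"
  assumes [measurable]: "f \<in> borel_measurable borel"
  shows "L2_norm lborel (\<lambda>x. f (x + c)) = L2_norm lborel f"
  using lborel_integral_translate[of "\<lambda>x. (norm (f x))\<^sup>2" c] by (simp add: L2_norm_def)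

lemma L2_norm_multiple_translate_le:
  fixes f :: "'a::euclidean_space \<Rightarrow> 'b::euclidean_space"
  assumes f: "square_integrable lborel f"
  shows "L2_norm lborel (\<lambda>x. f (x + real k *\<^sub>R e) - f x) \<le> real k * L2_norm lborel (\<lambda>x. f (x + e) - f x)"
proof (induction k)
  case 0
  then show ?case by (simp add: L2_norm_zero)
next
  case (Suc k)
  let ?d = "\<lambda>x. f (x + real k *\<^sub>R e) - f x"
  have shift: "square_integrable lborel ?d" and step: "square_integrable lborel (\<lambda>x. f (x + e) - f x)"
    by (intro square_integrable_diff square_integrable_translate f)+
  have "L2_norm lborel (\<lambda>x. f (x + real (Suc k) *\<^sub>R e) - f x)
      = L2_norm lborel (\<lambda>x. ?d (x + e) + (f (x + e) - f x))"
    by (simp add: algebra_simps)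
  also have "\<dots> \<le> L2_norm lborel (\<lambda>x. ?d (x + e)) + L2_norm lborel (\<lambda>x. f (x + e) - f x)"
    by (rule L2_norm_triangle_ineq[OF square_integrable_translate[OF shift] step])
  also have "L2_norm lborel (\<lambda>x. ?d (x + e)) = L2_norm lborel ?d"
    using square_integrable_measurable[OF shift] by (intro L2_norm_translate) simp
  finally show ?case using Suc.IH by (simp add: algebra_simps)
qed

lemma square_integrable_if_bounded_support:
  fixes f :: "'a::euclidean_space \<Rightarrow> 'b::euclidean_space"
  assumes [measurable]: "f \<in> borel_measurable borel"
    and "\<And>x. norm (f x) \<le> C" "\<And>x. r < norm x \<Longrightarrow> f x = 0"
  shows "square_integrable lborel f"
proof -
  have "integrable lborel (\<lambda>x. (norm (f x))\<^sup>2)"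
    by (rule integrable_lborel_if_bounded_support[where C="C\<^sup>2" and r=r])
      (use assms in \<open>auto intro: power_mono\<close>)
  then show ?thesis by (simp add: square_integrable_def)
qed

lemma square_integrable_lborel_test_fun:
  assumes test: "test_fun \<Omega> \<phi>"
  shows "square_integrable lborel \<phi>" "square_integrable lborel (grad \<phi>)"
proof -
  obtain C where C: "\<And>x. \<bar>\<phi> x\<bar> \<le> C" "\<And>x. norm (grad \<phi> x) \<le> C" using test_fun_bounded[OF test] by metis
  obtain r where r: "\<And>x. r < norm x \<Longrightarrow> \<phi> x = 0" "\<And>x. r < norm x \<Longrightarrow> grad \<phi> x = 0"
    using test_fun_bounded_support[OF test] by metis
  show "square_integrable lborel \<phi>"
    by (rule square_integrable_if_bounded_support[OF test_fun_measurable[OF test] _ r(1)]) (use C in auto)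
  show "square_integrable lborel (grad \<phi>)"
    by (rule square_integrable_if_bounded_support[OF grad_test_fun_measurable[OF test] C(2) r(2)])
qed

lemma difference_quotient_test_fun_L2_tendsto:
  assumes test: "test_fun \<Omega> \<phi>"
  shows "L2_tendsto lborel (difference_quotient \<phi> h) (\<lambda>x. grad \<phi> x \<bullet> h)"
proof -
  note [measurable] = test_fun_measurable[OF test] grad_test_fun_measurable[OF test]
  obtain C r where C: "\<And>n x. \<bar>difference_quotient \<phi> h n x\<bar> \<le> C * indicator (cball 0 r) x"
    using test_fun_difference_quotient_bound[OF test, of h] by blast
  show ?thesis
  proof (rule L2_dominated_convergence(2))
    show "square_integrable lborel (\<lambda>x. C * indicator (cball 0 r) x :: real)"
      by (rule square_integrable_if_bounded_support[of _ "\<bar>C\<bar>" r]) (auto simp: indicator_def)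
    show "AE x in lborel. norm (difference_quotient \<phi> h n x) \<le> norm (C * indicator (cball 0 r) x)" for n
      using C by (auto intro: order_trans[OF _ abs_ge_self])
    show "AE x in lborel. (\<lambda>n. difference_quotient \<phi> h n x) \<longlonglongrightarrow> grad \<phi> x \<bullet> h"
      by (intro AE_I2 test_fun_difference_quotient_tendsto[OF test])
  qed (simp_all add: difference_quotient_def[abs_def])
qed

lemma L2_norm_translate_test_fun_le:
  assumes test: "test_fun \<Omega> \<phi>"
  shows "L2_norm lborel (\<lambda>x. \<phi> (x + h) - \<phi> x) \<le> norm h * L2_norm lborel (grad \<phi>)"
proof -
  note in_L2 = square_integrable_lborel_test_fun[OF test]
  have quotient: "L2_norm lborel (\<lambda>x. \<phi> (x + h) - \<phi> x) \<le> L2_norm lborel (difference_quotient \<phi> h n)" for n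
    using L2_norm_multiple_translate_le[OF in_L2(1), of "Suc n" "(1 / real (Suc n)) *\<^sub>R h"]
      L2_norm_scaleR[of lborel "real (Suc n)" "\<lambda>x. \<phi> (x + (1 / real (Suc n)) *\<^sub>R h) - \<phi> x"]
    by (simp add: difference_quotient_def[abs_def])
  have sq_quotient: "square_integrable lborel (difference_quotient \<phi> h n)" for n
    using square_integrable_scaleR[OF square_integrable_diff[OF square_integrable_translate[OF in_L2(1)]
        in_L2(1)]]
    unfolding difference_quotient_def[abs_def] by simp
  have "(\<lambda>n. L2_norm lborel (difference_quotient \<phi> h n)) \<longlonglongrightarrow> L2_norm lborel (\<lambda>x. grad \<phi> x \<bullet> h)"
    by (rule L2_tendsto_norm[OF sq_quotient square_integrable_inner_const[OF in_L2(2)]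
        difference_quotient_test_fun_L2_tendsto[OF test]])
  then have "L2_norm lborel (\<lambda>x. \<phi> (x + h) - \<phi> x) \<le> L2_norm lborel (\<lambda>x. grad \<phi> x \<bullet> h)"
    using quotient by (intro LIMSEQ_le_const) auto
  also have "\<dots> \<le> L2_norm lborel (\<lambda>x. norm h *\<^sub>R grad \<phi> x)"
  proof (rule L2_norm_mono[OF square_integrable_scaleR[OF in_L2(2)]])
    show "AE x in lborel. norm (grad \<phi> x \<bullet> h) \<le> norm (norm h *\<^sub>R grad \<phi> x)"
      using Cauchy_Schwarz_ineq2[of "grad \<phi> _" h] by (simp add: mult.commute)
  qed (use square_integrable_inner_const[OF in_L2(2)] in measurable)
  also have "\<dots> = norm h * L2_norm lborel (grad \<phi>)" by (simp add: L2_norm_scaleR)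
  finally show ?thesis .
qed

lemma L2_norm_autocorrelation:
  fixes f :: "'a::euclidean_space \<Rightarrow> 'b::euclidean_space"
  assumes f: "square_integrable lborel f"
  shows "(L2_norm lborel (\<lambda>x. f (x + h) - f x))\<^sup>2
      = 2 * (L2_norm lborel f)\<^sup>2 - 2 * (\<integral>x. f x \<bullet> f (x + h) \<partial>lborel)"
proof -
  note fh = square_integrable_translate[OF f, of h]
  have "(L2_norm lborel (\<lambda>x. f (x + h) - f x))\<^sup>2
      = (\<integral>x. (norm (f (x + h)))\<^sup>2 + (norm (f x))\<^sup>2 - 2 * (f x \<bullet> f (x + h)) \<partial>lborel)"
    unfolding L2_norm_power2
    by (intro Bochner_Integration.integral_cong refl)
      (simp add: power2_norm_eq_inner inner_simps inner_commute)
  also have "\<dots> = (L2_norm lborel (\<lambda>x. f (x + h)))\<^sup>2 + (L2_norm lborel f)\<^sup>2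
      - 2 * (\<integral>x. f x \<bullet> f (x + h) \<partial>lborel)"
    using square_integrable_integrable_power2[OF f] square_integrable_integrable_power2[OF fh]
      integrable_inner_square_integrable[OF f fh] unfolding L2_norm_power2 by simp
  also have "L2_norm lborel (\<lambda>x. f (x + h)) = L2_norm lborel f"
    using square_integrable_measurable[OF f] by (intro L2_norm_translate) simp
  finally show ?thesis by simp
qed

definition ball_integral :: "real \<Rightarrow> ('a::euclidean_space \<Rightarrow> real) \<Rightarrow> 'a \<Rightarrow> real" where
  "ball_integral r f x = (\<integral>y. f y * indicator (cball x r) y \<partial>lborel)"

lemma borel_measurable_times_indicator_cball:
  fixes f :: "'a::euclidean_space \<Rightarrow> real"
  assumes "f \<in> borel_measurable borel"
  shows "(\<lambda>y. f y * indicator (cball x r) y) \<in> borel_measurable borel"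
  by (intro borel_measurable_times borel_measurable_indicator assms) simp

lemma borel_measurable_ball_integral:
  fixes f :: "'a::euclidean_space \<Rightarrow> real"
  assumes [measurable]: "f \<in> borel_measurable borel"
  shows "ball_integral r f \<in> borel_measurable borel"
proof -
  have "(\<lambda>p::'a\<times>'a. f (snd p) * indicator {..r} (dist (fst p) (snd p)))
      \<in> borel_measurable (lborel \<Otimes>\<^sub>M lborel)"
    by measurable
  moreover have "(\<lambda>p. f (snd p) * indicator {..r} (dist (fst p) (snd p)))
      = (\<lambda>(x, y). f y * indicator (cball x r) y)"
    by (auto simp: indicator_def fun_eq_iff)
  ultimately have "(\<lambda>x. \<integral>y. f y * indicator (cball x r) y \<partial>lborel) \<in> borel_measurable lborel"
    by (intro lborel.borel_measurable_lebesgue_integral) simp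
  then show ?thesis unfolding ball_integral_def[abs_def] by simp
qed

lemma integrable_autocorrelation_kernel:
  fixes \<phi> :: "'a::euclidean_space \<Rightarrow> real"
  assumes test: "test_fun \<Omega> \<phi>"
  shows "integrable (lborel \<Otimes>\<^sub>M lborel) (\<lambda>(h, x). indicator (cball 0 r) h * (\<phi> x * \<phi> (x + h)))"
proof -
  note [measurable] = test_fun_measurable[OF test]
  obtain C where C: "0 < C" "\<And>x. \<bar>\<phi> x\<bar> \<le> C" using test_fun_bounded[OF test] by metis
  obtain R where R: "\<And>x. R < norm x \<Longrightarrow> \<phi> x = 0" using test_fun_bounded_support[OF test] by metis
  let ?F = "\<lambda>p::'a\<times>'a. indicator (cball 0 r) (fst p) * (\<phi> (snd p) * \<phi> (snd p + fst p))"
  have "(\<lambda>p::'a\<times>'a. indicator {..r} (norm (fst p)) * (\<phi> (snd p) * \<phi> (snd p + fst p)))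
      \<in> borel_measurable (lborel \<Otimes>\<^sub>M lborel)" by measurable
  moreover have "(\<lambda>p. indicator {..r} (norm (fst p)) * (\<phi> (snd p) * \<phi> (snd p + fst p))) = ?F"
    by (auto simp: indicator_def)
  ultimately have "?F \<in> borel_measurable borel" by (simp add: lborel_prod)
  then have "integrable lborel ?F"
  proof (rule integrable_lborel_if_bounded_support[where C="C * C" and r="r + R"])
    fix p :: "'a \<times> 'a"
    have "\<bar>\<phi> (snd p)\<bar> * \<bar>\<phi> (snd p + fst p)\<bar> \<le> C * C" using C by (intro mult_mono) auto
    then show "norm (?F p) \<le> C * C" using C(1) by (auto simp: indicator_def abs_mult)
    assume "r + R < norm p"
    then have "r < norm (fst p) \<or> R < norm (snd p)" using norm_Pair_le[of "fst p" "snd p"] by simp linarith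
    then show "?F p = 0" using R by auto
  qed
  then show ?thesis by (simp add: lborel_prod case_prod_unfold)
qed

lemma integral_autocorrelation_over_cball:
  fixes \<phi> :: "'a::euclidean_space \<Rightarrow> real"
  assumes test: "test_fun \<Omega> \<phi>"
  shows "(\<integral>h. indicator (cball 0 r) h * (\<integral>x. \<phi> x * \<phi> (x + h) \<partial>lborel) \<partial>lborel)
    = (\<integral>x. \<phi> x * ball_integral r \<phi> x \<partial>lborel)"
proof -
  note [measurable] = test_fun_measurable[OF test]
  have shift: "(\<integral>h. indicator (cball 0 r) h * (\<phi> x * \<phi> (x + h)) \<partial>lborel) = \<phi> x * ball_integral r \<phi> x" for x
  proof -
    have "(\<integral>h. indicator (cball 0 r) h * (\<phi> x * \<phi> (x + h)) \<partial>lborel)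
        = (\<integral>h. \<phi> x * (\<phi> (h + x) * indicator (cball x r) (h + x)) \<partial>lborel)"
      by (intro Bochner_Integration.integral_cong refl)
        (auto simp: indicator_def dist_norm add.commute mult.commute)
    also have "\<dots> = \<phi> x * (\<integral>h. \<phi> (h + x) * indicator (cball x r) (h + x) \<partial>lborel)"
      by (rule integral_mult_right_zero)
    also have "\<dots> = \<phi> x * ball_integral r \<phi> x" unfolding ball_integral_def
      by (rule arg_cong[OF lborel_integral_translate[OF borel_measurable_times_indicator_cball]]) measurable
    finally show ?thesis .
  qed
  show ?thesis
    using lborel_pair.Fubini_integral[OF integrable_autocorrelation_kernel[OF test, of r]]
    by (simp add: shift)
qed

lemma L2_norm_le_gradient_plus_ball_integral:
  fixes \<phi> :: "'a::euclidean_space \<Rightarrow> real"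
  assumes test: "test_fun \<Omega> \<phi>" and "0 < r"
  shows "(L2_norm lborel \<phi>)\<^sup>2 \<le> r\<^sup>2 * (L2_norm lborel (grad \<phi>))\<^sup>2
    + (\<integral>x. \<phi> x * ball_integral r \<phi> x \<partial>lborel) / measure lborel (cball (0::'a) r)"
proof -
  let ?B = "cball (0::'a) r" and ?N = "(L2_norm lborel \<phi>)\<^sup>2 - r\<^sup>2 * (L2_norm lborel (grad \<phi>))\<^sup>2"
  have volume: "0 < measure lborel ?B" using content_cball_pos[OF \<open>0 < r\<close>, of "0::'a"] by simp
  have autocorrelation: "?N \<le> (\<integral>x. \<phi> x * \<phi> (x + h) \<partial>lborel)" if "h \<in> ?B" for h
  proof -
    have "(L2_norm lborel (\<lambda>x. \<phi> (x + h) - \<phi> x))\<^sup>2 \<le> (r * L2_norm lborel (grad \<phi>))\<^sup>2"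
      using that by (intro power_mono L2_norm_nonneg
          order_trans[OF L2_norm_translate_test_fun_le[OF test]] mult_right_mono) auto
    then show ?thesis
      using L2_norm_autocorrelation[OF square_integrable_lborel_test_fun(1)[OF test], of h]
        zero_le_power2[of "r * L2_norm lborel (grad \<phi>)"]
      unfolding power_mult_distrib inner_real_def by linarith
  qed
  have "measure lborel ?B * ?N = (\<integral>h. indicator ?B h * ?N \<partial>lborel)" by simp
  also have "\<dots> \<le> (\<integral>h. indicator ?B h * (\<integral>x. \<phi> x * \<phi> (x + h) \<partial>lborel) \<partial>lborel)"
  proof (rule integral_mono)
    show "integrable lborel (\<lambda>h. indicator ?B h * ?N)"
      using emeasure_lborel_cball_finite[of "0::'a" r]
      by (intro integrable_mult_left integrable_real_indicator) auto
    show "integrable lborel (\<lambda>h. indicator ?B h * (\<integral>x. \<phi> x * \<phi> (x + h) \<partial>lborel))"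
      using lborel_pair.integrable_fst[OF integrable_autocorrelation_kernel[OF test, of r]] by simp
  qed (use autocorrelation in \<open>auto simp: indicator_def\<close>)
  also have "\<dots> = (\<integral>x. \<phi> x * ball_integral r \<phi> x \<partial>lborel)"
    by (rule integral_autocorrelation_over_cball[OF test])
  finally show ?thesis using volume by (simp add: field_simps)
qed

lemma tendsto_zero_if_le_eps_plus_null:
  fixes a :: "nat \<Rightarrow> real"
  assumes "\<And>n. 0 \<le> a n" and le_eps: "\<And>e. 0 < e \<Longrightarrow> \<exists>b. b \<longlonglongrightarrow> 0 \<and> (\<forall>n. a n \<le> e + b n)"
  shows "a \<longlonglongrightarrow> 0"
proof (rule order_tendstoI)
  fix c :: real assume "0 < c"
  then obtain b where "b \<longlonglongrightarrow> 0" and a_le: "\<And>n. a n \<le> c / 2 + b n" using le_eps[of "c / 2"] by auto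
  then have "\<forall>\<^sub>F n in sequentially. b n < c / 2" using \<open>0 < c\<close> by (intro order_tendstoD) auto
  then show "\<forall>\<^sub>F n in sequentially. a n < c"
  proof eventually_elim
    case (elim n) then show ?case using a_le[of n] by linarith
  qed
qed (use assms(1) in \<open>auto intro!: always_eventually intro: less_le_trans\<close>)

context bounded_domain
begin

lemma test_fun_domain_eq_lborel:
  assumes test: "test_fun \<Omega> \<phi>"
  shows "L2_norm M\<Omega> \<phi> = L2_norm lborel \<phi>" "L2_norm M\<Omega> (grad \<phi>) = L2_norm lborel (grad \<phi>)"
    and "(\<integral>x. \<phi> x * ball_integral r \<phi> x \<partial>M\<Omega>) = (\<integral>x. \<phi> x * ball_integral r \<phi> x \<partial>lborel)"
    and "(\<integral>y. \<phi> y * indicator (cball x r) y \<partial>M\<Omega>) = ball_integral r \<phi> x"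
proof -
  note [measurable] = test_fun_measurable[OF test] grad_test_fun_measurable[OF test]
    borel_measurable_ball_integral[OF test_fun_measurable[OF test]]
  note outside = test_fun_outside[OF test]
  show "L2_norm M\<Omega> \<phi> = L2_norm lborel \<phi>" "L2_norm M\<Omega> (grad \<phi>) = L2_norm lborel (grad \<phi>)"
    unfolding L2_norm_def by (subst integral_domain_eq_lborel; simp add: outside)+
  show "(\<integral>x. \<phi> x * ball_integral r \<phi> x \<partial>M\<Omega>) = (\<integral>x. \<phi> x * ball_integral r \<phi> x \<partial>lborel)"
    by (rule integral_domain_eq_lborel) (simp_all add: outside)
  show "(\<integral>y. \<phi> y * indicator (cball x r) y \<partial>M\<Omega>) = ball_integral r \<phi> x"
    unfolding ball_integral_def
    by (rule integral_domain_eq_lborel[OF borel_measurable_times_indicator_cball])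
      (measurable, simp add: outside)
qed

lemma integral_times_ball_integral_tendsto_zero:
  assumes test: "\<And>n. test_fun \<Omega> (\<phi> n)" and bounded: "\<And>n. L2_norm M\<Omega> (\<phi> n) \<le> B"
    and weak: "L2_weakly_tendsto M\<Omega> \<phi> (\<lambda>x. 0)"
  shows "(\<lambda>n. \<integral>x. \<phi> n x * ball_integral r (\<phi> n) x \<partial>M\<Omega>) \<longlonglongrightarrow> 0"
proof -
  note in_L2 = square_integrable_test_fun[OF test]
  have ball: "square_integrable M\<Omega> (indicator (cball x r) :: 'a \<Rightarrow> real)" for x
    by (intro square_integrable_bounded[of _ 1] borel_measurable_domain_if_borel borel_measurable_indicator)
      (auto simp: indicator_def)
  let ?C = "B * L2_norm M\<Omega> (\<lambda>x. 1::real)"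
  have bound: "\<bar>ball_integral r (\<phi> n) x\<bar> \<le> ?C" for n x
  proof -
    have "\<bar>ball_integral r (\<phi> n) x\<bar> \<le> L2_norm M\<Omega> (\<phi> n) * L2_norm M\<Omega> (indicator (cball x r) :: 'a \<Rightarrow> real)"
      using abs_integral_inner_le_L2_norm[OF in_L2[of n] ball[of x]]
      by (simp add: test_fun_domain_eq_lborel(4)[OF test])
    also have "\<dots> \<le> ?C"
      by (intro mult_mono bounded L2_norm_nonneg order_trans[OF L2_norm_nonneg bounded]
          L2_norm_mono[OF square_integrable_const square_integrable_measurable[OF ball]])
        (simp add: indicator_def)
    finally show ?thesis .
  qed
  have lim: "(\<lambda>n. ball_integral r (\<phi> n) x) \<longlonglongrightarrow> 0" for x
    using L2_weakly_tendstoD[OF weak ball[of x]] by (simp add: test_fun_domain_eq_lborel(4)[OF test])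
  have "(\<lambda>n. \<integral>x. \<phi> n x \<bullet> ball_integral r (\<phi> n) x \<partial>M\<Omega>) \<longlonglongrightarrow> 0"
  proof (rule integral_inner_dominated_tendsto_zero[OF in_L2 bounded square_integrable_const[of ?C]])
    show "ball_integral r (\<phi> n) \<in> borel_measurable M\<Omega>" for n
      by (intro borel_measurable_domain_if_borel borel_measurable_ball_integral
          test_fun_measurable[OF test])
    show "AE x in M\<Omega>. norm (ball_integral r (\<phi> n) x) \<le> norm ?C" for n
      using bound by (auto intro: order_trans[OF _ abs_ge_self])
  qed (use lim in simp)
  then show ?thesis by simp
qed

lemma Rellich_test_fun:
  assumes test: "\<And>n. test_fun \<Omega> (\<phi> n)" and bounded: "\<And>n. L2_norm M\<Omega> (\<phi> n) \<le> B"
    "\<And>n. L2_norm M\<Omega> (grad (\<phi> n)) \<le> B"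
    and weak: "L2_weakly_tendsto M\<Omega> \<phi> (\<lambda>x. 0)"
  shows "(\<lambda>n. L2_norm M\<Omega> (\<phi> n)) \<longlonglongrightarrow> 0"
proof -
  have "(\<lambda>n. (L2_norm M\<Omega> (\<phi> n))\<^sup>2) \<longlonglongrightarrow> 0"
  proof (rule tendsto_zero_if_le_eps_plus_null)
    fix e :: real assume "0 < e"
    define r where "r = sqrt (e / (B\<^sup>2 + 1))"
    have "0 < B\<^sup>2 + 1" by (simp add: add_nonneg_pos)
    then have "0 < r" and r_power2: "r\<^sup>2 * (B\<^sup>2 + 1) = e" using \<open>0 < e\<close> by (simp_all add: r_def)
    let ?b = "\<lambda>n. (\<integral>x. \<phi> n x * ball_integral r (\<phi> n) x \<partial>M\<Omega>) / measure lborel (cball (0::'a) r)"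
    have "?b \<longlonglongrightarrow> 0"
      using tendsto_divide_zero[OF integral_times_ball_integral_tendsto_zero[OF test bounded(1) weak]]
      by simp
    moreover have "(L2_norm M\<Omega> (\<phi> n))\<^sup>2 \<le> e + ?b n" for n
    proof -
      have "r\<^sup>2 * (L2_norm M\<Omega> (grad (\<phi> n)))\<^sup>2 \<le> r\<^sup>2 * (B\<^sup>2 + 1)"
        using power_mono[OF bounded(2)[of n] L2_norm_nonneg, of 2] by (intro mult_left_mono) auto
      then show ?thesis
        using L2_norm_le_gradient_plus_ball_integral[OF test[of n] \<open>0 < r\<close>] unfolding r_power2
        by (simp add: test_fun_domain_eq_lborel[OF test])
    qed
    ultimately show "\<exists>b. b \<longlonglongrightarrow> 0 \<and> (\<forall>n. (L2_norm M\<Omega> (\<phi> n))\<^sup>2 \<le> e + b n)" by blast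
  qed simp
  from tendsto_real_sqrt[OF this] show ?thesis by (simp add: L2_norm_nonneg)
qed

lemma H01_grad_close_test_fun:
  assumes in_H01: "H01_grad u g" and "0 < e"
  obtains \<phi> where "test_fun \<Omega> \<phi>" "L2_norm M\<Omega> (\<lambda>x. \<phi> x - u x) < e" "L2_norm M\<Omega> (\<lambda>x. grad \<phi> x - g x) < e"
proof -
  obtain \<phi> where \<phi>: "\<And>k. test_fun \<Omega> (\<phi> k)" "L2_tendsto M\<Omega> \<phi> u" "L2_tendsto M\<Omega> (\<lambda>k. grad (\<phi> k)) g"
    using H01_grad_approx[OF in_H01] by blast
  have "\<forall>\<^sub>F k in sequentially. L2_norm M\<Omega> (\<lambda>x. \<phi> k x - u x) < e \<and> L2_norm M\<Omega> (\<lambda>x. grad (\<phi> k) x - g x) < e"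
    by (intro eventually_conj order_tendstoD(2)[OF L2_tendstoD] \<phi> \<open>0 < e\<close>)
  then show thesis using that \<phi>(1) eventually_happens'[OF sequentially_bot] by blast
qed

lemma Rellich:
  assumes in_H01: "\<And>n. H01_grad (u n) (g n)"
    and bounded: "\<And>n. L2_norm M\<Omega> (u n) \<le> B" "\<And>n. L2_norm M\<Omega> (g n) \<le> B"
    and weak: "L2_weakly_tendsto M\<Omega> u (\<lambda>x. 0)"
  shows "(\<lambda>n. L2_norm M\<Omega> (u n)) \<longlonglongrightarrow> 0"
proof -
  note in_L2 = H01_grad_square_integrable(1,2)[OF in_H01]
  have "\<exists>\<phi>. test_fun \<Omega> \<phi> \<and> L2_norm M\<Omega> (\<lambda>x. \<phi> x - u n x) < inverse (real (Suc n)) \<and>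
      L2_norm M\<Omega> (\<lambda>x. grad \<phi> x - g n x) < inverse (real (Suc n))" for n
    by (rule H01_grad_close_test_fun[OF in_H01[of n], of "inverse (real (Suc n))"]) auto
  then obtain \<phi> where test: "\<And>n. test_fun \<Omega> (\<phi> n)"
    and close: "\<And>n. L2_norm M\<Omega> (\<lambda>x. \<phi> n x - u n x) < inverse (real (Suc n))"
      "\<And>n. L2_norm M\<Omega> (\<lambda>x. grad (\<phi> n) x - g n x) < inverse (real (Suc n))"
    by metis
  note test_in_L2 = square_integrable_test_fun[OF test] square_integrable_grad_test_fun[OF test]
  have le_one: "inverse (real (Suc n)) \<le> 1" for n by (simp add: inverse_le_1_iff)
  have bounds: "L2_norm M\<Omega> (\<phi> n) \<le> B + 1" "L2_norm M\<Omega> (grad (\<phi> n)) \<le> B + 1" for n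
    using L2_norm_triangle_sub[OF test_in_L2(1)[of n] in_L2(1)[of n]]
      L2_norm_triangle_sub[OF test_in_L2(2)[of n] in_L2(2)[of n]]
      close[of n] bounded[of n] le_one[of n] by linarith+
  have diff_tendsto: "L2_tendsto M\<Omega> (\<lambda>n x. u n x - \<phi> n x) (\<lambda>x. 0)"
    by (rule L2_tendsto_if_le[OF _ LIMSEQ_inverse_real_of_nat])
      (use close(1) in \<open>simp add: L2_norm_minus_commute[of _ "u _"] less_imp_le\<close>)
  have "L2_weakly_tendsto M\<Omega> (\<lambda>n x. u n x - (u n x - \<phi> n x)) (\<lambda>x. 0 - 0)"
    by (intro L2_weakly_tendsto_diff L2_tendsto_imp_weakly_tendsto square_integrable_diff
        square_integrable_zero
        in_L2 test_in_L2 weak diff_tendsto)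
  then have "L2_weakly_tendsto M\<Omega> \<phi> (\<lambda>x. 0)" by simp
  from tendsto_add[OF Rellich_test_fun[OF test bounds this] L2_tendstoD[OF diff_tendsto]]
  have lim: "(\<lambda>n. L2_norm M\<Omega> (\<phi> n) + L2_norm M\<Omega> (\<lambda>x. u n x - \<phi> n x)) \<longlonglongrightarrow> 0" by simp
  show ?thesis
    by (rule Lim_null_comparison[OF always_eventually lim])
      (use L2_norm_triangle_sub[OF in_L2(1) test_in_L2(1)] in \<open>simp add: L2_norm_nonneg\<close>)
qed

lemma H01_grad_weak_compactness:
  assumes in_H01: "\<And>n. H01_grad (u n) (g n)" and bounded: "\<And>n. L2_norm M\<Omega> (\<lambda>x. (u n x, g n x)) \<le> B"
  obtains r v h where "strict_mono (r::nat\<Rightarrow>nat)" "H01_grad v h"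
    "L2_weakly_tendsto M\<Omega> (\<lambda>n. u (r n)) v" "L2_weakly_tendsto M\<Omega> (\<lambda>n. g (r n)) h"
proof -
  note in_L2 = H01_grad_square_integrable(3)[OF in_H01]
  obtain r l where r: "strict_mono (r::nat\<Rightarrow>nat)" and l: "l \<in> closure test_graph"
    and weak: "\<And>y. (\<lambda>n. graph_class (u (r n)) (g (r n)) \<bullet> y) \<longlonglongrightarrow> l \<bullet> y"
  proof (rule bounded_imp_weakly_convergent_subsequence[OF closed_closure subspace_closure_test_graph])
    show "graph_class (u n) (g n) \<in> closure test_graph" for n using in_H01 by (simp add: H01_grad_def)
    show "norm (graph_class (u n) (g n)) \<le> B" for n using bounded in_L2
      by (simp add: norm_L2_class[OF sets_domain])
  qed (rule that)
  obtain v h where limit_in_H01: "H01_grad v h" and l_eq: "l = graph_class v h"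
    using closure_test_graphE[OF l] by blast
  have pair: "(\<lambda>n. \<integral>x. (u (r n) x, g (r n) x) \<bullet> k x \<partial>M\<Omega>) \<longlonglongrightarrow> (\<integral>x. (v x, h x) \<bullet> k x \<partial>M\<Omega>)"
    if "square_integrable M\<Omega> k" for k
    using weak[of "L2_class \<Omega> k"] unfolding l_eq L2_class_inner[OF sets_domain in_L2 that]
      L2_class_inner[OF sets_domain H01_grad_square_integrable(3)[OF limit_in_H01] that] .
  have "L2_weakly_tendsto M\<Omega> (\<lambda>n. u (r n)) v" unfolding L2_weakly_tendsto_def
    using pair[OF square_integrable_Pair[OF _ square_integrable_zero]] by simp
  moreover have "L2_weakly_tendsto M\<Omega> (\<lambda>n. g (r n)) h" unfolding L2_weakly_tendsto_def
    using pair[OF square_integrable_Pair[OF square_integrable_zero]] by simp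
  ultimately show thesis using that r limit_in_H01 by blast
qed

lemma Rellich_Kondrachov:
  assumes in_H01: "\<And>n. H01_grad (u n) (g n)" and bounded: "\<And>n. L2_norm M\<Omega> (\<lambda>x. (u n x, g n x)) \<le> B"
  obtains r v h where "strict_mono (r::nat\<Rightarrow>nat)" "H01_grad v h"
    "L2_tendsto M\<Omega> (\<lambda>n. u (r n)) v" "L2_weakly_tendsto M\<Omega> (\<lambda>n. g (r n)) h"
proof -
  obtain r v h where r: "strict_mono (r::nat\<Rightarrow>nat)" and limit_in_H01: "H01_grad v h"
    and weak: "L2_weakly_tendsto M\<Omega> (\<lambda>n. u (r n)) v" "L2_weakly_tendsto M\<Omega> (\<lambda>n. g (r n)) h"
    by (rule H01_grad_weak_compactness[OF in_H01 bounded]) (rule that)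
  note in_L2 = H01_grad_square_integrable(1,2)[OF in_H01]
    and limit_in_L2 = H01_grad_square_integrable(1,2)[OF limit_in_H01]
  define C where "C = B + (L2_norm M\<Omega> v + L2_norm M\<Omega> h)"
  have "L2_norm M\<Omega> (\<lambda>x. u n x - v x) \<le> C" "L2_norm M\<Omega> (\<lambda>x. g n x - h x) \<le> C" for n
    using L2_norm_triangle_ineq4[OF in_L2(1)[of n] limit_in_L2(1)]
      L2_norm_triangle_ineq4[OF in_L2(2)[of n] limit_in_L2(2)]
      order_trans[OF L2_norm_Pair_bounds(1)[OF in_L2(1,2)[of n]] bounded]
        order_trans[OF L2_norm_Pair_bounds(2)[OF in_L2(1,2)[of n]] bounded]
      L2_norm_nonneg[of M\<Omega> v] L2_norm_nonneg[of M\<Omega> h] unfolding C_def by linarith+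
  moreover have "L2_weakly_tendsto M\<Omega> (\<lambda>n x. u (r n) x - v x) (\<lambda>x. v x - v x)"
    by (intro L2_weakly_tendsto_diff L2_weakly_tendsto_const in_L2 limit_in_L2 weak)
  ultimately have "L2_tendsto M\<Omega> (\<lambda>n. u (r n)) v" unfolding L2_tendsto_def
    by (intro Rellich[OF H01_grad_diff[OF in_H01 limit_in_H01]]) simp_all
  with that r limit_in_H01 weak(2) show thesis by blast
qed

lemma H01_grad_bounded_imp_grad_weakly_tendsto_zero:
  assumes in_H01: "\<And>n. H01_grad (v n) (h n)" and bounded: "\<And>n. L2_norm M\<Omega> (\<lambda>x. (v n x, h n x)) \<le> B"
    and lim: "L2_tendsto M\<Omega> v (\<lambda>x. 0)"
  shows "L2_weakly_tendsto M\<Omega> h (\<lambda>x. 0)"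
  unfolding L2_weakly_tendsto_def
proof (intro allI impI, rule tendsto_if_subsubsequence_tendsto)
  fix k :: "'a \<Rightarrow> 'a" and r :: "nat \<Rightarrow> nat" assume k: "square_integrable M\<Omega> k" and r: "strict_mono r"
  obtain q v' h' where q: "strict_mono (q::nat\<Rightarrow>nat)" and v': "H01_grad v' h'"
    and strong: "L2_tendsto M\<Omega> (\<lambda>n. v (r (q n))) v'" and weak: "L2_weakly_tendsto M\<Omega> (\<lambda>n. h (r (q n))) h'"
    by (rule Rellich_Kondrachov[of "\<lambda>n. v (r n)" "\<lambda>n. h (r n)", OF in_H01 bounded]) (rule that)
  have "AE x in M\<Omega>. v' x = 0"
    by (rule L2_tendsto_unique[OF H01_grad_square_integrable(1)[OF in_H01]
        H01_grad_square_integrable(1)[OF v'] square_integrable_zero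
          strong L2_tendsto_subseq[OF L2_tendsto_subseq[OF lim r] q]])
  then have "H01_grad (\<lambda>x. 0) h'" by (intro H01_grad_cong_AE[OF v']) auto
  moreover have "H01_grad (\<lambda>x. 0) (\<lambda>x. 0)" using H01_grad_scaleR[OF v', of 0] by simp
  ultimately have "AE x in M\<Omega>. h' x = 0" by (intro is_weak_grad_unique H01_grad_imp_is_weak_grad)
  then have "(\<integral>x. h' x \<bullet> k x \<partial>M\<Omega>) = (\<integral>x. 0 \<bullet> k x \<partial>M\<Omega>)"
    using square_integrable_measurable[OF H01_grad_square_integrable(2)[OF v']]
      square_integrable_measurable[OF k]
    by (intro integral_cong_AE) auto
  with L2_weakly_tendstoD[OF weak k] q
  show "\<exists>q. strict_mono q \<and> (\<lambda>n. \<integral>x. h (r (q n)) x \<bullet> k x \<partial>M\<Omega>) \<longlonglongrightarrow> (\<integral>x. 0 \<bullet> k x \<partial>M\<Omega>)" by auto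
qed

end

section \<open>Functionals\<close>

lemma h1norm_nonneg: "0 \<le> h1norm \<Omega> u"
  by (auto simp: h1norm_def set_lebesgue_integral_def intro!: add_nonneg_nonneg integral_nonneg)

lemma Hm1_diff:
  assumes W: "Hm1 \<Omega> W" and w: "Hm1 \<Omega> w" shows "Hm1 \<Omega> (\<lambda>v. W v - w v)"
proof -
  obtain C D where "\<And>v. H01 \<Omega> v \<Longrightarrow> \<bar>W v\<bar> \<le> C * h1norm \<Omega> v" "\<And>v. H01 \<Omega> v \<Longrightarrow> \<bar>w v\<bar> \<le> D * h1norm \<Omega> v"
    using W w unfolding Hm1_def by blast
  then have "\<bar>W v - w v\<bar> \<le> (C + D) * h1norm \<Omega> v" if "H01 \<Omega> v" for v
    using that unfolding distrib_right by (smt (verit, best))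
  then have "\<exists>C. \<forall>v. H01 \<Omega> v \<longrightarrow> \<bar>W v - w v\<bar> \<le> C * h1norm \<Omega> v" by blast
  moreover have "W (\<lambda>x. u x + v x) - w (\<lambda>x. u x + v x) = W u - w u + (W v - w v)"
    if "H01 \<Omega> u" "H01 \<Omega> v" for u v
    using W w that unfolding Hm1_def by simp
  moreover have "W (\<lambda>x. c * u x) - w (\<lambda>x. c * u x) = c * (W u - w u)" if "H01 \<Omega> u" for u c
    using W w that unfolding Hm1_def by (simp add: right_diff_distrib)
  ultimately show ?thesis unfolding Hm1_def by blast
qed

lemma bdd_above_hm1norm:
  assumes "Hm1 \<Omega> w" shows "bdd_above {\<bar>w v\<bar> | v. H01 \<Omega> v \<and> h1norm \<Omega> v \<le> 1}"
proof -
  obtain C where C: "\<And>v. H01 \<Omega> v \<Longrightarrow> \<bar>w v\<bar> \<le> C * h1norm \<Omega> v" using assms unfolding Hm1_def by blast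
  have "C * h1norm \<Omega> v \<le> \<bar>C\<bar>" if "h1norm \<Omega> v \<le> 1" for v
    using mult_mono[OF abs_ge_self that abs_ge_zero h1norm_nonneg, of C] by simp
  with C show ?thesis by (intro bdd_aboveI[of _ "\<bar>C\<bar>"]) (auto intro: order_trans)
qed

context bounded_domain
begin

context
  fixes w :: "('a \<Rightarrow> real) \<Rightarrow> real"
  assumes w: "Hm1 \<Omega> w"
begin

lemma Hm1_add: "H01_grad u g \<Longrightarrow> H01_grad v h \<Longrightarrow> w (\<lambda>x. u x + v x) = w u + w v"
  using w H01_grad_imp_H01 unfolding Hm1_def by blast

lemma Hm1_scaleR: "H01_grad u g \<Longrightarrow> w (\<lambda>x. c * u x) = c * w u"
  using w H01_grad_imp_H01 unfolding Hm1_def by blast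

lemma Hm1_bounded:
  obtains C where "\<And>v h. H01_grad v h \<Longrightarrow> \<bar>w v\<bar> \<le> C * L2_norm M\<Omega> (\<lambda>x. (v x, h x))"
  using w H01_grad_imp_H01 H01_grad_h1norm unfolding Hm1_def by metis

lemma Hm1_le_hm1norm:
  assumes v: "H01_grad v h"
  shows "\<bar>w v\<bar> \<le> hm1norm \<Omega> w * L2_norm M\<Omega> (\<lambda>x. (v x, h x))"
proof (cases "L2_norm M\<Omega> (\<lambda>x. (v x, h x)) = 0")
  case True
  obtain C where "\<bar>w v\<bar> \<le> C * L2_norm M\<Omega> (\<lambda>x. (v x, h x))" by (rule Hm1_bounded) (use v in blast)
  with True show ?thesis by simp
next
  case False
  let ?c = "L2_norm M\<Omega> (\<lambda>x. (v x, h x))"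
  have norm_pos: "0 < ?c" using False L2_norm_nonneg[of M\<Omega> "\<lambda>x. (v x, h x)"] by linarith
  note scaled = H01_grad_scaleR[OF v, of "1 / ?c"]
  have "h1norm \<Omega> (\<lambda>x. (1 / ?c) * v x) = L2_norm M\<Omega> (\<lambda>x. (1 / ?c) *\<^sub>R (v x, h x))"
    using H01_grad_h1norm[OF scaled] by simp
  also have "\<dots> = 1" unfolding L2_norm_scaleR using norm_pos by simp
  finally have "\<bar>w (\<lambda>x. (1 / ?c) * v x)\<bar> \<in> {\<bar>w v\<bar> | v. H01 \<Omega> v \<and> h1norm \<Omega> v \<le> 1}"
    using H01_grad_imp_H01[OF scaled] by (intro CollectI exI[of _ "\<lambda>x. (1 / ?c) * v x"]) simp
  then have "\<bar>w (\<lambda>x. (1 / ?c) * v x)\<bar> \<le> hm1norm \<Omega> w"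
    unfolding hm1norm_def by (rule cSup_upper[OF _ bdd_above_hm1norm[OF w]])
  then show ?thesis using norm_pos unfolding Hm1_scaleR[OF v] by (simp add: abs_mult divide_le_eq)
qed

lemma Hm1_eq_if_graph_class_eq:
  assumes u: "H01_grad u g" and v: "H01_grad v h" and eq: "graph_class u g = graph_class v h"
  shows "w u = w v"
proof -
  note diff = H01_grad_diff[OF u v]
  have "graph_class (\<lambda>x. u x - v x) (\<lambda>x. g x - h x) = 0"
    using eq L2_class_diff[OF sets_domain H01_grad_square_integrable(3)[OF u]
        H01_grad_square_integrable(3)[OF v]]
    by simp
  then have "L2_norm M\<Omega> (\<lambda>x. (u x - v x, g x - h x)) = 0"
    using norm_L2_class[OF sets_domain H01_grad_square_integrable(3)[OF diff]] by simp
  then have "w (\<lambda>x. u x - v x) = 0" using Hm1_le_hm1norm[OF diff] by simp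
  then show ?thesis using Hm1_add[OF v diff] by simp
qed

definition graph_functional :: "('a, real \<times> 'a) ltwo \<Rightarrow> real" where
  "graph_functional l = w (SOME v. \<exists>h. H01_grad v h \<and> l = graph_class v h)"

lemma graph_functional_graph_class:
  assumes "H01_grad v h" shows "graph_functional (graph_class v h) = w v"
proof -
  define represents where "represents v'
      \<longleftrightarrow> (\<exists>h'. H01_grad v' h' \<and> graph_class v h = graph_class v' h')" for v'
  have "represents v" using assms by (auto simp: represents_def)
  then have "represents (SOME v'. represents v')" by (rule someI[of represents])
  then obtain h' where "H01_grad (SOME v'. represents v') h'"
    "graph_class v h = graph_class (SOME v'. represents v') h'"
    unfolding represents_def[of "SOME v'. represents v'"] by blast
  from Hm1_eq_if_graph_class_eq[OF assms this] show ?thesis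
    unfolding graph_functional_def represents_def by simp
qed

lemma bounded_functional_on_graph_functional: "bounded_functional_on (closure test_graph) graph_functional"
  unfolding bounded_functional_on_def
proof (intro conjI ballI allI)
  fix l m assume l: "l \<in> closure test_graph" and m: "m \<in> closure test_graph"
  obtain u g where u: "H01_grad u g" "l = graph_class u g" using closure_test_graphE[OF l] by metis
  obtain v h where v: "H01_grad v h" "m = graph_class v h" using closure_test_graphE[OF m] by metis
  note in_H01 = u(1) v(1) and l_m_eq = u(2) v(2)
  have "l + m = graph_class (\<lambda>x. u x + v x) (\<lambda>x. g x + h x)"
    unfolding l_m_eq
    using L2_class_add[OF sets_domain H01_grad_square_integrable(3)[OF in_H01(1)]
        H01_grad_square_integrable(3)[OF in_H01(2)]]
    by simp
  then show "graph_functional (l + m) = graph_functional l + graph_functional m"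
    using H01_grad_add[OF in_H01] Hm1_add[OF in_H01] in_H01
    by (simp add: l_m_eq graph_functional_graph_class)
next
  fix c l assume l: "l \<in> closure test_graph"
  obtain u g where in_H01: "H01_grad u g" and l: "l = graph_class u g" using closure_test_graphE[OF l]
    by metis
  have "c *\<^sub>R l = graph_class (\<lambda>x. c * u x) (\<lambda>x. c *\<^sub>R g x)"
    unfolding l using L2_class_scaleR[OF sets_domain H01_grad_square_integrable(3)[OF in_H01]] by simp
  then show "graph_functional (c *\<^sub>R l) = c * graph_functional l"
    using H01_grad_scaleR[OF in_H01] Hm1_scaleR[OF in_H01] in_H01
    by (simp add: l graph_functional_graph_class)
next
  obtain C where C: "\<And>v h. H01_grad v h \<Longrightarrow> \<bar>w v\<bar> \<le> C * L2_norm M\<Omega> (\<lambda>x. (v x, h x))"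
    by (rule Hm1_bounded) (rule that)
  have "\<bar>graph_functional l\<bar> \<le> C * norm l" if l: "l \<in> closure test_graph" for l
  proof -
    obtain u g where in_H01: "H01_grad u g" and l: "l = graph_class u g" using closure_test_graphE[OF l]
      by metis
    show ?thesis
      using C[OF in_H01] norm_L2_class[OF sets_domain H01_grad_square_integrable(3)[OF in_H01]]
      by (simp add: l graph_functional_graph_class[OF in_H01])
  qed
  then show "\<exists>C. \<forall>l\<in>closure test_graph. \<bar>graph_functional l\<bar> \<le> C * norm l" by blast
qed

lemma Hm1_representation:
  obtains F :: "'a \<Rightarrow> real \<times> 'a" where "square_integrable M\<Omega> F"
    "\<And>v h. H01_grad v h \<Longrightarrow> w v = (\<integral>x. F x \<bullet> (v x, h x) \<partial>M\<Omega>)"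
proof -
  obtain y where y: "y \<in> closure test_graph" "\<And>l. l \<in> closure test_graph \<Longrightarrow> graph_functional l = y \<bullet> l"
    by (rule Riesz_representation[OF closed_closure subspace_closure_test_graph
          bounded_functional_on_graph_functional]) (rule that)
  obtain z k where representer_in_H01: "H01_grad z k" and y_eq: "y = graph_class z k"
    using closure_test_graphE[OF y(1)] by metis
  show thesis
  proof (rule that[of "\<lambda>x. (z x, k x)"])
    show "w v = (\<integral>x. (z x, k x) \<bullet> (v x, h x) \<partial>M\<Omega>)" if v: "H01_grad v h" for v h
      using y(2)[of "graph_class v h"] v
        L2_class_inner[OF sets_domain H01_grad_square_integrable(3)[OF representer_in_H01]
          H01_grad_square_integrable(3)[OF v]]
      by (simp add: y_eq graph_functional_graph_class[OF v] H01_grad_def)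
  qed (rule H01_grad_square_integrable(3)[OF representer_in_H01])
qed

end

end

section \<open>Convex integrands\<close>

lemma strictly_convex_fun_above_tangent_le:
  fixes f :: "'a::real_inner \<Rightarrow> real"
  assumes f: "strictly_convex_fun f" and deriv: "(f has_derivative (\<lambda>h. v \<bullet> h)) (at x)"
  shows "f x + v \<bullet> (y - x) \<le> f y"
proof -
  have "difference_quotient f (y - x) n x \<le> f y - f x" for n
  proof (cases "n = 0 \<or> x = y")
    case True
    then show ?thesis by (auto simp: difference_quotient_def)
  next
    case False
    define t where "t = 1 / real (Suc n)"
    have t: "0 < t" "t < 1" using False by (auto simp: t_def)
    have "f ((1 - t) *\<^sub>R x + t *\<^sub>R y) < (1 - t) * f x + t * f y"
      using f False t unfolding strictly_convex_fun_def by blast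
    moreover have "(1 - t) *\<^sub>R x + t *\<^sub>R y = x + t *\<^sub>R (y - x)"
      by (simp add: scaleR_diff_left scaleR_diff_right)
    ultimately have "f (x + t *\<^sub>R (y - x)) - f x \<le> t * (f y - f x)" by (simp add: algebra_simps)
    then have "real (Suc n) * (f (x + t *\<^sub>R (y - x)) - f x) \<le> real (Suc n) * (t * (f y - f x))"
      by (rule mult_left_mono) simp
    also have "\<dots> = f y - f x" by (simp add: t_def)
    finally show ?thesis by (simp add: difference_quotient_def t_def)
  qed
  then have "v \<bullet> (y - x) \<le> f y - f x"
    by (intro LIMSEQ_le_const2[OF has_derivative_imp_difference_quotient_tendsto[OF deriv]]) auto
  then show ?thesis by simp
qed

lemma strictly_convex_fun_above_tangent:
  fixes f :: "'a::real_inner \<Rightarrow> real"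
  assumes f: "strictly_convex_fun f" and deriv: "(f has_derivative (\<lambda>h. v \<bullet> h)) (at x)" and "x \<noteq> y"
  shows "f x + v \<bullet> (y - x) < f y"
proof -
  have "f x + v \<bullet> (midpoint x y - x) \<le> f (midpoint x y)"
    by (rule strictly_convex_fun_above_tangent_le[OF f deriv])
  also have "\<dots> < (f x + f y) / 2"
    using f[unfolded strictly_convex_fun_def, rule_format, of x y "1 / 2"] \<open>x \<noteq> y\<close>
    by (simp add: midpoint_def scaleR_add_right inverse_eq_divide)
  also have "midpoint x y - x = (1 / 2) *\<^sub>R (x + y) - (1 / 2) *\<^sub>R (x + x)"
    by (simp add: midpoint_def inverse_eq_divide del: scaleR_add_right)
  also have "\<dots> = (1 / 2) *\<^sub>R (y - x)" by (simp flip: scaleR_diff_right del: scaleR_half_double)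
  finally show ?thesis by simp
qed

lemma strictly_convex_gradient_strictly_monotone:
  fixes f :: "'a::real_inner \<Rightarrow> real"
  assumes f: "strictly_convex_fun f" and "x \<noteq> y"
    and deriv: "(f has_derivative (\<lambda>h. v \<bullet> h)) (at x)" "(f has_derivative (\<lambda>h. w \<bullet> h)) (at y)"
  shows "0 < (v - w) \<bullet> (x - y)"
  using strictly_convex_fun_above_tangent[OF f deriv(1) \<open>x \<noteq> y\<close>]
    strictly_convex_fun_above_tangent[OF f deriv(2) \<open>x \<noteq> y\<close>[symmetric]]
  by (simp add: inner_diff_left inner_diff_right)

text \<open>The constant comes from testing the tangent inequality at \<open>x + v / (4 a)\<close>.\<close>

lemma subgradient_norm_le_if_quadratic_growth:
  fixes f :: "'a::real_inner \<Rightarrow> real"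
  assumes tangent: "\<And>y. f x + v \<bullet> (y - x) \<le> f y" and "0 < a" "0 \<le> f x"
    and growth: "\<And>y. f y \<le> a * (norm y)\<^sup>2"
  shows "norm v \<le> 4 * a * norm x"
proof -
  let ?d = "(1 / (4 * a)) *\<^sub>R v"
  have "(norm v)\<^sup>2 / (4 * a) = v \<bullet> ((x + ?d) - x)" by (simp add: power2_norm_eq_inner)
  also have "\<dots> \<le> a * (norm (x + ?d))\<^sup>2" using tangent[of "x + ?d"] growth[of "x + ?d"] \<open>0 \<le> f x\<close> by linarith
  also have "\<dots> \<le> a * (2 * (norm x)\<^sup>2 + 2 * (norm ?d)\<^sup>2)"
    using \<open>0 < a\<close> by (intro mult_left_mono power2_norm_add_le) auto
  also have "\<dots> = 2 * a * (norm x)\<^sup>2 + (norm v)\<^sup>2 / (8 * a)"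
    using \<open>0 < a\<close> by (simp add: power_divide field_simps power2_eq_square)
  finally have "(norm v)\<^sup>2 \<le> (4 * a * norm x)\<^sup>2" using \<open>0 < a\<close> by (simp add: field_simps power2_eq_square)
  then show ?thesis by (rule power2_le_imp_le) (use \<open>0 < a\<close> in simp)
qed

lemma monotone_gap_along_ray:
  fixes A :: "'a::real_inner \<Rightarrow> 'a"
  assumes mono: "\<And>\<xi> \<eta>. 0 \<le> (A \<xi> - A \<eta>) \<bullet> (\<xi> - \<eta>)" and "0 < e" "e \<le> l"
  shows "e * ((A (\<eta> + e *\<^sub>R d) - A \<eta>) \<bullet> d) \<le> (A (\<eta> + l *\<^sub>R d) - A \<eta>) \<bullet> (l *\<^sub>R d)"
proof -
  have ray: "0 \<le> (l - e) * ((A (\<eta> + l *\<^sub>R d) - A (\<eta> + e *\<^sub>R d)) \<bullet> d)"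
    using mono[of "\<eta> + l *\<^sub>R d" "\<eta> + e *\<^sub>R d"] by (simp flip: scaleR_diff_left)
  have "(A (\<eta> + e *\<^sub>R d) - A \<eta>) \<bullet> d \<le> (A (\<eta> + l *\<^sub>R d) - A \<eta>) \<bullet> d"
  proof (cases "l = e")
    case False
    then show ?thesis using ray \<open>e \<le> l\<close> by (simp add: zero_le_mult_iff inner_diff_left)
  qed simp
  moreover have "0 \<le> (A (\<eta> + e *\<^sub>R d) - A \<eta>) \<bullet> d"
    using mono[of "\<eta> + e *\<^sub>R d" \<eta>] \<open>0 < e\<close> by (simp add: zero_le_mult_iff)
  ultimately have "e * ((A (\<eta> + e *\<^sub>R d) - A \<eta>) \<bullet> d) \<le> l * ((A (\<eta> + l *\<^sub>R d) - A \<eta>) \<bullet> d)"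
    using assms(2,3) by (intro mult_mono) auto
  then show ?thesis by simp
qed

lemma strictly_monotone_uniform_gap:
  fixes A :: "'p::topological_space \<Rightarrow> 'a::euclidean_space \<Rightarrow> 'a"
  assumes cont: "continuous_on UNIV (\<lambda>(p, \<xi>). A p \<xi>)"
    and mono: "\<And>p \<xi> \<eta>. \<xi> \<noteq> \<eta> \<Longrightarrow> 0 < (A p \<xi> - A p \<eta>) \<bullet> (\<xi> - \<eta>)"
    and K: "compact K" "K \<noteq> {}" and "0 < e"
  obtains m where "0 < m" "\<And>p d. p \<in> K \<Longrightarrow> norm d = 1 \<Longrightarrow> m \<le> (A p (\<eta> + e *\<^sub>R d) - A p \<eta>) \<bullet> d"
proof -
  let ?S = "K \<times> sphere (0::'a) 1" and ?\<phi> = "\<lambda>(p, d). (A p (\<eta> + e *\<^sub>R d) - A p \<eta>) \<bullet> d"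
  have "continuous_on ?S (\<lambda>z. A (fst z) (\<eta> + t *\<^sub>R snd z))" for t
  proof -
    have "continuous_on ?S (\<lambda>z. (fst z, \<eta> + t *\<^sub>R snd z))" by (intro continuous_intros)
    from continuous_on_compose2[OF cont this] show ?thesis by simp
  qed
  from this[of e] this[of 0] have "continuous_on ?S ?\<phi>"
    unfolding case_prod_unfold by (intro continuous_intros) simp_all
  moreover have "compact ?S" "?S \<noteq> {}" using K by (simp_all add: compact_Times)
  ultimately obtain z where z: "z \<in> ?S" "\<And>y. y \<in> ?S \<Longrightarrow> ?\<phi> z \<le> ?\<phi> y"
    using continuous_attains_inf[of ?S ?\<phi>] by blast
  have "norm (snd z) = 1" using z(1) by auto
  then have "snd z \<noteq> 0" by auto
  then have "0 < ?\<phi> z"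
    using mono[of "\<eta> + e *\<^sub>R snd z" \<eta> "fst z"] \<open>0 < e\<close> by (simp add: zero_less_mult_iff case_prod_unfold)
  moreover have "?\<phi> z \<le> (A p (\<eta> + e *\<^sub>R d) - A p \<eta>) \<bullet> d" if "p \<in> K" "norm d = 1" for p d
    using z(2)[of "(p, d)"] that by simp
  ultimately show thesis by (rule that)
qed

lemma strictly_monotone_gap_tendsto_zero_imp_tendsto:
  fixes A :: "'p::heine_borel \<Rightarrow> 'a::euclidean_space \<Rightarrow> 'a"
  assumes cont: "continuous_on UNIV (\<lambda>(p, \<xi>). A p \<xi>)"
    and mono: "\<And>p \<xi> \<eta>. \<xi> \<noteq> \<eta> \<Longrightarrow> 0 < (A p \<xi> - A p \<eta>) \<bullet> (\<xi> - \<eta>)"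
    and p: "p \<longlonglongrightarrow> p0" and gap: "(\<lambda>n. (A (p n) (\<xi> n) - A (p n) \<eta>) \<bullet> (\<xi> n - \<eta>)) \<longlonglongrightarrow> 0"
  shows "\<xi> \<longlonglongrightarrow> \<eta>"
proof (rule tendstoI)
  fix e :: real assume "0 < e"
  have mono_le: "0 \<le> (A q \<xi> - A q \<zeta>) \<bullet> (\<xi> - \<zeta>)" for q \<xi> \<zeta> using mono[of \<xi> \<zeta> q] by (cases "\<xi> = \<zeta>") auto
  obtain m where "0 < m" and m: "\<And>q d. q \<in> insert p0 (range p) \<Longrightarrow> norm d = 1 \<Longrightarrow> m
      \<le> (A q (\<eta> + e *\<^sub>R d) - A q \<eta>) \<bullet> d"
    by (rule strictly_monotone_uniform_gap[OF cont mono compact_sequence_with_limit[OF p] _ \<open>0 < e\<close>,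
        where \<eta>=\<eta>])
      (auto intro: that)
  have "\<forall>\<^sub>F n in sequentially. (A (p n) (\<xi> n) - A (p n) \<eta>) \<bullet> (\<xi> n - \<eta>) < e * m"
    using \<open>0 < e\<close> \<open>0 < m\<close> by (intro order_tendstoD(2)[OF gap]) simp
  then show "\<forall>\<^sub>F n in sequentially. dist (\<xi> n) \<eta> < e"
  proof eventually_elim
    case (elim n)
    show ?case
    proof (rule ccontr)
      assume "\<not> dist (\<xi> n) \<eta> < e"
      then have far: "e \<le> norm (\<xi> n - \<eta>)" by (simp add: dist_norm)
      define d where "d = sgn (\<xi> n - \<eta>)"
      have "\<xi> n \<noteq> \<eta>" using far \<open>0 < e\<close> by auto
      then have "norm d = 1" and ray: "norm (\<xi> n - \<eta>) *\<^sub>R d = \<xi> n - \<eta>"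
        by (simp_all add: d_def norm_sgn sgn_div_norm)
      have "e * m \<le> e * ((A (p n) (\<eta> + e *\<^sub>R d) - A (p n) \<eta>) \<bullet> d)"
        using m[OF _ \<open>norm d = 1\<close>, of "p n"] \<open>0 < e\<close> by (intro mult_left_mono) auto
      also have "\<dots> \<le> (A (p n) (\<xi> n) - A (p n) \<eta>) \<bullet> (\<xi> n - \<eta>)"
        using monotone_gap_along_ray[of "A (p n)", OF mono_le \<open>0 < e\<close> far, of \<eta> d] ray by simp
      finally show False using elim by linarith
    qed
  qed
qed

lemma Caratheodory_measurable:
  fixes f :: "'m \<Rightarrow> 'p::{metric_space,second_countable_topology} \<Rightarrow> 'b::{metric_space,second_countable_topology}"
  assumes f: "\<And>p. (\<lambda>x. f x p) \<in> borel_measurable M"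
    and cont: "\<And>x. x \<in> space M \<Longrightarrow> continuous_on UNIV (f x)" and g: "g \<in> borel_measurable M"
  shows "(\<lambda>x. f x (g x)) \<in> borel_measurable M"
proof -
  obtain F where F: "\<And>i. simple_function M (F i)" "\<And>x. x \<in> space M \<Longrightarrow> (\<lambda>i. F i x) \<longlonglongrightarrow> g x"
    using borel_measurable_implies_sequence_metric[OF g, of undefined] by blast
  have "(\<lambda>x. f x (F i x)) \<in> borel_measurable M" for i
  proof (rule measurable_compose_countable'[OF f])
    show "countable (F i ` space M)" using simple_functionD(1)[OF F(1)] by (rule countable_finite)
    show "F i \<in> M \<rightarrow>\<^sub>M count_space (F i ` space M)"
      unfolding measurable_count_space_eq2[OF simple_functionD(1)[OF F(1)]]
      using simple_functionD(2)[OF F(1)] by auto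
  qed
  then show ?thesis
    by (rule borel_measurable_LIMSEQ_metric) (rule continuous_on_tendsto_compose[OF cont F(2)], auto)
qed

lemma Caratheodory_gradient_measurable:
  fixes f :: "'m \<Rightarrow> 'p::euclidean_space \<Rightarrow> real"
  assumes f: "\<And>p. (\<lambda>x. f x p) \<in> borel_measurable M"
    and deriv: "\<And>x p. x \<in> space M \<Longrightarrow> (f x has_derivative (\<lambda>h. f' x p \<bullet> h)) (at p)"
    and g [measurable]: "g \<in> borel_measurable M"
  shows "(\<lambda>x. f' x (g x)) \<in> borel_measurable M"
proof (rule borel_measurable_euclidean_space[THEN iffD2], rule ballI)
  fix b :: 'p
  have cont: "continuous_on UNIV (f x)" if "x \<in> space M" for x
    using deriv[OF that] by (meson continuous_at_imp_continuous_on has_derivative_continuous)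
  have shifted: "(\<lambda>x. f x (g x + c)) \<in> borel_measurable M" for c
    by (rule Caratheodory_measurable[OF f cont]) measurable
  have "(\<lambda>x. difference_quotient (f x) b n (g x)) \<in> borel_measurable M" for n
    using shifted[of "(1 / real (Suc n)) *\<^sub>R b"] shifted[of 0] by (simp add: difference_quotient_def)
  then show "(\<lambda>x. f' x (g x) \<bullet> b) \<in> borel_measurable M"
    by (rule borel_measurable_LIMSEQ_metric) (rule has_derivative_imp_difference_quotient_tendsto[OF deriv])
qed

locale quasilinear_integrand = bounded_domain \<Omega> for \<Omega> :: "'a::euclidean_space set" +
  fixes j js :: "'a \<Rightarrow> real \<Rightarrow> 'a \<Rightarrow> real" and jxi :: "'a \<Rightarrow> real \<Rightarrow> 'a \<Rightarrow> 'a"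
    and \<alpha> \<beta> :: "real \<Rightarrow> real" and \<alpha>0 R :: real
  assumes j_measurable: "\<And>s \<xi>. set_borel_measurable lebesgue \<Omega> (\<lambda>x. j x s \<xi>)"
    and j_has_derivative: "\<And>x s \<xi>. x \<in> \<Omega> \<Longrightarrow>
        ((\<lambda>(s', \<xi>'). j x s' \<xi>') has_derivative (\<lambda>(ds, d\<xi>). js x s \<xi> * ds + jxi x s \<xi> \<bullet> d\<xi>)) (at (s, \<xi>))"
    and jxi_continuous: "\<And>x. x \<in> \<Omega> \<Longrightarrow> continuous_on UNIV (\<lambda>(s, \<xi>). jxi x s \<xi>)"
    and strictly_convex: "\<And>x s. x \<in> \<Omega> \<Longrightarrow> strictly_convex_fun (j x s)"
    and \<alpha>0_pos: "\<alpha>0 > 0"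
    and \<alpha>_pos: "\<And>t. t \<ge> 0 \<Longrightarrow> \<alpha> t > 0" and \<alpha>_mono: "mono_on {0..} \<alpha>"
    and quadratic_growth: "\<And>x s \<xi>. x \<in> \<Omega> \<Longrightarrow>
        \<alpha>0 * (norm \<xi>)\<^sup>2 \<le> j x s \<xi> \<and> j x s \<xi> \<le> \<alpha> \<bar>s\<bar> * (norm \<xi>)\<^sup>2"
    and \<beta>_pos: "\<And>t. t \<ge> 0 \<Longrightarrow> \<beta> t > 0" and \<beta>_mono: "mono_on {0..} \<beta>"
    and js_growth: "\<And>x s \<xi>. x \<in> \<Omega> \<Longrightarrow> \<bar>js x s \<xi>\<bar> \<le> \<beta> \<bar>s\<bar> * (norm \<xi>)\<^sup>2"
    and R_pos: "R > 0"
    and js_sign: "\<And>x s \<xi>. x \<in> \<Omega> \<Longrightarrow> \<bar>s\<bar> \<ge> R \<Longrightarrow> js x s \<xi> * s \<ge> 0"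
begin

lemma j_has_derivative_Pair:
  "x \<in> \<Omega> \<Longrightarrow> ((\<lambda>p. j x (fst p) (snd p)) has_derivative
    (\<lambda>h. (js x (fst p) (snd p), jxi x (fst p) (snd p)) \<bullet> h)) (at p)"
  using j_has_derivative[of x "fst p" "snd p"] by (simp add: case_prod_unfold inner_prod_def)

lemma j_has_derivative_xi:
  assumes "x \<in> \<Omega>" shows "(j x s has_derivative (\<lambda>h. jxi x s \<xi> \<bullet> h)) (at \<xi>)"
proof -
  have "((\<lambda>\<xi>. (s, \<xi>)) has_derivative (\<lambda>h. (0, h))) (at \<xi>)" by (auto intro!: derivative_eq_intros)
  from has_derivative_compose[OF this j_has_derivative_Pair[OF assms, of "(s, \<xi>)"]] show ?thesis by simp
qed

lemma jxi_tangent: "x \<in> \<Omega> \<Longrightarrow> j x s \<xi> + jxi x s \<xi> \<bullet> (\<eta> - \<xi>) \<le> j x s \<eta>"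
  by (rule strictly_convex_fun_above_tangent_le[OF strictly_convex j_has_derivative_xi])

lemma jxi_strictly_monotone: "x \<in> \<Omega> \<Longrightarrow> \<xi> \<noteq> \<eta> \<Longrightarrow> 0 < (jxi x s \<xi> - jxi x s \<eta>) \<bullet> (\<xi> - \<eta>)"
  by (rule strictly_convex_gradient_strictly_monotone[OF strictly_convex _ j_has_derivative_xi
      j_has_derivative_xi])

lemma jxi_monotone: "x \<in> \<Omega> \<Longrightarrow> 0 \<le> (jxi x s \<xi> - jxi x s \<eta>) \<bullet> (\<xi> - \<eta>)"
  using jxi_strictly_monotone[of x \<xi> \<eta> s] by (cases "\<xi> = \<eta>") auto

lemma jxi_coercive:
  assumes x: "x \<in> \<Omega>" shows "\<alpha>0 * (norm \<xi>)\<^sup>2 \<le> jxi x s \<xi> \<bullet> \<xi>"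
  using jxi_tangent[OF x, of s \<xi> 0] quadratic_growth[OF x, of \<xi> s] quadratic_growth[OF x, of 0 s] by simp

lemma jxi_growth:
  assumes x: "x \<in> \<Omega>" and "\<bar>s\<bar> \<le> k" shows "norm (jxi x s \<xi>) \<le> 4 * \<alpha> k * norm \<xi>"
proof -
  have "0 \<le> \<alpha>0 * (norm \<xi>)\<^sup>2" using \<alpha>0_pos by simp
  then have "0 \<le> j x s \<xi>" using quadratic_growth[OF x, of \<xi> s] by linarith
  then have "norm (jxi x s \<xi>) \<le> 4 * \<alpha> \<bar>s\<bar> * norm \<xi>"
    using quadratic_growth[OF x] \<alpha>_pos[of "\<bar>s\<bar>"]
    by (intro subgradient_norm_le_if_quadratic_growth[of "j x s", OF jxi_tangent[OF x]]) auto
  also have "\<dots> \<le> 4 * \<alpha> k * norm \<xi>" using \<open>\<bar>s\<bar> \<le> k\<close> by (auto intro!: mult_right_mono mono_onD[OF \<alpha>_mono])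
  finally show ?thesis .
qed

lemma jxi_zero: "x \<in> \<Omega> \<Longrightarrow> jxi x s 0 = 0"
  using jxi_growth[OF _ order_refl, of x s 0] by simp

lemma js_bound:
  assumes x: "x \<in> \<Omega>" and "\<bar>s\<bar> \<le> k" shows "\<bar>js x s \<xi>\<bar> \<le> \<beta> k * (norm \<xi>)\<^sup>2"
  using js_growth[OF x] by (rule order_trans)
    (use \<open>\<bar>s\<bar> \<le> k\<close> in \<open>auto intro!: mult_right_mono mono_onD[OF \<beta>_mono]\<close>)

lemma jxi_monotone_gap_imp_tendsto:
  assumes x: "x \<in> \<Omega>" and "s \<longlonglongrightarrow> s0" and "(\<lambda>n. (jxi x (s n) (\<xi> n) - jxi x (s n) \<eta>) \<bullet> (\<xi> n - \<eta>)) \<longlonglongrightarrow> 0"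
  shows "\<xi> \<longlonglongrightarrow> \<eta>"
  using strictly_monotone_gap_tendsto_zero_imp_tendsto[OF jxi_continuous[OF x] jxi_strictly_monotone[OF x]
      assms(2,3)] .

lemma derivatives_measurable:
  assumes "u \<in> borel_measurable M\<Omega>" "g \<in> borel_measurable M\<Omega>"
  shows js_measurable: "(\<lambda>x. js x (u x) (g x)) \<in> borel_measurable M\<Omega>"
    and jxi_measurable: "(\<lambda>x. jxi x (u x) (g x)) \<in> borel_measurable M\<Omega>"
proof -
  have pair: "(\<lambda>x. (js x (u x) (g x), jxi x (u x) (g x))) \<in> borel_measurable M\<Omega>"
    using Caratheodory_gradient_measurable[of "\<lambda>x p. j x (fst p) (snd p)" M\<Omega>
        "\<lambda>x p. (js x (fst p) (snd p), jxi x (fst p) (snd p))" "\<lambda>x. (u x, g x)"]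
      j_measurable[unfolded set_borel_measurable_domain] j_has_derivative_Pair
        borel_measurable_Pair[OF assms]
    by simp
  show "(\<lambda>x. js x (u x) (g x)) \<in> borel_measurable M\<Omega>"
    using measurable_fst'[OF pair[folded borel_prod]] by simp
  show "(\<lambda>x. jxi x (u x) (g x)) \<in> borel_measurable M\<Omega>"
    using measurable_snd'[OF pair[folded borel_prod]] by simp
qed

end

section \<open>Approximate solutions\<close>

abbreviation below :: "real \<Rightarrow> real \<Rightarrow> real" where "below k s \<equiv> indicator {-k..k} s"
abbreviation above :: "real \<Rightarrow> real \<Rightarrow> real" where "above k s \<equiv> indicator (- {-k..k}) s"

lemma abs_indicator_le_1: "\<bar>indicator A s :: real\<bar> \<le> 1"
  by (simp add: indicator_def)

context
  fixes M :: "'m measure" and f :: "'m \<Rightarrow> 'b::euclidean_space" and u :: "'m \<Rightarrow> real" and A :: "real set"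
  assumes f: "square_integrable M f" and u [measurable]: "u \<in> borel_measurable M"
    and A [measurable]: "A \<in> sets borel"
begin

lemma square_integrable_indicator_scaleR: "square_integrable M (\<lambda>x. indicator A (u x) *\<^sub>R f x)"
  by (rule square_integrable_bounded_scaleR[OF f _ abs_indicator_le_1]) measurable

lemma L2_norm_indicator_scaleR_le: "L2_norm M (\<lambda>x. indicator A (u x) *\<^sub>R f x) \<le> L2_norm M f"
  using L2_norm_bounded_scaleR_le[where c="\<lambda>x. indicator A (u x)", OF f _ abs_indicator_le_1] by simp

end

lemma norm_Pair_mono:
  fixes a c :: "'b::real_normed_vector" and b d :: "'c::real_normed_vector"
  assumes "norm a \<le> norm c" "norm b \<le> norm d" shows "norm (a, b) \<le> norm (c, d)"
  unfolding norm_Pair using assms by (intro real_sqrt_le_mono add_mono power_mono) auto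

text \<open>The test function of the tail estimate rises with slope \<open>1\<close> from the level \<open>k\<close> to the level \<open>M\<close> and then
  returns to zero with slope \<open>-1\<close>, so that it is admissible for the equation; the descending part disappears
  for \<open>M \<rightarrow> \<infinity>\<close> because the energy is integrable.\<close>

definition tail_test :: "real \<Rightarrow> real \<Rightarrow> real \<Rightarrow> real" where
  "tail_test k M s = 2 * truncate M s - truncate k s - truncate (2 * M - k) s"

definition tail_slope :: "real \<Rightarrow> real \<Rightarrow> real \<Rightarrow> real" where
  "tail_slope k M s = 2 * below M s - below k s - below (2 * M - k) s"

lemma tail_test_bounds:
  assumes "0 \<le> k" "k \<le> M"
  shows abs_tail_test_le_abs: "\<bar>tail_test k M s\<bar> \<le> \<bar>s\<bar>" and abs_tail_test_le: "\<bar>tail_test k M s\<bar> \<le> M"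
    and tail_test_eq_0: "\<bar>s\<bar> \<le> k \<or> 2 * M - k \<le> \<bar>s\<bar> \<Longrightarrow> tail_test k M s = 0"
  using assms by (auto simp: tail_test_def truncate_def max_def min_def)

lemma tail_test_same_sign:
  assumes "0 \<le> k" "k \<le> M" shows "0 \<le> s * tail_test k M s"
proof (cases "0 \<le> s")
  case True
  then have "0 \<le> tail_test k M s" using assms by (auto simp: tail_test_def truncate_def max_def min_def)
  with True show ?thesis by simp
next
  case False
  then have "tail_test k M s \<le> 0" using assms by (auto simp: tail_test_def truncate_def max_def min_def)
  with False show ?thesis by (simp add: mult_nonpos_nonpos)
qed

lemma tail_slope_bounds:
  assumes "0 \<le> k" "k \<le> M"
  shows abs_tail_slope_le_1: "\<bar>tail_slope k M s\<bar> \<le> 1" and tail_slope_eq_0: "\<bar>s\<bar> \<le> k \<Longrightarrow> tail_slope k M s = 0"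
  using assms by (auto simp: tail_slope_def indicator_def abs_le_iff)

lemma tail_slope_eventually_above:
  assumes "0 \<le> k" shows "\<forall>\<^sub>F m in sequentially. tail_slope k (k + real m) s = above k s"
proof -
  obtain N :: nat where N: "\<bar>s\<bar> < real N" using reals_Archimedean2 by blast
  show ?thesis using eventually_ge_at_top[of N]
  proof eventually_elim
    case (elim m)
    then have "\<bar>s\<bar> < real m" using N by linarith
    then show ?case using assms by (auto simp: tail_slope_def indicator_def)
  qed
qed

lemma borel_measurable_tail_slope [measurable]: "tail_slope k M \<in> borel_measurable borel"
  unfolding tail_slope_def[abs_def] by measurable

lemma (in bounded_domain) H01_grad_tail_test:
  assumes in_H01: "H01_grad v h" and k: "0 \<le> k" "k \<le> M"
  shows "H01_grad (\<lambda>x. tail_test k M (v x)) (\<lambda>x. tail_slope k M (v x) *\<^sub>R h x)"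
proof -
  have "H01_grad (\<lambda>x. 2 * truncate M (v x) - truncate k (v x) - truncate (2 * M - k) (v x))
      (\<lambda>x. 2 *\<^sub>R (below M (v x) *\<^sub>R h x) - below k (v x) *\<^sub>R h x - below (2 * M - k) (v x) *\<^sub>R h x)"
    using k by (intro H01_grad_diff H01_grad_scaleR H01_grad_truncate[OF in_H01]) auto
  then show ?thesis by (simp only: tail_test_def tail_slope_def scaleR_diff_left scaleR_scaleR)
qed

lemma (in quasilinear_integrand) js_mult_nonneg:
  assumes x: "x \<in> \<Omega>" and "t \<noteq> 0 \<Longrightarrow> R \<le> \<bar>s\<bar>" "0 \<le> s * t"
  shows "0 \<le> js x s \<xi> * t"
proof (cases "t = 0")
  case False
  then have above_R: "R \<le> \<bar>s\<bar>" using assms(2) by blast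
  then show ?thesis using js_sign[OF x above_R, of \<xi>] R_pos \<open>0 \<le> s * t\<close>
    by (cases "0 < s") (auto simp: zero_le_mult_iff)
qed simp

definition (in quasilinear_integrand) approximate_weak_solution ::
    "('a \<Rightarrow> real \<times> 'a) \<Rightarrow> real \<Rightarrow> ('a \<Rightarrow> real) \<Rightarrow> ('a \<Rightarrow> 'a) \<Rightarrow> bool" where
  "approximate_weak_solution F \<epsilon> u g \<longleftrightarrow>
     (\<forall>v h C. H01_grad v h \<longrightarrow> (\<forall>x. \<bar>v x\<bar> \<le> C) \<longrightarrow> (\<forall>x. v x \<noteq> 0 \<longrightarrow> \<bar>u x\<bar> \<le> C) \<longrightarrow>
       \<bar>(\<integral>x. js x (u x) (g x) * v x \<partial>M\<Omega>) + (\<integral>x. jxi x (u x) (g x) \<bullet> h x \<partial>M\<Omega>)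
         - (\<integral>x. F x \<bullet> (v x, h x) \<partial>M\<Omega>)\<bar> \<le> \<epsilon> * L2_norm M\<Omega> (\<lambda>x. (v x, h x)))"

locale approximate_solutions = quasilinear_integrand \<Omega> j js jxi \<alpha> \<beta> \<alpha>0 R
  for \<Omega> :: "'a::euclidean_space set" and j js jxi \<alpha> \<beta> \<alpha>0 R +
  fixes u :: "nat \<Rightarrow> 'a \<Rightarrow> real" and g :: "nat \<Rightarrow> 'a \<Rightarrow> 'a" and u0 :: "'a \<Rightarrow> real" and g0 :: "'a \<Rightarrow> 'a"
    and F :: "'a \<Rightarrow> real \<times> 'a" and \<delta> :: "nat \<Rightarrow> real" and B :: real
  assumes H01_u: "\<And>n. H01_grad (u n) (g n)" and H01_u0: "H01_grad u0 g0"
    and bound: "\<And>n. L2_norm M\<Omega> (\<lambda>x. (u n x, g n x)) \<le> B"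
    and energy_integrable: "\<And>n. integrable M\<Omega> (\<lambda>x. jxi x (u n x) (g n x) \<bullet> g n x)"
    and g_weakly_tendsto: "L2_weakly_tendsto M\<Omega> g g0"
    and u_AE_tendsto: "AE x in M\<Omega>. (\<lambda>n. u n x) \<longlonglongrightarrow> u0 x"
    and F_square_integrable: "square_integrable M\<Omega> F"
    and approximate_weak_solution: "\<And>n. approximate_weak_solution F (\<delta> n) (u n) (g n)"
    and \<delta>_nonneg: "\<And>n. 0 \<le> \<delta> n" and \<delta>_tendsto: "\<delta> \<longlonglongrightarrow> 0"
begin

abbreviation flux :: "nat \<Rightarrow> 'a \<Rightarrow> 'a" where "flux n x \<equiv> jxi x (u n x) (g n x)"
abbreviation energy :: "nat \<Rightarrow> 'a \<Rightarrow> real" where "energy n x \<equiv> flux n x \<bullet> g n x"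

lemmas u_square_integrable = H01_grad_square_integrable(1)[OF H01_u]
  and g_square_integrable = H01_grad_square_integrable(2)[OF H01_u]
  and u0_square_integrable = H01_grad_square_integrable(1)[OF H01_u0]
  and g0_square_integrable = H01_grad_square_integrable(2)[OF H01_u0]

lemma measurable_solutions [measurable]:
  shows u_measurable: "u n \<in> borel_measurable M\<Omega>" and g_measurable: "g n \<in> borel_measurable M\<Omega>"
    and u0_measurable: "u0 \<in> borel_measurable M\<Omega>" and g0_measurable: "g0 \<in> borel_measurable M\<Omega>"
    and F_measurable: "F \<in> borel_measurable M\<Omega>"
  by (intro square_integrable_measurable u_square_integrable g_square_integrable u0_square_integrable
      g0_square_integrable F_square_integrable)+

lemma flux_measurable [measurable]: "flux n \<in> borel_measurable M\<Omega>"
  by (intro jxi_measurable u_measurable g_measurable)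

lemma g_bound: "L2_norm M\<Omega> (g n) \<le> B"
  using L2_norm_snd_le_Pair[OF u_square_integrable g_square_integrable] bound by (rule order_trans)

lemma B_nonneg: "0 \<le> B"
  using L2_norm_nonneg bound by (rule order_trans)

lemma energy_nonneg: "x \<in> \<Omega> \<Longrightarrow> 0 \<le> energy n x"
  by (rule order_trans[OF _ jxi_coercive]) (use \<alpha>0_pos in auto)

lemma energy_indicator_integrable:
  assumes [measurable]: "A \<in> sets borel"
  shows "integrable M\<Omega> (\<lambda>x. indicator A (u n x) * energy n x)"
  by (rule Bochner_Integration.integrable_bound[OF energy_integrable[of n]]) (auto simp: indicator_def)

lemma equation_le:
  assumes "H01_grad v h" "\<And>x. \<bar>v x\<bar> \<le> C" "\<And>x. v x \<noteq> 0 \<Longrightarrow> \<bar>u n x\<bar> \<le> C"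
  shows "(\<integral>x. js x (u n x) (g n x) * v x \<partial>M\<Omega>) + (\<integral>x. flux n x \<bullet> h x \<partial>M\<Omega>)
    \<le> (\<integral>x. F x \<bullet> (v x, h x) \<partial>M\<Omega>) + \<delta> n * L2_norm M\<Omega> (\<lambda>x. (v x, h x))"
  using approximate_weak_solution[of n, unfolded approximate_weak_solution_def, rule_format, OF assms]
  by linarith

lemma functional_le_tail_L2_norm:
  assumes q: "square_integrable M\<Omega> q" and zero: "\<And>x. \<bar>u n x\<bar> \<le> k \<Longrightarrow> q x = 0"
  shows "(\<integral>x. F x \<bullet> q x \<partial>M\<Omega>) \<le> L2_norm M\<Omega> (\<lambda>x. above k (u n x) *\<^sub>R F x) * L2_norm M\<Omega> q"
proof -
  have "(\<integral>x. F x \<bullet> q x \<partial>M\<Omega>) = (\<integral>x. (above k (u n x) *\<^sub>R F x) \<bullet> q x \<partial>M\<Omega>)"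
    using zero by (intro Bochner_Integration.integral_cong refl) (auto simp: indicator_def abs_le_iff)
  also have "\<dots> \<le> L2_norm M\<Omega> (\<lambda>x. above k (u n x) *\<^sub>R F x) * L2_norm M\<Omega> q"
    by (rule order_trans[OF abs_ge_self abs_integral_inner_le_L2_norm[OF
          square_integrable_indicator_scaleR[OF F_square_integrable u_measurable] q]]) simp
  finally show ?thesis .
qed

lemma tail_slope_energy_le:
  assumes k: "R \<le> k" "k \<le> M"
  shows "(\<integral>x. tail_slope k M (u n x) * energy n x \<partial>M\<Omega>)
      \<le> B * (\<delta> n + L2_norm M\<Omega> (\<lambda>x. above k (u n x) *\<^sub>R F x))"
proof -
  let ?v = "\<lambda>x. tail_test k M (u n x)" and ?h = "\<lambda>x. tail_slope k M (u n x) *\<^sub>R g n x"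
  let ?F = "\<lambda>x. above k (u n x) *\<^sub>R F x"
    and ?N = "L2_norm M\<Omega> (\<lambda>x. (tail_test k M (u n x), tail_slope k M (u n x) *\<^sub>R g n x))"
  have k_nonneg: "0 \<le> k" using k(1) R_pos by linarith
  note levels = k_nonneg k(2)
  note in_H01 = H01_grad_tail_test[OF H01_u[of n] levels]
  have v_le: "\<bar>?v x\<bar> \<le> 2 * M - k" for x using abs_tail_test_le[OF levels, of "u n x"] k by linarith
  have u_le: "?v x \<noteq> 0 \<Longrightarrow> \<bar>u n x\<bar> \<le> 2 * M - k" for x using tail_test_eq_0[OF levels, of "u n x"] by linarith
  have "(\<integral>x. js x (u n x) (g n x) * ?v x \<partial>M\<Omega>) + (\<integral>x. flux n x \<bullet> ?h x \<partial>M\<Omega>)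
      \<le> (\<integral>x. F x \<bullet> (?v x, ?h x) \<partial>M\<Omega>) + \<delta> n * ?N"
    by (rule equation_le[OF in_H01 v_le u_le])
  moreover have "0 \<le> (\<integral>x. js x (u n x) (g n x) * ?v x \<partial>M\<Omega>)"
  proof (rule integral_nonneg_AE[OF AE_I2])
    fix x assume "x \<in> space M\<Omega>"
    then show "0 \<le> js x (u n x) (g n x) * ?v x"
      using tail_test_eq_0[OF levels, of "u n x"] k(1) tail_test_same_sign[OF levels]
      by (intro js_mult_nonneg) (simp, linarith)
  qed
  moreover have "(\<integral>x. F x \<bullet> (?v x, ?h x) \<partial>M\<Omega>) \<le> L2_norm M\<Omega> ?F * ?N"
    using tail_test_eq_0[OF levels] tail_slope_eq_0[OF levels]
    by (intro functional_le_tail_L2_norm H01_grad_square_integrable(3)[OF in_H01]) (simp add: zero_prod_def)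
  moreover have "?N \<le> B"
  proof (rule order_trans[OF L2_norm_mono[OF H01_grad_square_integrable(3)[OF H01_u]
        square_integrable_measurable[OF H01_grad_square_integrable(3)[OF in_H01]]] bound])
    show "AE x in M\<Omega>. norm (?v x, ?h x) \<le> norm (u n x, g n x)"
      using abs_tail_test_le_abs[OF levels] abs_tail_slope_le_1[OF levels]
      by (intro AE_I2 norm_Pair_mono) (auto simp: mult_left_le_one_le)
  qed
  then have "(\<delta> n + L2_norm M\<Omega> ?F) * ?N \<le> (\<delta> n + L2_norm M\<Omega> ?F) * B"
    by (rule mult_left_mono) (simp add: \<delta>_nonneg L2_norm_nonneg)
  ultimately show ?thesis by (simp add: algebra_simps)
qed

lemma tail_energy_le:
  assumes k: "R \<le> k"
  shows "(\<integral>x. above k (u n x) * energy n x \<partial>M\<Omega>) \<le> B * (\<delta> n + L2_norm M\<Omega> (\<lambda>x. above k (u n x) *\<^sub>R F x))"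
proof -
  have k_nonneg: "0 \<le> k" using k R_pos by linarith
  have "(\<lambda>m. \<integral>x. tail_slope k (k + real m) (u n x) * energy n x \<partial>M\<Omega>)
      \<longlonglongrightarrow> (\<integral>x. above k (u n x) * energy n x \<partial>M\<Omega>)"
  proof (rule integral_dominated_convergence[OF _ _ integrable_norm[OF energy_integrable]])
    show "AE x in M\<Omega>. (\<lambda>m. tail_slope k (k + real m) (u n x) * energy n x) \<longlonglongrightarrow> above k (u n x) * energy n x"
      by (intro AE_I2 tendsto_mult tendsto_const tendsto_eventually tail_slope_eventually_above k_nonneg)
    show "AE x in M\<Omega>. norm (tail_slope k (k + real m) (u n x) * energy n x) \<le> norm (energy n x)" for m
      using abs_tail_slope_le_1[OF k_nonneg, of "k + real m"]
      by (intro AE_I2) (simp add: abs_mult mult_left_le_one_le)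
  qed measurable
  then show ?thesis using tail_slope_energy_le[OF k] by (intro LIMSEQ_le_const2) auto
qed

lemma tail_energy_bounded:
  obtains C where "0 \<le> C" "\<And>n k. R \<le> k \<Longrightarrow> (\<integral>x. above k (u n x) * energy n x \<partial>M\<Omega>) \<le> C"
proof -
  obtain D where D: "\<And>n. \<delta> n \<le> D"
    using convergent_imp_Bseq[of \<delta>] \<delta>_tendsto unfolding convergent_def Bseq_def by (auto simp: abs_le_iff)
  show thesis
  proof (rule that[of "B * (D + L2_norm M\<Omega> F)"])
    show "0 \<le> B * (D + L2_norm M\<Omega> F)"
      using B_nonneg order_trans[OF \<delta>_nonneg D] by (simp add: L2_norm_nonneg)
    show "(\<integral>x. above k (u n x) * energy n x \<partial>M\<Omega>) \<le> B * (D + L2_norm M\<Omega> F)" if "R \<le> k" for n k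
      by (rule order_trans[OF tail_energy_le[OF that]])
        (intro mult_left_mono add_mono D B_nonneg L2_norm_indicator_scaleR_le F_square_integrable
            u_measurable, simp)
  qed
qed

definition truncated_grad :: "real \<Rightarrow> 'a \<Rightarrow> 'a" where
  "truncated_grad k x = below k (u0 x) *\<^sub>R g0 x"

definition gap :: "real \<Rightarrow> nat \<Rightarrow> 'a \<Rightarrow> real" where
  "gap k n x = below k (u n x) * ((flux n x - jxi x (u n x) (truncated_grad k x)) \<bullet> (g n x - truncated_grad k x))"

lemma truncated_grad_square_integrable: "square_integrable M\<Omega> (truncated_grad k)"
  unfolding truncated_grad_def[abs_def] by
    (intro square_integrable_indicator_scaleR g0_square_integrable u0_measurable) simp

lemma truncated_grad_measurable [measurable]: "truncated_grad k \<in> borel_measurable M\<Omega>"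
  by (rule square_integrable_measurable[OF truncated_grad_square_integrable])

lemma H01_grad_truncate_u0: "0 \<le> k \<Longrightarrow> H01_grad (\<lambda>x. truncate k (u0 x)) (truncated_grad k)"
  unfolding truncated_grad_def[abs_def] by (rule H01_grad_truncate[OF H01_u0])

lemma gap_nonneg: "x \<in> \<Omega> \<Longrightarrow> 0 \<le> gap k n x"
  unfolding gap_def using jxi_monotone by simp

context
  fixes k :: real and n :: nat and q :: "'a \<Rightarrow> 'a"
  assumes k: "0 \<le> k" and q: "square_integrable M\<Omega> q"
begin

lemma norm_truncated_flux_le:
  "x \<in> \<Omega> \<Longrightarrow> norm (below k (u n x) *\<^sub>R jxi x (u n x) (q x)) \<le> 4 * \<alpha> k * norm (q x)"
  using jxi_growth[of x "u n x" k "q x"] \<alpha>_pos[OF k] by (auto simp: indicator_def abs_le_iff)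

lemma truncated_flux_measurable: "(\<lambda>x. below k (u n x) *\<^sub>R jxi x (u n x) (q x)) \<in> borel_measurable M\<Omega>"
  by (intro borel_measurable_scaleR jxi_measurable u_measurable square_integrable_measurable[OF q])
    measurable

lemma norm_truncated_flux_le_AE:
  "AE x in M\<Omega>. norm (below k (u n x) *\<^sub>R jxi x (u n x) (q x)) \<le> norm ((4 * \<alpha> k) *\<^sub>R q x)"
  using norm_truncated_flux_le \<alpha>_pos[OF k] by (intro AE_I2) auto

lemma truncated_flux_square_integrable: "square_integrable M\<Omega> (\<lambda>x. below k (u n x) *\<^sub>R jxi x (u n x) (q x))"
  by (rule square_integrable_bound[OF square_integrable_scaleR[OF q] truncated_flux_measurable
      norm_truncated_flux_le_AE])

lemma truncated_flux_L2_norm_le: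
  "L2_norm M\<Omega> (\<lambda>x. below k (u n x) *\<^sub>R jxi x (u n x) (q x)) \<le> 4 * \<alpha> k * L2_norm M\<Omega> q"
  using L2_norm_mono[OF square_integrable_scaleR[OF q] truncated_flux_measurable
      norm_truncated_flux_le_AE] \<alpha>_pos[OF k]
  unfolding L2_norm_scaleR by simp

end

lemma gap_integrable:
  assumes k: "0 \<le> k" shows "integrable M\<Omega> (gap k n)"
proof -
  have "integrable M\<Omega> (\<lambda>x. (below k (u n x) *\<^sub>R flux n x - below k (u n x) *\<^sub>R jxi x (u n x) (truncated_grad k x))
      \<bullet> (g n x - truncated_grad k x))"
    by (intro integrable_inner_square_integrable square_integrable_diff truncated_flux_square_integrable k
        g_square_integrable truncated_grad_square_integrable)
  then show ?thesis by (simp add: gap_def[abs_def] flip: scaleR_diff_right)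
qed

lemma below_eventually_eq:
  assumes "AE x in M\<Omega>. \<bar>u0 x\<bar> \<noteq> k"
  shows "AE x in M\<Omega>. \<forall>\<^sub>F n in sequentially. u n x \<in> {-k..k} \<longleftrightarrow> u0 x \<in> {-k..k}"
  using assms u_AE_tendsto
proof eventually_elim
  case (elim x)
  have lim: "(\<lambda>n. \<bar>u n x\<bar>) \<longlonglongrightarrow> \<bar>u0 x\<bar>" by (intro tendsto_intros elim)
  consider "\<bar>u0 x\<bar> < k" | "k < \<bar>u0 x\<bar>" using elim by linarith
  then show ?case
  proof cases
    case 1
    from order_tendstoD(2)[OF lim 1] show ?thesis by eventually_elim (use 1 in \<open>auto simp: abs_less_iff\<close>)
  next
    case 2
    from order_tendstoD(1)[OF lim 2] show ?thesis by eventually_elim (use 2 in auto)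
  qed
qed

end

section \<open>The truncated gap\<close>

lemma abs_sinh_le_cosh: "\<bar>sinh x\<bar> \<le> cosh (x::real)"
  using sinh_le_cosh_real[of "\<bar>x\<bar>"] by simp

definition ramp :: "real \<Rightarrow> real \<Rightarrow> real" where
  "ramp M s = ((truncate (2 * M) s - truncate M s) / M)\<^sup>2"

definition ramp_slope :: "real \<Rightarrow> real \<Rightarrow> real" where
  "ramp_slope M s = 2 * ((truncate (2 * M) s - truncate M s) / M) * ((below (2 * M) s - below M s) / M)"

lemma abs_truncate_diff_le:
  assumes "0 < M" shows "\<bar>(truncate (2 * M) s - truncate M s) / M\<bar> \<le> 1"
proof -
  have "\<bar>truncate (2 * M) s - truncate M s\<bar> \<le> M" using assms by (auto simp: truncate_def max_def min_def)
  then show ?thesis using assms by (simp add: abs_divide)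
qed

lemma ramp_nonneg: "0 \<le> ramp M s"
  by (simp add: ramp_def)

lemma ramp_le_1: "0 < M \<Longrightarrow> ramp M s \<le> 1"
  using abs_truncate_diff_le[of M s] by (simp add: ramp_def abs_square_le_1 del: abs_divide)

lemma ramp_eq_0: "\<bar>s\<bar> \<le> M \<Longrightarrow> ramp M s = 0"
  by (simp add: ramp_def truncate_eq)

lemma ramp_eq_1:
  assumes "0 < M" "2 * M \<le> \<bar>s\<bar>" shows "ramp M s = 1"
proof (cases "0 \<le> s")
  case True
  then show ?thesis using assms by (simp add: ramp_def truncate_eq_level)
next
  case False
  then show ?thesis using assms by (simp add: ramp_def truncate_eq_minus_level)
qed

lemma abs_ramp_slope_le:
  assumes M: "0 < M" shows "\<bar>ramp_slope M s\<bar> \<le> 2 / M * above M s"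
proof -
  have "\<bar>below (2 * M) s - below M s\<bar> \<le> (above M s :: real)" using M by (auto simp: indicator_def)
  then have "\<bar>(below (2 * M) s - below M s) / M\<bar> \<le> above M s / M" using M by (simp add: divide_right_mono)
  then have "\<bar>(truncate (2 * M) s - truncate M s) / M\<bar> * \<bar>(below (2 * M) s - below M s) / M\<bar>
      \<le> 1 * (above M s / M)"
    using M by (intro mult_mono abs_truncate_diff_le) auto
  then show ?thesis unfolding ramp_slope_def abs_mult by simp
qed

lemma ramp_slope_eq_0: "0 < M \<Longrightarrow> \<bar>s\<bar> \<le> M \<or> 2 * M < \<bar>s\<bar> \<Longrightarrow> ramp_slope M s = 0"
  by (auto simp: ramp_slope_def indicator_def abs_le_iff)

lemma borel_measurable_ramp [measurable]: "ramp M \<in> borel_measurable borel"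
  and borel_measurable_ramp_slope [measurable]: "ramp_slope M \<in> borel_measurable borel"
  unfolding ramp_def[abs_def] ramp_slope_def[abs_def] by measurable

lemma (in bounded_domain) H01_grad_ramp:
  assumes in_H01: "H01_grad v h" and M: "0 < M"
  shows "H01_grad (\<lambda>x. ramp M (v x)) (\<lambda>x. ramp_slope M (v x) *\<^sub>R h x)"
proof -
  have "H01_grad (\<lambda>x. (1 / M) * (truncate (2 * M) (v x) - truncate M (v x)))
      (\<lambda>x. (1 / M) *\<^sub>R (below (2 * M) (v x) *\<^sub>R h x - below M (v x) *\<^sub>R h x))"
    using M by (intro H01_grad_scaleR H01_grad_diff H01_grad_truncate[OF in_H01]) auto
  then have "H01_grad (\<lambda>x. (truncate (2 * M) (v x) - truncate M (v x)) / M)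
      (\<lambda>x. ((below (2 * M) (v x) - below M (v x)) / M) *\<^sub>R h x)"
    by (simp add: scaleR_diff_left[symmetric])
  from H01_grad_power2[OF this abs_truncate_diff_le[OF M]] show ?thesis
    by (simp only: ramp_def ramp_slope_def scaleR_scaleR)
qed

context approximate_solutions
begin

definition rate :: "real \<Rightarrow> real" where "rate k = \<beta> k / \<alpha>0 + 1"

definition truncation_diff :: "real \<Rightarrow> nat \<Rightarrow> 'a \<Rightarrow> real" where
  "truncation_diff k n x = truncate k (u n x) - truncate k (u0 x)"

definition bent :: "real \<Rightarrow> nat \<Rightarrow> 'a \<Rightarrow> real" where
  "bent k n x = sinh (rate k * truncation_diff k n x)"

definition bent_slope :: "real \<Rightarrow> nat \<Rightarrow> 'a \<Rightarrow> real" where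
  "bent_slope k n x = rate k * cosh (rate k * truncation_diff k n x)"

definition bent_bound :: "real \<Rightarrow> real" where
  "bent_bound k = rate k * cosh (rate k * (2 * k))"

text \<open>The factor \<open>rate k - 1 = \<beta> k / \<alpha>0\<close> is the one with which the energy controls \<open>j\<^sub>s\<close> below the level \<open>k\<close>, and
  the exponential growth of \<open>bent\<close> makes the weight at least one.\<close>

definition weight :: "real \<Rightarrow> nat \<Rightarrow> 'a \<Rightarrow> real" where
  "weight k n x = bent_slope k n x - (rate k - 1) * \<bar>bent k n x\<bar>"

lemma test_factors_measurable [measurable]:
  shows truncation_diff_measurable: "truncation_diff k n \<in> borel_measurable M\<Omega>"
    and bent_measurable: "bent k n \<in> borel_measurable M\<Omega>"
    and bent_slope_measurable: "bent_slope k n \<in> borel_measurable M\<Omega>"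
    and weight_measurable: "weight k n \<in> borel_measurable M\<Omega>"
proof -
  show d [measurable]: "truncation_diff k n \<in> borel_measurable M\<Omega>" unfolding truncation_diff_def[abs_def]
    by measurable
  have "(\<lambda>t::real. sinh (rate k * t)) \<in> borel_measurable borel"
    "(\<lambda>t::real. rate k * cosh (rate k * t)) \<in> borel_measurable borel"
    by (intro borel_measurable_continuous_onI continuous_intros)+
  from measurable_compose[OF d this(1)] measurable_compose[OF d this(2)]
  show b [measurable]: "bent k n \<in> borel_measurable M\<Omega>"
    and s [measurable]: "bent_slope k n \<in> borel_measurable M\<Omega>"
    by (simp_all add: bent_def[abs_def] bent_slope_def[abs_def])
  show "weight k n \<in> borel_measurable M\<Omega>" unfolding weight_def[abs_def] by measurable
qed

context
  fixes k :: real
  assumes k: "R \<le> k"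
begin

lemma k_pos: "0 < k"
  using k R_pos by linarith

lemma rate_ge_1: "1 \<le> rate k"
  using \<beta>_pos[of k] \<alpha>0_pos k_pos by (simp add: rate_def)

lemma abs_js_le_energy:
  assumes "x \<in> \<Omega>" "\<bar>u n x\<bar> \<le> k" shows "\<bar>js x (u n x) (g n x)\<bar> \<le> (rate k - 1) * energy n x"
proof -
  have "\<bar>js x (u n x) (g n x)\<bar> \<le> \<beta> k * (norm (g n x))\<^sup>2" by (rule js_bound[OF assms])
  also have "\<dots> = (rate k - 1) * (\<alpha>0 * (norm (g n x))\<^sup>2)" using \<alpha>0_pos by (simp add: rate_def)
  also have "\<dots> \<le> (rate k - 1) * energy n x"
    using rate_ge_1 by (intro mult_left_mono jxi_coercive assms) auto
  finally show ?thesis .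
qed

lemma abs_truncation_diff_le: "\<bar>truncation_diff k n x\<bar> \<le> 2 * k"
  using abs_truncate_le[of k "u n x"] abs_truncate_le[of k "u0 x"] k_pos by (simp add: truncation_diff_def)

lemma truncation_diff_tendsto: "AE x in M\<Omega>. (\<lambda>n. truncation_diff k n x) \<longlonglongrightarrow> 0"
  using u_AE_tendsto
proof eventually_elim
  case (elim x)
  have "(\<lambda>n. truncate k (u n x)) \<longlonglongrightarrow> truncate k (u0 x)"
    by (rule continuous_on_tendsto_compose[OF continuous_on_truncate[of UNIV] elim]) auto
  then show ?case by (simp add: truncation_diff_def LIM_zero)
qed

lemma H01_grad_truncation_diff:
  "H01_grad (truncation_diff k n) (\<lambda>x. below k (u n x) *\<^sub>R g n x - truncated_grad k x)"
  unfolding truncation_diff_def[abs_def] using k_pos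
  by (intro H01_grad_diff H01_grad_truncate[OF H01_u] H01_grad_truncate_u0) auto

lemma H01_grad_bent:
  "H01_grad (bent k n) (\<lambda>x. bent_slope k n x *\<^sub>R (below k (u n x) *\<^sub>R g n x - truncated_grad k x))"
  unfolding bent_def[abs_def] bent_slope_def
  by (rule H01_grad_chain_bounded[OF H01_grad_truncation_diff abs_truncation_diff_le])
    (auto intro!: derivative_eq_intros continuous_intros)

lemma cosh_truncation_diff_le: "cosh (rate k * truncation_diff k n x) \<le> cosh (rate k * (2 * k))"
proof -
  have "\<bar>rate k * truncation_diff k n x\<bar> \<le> rate k * (2 * k)"
    using abs_truncation_diff_le rate_ge_1 by (simp add: abs_mult mult_left_mono)
  then have "cosh \<bar>rate k * truncation_diff k n x\<bar> \<le> cosh (rate k * (2 * k))"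
    by (subst cosh_real_nonneg_le_iff) (use rate_ge_1 k_pos in auto)
  then show ?thesis by (simp del: abs_mult)
qed

lemma bent_slope_ge: "\<bar>bent k n x\<bar> \<le> bent_slope k n x"
proof -
  have "1 * cosh (rate k * truncation_diff k n x) \<le> bent_slope k n x"
    unfolding bent_slope_def using rate_ge_1 by (intro mult_right_mono) auto
  then show ?thesis using abs_sinh_le_cosh[of "rate k * truncation_diff k n x"] by (simp add: bent_def)
qed

lemma bent_slope_le: "bent_slope k n x \<le> bent_bound k"
  unfolding bent_slope_def bent_bound_def using rate_ge_1 cosh_truncation_diff_le
  by (intro mult_left_mono) auto

lemma abs_bent_le: "\<bar>bent k n x\<bar> \<le> bent_bound k"
  using bent_slope_ge bent_slope_le by (rule order_trans)

lemma bent_slope_nonneg: "0 \<le> bent_slope k n x"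
  using bent_slope_ge[of n x] by linarith

lemma abs_bent_slope_le: "\<bar>bent_slope k n x\<bar> \<le> bent_bound k"
  using bent_slope_le bent_slope_nonneg by simp

lemma bent_bound_nonneg: "0 \<le> bent_bound k"
  using abs_bent_le[of 0 undefined] by linarith

lemma weight_ge_1: "1 \<le> weight k n x"
proof -
  let ?c = "cosh (rate k * truncation_diff k n x)"
  have "(rate k - 1) * \<bar>bent k n x\<bar> \<le> (rate k - 1) * ?c"
    unfolding bent_def using rate_ge_1 by (intro mult_left_mono abs_sinh_le_cosh) auto
  moreover have "1 \<le> ?c" by (rule cosh_real_ge_1)
  ultimately show ?thesis by (simp add: weight_def bent_slope_def algebra_simps)
qed

lemma abs_weight_le: "\<bar>weight k n x\<bar> \<le> bent_bound k"
proof -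
  have "0 \<le> (rate k - 1) * \<bar>bent k n x\<bar>" using rate_ge_1 by simp
  then have "weight k n x \<le> bent_bound k" using bent_slope_le[of n x] unfolding weight_def by linarith
  then show ?thesis using weight_ge_1[of n x] by linarith
qed

lemma bent_tendsto: "AE x in M\<Omega>. (\<lambda>n. bent k n x) \<longlonglongrightarrow> 0"
  using truncation_diff_tendsto
proof eventually_elim
  case (elim x)
  have "(\<lambda>n. sinh (rate k * truncation_diff k n x)) \<longlonglongrightarrow> sinh (rate k * 0)" by (intro tendsto_intros elim)
  then show ?case by (simp add: bent_def)
qed

lemma weight_tendsto: "AE x in M\<Omega>. (\<lambda>n. weight k n x) \<longlonglongrightarrow> rate k"
  using truncation_diff_tendsto bent_tendsto
proof eventually_elim
  case (elim x)
  have "(\<lambda>n. rate k * cosh (rate k * truncation_diff k n x) - (rate k - 1) * \<bar>bent k n x\<bar>)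
      \<longlonglongrightarrow> rate k * cosh (rate k * 0) - (rate k - 1) * \<bar>0\<bar>"
    by (intro tendsto_intros elim)
  then show ?case by (simp add: weight_def bent_slope_def)
qed

lemma bent_same_sign:
  assumes "k \<le> \<bar>u n x\<bar>" shows "0 \<le> u n x * bent k n x"
proof (cases "0 \<le> u n x")
  case True
  then have "truncate k (u n x) = k" using assms k_pos by (intro truncate_eq_level) auto
  then have "0 \<le> truncation_diff k n x"
    using abs_truncate_le[of k "u0 x"] k_pos by (simp add: truncation_diff_def abs_le_iff)
  then show ?thesis using True rate_ge_1 by (simp add: bent_def)
next
  case False
  then have "truncate k (u n x) = - k" using assms k_pos by (intro truncate_eq_minus_level) auto
  then have "truncation_diff k n x \<le> 0"
    using abs_truncate_le[of k "u0 x"] k_pos by (simp add: truncation_diff_def abs_le_iff)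
  then have "bent k n x \<le> 0" using rate_ge_1 by (simp add: bent_def mult_le_0_iff)
  with False show ?thesis by (simp add: mult_nonpos_nonpos)
qed

end

text \<open>The test function is \<open>bent\<close> times the cutoff \<open>1 - ramp\<close>, which equals one up to the level \<open>M\<close> and
  vanishes above \<open>2 M\<close>; the derivative of the cutoff costs an error of order \<open>1 / M\<close>.\<close>

definition cutoff_test :: "real \<Rightarrow> real \<Rightarrow> nat \<Rightarrow> 'a \<Rightarrow> real" where
  "cutoff_test k M n x = bent k n x * (1 - ramp M (u n x))"

definition solution_coeff :: "real \<Rightarrow> real \<Rightarrow> nat \<Rightarrow> 'a \<Rightarrow> real" where
  "solution_coeff k M n x = bent_slope k n x * below k (u n x) - bent k n x * ramp_slope M (u n x)"

definition limit_coeff :: "real \<Rightarrow> real \<Rightarrow> nat \<Rightarrow> 'a \<Rightarrow> real" where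
  "limit_coeff k M n x = bent_slope k n x * (1 - ramp M (u n x))"

definition cutoff_test_grad :: "real \<Rightarrow> real \<Rightarrow> nat \<Rightarrow> 'a \<Rightarrow> 'a" where
  "cutoff_test_grad k M n x = solution_coeff k M n x *\<^sub>R g n x - limit_coeff k M n x *\<^sub>R truncated_grad k x"

text \<open>The flux against the limit gradient, which vanishes in the limit: above the level \<open>k\<close> because
  the limit gradient is truncated, below it because \<open>bent\<close> tends to zero.\<close>

definition flux_coeff :: "real \<Rightarrow> real \<Rightarrow> nat \<Rightarrow> 'a \<Rightarrow> real" where
  "flux_coeff k M n x =
    (1 - below k (u n x)) * limit_coeff k M n x + below k (u n x) * ((rate k - 1) * \<bar>bent k n x\<bar>)"

definition weighted_limit_flux :: "real \<Rightarrow> nat \<Rightarrow> 'a \<Rightarrow> 'a" where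
  "weighted_limit_flux k n x = weight k n x *\<^sub>R below k (u n x) *\<^sub>R jxi x (u n x) (truncated_grad k x)"

lemma coefficients_measurable [measurable]:
  shows cutoff_test_measurable: "cutoff_test k M n \<in> borel_measurable M\<Omega>"
    and solution_coeff_measurable: "solution_coeff k M n \<in> borel_measurable M\<Omega>"
    and limit_coeff_measurable: "limit_coeff k M n \<in> borel_measurable M\<Omega>"
    and flux_coeff_measurable: "flux_coeff k M n \<in> borel_measurable M\<Omega>"
proof -
  show "cutoff_test k M n \<in> borel_measurable M\<Omega>" "solution_coeff k M n \<in> borel_measurable M\<Omega>"
    and [measurable]: "limit_coeff k M n \<in> borel_measurable M\<Omega>"
    unfolding cutoff_test_def[abs_def] solution_coeff_def[abs_def] limit_coeff_def[abs_def] by measurable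
  show "flux_coeff k M n \<in> borel_measurable M\<Omega>" unfolding flux_coeff_def[abs_def] by measurable
qed

context
  fixes k M :: real
  assumes k: "R \<le> k" and M: "1 \<le> M" "k \<le> M"
begin

lemma M_pos: "0 < M"
  using M(1) by simp

lemma cutoff_bounds: "0 \<le> 1 - ramp M s" "1 - ramp M s \<le> 1"
  using ramp_le_1[OF M_pos] ramp_nonneg by auto

lemma cutoff_test_eq_0: "2 * M < \<bar>u n x\<bar> \<Longrightarrow> cutoff_test k M n x = 0"
  and cutoff_test_grad_eq_0: "2 * M < \<bar>u n x\<bar> \<Longrightarrow> cutoff_test_grad k M n x = 0"
  and flux_coeff_eq_0: "2 * M < \<bar>u n x\<bar> \<Longrightarrow> flux_coeff k M n x = 0"
  using M ramp_eq_1[OF M_pos, of "u n x"] ramp_slope_eq_0[OF M_pos, of "u n x"]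
  by (auto simp: cutoff_test_def cutoff_test_grad_def solution_coeff_def limit_coeff_def flux_coeff_def
      indicator_def)

lemma H01_grad_cutoff_test: "H01_grad (cutoff_test k M n) (cutoff_test_grad k M n)"
proof -
  let ?d = "\<lambda>x. bent_slope k n x *\<^sub>R (below k (u n x) *\<^sub>R g n x - truncated_grad k x)"
  have "H01_grad (\<lambda>x. bent k n x - bent k n x * ramp M (u n x))
      (\<lambda>x. ?d x - (bent k n x *\<^sub>R ramp_slope M (u n x) *\<^sub>R g n x + ramp M (u n x) *\<^sub>R ?d x))"
    using ramp_nonneg ramp_le_1[OF M_pos]
    by (intro H01_grad_diff[OF H01_grad_bent[OF k]]
        H01_grad_mult[OF H01_grad_bent[OF k] abs_bent_le[OF k] H01_grad_ramp[OF H01_u M_pos], where B=1])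
          auto
  moreover have "bent k n x - bent k n x * ramp M (u n x) = cutoff_test k M n x" for x
    by (simp add: cutoff_test_def algebra_simps)
  moreover have "?d x - (bent k n x *\<^sub>R ramp_slope M (u n x) *\<^sub>R g n x + ramp M (u n x) *\<^sub>R ?d x)
      = cutoff_test_grad k M n x" for x
    using ramp_eq_0[of "u n x" M] M(2)
    by (auto simp: cutoff_test_grad_def solution_coeff_def limit_coeff_def indicator_def algebra_simps)
  ultimately show ?thesis by simp
qed

lemma abs_cutoff_test_le: "\<bar>cutoff_test k M n x\<bar> \<le> bent_bound k"
  unfolding cutoff_test_def abs_mult
  using mult_mono[OF abs_bent_le[OF k, of n x], of "\<bar>1 - ramp M (u n x)\<bar>" 1] cutoff_bounds[of "u n x"]
    bent_bound_nonneg[OF k]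
  by simp

lemma abs_limit_coeff_le: "\<bar>limit_coeff k M n x\<bar> \<le> bent_bound k"
  unfolding limit_coeff_def abs_mult
  using mult_mono[OF abs_bent_slope_le[OF k, of n x], of "\<bar>1 - ramp M (u n x)\<bar>" 1]
    cutoff_bounds[of "u n x"] bent_bound_nonneg[OF k]
  by simp

lemma abs_bent_ramp_slope_le: "\<bar>bent k n x * ramp_slope M (u n x)\<bar> \<le> 2 * bent_bound k / M * above M (u n x)"
proof -
  have "\<bar>bent k n x\<bar> * \<bar>ramp_slope M (u n x)\<bar> \<le> bent_bound k * (2 / M * above M (u n x))"
    by (intro mult_mono abs_bent_le[OF k] abs_ramp_slope_le[OF M_pos] bent_bound_nonneg[OF k]) auto
  then show ?thesis by (simp add: abs_mult mult_ac)
qed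

lemma abs_solution_coeff_le: "\<bar>solution_coeff k M n x\<bar> \<le> 3 * bent_bound k"
proof -
  have "\<bar>bent_slope k n x * below k (u n x)\<bar> \<le> bent_bound k"
    using abs_bent_slope_le[OF k, of n x] bent_bound_nonneg[OF k] by (simp add: indicator_def)
  moreover have "2 * bent_bound k / M * above M (u n x) \<le> 2 * bent_bound k"
    using bent_bound_nonneg[OF k] M mult_left_mono[of 1 M "bent_bound k"]
    by (auto simp: indicator_def divide_le_eq)
  ultimately show ?thesis
    using abs_bent_ramp_slope_le[of n x] unfolding solution_coeff_def by linarith
qed

lemma abs_flux_coeff_le: "\<bar>flux_coeff k M n x\<bar> \<le> rate k * bent_bound k"
proof -
  have "bent_bound k \<le> rate k * bent_bound k" "(rate k - 1) * \<bar>bent k n x\<bar> \<le> rate k * bent_bound k"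
    using rate_ge_1[OF k] bent_bound_nonneg[OF k] abs_bent_le[OF k, of n x]
      mult_right_mono[of 1 "rate k" "bent_bound k"] by (auto intro: mult_mono)
  then show ?thesis
    using abs_limit_coeff_le[of n x] rate_ge_1[OF k] by (auto simp: flux_coeff_def indicator_def abs_mult)
qed

lemma cutoff_test_L2_bounded:
  obtains N where "\<And>n. L2_norm M\<Omega> (\<lambda>x. (cutoff_test k M n x, cutoff_test_grad k M n x)) \<le> N"
proof
  fix n
  note in_H01 = H01_grad_square_integrable(1,2)[OF H01_grad_cutoff_test]
  have bound_nonneg: "0 \<le> bent_bound k" by (rule bent_bound_nonneg[OF k])
  have "L2_norm M\<Omega> (cutoff_test k M n) \<le> L2_norm M\<Omega> (\<lambda>x. bent_bound k)"
    by (rule L2_norm_mono[OF square_integrable_const]) (use abs_cutoff_test_le bound_nonneg in auto)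
  moreover have "L2_norm M\<Omega> (\<lambda>x. solution_coeff k M n x *\<^sub>R g n x) \<le> 3 * bent_bound k * B"
  proof (rule order_trans)
    show "L2_norm M\<Omega> (\<lambda>x. solution_coeff k M n x *\<^sub>R g n x) \<le> 3 * bent_bound k * L2_norm M\<Omega> (g n)"
      by (rule L2_norm_bounded_scaleR_le[OF g_square_integrable solution_coeff_measurable
          abs_solution_coeff_le])
  qed (use mult_left_mono[OF g_bound[of n]] bound_nonneg in simp)
  moreover have "L2_norm M\<Omega> (\<lambda>x. limit_coeff k M n x *\<^sub>R truncated_grad k x)
      \<le> bent_bound k * L2_norm M\<Omega> (truncated_grad k)"
    by (rule L2_norm_bounded_scaleR_le[OF truncated_grad_square_integrable limit_coeff_measurable
        abs_limit_coeff_le])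
  moreover have "L2_norm M\<Omega> (cutoff_test_grad k M n) \<le> L2_norm M\<Omega> (\<lambda>x. solution_coeff k M n x *\<^sub>R g n x)
      + L2_norm M\<Omega> (\<lambda>x. limit_coeff k M n x *\<^sub>R truncated_grad k x)"
    unfolding cutoff_test_grad_def[abs_def]
    by (intro L2_norm_triangle_ineq4 square_integrable_bounded_scaleR[OF g_square_integrable
        solution_coeff_measurable abs_solution_coeff_le]
        square_integrable_bounded_scaleR[OF truncated_grad_square_integrable limit_coeff_measurable
            abs_limit_coeff_le])
  ultimately show "L2_norm M\<Omega> (\<lambda>x. (cutoff_test k M n x, cutoff_test_grad k M n x))
      \<le> L2_norm M\<Omega> (\<lambda>x. bent_bound k) + (3 * bent_bound k * B + bent_bound k * L2_norm M\<Omega>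
          (truncated_grad k))"
    using L2_norm_Pair_le[OF in_H01, of n n] by linarith
qed

lemma cutoff_test_functional_tendsto:
  "(\<lambda>n. \<integral>x. F x \<bullet> (cutoff_test k M n x, cutoff_test_grad k M n x) \<partial>M\<Omega>) \<longlonglongrightarrow> 0"
proof -
  let ?v = "cutoff_test k M" and ?h = "cutoff_test_grad k M"
  obtain N where N: "\<And>n. L2_norm M\<Omega> (\<lambda>x. (?v n x, ?h n x)) \<le> N" by (rule cutoff_test_L2_bounded) (rule that)
  note in_H01 = H01_grad_cutoff_test and in_L2 = H01_grad_square_integrable(1,2)[OF H01_grad_cutoff_test]
  have "AE x in M\<Omega>. (\<lambda>n. ?v n x) \<longlonglongrightarrow> 0"
    using bent_tendsto[OF k]
  proof eventually_elim
    case (elim x)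
    have "norm (?v n x) \<le> \<bar>bent k n x\<bar>" for n
      unfolding cutoff_test_def real_norm_def abs_mult using cutoff_bounds[of "u n x"]
      by (intro mult_left_le) auto
    then show ?case by (intro Lim_null_comparison[OF always_eventually tendsto_rabs_zero[OF elim]] allI)
  qed
  then have v: "L2_tendsto M\<Omega> ?v (\<lambda>x. 0)"
    using abs_cutoff_test_le bent_bound_nonneg[OF k]
    by (intro L2_dominated_convergence(2)[OF square_integrable_const[of "bent_bound k"]
        cutoff_test_measurable]) auto
  have h: "L2_weakly_tendsto M\<Omega> ?h (\<lambda>x. 0)"
    by (rule H01_grad_bounded_imp_grad_weakly_tendsto_zero[OF in_H01 N v])
  note F = square_integrable_fst[OF F_square_integrable] square_integrable_snd[OF F_square_integrable]
  have "(\<lambda>n. (\<integral>x. ?v n x \<bullet> fst (F x) \<partial>M\<Omega>) + (\<integral>x. ?h n x \<bullet> snd (F x) \<partial>M\<Omega>)) \<longlonglongrightarrow> 0 + 0"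
    using tendsto_add[OF L2_weakly_tendstoD[OF L2_tendsto_imp_weakly_tendsto[OF in_L2(1)
        square_integrable_zero v] F(1)]
        L2_weakly_tendstoD[OF h F(2)]] by simp
  moreover have "(\<integral>x. F x \<bullet> (?v n x, ?h n x) \<partial>M\<Omega>)
      = (\<integral>x. ?v n x \<bullet> fst (F x) \<partial>M\<Omega>) + (\<integral>x. ?h n x \<bullet> snd (F x) \<partial>M\<Omega>)" for n
    using Bochner_Integration.integral_add[OF integrable_inner_square_integrable[OF in_L2(1)[of n] F(1)]
        integrable_inner_square_integrable[OF in_L2(2)[of n] F(2)]]
    by (simp add: inner_prod_def inner_commute mult.commute)
  ultimately show ?thesis by simp
qed

lemma gap_le_below:
  assumes x: "x \<in> \<Omega>" and u: "\<bar>u n x\<bar> \<le> k"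
  shows "gap k n x \<le> js x (u n x) (g n x) * cutoff_test k M n x + flux n x \<bullet> cutoff_test_grad k M n x
    + flux n x \<bullet> (flux_coeff k M n x *\<^sub>R truncated_grad k x) + bent k n x * ramp_slope M (u n x) * energy
      n x
    - (g n x - truncated_grad k x) \<bullet> weighted_limit_flux k n x"
proof -
  let ?A = "flux n x" and ?\<xi> = "truncated_grad k x" and ?b = "bent k n x" and ?c = "rate k - 1"
  let ?A' = "jxi x (u n x) ?\<xi>"
  have below: "below k (u n x) = (1::real)" using u by (auto simp: indicator_def abs_le_iff)
  have cutoff: "ramp M (u n x) = 0" "ramp_slope M (u n x) = 0"
    using u M(2) ramp_eq_0[of "u n x" M] ramp_slope_eq_0[OF M_pos, of "u n x"] by auto
  have "\<bar>js x (u n x) (g n x)\<bar> * \<bar>?b\<bar> \<le> ?c * energy n x * \<bar>?b\<bar>"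
    by (rule mult_right_mono[OF abs_js_le_energy[OF k x u]]) simp
  then have js: "- (?c * \<bar>?b\<bar> * energy n x) \<le> js x (u n x) (g n x) * ?b"
    using abs_ge_minus_self[of "js x (u n x) (g n x) * ?b"] by (simp add: abs_mult mult_ac)
  have "gap k n x = (?A - ?A') \<bullet> (g n x - ?\<xi>)" by (simp add: gap_def below)
  also have "\<dots> \<le> weight k n x * ((?A - ?A') \<bullet> (g n x - ?\<xi>))"
    using jxi_monotone[OF x, of "u n x" "g n x" ?\<xi>] weight_ge_1[OF k, of n x]
    by (simp add: mult_le_cancel_right1)
  also have "\<dots> = bent_slope k n x * energy n x - bent_slope k n x * (?A \<bullet> ?\<xi>) - ?c * \<bar>?b\<bar> * energy n x
      + ?c * \<bar>?b\<bar> * (?A \<bullet> ?\<xi>) - weight k n x * ((g n x - ?\<xi>) \<bullet> ?A')"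
    unfolding weight_def by (simp add: inner_diff_left inner_diff_right inner_commute algebra_simps)
  also have "\<dots> \<le> js x (u n x) (g n x) * ?b + bent_slope k n x * energy n x - bent_slope k n x * (?A \<bullet> ?\<xi>)
      + ?c * \<bar>?b\<bar> * (?A \<bullet> ?\<xi>) - weight k n x * ((g n x - ?\<xi>) \<bullet> ?A')"
    using js by linarith
  finally show ?thesis
    by (simp add: cutoff_test_def cutoff_test_grad_def solution_coeff_def limit_coeff_def flux_coeff_def
        weighted_limit_flux_def below cutoff inner_diff_right)
qed

lemma gap_le_above:
  assumes x: "x \<in> \<Omega>" and u: "k < \<bar>u n x\<bar>"
  shows "gap k n x \<le> js x (u n x) (g n x) * cutoff_test k M n x + flux n x \<bullet> cutoff_test_grad k M n x
    + flux n x \<bullet> (flux_coeff k M n x *\<^sub>R truncated_grad k x) + bent k n x * ramp_slope M (u n x) * energy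
      n x
    - (g n x - truncated_grad k x) \<bullet> weighted_limit_flux k n x"
proof -
  have "below k (u n x) = (0::real)" using u by (auto simp: indicator_def)
  moreover have "0 \<le> js x (u n x) (g n x) * cutoff_test k M n x"
    using u k mult_nonneg_nonneg[OF bent_same_sign[OF k less_imp_le[OF u]] cutoff_bounds(1)[of "u n x"]]
    by (intro js_mult_nonneg[OF x]) (auto simp: cutoff_test_def mult.assoc)
  ultimately show ?thesis
    by (simp add: gap_def cutoff_test_grad_def solution_coeff_def flux_coeff_def weighted_limit_flux_def
        inner_diff_right)
qed

lemma flux_inner_eq_truncated:
  "(2 * M < \<bar>u n x\<bar> \<Longrightarrow> v = 0) \<Longrightarrow> flux n x \<bullet> v = (below (2 * M) (u n x) *\<^sub>R flux n x) \<bullet> v"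
  by (cases "2 * M < \<bar>u n x\<bar>") (auto simp: indicator_def)

lemma flux_inner_integrable:
  assumes q: "square_integrable M\<Omega> q" and zero: "\<And>x. 2 * M < \<bar>u n x\<bar> \<Longrightarrow> q x = 0"
  shows "integrable M\<Omega> (\<lambda>x. flux n x \<bullet> q x)"
proof -
  have "0 \<le> 2 * M" using M_pos by simp
  from integrable_inner_square_integrable[OF truncated_flux_square_integrable[OF this
      g_square_integrable[of n]] q, of n]
  show ?thesis by (simp only: flux_inner_eq_truncated[OF zero])
qed

lemma js_cutoff_test_integrable: "integrable M\<Omega> (\<lambda>x. js x (u n x) (g n x) * cutoff_test k M n x)"
proof (rule Bochner_Integration.integrable_bound[OF integrable_mult_right[OF
      square_integrable_integrable_power2[OF g_square_integrable], of "\<beta> (2 * M) * bent_bound k" n]])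
  show "(\<lambda>x. js x (u n x) (g n x) * cutoff_test k M n x) \<in> borel_measurable M\<Omega>"
    by (intro borel_measurable_times js_measurable u_measurable g_measurable cutoff_test_measurable)
  have \<beta>: "0 \<le> \<beta> (2 * M)" using \<beta>_pos[of "2 * M"] M_pos by simp
  have "\<bar>js x (u n x) (g n x)\<bar> * \<bar>cutoff_test k M n x\<bar> \<le> \<beta> (2 * M) * (norm (g n x))\<^sup>2 * bent_bound k"
    if "x \<in> \<Omega>" for x
  proof (cases "\<bar>u n x\<bar> \<le> 2 * M")
    case True
    then show ?thesis using \<beta> by (intro mult_mono js_bound[OF that] abs_cutoff_test_le) auto
  next
    case False
    then show ?thesis using \<beta> bent_bound_nonneg[OF k] by (simp add: cutoff_test_eq_0)
  qed
  then show "AE x in M\<Omega>. norm (js x (u n x) (g n x) * cutoff_test k M n x)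
      \<le> norm (\<beta> (2 * M) * bent_bound k * (norm (g n x))\<^sup>2)"
    using \<beta> bent_bound_nonneg[OF k] by (intro AE_I2) (simp add: abs_mult mult_ac)
qed

lemma ramp_energy_integrable: "integrable M\<Omega> (\<lambda>x. bent k n x * ramp_slope M (u n x) * energy n x)"
  and ramp_energy_le: "(\<integral>x. bent k n x * ramp_slope M (u n x) * energy n x \<partial>M\<Omega>)
    \<le> 2 * bent_bound k / M * (\<integral>x. above M (u n x) * energy n x \<partial>M\<Omega>)"
proof -
  have tail: "integrable M\<Omega> (\<lambda>x. 2 * bent_bound k / M * (above M (u n x) * energy n x))"
    by (intro integrable_mult_right energy_indicator_integrable) simp
  have ramp_energy_bound: "\<bar>bent k n x * ramp_slope M (u n x)\<bar> * energy n x
      \<le> 2 * bent_bound k / M * (above M (u n x) * energy n x)"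
    if "x \<in> \<Omega>" for x
    using mult_right_mono[OF abs_bent_ramp_slope_le energy_nonneg[OF that]] by (simp add: mult.assoc)
  show ramp: "integrable M\<Omega> (\<lambda>x. bent k n x * ramp_slope M (u n x) * energy n x)"
  proof (rule Bochner_Integration.integrable_bound[OF tail])
    show "AE x in M\<Omega>. norm (bent k n x * ramp_slope M (u n x) * energy n x)
        \<le> norm (2 * bent_bound k / M * (above M (u n x) * energy n x))"
      using order_trans[OF ramp_energy_bound abs_ge_self] energy_nonneg
      by (intro AE_I2) (auto simp: abs_mult)
  qed measurable
  have "(\<integral>x. bent k n x * ramp_slope M (u n x) * energy n x \<partial>M\<Omega>)
      \<le> (\<integral>x. 2 * bent_bound k / M * (above M (u n x) * energy n x) \<partial>M\<Omega>)"
  proof (rule integral_mono[OF ramp tail])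
    fix x assume "x \<in> space M\<Omega>"
    then have x: "x \<in> \<Omega>" by simp
    show "bent k n x * ramp_slope M (u n x) * energy n x
        \<le> 2 * bent_bound k / M * (above M (u n x) * energy n x)"
      by (rule order_trans[OF mult_right_mono[OF abs_ge_self energy_nonneg[OF x]] ramp_energy_bound[OF x]])
  qed
  then show "(\<integral>x. bent k n x * ramp_slope M (u n x) * energy n x \<partial>M\<Omega>)
      \<le> 2 * bent_bound k / M * (\<integral>x. above M (u n x) * energy n x \<partial>M\<Omega>)" by simp
qed

lemma flux_coeff_truncated_grad_tendsto:
  assumes regular: "AE x in M\<Omega>. \<bar>u0 x\<bar> \<noteq> k"
  shows "AE x in M\<Omega>. (\<lambda>n. flux_coeff k M n x *\<^sub>R truncated_grad k x) \<longlonglongrightarrow> 0"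
  using below_eventually_eq[OF regular] bent_tendsto[OF k]
proof eventually_elim
  case (elim x)
  show ?case
  proof (cases "u0 x \<in> {-k..k}")
    case True
    have "(\<lambda>n. ((rate k - 1) * \<bar>bent k n x\<bar>) *\<^sub>R truncated_grad k x)
        \<longlonglongrightarrow> ((rate k - 1) * \<bar>0\<bar>) *\<^sub>R truncated_grad k x"
      by (intro tendsto_intros elim)
    moreover have "\<forall>\<^sub>F n in sequentially. ((rate k - 1) * \<bar>bent k n x\<bar>) *\<^sub>R truncated_grad k x
        = flux_coeff k M n x *\<^sub>R truncated_grad k x"
      using elim(1) by eventually_elim (use True in \<open>simp add: flux_coeff_def\<close>)
    ultimately show ?thesis by (auto intro: Lim_transform_eventually)
  next
    case False
    then have "truncated_grad k x = 0" by (simp add: truncated_grad_def)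
    then show ?thesis by simp
  qed
qed

lemma flux_coeff_integral_tendsto:
  assumes regular: "AE x in M\<Omega>. \<bar>u0 x\<bar> \<noteq> k"
  shows "(\<lambda>n. \<integral>x. flux n x \<bullet> (flux_coeff k M n x *\<^sub>R truncated_grad k x) \<partial>M\<Omega>) \<longlonglongrightarrow> 0"
proof -
  have level_nonneg: "0 \<le> 2 * M" using M_pos by simp
  have flux_bound: "L2_norm M\<Omega> (\<lambda>x. below (2 * M) (u n x) *\<^sub>R flux n x) \<le> 4 * \<alpha> (2 * M) * B" for n
    by (rule order_trans[OF truncated_flux_L2_norm_le[OF level_nonneg g_square_integrable]])
      (use \<alpha>_pos[OF level_nonneg] g_bound in \<open>simp add: mult_left_mono\<close>)
  have "(\<lambda>n. \<integral>x. (below (2 * M) (u n x) *\<^sub>R flux n x) \<bullet> (flux_coeff k M n x *\<^sub>R truncated_grad k x) \<partial>M\<Omega>)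
      \<longlonglongrightarrow> 0"
  proof (rule integral_inner_dominated_tendsto_zero[OF
        truncated_flux_square_integrable[OF level_nonneg g_square_integrable] flux_bound
        square_integrable_scaleR[OF truncated_grad_square_integrable]])
    show "AE x in M\<Omega>. norm (flux_coeff k M n x *\<^sub>R truncated_grad k x)
        \<le> norm ((rate k * bent_bound k) *\<^sub>R truncated_grad k x)" for n
      unfolding norm_scaleR using order_trans[OF abs_flux_coeff_le abs_ge_self]
      by (intro AE_I2 mult_right_mono) auto
  qed (measurable, rule flux_coeff_truncated_grad_tendsto[OF regular])
  moreover have "flux n x \<bullet> (flux_coeff k M n x *\<^sub>R truncated_grad k x)
      = (below (2 * M) (u n x) *\<^sub>R flux n x) \<bullet> (flux_coeff k M n x *\<^sub>R truncated_grad k x)" for n x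
    by (rule flux_inner_eq_truncated) (simp add: flux_coeff_eq_0)
  ultimately show ?thesis by (simp only:)
qed

end

lemma weighted_limit_flux_bound:
  assumes k: "R \<le> k"
  shows "x \<in> \<Omega> \<Longrightarrow> norm (weighted_limit_flux k n x) \<le> bent_bound k * (4 * \<alpha> k) * norm (truncated_grad k x)"
    and "square_integrable M\<Omega> (weighted_limit_flux k n)"
proof -
  have k_nonneg: "0 \<le> k" using k_pos[OF k] by simp
  show "norm (weighted_limit_flux k n x) \<le> bent_bound k * (4 * \<alpha> k) * norm (truncated_grad k x)" if "x \<in> \<Omega>"
    unfolding weighted_limit_flux_def norm_scaleR[of "weight k n x"] mult.assoc[of "bent_bound k"]
    using norm_truncated_flux_le[OF k_nonneg truncated_grad_square_integrable that]
    by (intro mult_mono abs_weight_le[OF k] bent_bound_nonneg[OF k]) auto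
  show "square_integrable M\<Omega> (weighted_limit_flux k n)"
    unfolding weighted_limit_flux_def[abs_def]
    by (rule square_integrable_bounded_scaleR[OF truncated_flux_square_integrable[OF k_nonneg
        truncated_grad_square_integrable]
          weight_measurable abs_weight_le[OF k]])
qed

lemma weighted_limit_flux_tendsto:
  assumes k: "R \<le> k" and regular: "AE x in M\<Omega>. \<bar>u0 x\<bar> \<noteq> k"
  shows "AE x in M\<Omega>. (\<lambda>n. weighted_limit_flux k n x) \<longlonglongrightarrow> rate k *\<^sub>R jxi x (u0 x) (truncated_grad k x)"
  using below_eventually_eq[OF regular] weight_tendsto[OF k] u_AE_tendsto AE_space
proof eventually_elim
  case (elim x)
  then have x: "x \<in> \<Omega>" by simp
  show ?case
  proof (cases "u0 x \<in> {-k..k}")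
    case True
    have "(\<lambda>n. (u n x, truncated_grad k x)) \<longlonglongrightarrow> (u0 x, truncated_grad k x)" by (intro tendsto_intros elim)
    from continuous_on_tendsto_compose[OF jxi_continuous[OF x] this]
    have "(\<lambda>n. weight k n x *\<^sub>R jxi x (u n x) (truncated_grad k x))
        \<longlonglongrightarrow> rate k *\<^sub>R jxi x (u0 x) (truncated_grad k x)"
      by (intro tendsto_scaleR elim) simp
    moreover have "\<forall>\<^sub>F n in sequentially. weight k n x *\<^sub>R jxi x (u n x) (truncated_grad k x)
        = weighted_limit_flux k n x"
      using elim(1) by eventually_elim (use True in \<open>simp add: weighted_limit_flux_def\<close>)
    ultimately show ?thesis by (rule Lim_transform_eventually)
  next
    case False
    then have "truncated_grad k x = 0" by (simp add: truncated_grad_def)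
    then show ?thesis by (simp add: weighted_limit_flux_def jxi_zero[OF x])
  qed
qed

lemma weighted_limit_flux_integral_tendsto:
  assumes k: "R \<le> k" and regular: "AE x in M\<Omega>. \<bar>u0 x\<bar> \<noteq> k"
  shows "(\<lambda>n. \<integral>x. (g n x - truncated_grad k x) \<bullet> weighted_limit_flux k n x \<partial>M\<Omega>) \<longlonglongrightarrow> 0"
proof -
  let ?A = "\<lambda>x. rate k *\<^sub>R jxi x (u0 x) (truncated_grad k x)" and ?C = "bent_bound k * (4 * \<alpha> k)"
  note in_L2 = square_integrable_diff[OF g_square_integrable truncated_grad_square_integrable[of k]]
  have C: "0 \<le> ?C" using bent_bound_nonneg[OF k] \<alpha>_pos[of k] k_pos[OF k] by simp
  have "(\<lambda>n. \<integral>x. (g n x - truncated_grad k x) \<bullet> weighted_limit_flux k n x \<partial>M\<Omega>)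
      \<longlonglongrightarrow> (\<integral>x. (g0 x - truncated_grad k x) \<bullet> ?A x \<partial>M\<Omega>)"
  proof (rule L2_weakly_tendsto_inner_dominated[OF in_L2])
    show "L2_norm M\<Omega> (\<lambda>x. g n x - truncated_grad k x) \<le> B + L2_norm M\<Omega> (truncated_grad k)" for n
      by (rule order_trans[OF L2_norm_triangle_ineq4[OF g_square_integrable
          truncated_grad_square_integrable]])
        (simp add: g_bound)
    show "L2_weakly_tendsto M\<Omega> (\<lambda>n x. g n x - truncated_grad k x) (\<lambda>x. g0 x - truncated_grad k x)"
      by (intro L2_weakly_tendsto_diff L2_weakly_tendsto_const g_square_integrable g0_square_integrable
          truncated_grad_square_integrable g_weakly_tendsto)
    show "square_integrable M\<Omega> (\<lambda>x. ?C *\<^sub>R truncated_grad k x)"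
      by (rule square_integrable_scaleR[OF truncated_grad_square_integrable])
    show "weighted_limit_flux k n \<in> borel_measurable M\<Omega>" for n
      by (rule square_integrable_measurable[OF weighted_limit_flux_bound(2)[OF k]])
    show "?A \<in> borel_measurable M\<Omega>"
      by (intro borel_measurable_scaleR borel_measurable_const jxi_measurable u0_measurable
          truncated_grad_measurable)
    show "AE x in M\<Omega>. norm (weighted_limit_flux k n x) \<le> norm (?C *\<^sub>R truncated_grad k x)" for n
      unfolding norm_scaleR abs_of_nonneg[OF C] using weighted_limit_flux_bound(1)[OF k]
      by (intro AE_I2) simp
  qed (rule weighted_limit_flux_tendsto[OF k regular])
  moreover have "(g0 x - truncated_grad k x) \<bullet> ?A x = 0" if "x \<in> \<Omega>" for x
    using jxi_zero[OF that] by (cases "u0 x \<in> {-k..k}") (auto simp: truncated_grad_def)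
  then have "(\<integral>x. (g0 x - truncated_grad k x) \<bullet> ?A x \<partial>M\<Omega>) = 0" by (intro integral_eq_zero_AE AE_I2) simp
  ultimately show ?thesis by (simp only:)
qed

context
  fixes k M :: real
  assumes k: "R \<le> k" and M: "1 \<le> M" "k \<le> M"
begin

lemma gap_integral_le:
  "(\<integral>x. gap k n x \<partial>M\<Omega>) \<le> (\<integral>x. js x (u n x) (g n x) * cutoff_test k M n x \<partial>M\<Omega>)
    + (\<integral>x. flux n x \<bullet> cutoff_test_grad k M n x \<partial>M\<Omega>)
    + (\<integral>x. flux n x \<bullet> (flux_coeff k M n x *\<^sub>R truncated_grad k x) \<partial>M\<Omega>)
    + (\<integral>x. bent k n x * ramp_slope M (u n x) * energy n x \<partial>M\<Omega>)
    - (\<integral>x. (g n x - truncated_grad k x) \<bullet> weighted_limit_flux k n x \<partial>M\<Omega>)"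
    (is "_ \<le> integral\<^sup>L _ ?js + integral\<^sup>L _ ?h + integral\<^sup>L _ ?l + integral\<^sup>L _ ?r - integral\<^sup>L _ ?w")
proof -
  note in_H01 = H01_grad_cutoff_test[OF k M]
  have integrable: "integrable M\<Omega> ?js" "integrable M\<Omega> ?h" "integrable M\<Omega> ?l" "integrable M\<Omega> ?r"
    "integrable M\<Omega> ?w"
  proof -
    show "integrable M\<Omega> ?js" by (rule js_cutoff_test_integrable[OF k M])
    show "integrable M\<Omega> ?h"
      by (rule flux_inner_integrable[OF k M H01_grad_square_integrable(2)[OF in_H01]
          cutoff_test_grad_eq_0[OF k M]])
    show "integrable M\<Omega> ?l"
      using flux_coeff_eq_0[OF k M]
      by (intro flux_inner_integrable[OF k M]
          square_integrable_bounded_scaleR[OF truncated_grad_square_integrable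
            flux_coeff_measurable abs_flux_coeff_le[OF k M]]) simp
    show "integrable M\<Omega> ?r" by (rule ramp_energy_integrable[OF k M])
    show "integrable M\<Omega> ?w"
      by (intro integrable_inner_square_integrable square_integrable_diff g_square_integrable
          truncated_grad_square_integrable weighted_limit_flux_bound(2)[OF k])
  qed
  have "(\<integral>x. gap k n x \<partial>M\<Omega>) \<le> (\<integral>x. ?js x + ?h x + ?l x + ?r x - ?w x \<partial>M\<Omega>)"
  proof (rule integral_mono)
    show "integrable M\<Omega> (gap k n)" using k_pos[OF k] by (intro gap_integrable) simp
    show "integrable M\<Omega> (\<lambda>x. ?js x + ?h x + ?l x + ?r x - ?w x)"
      by (intro Bochner_Integration.integrable_diff Bochner_Integration.integrable_add integrable)
    show "gap k n x \<le> ?js x + ?h x + ?l x + ?r x - ?w x" if "x \<in> space M\<Omega>" for x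
      using gap_le_below[OF k M, of x n] gap_le_above[OF k M, of x n] that by (cases "\<bar>u n x\<bar> \<le> k") auto
  qed
  also have "\<dots> = integral\<^sup>L M\<Omega> ?js + integral\<^sup>L M\<Omega> ?h + integral\<^sup>L M\<Omega> ?l + integral\<^sup>L M\<Omega> ?r
      - integral\<^sup>L M\<Omega> ?w"
    by (simp only: integrable Bochner_Integration.integral_diff Bochner_Integration.integral_add
        Bochner_Integration.integrable_add)
  finally show ?thesis .
qed

lemma cutoff_test_equation_le:
  "(\<integral>x. js x (u n x) (g n x) * cutoff_test k M n x \<partial>M\<Omega>) + (\<integral>x. flux n x \<bullet> cutoff_test_grad k M n x \<partial>M\<Omega>)
    \<le> (\<integral>x. F x \<bullet> (cutoff_test k M n x, cutoff_test_grad k M n x) \<partial>M\<Omega>)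
      + \<delta> n * L2_norm M\<Omega> (\<lambda>x. (cutoff_test k M n x, cutoff_test_grad k M n x))"
proof -
  let ?C = "max (bent_bound k) (2 * M)"
  have v_le: "\<bar>cutoff_test k M n x\<bar> \<le> ?C" for x using abs_cutoff_test_le[OF k M, of n x] by simp
  have u_le: "cutoff_test k M n x \<noteq> 0 \<Longrightarrow> \<bar>u n x\<bar> \<le> ?C" for x
    using cutoff_test_eq_0[OF k M, of n x] by (cases "2 * M < \<bar>u n x\<bar>") auto
  show ?thesis by (rule equation_le[OF H01_grad_cutoff_test[OF k M] v_le u_le])
qed

lemma truncated_gap_integral_le:
  assumes regular: "AE x in M\<Omega>. \<bar>u0 x\<bar> \<noteq> k" and C: "\<And>n. (\<integral>x. above M (u n x) * energy n x \<partial>M\<Omega>) \<le> C"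
  shows "\<exists>e. e \<longlonglongrightarrow> 0 \<and> (\<forall>n. (\<integral>x. gap k n x \<partial>M\<Omega>) \<le> 2 * bent_bound k * C / M + e n)"
proof -
  let ?F = "\<lambda>n. \<integral>x. F x \<bullet> (cutoff_test k M n x, cutoff_test_grad k M n x) \<partial>M\<Omega>"
  let ?l = "\<lambda>n. \<integral>x. flux n x \<bullet> (flux_coeff k M n x *\<^sub>R truncated_grad k x) \<partial>M\<Omega>"
  let ?w = "\<lambda>n. \<integral>x. (g n x - truncated_grad k x) \<bullet> weighted_limit_flux k n x \<partial>M\<Omega>"
  obtain N where N: "\<And>n. L2_norm M\<Omega> (\<lambda>x. (cutoff_test k M n x, cutoff_test_grad k M n x)) \<le> N"
    by (rule cutoff_test_L2_bounded[OF k M]) (rule that)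
  have "(\<lambda>n. ?F n + \<delta> n * N + ?l n - ?w n) \<longlonglongrightarrow> 0 + 0 * N + 0 - 0"
    by (intro tendsto_intros cutoff_test_functional_tendsto[OF k M] \<delta>_tendsto
        flux_coeff_integral_tendsto[OF k M regular]
        weighted_limit_flux_integral_tendsto[OF k regular])
  moreover have "(\<integral>x. gap k n x \<partial>M\<Omega>) \<le> 2 * bent_bound k * C / M + (?F n + \<delta> n * N + ?l n - ?w n)" for n
  proof -
    have "(\<integral>x. bent k n x * ramp_slope M (u n x) * energy n x \<partial>M\<Omega>) \<le> 2 * bent_bound k / M * C"
      using bent_bound_nonneg[OF k] M(1)
      by (intro order_trans[OF ramp_energy_le[OF k M]] mult_left_mono C) auto
    then show ?thesis
      using gap_integral_le[of n] cutoff_test_equation_le[of n] mult_left_mono[OF N[of n] \<delta>_nonneg[of n]]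
      by simp
  qed
  ultimately show ?thesis by (intro exI[of _ "\<lambda>n. ?F n + \<delta> n * N + ?l n - ?w n"]) simp
qed

end

lemma truncated_gap_tendsto:
  assumes k: "R \<le> k" and regular: "AE x in M\<Omega>. \<bar>u0 x\<bar> \<noteq> k"
  shows "(\<lambda>n. \<integral>x. gap k n x \<partial>M\<Omega>) \<longlonglongrightarrow> 0"
proof (rule tendsto_zero_if_le_eps_plus_null)
  show "0 \<le> (\<integral>x. gap k n x \<partial>M\<Omega>)" for n by (intro integral_nonneg_AE AE_I2) (simp add: gap_nonneg)
  fix e :: real assume "0 < e"
  obtain C where C: "0 \<le> C" "\<And>n k. R \<le> k \<Longrightarrow> (\<integral>x. above k (u n x) * energy n x \<partial>M\<Omega>) \<le> C"
    by (rule tail_energy_bounded) (rule that)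
  define M where "M = max (max 1 k) (2 * bent_bound k * C / e)"
  have M: "1 \<le> M" "k \<le> M" "2 * bent_bound k * C / e \<le> M" by (auto simp: M_def)
  then have "2 * bent_bound k * C / M \<le> e" using \<open>0 < e\<close> by (simp add: divide_le_eq mult.commute)
  moreover obtain b where "b \<longlonglongrightarrow> 0" "\<And>n. (\<integral>x. gap k n x \<partial>M\<Omega>) \<le> 2 * bent_bound k * C / M + b n"
    using truncated_gap_integral_le[OF k M(1,2) regular C(2)] k M(2) by (metis order_trans)
  ultimately show "\<exists>b. b \<longlonglongrightarrow> 0 \<and> (\<forall>n. (\<integral>x. gap k n x \<partial>M\<Omega>) \<le> e + b n)" by (meson add_right_mono order_trans)
qed

end

section \<open>Convergence of the gradients\<close>

lemma power2_le_if_quadratic_le: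
  fixes G X :: real
  assumes a: "0 < a" and quadratic: "a * G\<^sup>2 \<le> p + b * G * X"
  shows "G\<^sup>2 \<le> 2 / a * p + (b / a)\<^sup>2 * X\<^sup>2"
proof -
  have "0 \<le> (a * G - b * X)\<^sup>2" by simp
  moreover have "2 * a * (a * G\<^sup>2) \<le> 2 * a * (p + b * G * X)" using quadratic a
    by (intro mult_left_mono) auto
  ultimately have "a\<^sup>2 * G\<^sup>2 \<le> 2 * a * p + b\<^sup>2 * X\<^sup>2" by (simp add: power2_eq_square algebra_simps)
  then have "G\<^sup>2 \<le> (2 * a * p + b\<^sup>2 * X\<^sup>2) / a\<^sup>2" using a by (simp add: pos_le_divide_eq mult.commute)
  also have "\<dots> = 2 / a * p + (b / a)\<^sup>2 * X\<^sup>2" using a by (simp add: add_divide_distrib power2_eq_square)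
  finally show ?thesis .
qed

lemma (in finite_measure) AE_noteq_outside_countable:
  fixes f :: "'a \<Rightarrow> real"
  assumes f: "f \<in> borel_measurable M"
  obtains D where "countable D" "\<And>c. c \<notin> D \<Longrightarrow> AE x in M. f x \<noteq> c"
proof
  interpret distr: finite_measure "distr M borel f" by (rule finite_measure_distr[OF f])
  show "countable {c. measure (distr M borel f) {c} \<noteq> 0}" by (rule distr.countable_support)
  fix c assume "c \<notin> {c. measure (distr M borel f) {c} \<noteq> 0}"
  then have "f -` {c} \<inter> space M \<in> null_sets M"
    using measurable_sets[OF f, of "{c}"] f by (simp add: measure_distr null_sets_def emeasure_eq_measure)
  from AE_not_in[OF this] AE_space show "AE x in M. f x \<noteq> c" by eventually_elim auto
qed

lemma L2_norm_above_levels_tendsto_zero: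
  assumes f: "square_integrable M f" and [measurable]: "u \<in> borel_measurable M" and K: "\<And>m. real m \<le> K m"
  shows "(\<lambda>m. L2_norm M (\<lambda>x. above (K m) (u x) *\<^sub>R f x)) \<longlonglongrightarrow> 0"
proof -
  have "(\<lambda>m. above (K m) s) \<longlonglongrightarrow> (0::real)" for s
  proof (rule tendsto_eventually)
    obtain N :: nat where N: "\<bar>s\<bar> < real N" using reals_Archimedean2 by blast
    show "\<forall>\<^sub>F m in sequentially. above (K m) s = (0::real)" using eventually_ge_at_top[of N]
    proof eventually_elim
      case (elim m)
      then have "\<bar>s\<bar> \<le> K m" using N K[of m] by linarith
      then show ?case by (simp add: indicator_def abs_le_iff)
    qed
  qed
  then have lim: "AE x in M. (\<lambda>m. above (K m) (u x) *\<^sub>R f x) \<longlonglongrightarrow> 0"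
    using tendsto_scaleR[OF _ tendsto_const] by (intro AE_I2) fastforce
  have "L2_tendsto M (\<lambda>m x. above (K m) (u x) *\<^sub>R f x) (\<lambda>x. 0)"
  proof (rule L2_dominated_convergence(2)[OF f _ _ _ lim])
    show "(\<lambda>x. above (K m) (u x) *\<^sub>R f x) \<in> borel_measurable M" for m
      by (rule square_integrable_measurable[OF square_integrable_indicator_scaleR[OF f]]) measurable
  qed (auto simp: indicator_def)
  from L2_tendstoD[OF this] show ?thesis by simp
qed

context approximate_solutions
begin

lemma regular_levels:
  obtains K where "\<And>m. R \<le> K m" "\<And>m::nat. real m \<le> K m" "\<And>m. AE x in M\<Omega>. \<bar>u0 x\<bar> \<noteq> K m"
proof -
  have "(\<lambda>x. \<bar>u0 x\<bar>) \<in> borel_measurable M\<Omega>" by measurable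
  then obtain D where D: "countable D" "\<And>c. c \<notin> D \<Longrightarrow> AE x in M\<Omega>. \<bar>u0 x\<bar> \<noteq> c"
    by (rule AE_noteq_outside_countable) (rule that)
  have "\<exists>c. R + real m < c \<and> c \<notin> D" for m
  proof -
    have "\<not> {R + real m<..<R + real m + 1} \<subseteq> D"
      using uncountable_open_interval[of "R + real m" "R + real m + 1"] countable_subset[OF _ D(1)] by auto
    then show ?thesis by auto
  qed
  then obtain K where K: "\<And>m. R + real m < K m" "\<And>m. K m \<notin> D" by metis
  show thesis
  proof (rule that[OF _ _ D(2)[OF K(2)]])
    show "R \<le> K m" "real m \<le> K m" for m using K(1)[of m] R_pos by linarith+
  qed
qed

lemma gradient_le_gap:
  assumes x: "x \<in> \<Omega>" and u: "\<bar>u n x\<bar> \<le> k"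
  shows "(norm (g n x))\<^sup>2 \<le> 2 / \<alpha>0 * gap k n x + (8 * \<alpha> k / \<alpha>0)\<^sup>2 * (norm (truncated_grad k x))\<^sup>2"
proof (rule power2_le_if_quadratic_le[OF \<alpha>0_pos])
  let ?\<xi> = "truncated_grad k x"
  let ?A = "flux n x" and ?A' = "jxi x (u n x) ?\<xi>"
  have "below k (u n x) = (1::real)" using u by (auto simp: indicator_def abs_le_iff)
  then have "energy n x = gap k n x + ?A \<bullet> ?\<xi> + ?A' \<bullet> g n x - ?A' \<bullet> ?\<xi>"
    by (simp add: gap_def inner_diff_left inner_diff_right)
  moreover have "?A \<bullet> ?\<xi> \<le> 4 * \<alpha> k * norm (g n x) * norm ?\<xi>"
    using mult_right_mono[OF jxi_growth[OF x u, of "g n x"] norm_ge_zero[of ?\<xi>]]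
    by (intro order_trans[OF norm_cauchy_schwarz])
  moreover have "?A' \<bullet> g n x \<le> 4 * \<alpha> k * norm (g n x) * norm ?\<xi>"
    using mult_right_mono[OF jxi_growth[OF x u, of ?\<xi>] norm_ge_zero[of "g n x"]]
    by (intro order_trans[OF norm_cauchy_schwarz]) (simp add: mult_ac)
  moreover have "0 \<le> ?A' \<bullet> ?\<xi>"
    by (rule order_trans[OF _ jxi_coercive[OF x]]) (use \<alpha>0_pos in simp)
  ultimately show "\<alpha>0 * (norm (g n x))\<^sup>2 \<le> gap k n x + 8 * \<alpha> k * norm (g n x) * norm ?\<xi>"
    using jxi_coercive[OF x, of "g n x" "u n x"] by linarith
qed

lemma truncated_gradient_diff_le:
  assumes x: "x \<in> \<Omega>"
  shows "below k (u n x) * (norm (g n x - truncated_grad k x))\<^sup>2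
    \<le> 4 / \<alpha>0 * gap k n x + (2 * (8 * \<alpha> k / \<alpha>0)\<^sup>2 + 2) * (norm (truncated_grad k x))\<^sup>2"
proof (cases "\<bar>u n x\<bar> \<le> k")
  case True
  then show ?thesis
    using power2_norm_add_le[of "g n x" "- truncated_grad k x"] gradient_le_gap[OF x True]
    by (simp add: indicator_def abs_le_iff algebra_simps)
next
  case False
  have "0 \<le> 4 / \<alpha>0 * gap k n x" using \<alpha>0_pos gap_nonneg[OF x] by simp
  with False show ?thesis by (auto simp: indicator_def)
qed

lemma truncated_gradient_AE_tendsto:
  assumes regular: "AE x in M\<Omega>. \<bar>u0 x\<bar> \<noteq> k" and r: "strict_mono r"
    and gap: "AE x in M\<Omega>. (\<lambda>n. gap k (r n) x) \<longlonglongrightarrow> 0"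
  shows "AE x in M\<Omega>. (\<lambda>n. below k (u (r n) x) * (norm (g (r n) x - truncated_grad k x))\<^sup>2) \<longlonglongrightarrow> 0"
  using gap below_eventually_eq[OF regular] u_AE_tendsto AE_space
proof eventually_elim
  case (elim x)
  then have x: "x \<in> \<Omega>" by simp
  let ?\<xi> = "truncated_grad k x"
  have below: "\<forall>\<^sub>F n in sequentially. u (r n) x \<in> {-k..k} \<longleftrightarrow> u0 x \<in> {-k..k}"
    by (rule eventually_subseq[OF r elim(2)])
  have u: "(\<lambda>n. u (r n) x) \<longlonglongrightarrow> u0 x" using LIMSEQ_subseq_LIMSEQ[OF elim(3) r] by (simp add: o_def)
  show ?case
  proof (cases "u0 x \<in> {-k..k}")
    case True
    have "\<forall>\<^sub>F n in sequentially. gap k (r n) x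
        = (jxi x (u (r n) x) (g (r n) x) - jxi x (u (r n) x) ?\<xi>) \<bullet> (g (r n) x - ?\<xi>)"
      using below by eventually_elim (use True in \<open>simp add: gap_def\<close>)
    then have "(\<lambda>n. g (r n) x) \<longlonglongrightarrow> ?\<xi>"
      by (intro jxi_monotone_gap_imp_tendsto[OF x u] Lim_transform_eventually[OF elim(1)])
    then have lim: "(\<lambda>n. (norm (g (r n) x - ?\<xi>))\<^sup>2) \<longlonglongrightarrow> 0"
      using tendsto_power[OF tendsto_norm[OF LIM_zero], of _ ?\<xi> sequentially 2] by simp
    show ?thesis
      by (rule Lim_null_comparison[OF always_eventually lim]) (simp add: indicator_def)
  next
    case False
    have "\<forall>\<^sub>F n in sequentially. below k (u (r n) x) * (norm (g (r n) x - ?\<xi>))\<^sup>2 = 0"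
      using below by eventually_elim (use False in simp)
    then show ?thesis by (rule tendsto_eventually)
  qed
qed

lemma truncated_gradient_tendsto:
  assumes k: "R \<le> k" and regular: "AE x in M\<Omega>. \<bar>u0 x\<bar> \<noteq> k"
  shows "(\<lambda>n. \<integral>x. below k (u n x) * (norm (g n x - truncated_grad k x))\<^sup>2 \<partial>M\<Omega>) \<longlonglongrightarrow> 0"
proof (rule integral_tendsto_zero_if_L1_controlled)
  let ?\<xi> = "truncated_grad k"
  have gap: "integrable M\<Omega> (gap k n)" for n using k_pos[OF k] by (intro gap_integrable) simp
  show "integrable M\<Omega> (\<lambda>x. 4 / \<alpha>0 * gap k n x)" for n by (rule integrable_mult_right[OF gap])
  show "(\<lambda>n. \<integral>x. 4 / \<alpha>0 * gap k n x \<partial>M\<Omega>) \<longlonglongrightarrow> 0"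
    using tendsto_mult_right_zero[OF truncated_gap_tendsto[OF k regular], of "4 / \<alpha>0"] by simp
  show "integrable M\<Omega> (\<lambda>x. (2 * (8 * \<alpha> k / \<alpha>0)\<^sup>2 + 2) * (norm (?\<xi> x))\<^sup>2)"
    by (intro integrable_mult_right square_integrable_integrable_power2 truncated_grad_square_integrable)
  show "AE x in M\<Omega>. below k (u n x) * (norm (g n x - ?\<xi> x))\<^sup>2
      \<le> 4 / \<alpha>0 * gap k n x + (2 * (8 * \<alpha> k / \<alpha>0)\<^sup>2 + 2) * (norm (?\<xi> x))\<^sup>2" for n
    by (intro AE_I2 truncated_gradient_diff_le) simp
  show "AE x in M\<Omega>. 0 \<le> 4 / \<alpha>0 * gap k n x" for n
    using gap_nonneg \<alpha>0_pos by (intro AE_I2) simp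
  fix r :: "nat \<Rightarrow> nat" assume r: "strict_mono r"
  assume "AE x in M\<Omega>. (\<lambda>n. 4 / \<alpha>0 * gap k (r n) x) \<longlonglongrightarrow> 0"
  then have "AE x in M\<Omega>. (\<lambda>n. gap k (r n) x) \<longlonglongrightarrow> 0"
  proof eventually_elim
    case (elim x)
    from tendsto_mult_right_zero[OF elim, of "\<alpha>0 / 4"] show ?case using \<alpha>0_pos by simp
  qed
  then show "AE x in M\<Omega>. (\<lambda>n. below k (u (r n) x) * (norm (g (r n) x - ?\<xi> x))\<^sup>2) \<longlonglongrightarrow> 0"
    by (rule truncated_gradient_AE_tendsto[OF regular r])
qed simp_all

lemma L2_norm_above_tendsto:
  assumes f: "square_integrable M\<Omega> f" and regular: "AE x in M\<Omega>. \<bar>u0 x\<bar> \<noteq> k"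
  shows "(\<lambda>n. L2_norm M\<Omega> (\<lambda>x. above k (u n x) *\<^sub>R f x)) \<longlonglongrightarrow> L2_norm M\<Omega> (\<lambda>x. above k (u0 x) *\<^sub>R f x)"
proof -
  have in_L2: "square_integrable M\<Omega> (\<lambda>x. above k (v x) *\<^sub>R f x)" if "v \<in> borel_measurable M\<Omega>" for v
    by (rule square_integrable_indicator_scaleR[OF f that]) simp
  have lim: "AE x in M\<Omega>. (\<lambda>n. above k (u n x) *\<^sub>R f x) \<longlonglongrightarrow> above k (u0 x) *\<^sub>R f x"
    using below_eventually_eq[OF regular]
  proof eventually_elim
    case (elim x)
    have "\<forall>\<^sub>F n in sequentially. above k (u n x) *\<^sub>R f x = above k (u0 x) *\<^sub>R f x"
      using elim by eventually_elim (auto simp: indicator_def)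
    then show ?case by (rule tendsto_eventually)
  qed
  have "L2_tendsto M\<Omega> (\<lambda>n x. above k (u n x) *\<^sub>R f x) (\<lambda>x. above k (u0 x) *\<^sub>R f x)"
    by (rule L2_dominated_convergence(2)[OF f square_integrable_measurable[OF in_L2[OF u_measurable]]
          square_integrable_measurable[OF in_L2[OF u0_measurable]] _ lim]) (simp add: indicator_def)
  then show ?thesis by (rule L2_tendsto_norm[OF in_L2[OF u_measurable] in_L2[OF u0_measurable]])
qed

lemma gradient_diff_le:
  assumes x: "x \<in> \<Omega>"
  shows "(norm (g n x - g0 x))\<^sup>2 \<le> 2 * (below k (u n x) * (norm (g n x - truncated_grad k x))\<^sup>2)
    + 2 * (norm (above k (u0 x) *\<^sub>R g0 x))\<^sup>2 + 2 / \<alpha>0 * (above k (u n x) * energy n x)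
    + 2 * (norm (above k (u n x) *\<^sub>R g0 x))\<^sup>2"
proof (cases "u n x \<in> {-k..k}")
  case True
  have "(norm (g n x - g0 x))\<^sup>2 \<le> 2 * (norm (g n x - truncated_grad k x))\<^sup>2
      + 2 * (norm (truncated_grad k x - g0 x))\<^sup>2"
    using power2_norm_add_le[of "g n x - truncated_grad k x" "truncated_grad k x - g0 x"] by simp
  moreover have "norm (truncated_grad k x - g0 x) = norm (above k (u0 x) *\<^sub>R g0 x)"
    by (simp add: truncated_grad_def indicator_def)
  ultimately show ?thesis using True by simp
next
  case False
  have "(norm (g n x - g0 x))\<^sup>2 \<le> 2 * (norm (g n x))\<^sup>2 + 2 * (norm (g0 x))\<^sup>2"
    using power2_norm_add_le[of "g n x" "- g0 x"] by simp
  moreover have "2 * (norm (g n x))\<^sup>2 \<le> 2 / \<alpha>0 * energy n x"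
    using jxi_coercive[OF x, of "g n x" "u n x"] \<alpha>0_pos by (simp add: pos_le_divide_eq mult.commute)
  moreover have "0 \<le> (norm (above k (u0 x) *\<^sub>R g0 x))\<^sup>2" by (rule zero_le_power2)
  moreover have "below k (u n x) = (0::real)" "above k (u n x) = (1::real)" using False by simp_all
  ultimately show ?thesis by (simp only: mult_zero_left mult_1_left scaleR_one)
qed

lemma gradient_L2_diff_le:
  assumes k: "R \<le> k"
  shows "(L2_norm M\<Omega> (\<lambda>x. g n x - g0 x))\<^sup>2
    \<le> 2 * (\<integral>x. below k (u n x) * (norm (g n x - truncated_grad k x))\<^sup>2 \<partial>M\<Omega>)
      + 2 * (L2_norm M\<Omega> (\<lambda>x. above k (u0 x) *\<^sub>R g0 x))\<^sup>2
      + 2 / \<alpha>0 * (B * (\<delta> n + L2_norm M\<Omega> (\<lambda>x. above k (u n x) *\<^sub>R F x)))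
      + 2 * (L2_norm M\<Omega> (\<lambda>x. above k (u n x) *\<^sub>R g0 x))\<^sup>2"
proof -
  let ?b = "\<lambda>x. below k (u n x) * (norm (g n x - truncated_grad k x))\<^sup>2"
    and ?e = "\<lambda>x. above k (u n x) * energy n x"
  let ?l = "\<lambda>x. (norm (above k (u0 x) *\<^sub>R g0 x))\<^sup>2" and ?t = "\<lambda>x. (norm (above k (u n x) *\<^sub>R g0 x))\<^sup>2"
  have truncated: "integrable M\<Omega> ?b"
    by (rule Bochner_Integration.integrable_bound[OF square_integrable_integrable_power2[OF
            square_integrable_diff[OF g_square_integrable[of n] truncated_grad_square_integrable[of k]]]])
      (auto simp: indicator_def)
  have limit_tail: "integrable M\<Omega> ?l" and solution_tail: "integrable M\<Omega> ?t"
    by (intro square_integrable_integrable_power2 square_integrable_indicator_scaleR g0_square_integrable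
        u_measurable u0_measurable, simp)+
  have energy: "integrable M\<Omega> ?e" by (rule energy_indicator_integrable) simp
  have "(L2_norm M\<Omega> (\<lambda>x. g n x - g0 x))\<^sup>2 \<le> (\<integral>x. 2 * ?b x + 2 * ?l x + 2 / \<alpha>0 * ?e x + 2 * ?t x \<partial>M\<Omega>)"
    unfolding L2_norm_power2
    by (intro integral_mono square_integrable_integrable_power2 square_integrable_diff g_square_integrable
        g0_square_integrable Bochner_Integration.integrable_add integrable_mult_right truncated limit_tail
          energy solution_tail gradient_diff_le) simp
  also have "\<dots> = 2 * (\<integral>x. ?b x \<partial>M\<Omega>) + 2 * (\<integral>x. ?l x \<partial>M\<Omega>) + 2 / \<alpha>0 * (\<integral>x. ?e x \<partial>M\<Omega>) + 2 * (\<integral>x. ?t x \<partial>M\<Omega>)"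
    using truncated limit_tail energy solution_tail by (simp del: norm_scaleR)
  also have "2 / \<alpha>0 * (\<integral>x. ?e x \<partial>M\<Omega>) \<le> 2 / \<alpha>0 * (B * (\<delta> n + L2_norm M\<Omega> (\<lambda>x. above k (u n x) *\<^sub>R F x)))"
    using \<alpha>0_pos by (intro mult_left_mono tail_energy_le k) simp
  finally show ?thesis by (simp only: L2_norm_power2)
qed

lemma gradient_L2_tendsto: "L2_tendsto M\<Omega> g g0"
proof -
  obtain K where K: "\<And>m. R \<le> K m" "\<And>m::nat. real m \<le> K m" and regular: "\<And>m. AE x in M\<Omega>. \<bar>u0 x\<bar> \<noteq> K m"
    by (rule regular_levels) (rule that)
  let ?G = "\<lambda>v m. L2_norm M\<Omega> (\<lambda>x. above (K m) (v x) *\<^sub>R g0 x)"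
    and ?F = "\<lambda>v m. L2_norm M\<Omega> (\<lambda>x. above (K m) (v x) *\<^sub>R F x)"
  let ?I = "\<lambda>m n. \<integral>x. below (K m) (u n x) * (norm (g n x - truncated_grad (K m) x))\<^sup>2 \<partial>M\<Omega>"
  define b where "b m n = 2 * ?I m n + 2 * (?G u0 m)\<^sup>2 + 2 / \<alpha>0 * (B * (\<delta> n + ?F (u n) m))
      + 2 * (?G (u n) m)\<^sup>2" for m n
  define l where "l m = 2 * 0 + 2 * (?G u0 m)\<^sup>2 + 2 / \<alpha>0 * (B * (0 + ?F u0 m)) + 2 * (?G u0 m)\<^sup>2" for m
  have b_tendsto: "b m \<longlonglongrightarrow> l m" for m
    unfolding b_def[abs_def] l_def
    by (intro tendsto_intros truncated_gradient_tendsto[OF K(1) regular] \<delta>_tendsto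
        L2_norm_above_tendsto[OF F_square_integrable regular]
          L2_norm_above_tendsto[OF g0_square_integrable regular])
  have "l \<longlonglongrightarrow> 2 * 0 + 2 * 0\<^sup>2 + 2 / \<alpha>0 * (B * (0 + 0)) + 2 * 0\<^sup>2"
    unfolding l_def[abs_def]
    by (intro tendsto_intros L2_norm_above_levels_tendsto_zero[OF F_square_integrable u0_measurable K(2)]
        L2_norm_above_levels_tendsto_zero[OF g0_square_integrable u0_measurable K(2)])
  then have l_tendsto: "l \<longlonglongrightarrow> 0" by simp
  have "(\<lambda>n. (L2_norm M\<Omega> (\<lambda>x. g n x - g0 x))\<^sup>2) \<longlonglongrightarrow> 0"
  proof (rule tendsto_zero_if_le_eps_plus_null)
    fix e :: real assume "0 < e"
    then obtain m where m: "l m < e"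
      using order_tendstoD(2)[OF l_tendsto] eventually_happens'[OF sequentially_bot] by blast
    have "(\<lambda>n. b m n - l m) \<longlonglongrightarrow> 0" by (rule LIM_zero[OF b_tendsto])
    moreover have "(L2_norm M\<Omega> (\<lambda>x. g n x - g0 x))\<^sup>2 \<le> e + (b m n - l m)" for n
      using gradient_L2_diff_le[OF K(1)[of m], of n] m unfolding b_def by linarith
    ultimately show "\<exists>b. b \<longlonglongrightarrow> 0 \<and> (\<forall>n. (L2_norm M\<Omega> (\<lambda>x. g n x - g0 x))\<^sup>2 \<le> e + b n)" by blast
  qed simp
  from tendsto_real_sqrt[OF this] show ?thesis by (simp add: L2_tendsto_def L2_norm_nonneg)
qed

end

context quasilinear_integrand
begin

lemma weak_formulation_imp_approximate_weak_solution:
  assumes U: "H01 \<Omega> U" and W: "Hm1 \<Omega> W" and w: "Hm1 \<Omega> w"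
    and F: "\<And>v h. H01_grad v h \<Longrightarrow> w v = (\<integral>x. F x \<bullet> (v x, h x) \<partial>M\<Omega>)"
    and eq: "\<And>v. v \<in> Vset \<Omega> U \<Longrightarrow> (LINT x:\<Omega>|lebesgue. js x (U x) (wgrad \<Omega> U x) * v x)
        + (LINT x:\<Omega>|lebesgue. jxi x (U x) (wgrad \<Omega> U x) \<bullet> wgrad \<Omega> v x) = W v"
  shows "approximate_weak_solution F (hm1norm \<Omega> (\<lambda>v. W v - w v)) U (wgrad \<Omega> U)"
  unfolding approximate_weak_solution_def
proof (intro allI impI)
  fix v h C assume v: "H01_grad v h" and bounds: "\<forall>x. \<bar>v x\<bar> \<le> C" "\<forall>x. v x \<noteq> 0 \<longrightarrow> \<bar>U x\<bar> \<le> C"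
  note U_in_H01 = H01_imp_H01_grad[OF U] and v_in_H01 = H01_imp_H01_grad[OF H01_grad_imp_H01[OF v]]
  have [measurable]: "(\<lambda>x. jxi x (U x) (wgrad \<Omega> U x)) \<in> borel_measurable M\<Omega>"
    by (intro jxi_measurable square_integrable_measurable H01_grad_square_integrable(1,2)[OF U_in_H01])
  have [measurable]: "wgrad \<Omega> v \<in> borel_measurable M\<Omega>" "h \<in> borel_measurable M\<Omega>"
    by (intro square_integrable_measurable H01_grad_square_integrable(2)[OF v_in_H01]
        H01_grad_square_integrable(2)[OF v])+
  have "v \<in> Vset \<Omega> U"
    unfolding Vset_def using H01_grad_imp_H01[OF v] bounds by (auto intro!: exI[of _ C] AE_I2)
  moreover have "(\<integral>x. jxi x (U x) (wgrad \<Omega> U x) \<bullet> wgrad \<Omega> v x \<partial>M\<Omega>)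
      = (\<integral>x. jxi x (U x) (wgrad \<Omega> U x) \<bullet> h x \<partial>M\<Omega>)"
  proof (rule integral_cong_AE)
    show "AE x in M\<Omega>. jxi x (U x) (wgrad \<Omega> U x) \<bullet> wgrad \<Omega> v x = jxi x (U x) (wgrad \<Omega> U x) \<bullet> h x"
      using H01_grad_imp_wgrad_AE[OF v] by eventually_elim simp
  qed measurable
  ultimately have "(\<integral>x. js x (U x) (wgrad \<Omega> U x) * v x \<partial>M\<Omega>) + (\<integral>x. jxi x (U x) (wgrad \<Omega> U x) \<bullet> h x \<partial>M\<Omega>)
      = W v"
    using eq[of v] unfolding set_integral_domain by simp
  then show "\<bar>(\<integral>x. js x (U x) (wgrad \<Omega> U x) * v x \<partial>M\<Omega>) + (\<integral>x. jxi x (U x) (wgrad \<Omega> U x) \<bullet> h x \<partial>M\<Omega>)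
      - (\<integral>x. F x \<bullet> (v x, h x) \<partial>M\<Omega>)\<bar> \<le> hm1norm \<Omega> (\<lambda>v. W v - w v) * L2_norm M\<Omega> (\<lambda>x. (v x, h x))"
    using Hm1_le_hm1norm[OF Hm1_diff[OF W w] v] F[OF v] by simp
qed

lemma approximate_weak_solution_mono:
  assumes "approximate_weak_solution F \<epsilon> u g" "\<epsilon> \<le> \<epsilon>'" shows "approximate_weak_solution F \<epsilon>' u g"
  using assms(1) mult_right_mono[OF assms(2) L2_norm_nonneg]
  unfolding approximate_weak_solution_def by (meson order_trans)

lemma approximate_weak_solutions_compact:
  fixes U :: "nat \<Rightarrow> 'a \<Rightarrow> real"
  assumes in_H01: "\<And>n. H01_grad (U n) (G n)" and bound: "\<And>n. L2_norm M\<Omega> (\<lambda>x. (U n x, G n x)) \<le> B"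
    and energy: "\<And>n. integrable M\<Omega> (\<lambda>x. jxi x (U n x) (G n x) \<bullet> G n x)" and F: "square_integrable M\<Omega> F"
    and solves: "\<And>n. approximate_weak_solution F (\<delta> n) (U n) (G n)"
    and \<delta>: "\<delta> \<longlonglongrightarrow> 0"
  obtains r u0 g0 where "strict_mono (r::nat\<Rightarrow>nat)" "H01_grad u0 g0"
    "L2_tendsto M\<Omega> (\<lambda>n. U (r n)) u0" "L2_tendsto M\<Omega> (\<lambda>n. G (r n)) g0"
proof -
  obtain r u0 g0 where r: "strict_mono (r::nat\<Rightarrow>nat)" and limit_in_H01: "H01_grad u0 g0"
    and strong: "L2_tendsto M\<Omega> (\<lambda>n. U (r n)) u0" and weak: "L2_weakly_tendsto M\<Omega> (\<lambda>n. G (r n)) g0"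
    by (rule Rellich_Kondrachov[OF in_H01 bound]) (rule that)
  obtain q where q: "strict_mono (q::nat\<Rightarrow>nat)" and AE: "AE x in M\<Omega>. (\<lambda>n. U (r (q n)) x) \<longlonglongrightarrow> u0 x"
    by (rule L2_tendsto_imp_AE_subseq[OF H01_grad_square_integrable(1)[OF in_H01]
        H01_grad_square_integrable(1)[OF limit_in_H01] strong])
      (rule that)
  have rq: "strict_mono (\<lambda>n. r (q n))" using r q by (simp add: strict_mono_def)
  interpret approximate_solutions \<Omega> j js jxi \<alpha> \<beta> \<alpha>0 R "\<lambda>n. U (r (q n))"
    "\<lambda>n. G (r (q n))" u0 g0 F "\<lambda>n. \<bar>\<delta> (r (q n))\<bar>" B
  proof unfold_locales
    show "(\<lambda>n. \<bar>\<delta> (r (q n))\<bar>) \<longlonglongrightarrow> 0"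
      using tendsto_rabs_zero[OF LIMSEQ_subseq_LIMSEQ[OF \<delta> rq]] by (simp add: o_def)
    show "approximate_weak_solution F \<bar>\<delta> (r (q n))\<bar> (U (r (q n))) (G (r (q n)))" for n
      by (rule approximate_weak_solution_mono[OF solves abs_ge_self])
  qed (use in_H01 limit_in_H01 bound energy F AE L2_weakly_tendsto_subseq[OF weak q] in auto)
  show thesis by (rule that[OF rq limit_in_H01 L2_tendsto_subseq[OF strong q] gradient_L2_tendsto])
qed

end

theorem theorem5p1:
  fixes \<Omega> :: "'a::euclidean_space set"
    and j js :: "'a \<Rightarrow> real \<Rightarrow> 'a \<Rightarrow> real"
    and jxi :: "'a \<Rightarrow> real \<Rightarrow> 'a \<Rightarrow> 'a"
    and \<alpha> \<beta> :: "real \<Rightarrow> real" and \<alpha>0 R :: real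
    and U :: "nat \<Rightarrow> 'a \<Rightarrow> real"
    and W :: "nat \<Rightarrow> ('a \<Rightarrow> real) \<Rightarrow> real"
  assumes dim: "DIM('a) \<ge> 3"
    and open_\<Omega>: "open \<Omega>" and bdd_\<Omega>: "bounded \<Omega>"
    and j_meas: "\<And>s \<xi>. set_borel_measurable lebesgue \<Omega> (\<lambda>x. j x s \<xi>)"
    and j_C1: "\<And>x s \<xi>. x \<in> \<Omega> \<Longrightarrow>
        ((\<lambda>(s', \<xi>'). j x s' \<xi>') has_derivative (\<lambda>(ds, d\<xi>). js x s \<xi> * ds + jxi x s \<xi> \<bullet> d\<xi>)) (at (s, \<xi>))"
    and js_cont: "\<And>x. x \<in> \<Omega> \<Longrightarrow> continuous_on UNIV (\<lambda>(s, \<xi>). js x s \<xi>)"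
    and jxi_cont: "\<And>x. x \<in> \<Omega> \<Longrightarrow> continuous_on UNIV (\<lambda>(s, \<xi>). jxi x s \<xi>)"
    and H1: "\<And>x s. x \<in> \<Omega> \<Longrightarrow> strictly_convex_fun (j x s)"
    and \<alpha>0_pos: "\<alpha>0 > 0"
    and \<alpha>_pos: "\<And>t. t \<ge> 0 \<Longrightarrow> \<alpha> t > 0"
    and \<alpha>_mono: "mono_on {0..} \<alpha>" and \<alpha>_cont: "continuous_on {0..} \<alpha>"
    and H2: "\<And>x s \<xi>. x \<in> \<Omega> \<Longrightarrow>
        \<alpha>0 * (norm \<xi>)\<^sup>2 \<le> j x s \<xi> \<and> j x s \<xi> \<le> \<alpha> \<bar>s\<bar> * (norm \<xi>)\<^sup>2"
    and \<beta>_pos: "\<And>t. t \<ge> 0 \<Longrightarrow> \<beta> t > 0"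
    and \<beta>_mono: "mono_on {0..} \<beta>" and \<beta>_cont: "continuous_on {0..} \<beta>"
    and H3: "\<And>x s \<xi>. x \<in> \<Omega> \<Longrightarrow> \<bar>js x s \<xi>\<bar> \<le> \<beta> \<bar>s\<bar> * (norm \<xi>)\<^sup>2"
    and R_pos: "R > 0"
    and H4: "\<And>x s \<xi>. x \<in> \<Omega> \<Longrightarrow> \<bar>s\<bar> \<ge> R \<Longrightarrow> js x s \<xi> * s \<ge> 0"
    and U_H01: "\<And>n. H01 \<Omega> (U n)"
    and U_bdd: "\<exists>M. \<forall>n. h1norm \<Omega> (U n) \<le> M"
    and U_L1: "\<And>n. set_integrable lebesgue \<Omega>
        (\<lambda>x. jxi x (U n x) (wgrad \<Omega> (U n) x) \<bullet> wgrad \<Omega> (U n) x)"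
    and W_Hm1: "\<And>n. Hm1 \<Omega> (W n)"
    and eq: "\<And>n v. v \<in> Vset \<Omega> (U n) \<Longrightarrow>
        (LINT x:\<Omega>|lebesgue. js x (U n x) (wgrad \<Omega> (U n) x) * v x)
        + (LINT x:\<Omega>|lebesgue. jxi x (U n x) (wgrad \<Omega> (U n) x) \<bullet> wgrad \<Omega> v x) = W n v"
    and W_conv: "\<exists>w. Hm1 \<Omega> w \<and> (\<lambda>n. hm1norm \<Omega> (\<lambda>v. W n v - w v)) \<longlonglongrightarrow> 0"
  shows "\<exists>r u. strict_mono r \<and> H01 \<Omega> u \<and>
           (\<lambda>k. h1norm \<Omega> (\<lambda>x. U (r k) x - u x)) \<longlonglongrightarrow> 0"
proof -
  interpret quasilinear_integrand \<Omega> j js jxi \<alpha> \<beta> \<alpha>0 R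
    by unfold_locales
      (fact open_\<Omega> bdd_\<Omega> j_meas j_C1 jxi_cont H1 \<alpha>0_pos \<alpha>_pos \<alpha>_mono H2 \<beta>_pos \<beta>_mono H3 R_pos H4)+
  note in_H01 = H01_imp_H01_grad[OF U_H01]
  obtain B where B: "\<And>n. h1norm \<Omega> (U n) \<le> B" using U_bdd by blast
  obtain w where w: "Hm1 \<Omega> w" and w_lim: "(\<lambda>n. hm1norm \<Omega> (\<lambda>v. W n v - w v)) \<longlonglongrightarrow> 0" using W_conv by blast
  obtain F where F: "square_integrable M\<Omega> F" "\<And>v h. H01_grad v h \<Longrightarrow> w v = (\<integral>x. F x \<bullet> (v x, h x) \<partial>M\<Omega>)"
    by (rule Hm1_representation[OF w]) (rule that)
  have solves: "approximate_weak_solution F (hm1norm \<Omega> (\<lambda>v. W n v - w v)) (U n) (wgrad \<Omega> (U n))" for n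
    by (rule weak_formulation_imp_approximate_weak_solution[OF U_H01 W_Hm1 w F(2) eq])
  obtain r u0 g0 where r: "strict_mono (r::nat\<Rightarrow>nat)" and limit_in_H01: "H01_grad u0 g0"
    and lim: "L2_tendsto M\<Omega> (\<lambda>n. U (r n)) u0" "L2_tendsto M\<Omega> (\<lambda>n. wgrad \<Omega> (U (r n))) g0"
  proof (rule approximate_weak_solutions_compact[OF in_H01 _ _ F(1) solves w_lim])
    show "L2_norm M\<Omega> (\<lambda>x. (U n x, wgrad \<Omega> (U n) x)) \<le> B" for n
      using B[of n] H01_grad_h1norm[OF in_H01[of n]] by simp
    show "integrable M\<Omega> (\<lambda>x. jxi x (U n x) (wgrad \<Omega> (U n) x) \<bullet> wgrad \<Omega> (U n) x)" for n
      using U_L1[of n] unfolding set_integrable_domain .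
  qed (rule that)
  have "(\<lambda>k. h1norm \<Omega> (\<lambda>x. U (r k) x - u0 x)) \<longlonglongrightarrow> 0"
    using lim by (subst h1norm_diff_tendsto_iff[OF H01_grad_imp_is_weak_grad[OF in_H01]
        H01_grad_square_integrable(1,2)[OF in_H01]
          H01_grad_imp_is_weak_grad[OF limit_in_H01] H01_grad_square_integrable(1,2)[OF limit_in_H01]]) simp
  then show ?thesis using r H01_grad_imp_H01[OF limit_in_H01] by blast
qed

end
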